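(* Suppose there exist independent identically distributed random variables $\xi_z$, $z\in\mathbb{Z}^d$, such that for all $z$ $$0\le \xi_z\le 1,\qquad |S_z|\ge \xi_z,\qquad \mathbf{P}\{\xi_z=0\}\le p,\qquad \mu=\mathbf{E}\xi_z>0,$$ where $p\in(0,1)$. Then for each $\varepsilon>0$ $$\lim_{t\to\infty}\mathbf{P}\left\{(\ln t)^{2/d}\,\mathfrak{S}_t>\left(\frac{\nu}{d}\right)^{2/d}\mathcal{S}-\varepsilon\right\}=1,\qquad \nu=\ln\left(\frac1p\right).$$
   Context: $d\ge 2$. $|A|$ is Lebesgue measure of $A\subset\mathbb{R}^d$. $V=V(x,\omega)$ is a measurable $\{0,1\}$-valued random field on $\mathbb{R}^d$ on a probability space $\langle\Omega,\mathcal{F},\mathbf{P}\rangle$, such that $S=S(\omega)=\{x\in\mathbb{R}^d: V(x,\omega)=1\}$ is closed. For $z\in\mathbb{Z}^d$, $S_z=S_z(\omega)=S\cap\{x: x-z\in(-\frac12,\frac12]^d\}$. For $t>1$ set $\widehat{Q}^0_t=(-\frac12 t,\frac12 t)^d$ and $F_t=\widehat{Q}^0_t\setminus S$. For an open bounded set $G$, $\mathbf{H}^1_0(G)$ is the Sobolev space of $\mathbb{R}^d$-valued functions obtained as the closure of the smooth functions with compact support in $G$ in the norm $(\|\phi\|_2^2+\|\nabla\phi\|_2^2)^{1/2}$; $\mathbf{H}^1(\mathbb{R}^d)$ is the analogous space of $\mathbb{R}^d$-valued functions on $\mathbb{R}^d$; $|\nabla\phi|^2=\sum_{j,k}(\nabla_j\phi^{(k)})^2$.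 The principal eigenvalue of the Stokes operator on $F_t$ is (infimum over nonzero $\phi$) $$\mathfrak{S}_t=\inf\{\|\phi\|_2^{-2}\|\nabla\phi\|_2^2:\ \mathrm{div}(\phi)=0,\ \phi\in\mathbf{H}^1_0(F_t)\}.$$ The constant $\mathcal{S}$ is $$\mathcal{S}=\inf\{\|\phi\|_2^{-2}\|\nabla\phi\|_2^2:\ \mathrm{div}(\phi)=0,\ |\{|\phi|>0\}|=1,\ \phi\in\mathbf{H}^1(\mathbb{R}^d)\}.$$ *)

theory Defs
  imports "HOL-Probability.Probability"
begin

text \<open>Classes of functions modulo Lebesgue null sets are handled through representatives:
  every notion below is invariant under changing a function on a null set.\<close>

definition square_integrable :: "(real^'n \<Rightarrow> 'b::euclidean_space) \<Rightarrow> bool" where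
  "square_integrable f \<longleftrightarrow>
     f \<in> borel_measurable lebesgue \<and> integrable lebesgue (\<lambda>x. (norm (f x))\<^sup>2)"

definition L2_norm :: "(real^'n \<Rightarrow> 'b::euclidean_space) \<Rightarrow> real" where
  "L2_norm f = sqrt (LINT x|lebesgue. (norm (f x))\<^sup>2)"

definition partial_deriv :: "'n \<Rightarrow> (real^'n \<Rightarrow> 'b::real_normed_vector) \<Rightarrow> real^'n \<Rightarrow> 'b" where
  "partial_deriv j f x = frechet_derivative f (at x) (axis j 1)"

primrec C_k :: "nat \<Rightarrow> (real^'n \<Rightarrow> 'b::real_normed_vector) \<Rightarrow> bool" where
  "C_k 0 f \<longleftrightarrow> continuous_on UNIV f"
| "C_k (Suc k) f \<longleftrightarrow> (\<forall>x. f differentiable (at x)) \<and> (\<forall>j. C_k k (partial_deriv j f))"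

definition test_functions :: "(real^'n) set \<Rightarrow> (real^'n \<Rightarrow> 'b::real_normed_vector) set" where
  "test_functions G =
     {f. (\<forall>k. C_k k f) \<and> compact (closure {x. f x \<noteq> 0}) \<and> closure {x. f x \<noteq> 0} \<subseteq> G}"

text \<open>\<open>D x $ k $ j\<close> stands for the weak derivative of the \<open>k\<close>-th component of \<open>\<phi>\<close> in the
  \<open>j\<close>-th direction. The norm of the type \<open>real^'n^'n\<close> is the Frobenius norm, so
  \<open>(norm (D x))\<^sup>2\<close> is the sum of the squares of all these derivatives.\<close>

definition has_weak_gradient :: "(real^'n \<Rightarrow> real^'n) \<Rightarrow> (real^'n \<Rightarrow> real^'n^'n) \<Rightarrow> bool" where
  "has_weak_gradient \<phi> D \<longleftrightarrow>
     (\<forall>(\<eta>::real^'n \<Rightarrow> real) \<in> test_functions UNIV. \<forall>j k.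
        (LINT x|lebesgue. \<phi> x $ k * partial_deriv j \<eta> x) = - (LINT x|lebesgue. D x $ k $ j * \<eta> x))"

definition weakly_diff_L2 :: "(real^'n \<Rightarrow> real^'n) set" where
  "weakly_diff_L2 =
     {\<phi>. square_integrable \<phi> \<and> (\<exists>D. square_integrable D \<and> has_weak_gradient \<phi> D)}"

text \<open>On \<^term>\<open>weakly_diff_L2\<close> the choice is unique up to a null set.\<close>

definition weak_gradient :: "(real^'n \<Rightarrow> real^'n) \<Rightarrow> real^'n \<Rightarrow> real^'n^'n" where
  "weak_gradient \<phi> = (SOME D. square_integrable D \<and> has_weak_gradient \<phi> D)"

definition H1_norm :: "(real^'n \<Rightarrow> real^'n) \<Rightarrow> real" where
  "H1_norm \<phi> = sqrt ((L2_norm \<phi>)\<^sup>2 + (L2_norm (weak_gradient \<phi>))\<^sup>2)"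

text \<open>The closure is taken among functions on the whole space, test functions in \<open>G\<close> being
  extended by zero; with \<open>G = UNIV\<close> this is the Sobolev space on the whole space.\<close>

definition H1_0 :: "(real^'n) set \<Rightarrow> (real^'n \<Rightarrow> real^'n) set" where
  "H1_0 G =
     {\<phi> \<in> weakly_diff_L2. \<exists>\<psi>. (\<forall>m. \<psi> m \<in> test_functions G) \<and>
        (\<lambda>m::nat. H1_norm (\<lambda>x. \<psi> m x - \<phi> x)) \<longlonglongrightarrow> 0}"

abbreviation H1 :: "(real^'n \<Rightarrow> real^'n) set" where
  "H1 \<equiv> H1_0 UNIV"

definition div_free :: "(real^'n \<Rightarrow> real^'n) \<Rightarrow> bool" where
  "div_free \<phi> \<longleftrightarrow> (AE x in lebesgue. trace (weak_gradient \<phi> x) = 0)"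

definition rayleigh_quotient :: "(real^'n \<Rightarrow> real^'n) \<Rightarrow> real" where
  "rayleigh_quotient \<phi> = (L2_norm (weak_gradient \<phi>))\<^sup>2 / (L2_norm \<phi>)\<^sup>2"

text \<open>The infima are taken in \<^typ>\<open>ereal\<close>, so that the infimum over the empty set (for
  instance when \<open>F\<close> is empty) is \<open>\<infinity>\<close>.\<close>

definition stokes_eigenvalue :: "(real^'n) set \<Rightarrow> ereal" where
  "stokes_eigenvalue F =
     (INF \<phi> \<in> {\<phi> \<in> H1_0 F. div_free \<phi> \<and> \<not> (AE x in lebesgue. \<phi> x = 0)}.
        ereal (rayleigh_quotient \<phi>))"

definition stokes_const :: "'n::finite itself \<Rightarrow> ereal" where
  "stokes_const _ =
     (INF \<phi> \<in> {\<phi> \<in> (H1 :: (real^'n \<Rightarrow> real^'n) set).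
                 div_free \<phi> \<and> emeasure lebesgue {x. norm (\<phi> x) > 0} = 1}.
        ereal (rayleigh_quotient \<phi>))"

definition obstacles :: "(real^'n \<Rightarrow> 'w \<Rightarrow> real) \<Rightarrow> 'w \<Rightarrow> (real^'n) set" where
  "obstacles V \<omega> = {x. V x \<omega> = 1}"

definition unit_cell :: "int^'n \<Rightarrow> (real^'n) set" where
  "unit_cell z = {x. \<forall>i. x $ i - of_int (z $ i) \<in> {-1/2<..1/2}}"

definition open_cube :: "real \<Rightarrow> (real^'n) set" where
  "open_cube t = {x. \<forall>i. x $ i \<in> {-t/2<..<t/2}}"

definition flow_region :: "(real^'n \<Rightarrow> 'w \<Rightarrow> real) \<Rightarrow> real \<Rightarrow> 'w \<Rightarrow> (real^'n) set" where
  "flow_region V t \<omega> = open_cube t - obstacles V \<omega>"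

text \<open>The principal eigenvalue of a random open set is in general measurable only with respect
  to the completion of the probability space (an infimum over a random class of functions), whereas
  \<^const>\<open>measure\<close> is \<open>0\<close> on non-measurable sets. The inner probability
  agrees with the probability on all events, also on those of the completion (lemmas below).\<close>

definition inner_prob :: "'w measure \<Rightarrow> 'w set \<Rightarrow> real" where
  "inner_prob M A = (SUP B \<in> {B \<in> sets M. B \<subseteq> A}. measure M B)"

lemma inner_prob_completion:
  assumes "prob_space M" "A \<in> sets (completion M)"
  shows "inner_prob M A = measure (completion M) A"
proof -
  interpret prob_space M by fact
  interpret C: prob_space "completion M" by (rule prob_space_completion)
  have le: "measure M B \<le> measure (completion M) A" if "B \<in> sets M" "B \<subseteq> A" for B
  proof -
    have "measure M B = measure (completion M) B" using that by simp
    also have "\<dots> \<le> measure (completion M) A"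
      using that assms by (intro C.finite_measure_mono) auto
    finally show ?thesis .
  qed
  have "main_part M A \<in> {B \<in> sets M. B \<subseteq> A}"
    using assms main_part_null_part_Un[of A M] main_part_sets[of A M] by blast
  moreover have "measure M (main_part M A) = measure (completion M) A"
    using assms by (simp add: measure_def emeasure_completion)
  ultimately show ?thesis
    unfolding inner_prob_def using le by (intro cSup_eq_maximum) (force simp: image_iff)+
qed

lemma inner_prob_eq:
  assumes "prob_space M" "A \<in> sets M"
  shows "inner_prob M A = measure M A"
  using inner_prob_completion[of M A] assms by simp

end

theory Submission
  imports Defs "HOL-Library.Diagonal_Subsequence"
begin

text \<open>If the rescaled eigenvalue is small, then a Poincare inequality on large blocks of unit cells shows
  that a trial field has almost no mass on blocks containing a positive fraction of obstacles. By a
  large deviation estimate, the total volume of the remaining sparse blocks in any window whose side is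
  of order \<open>(ln t)\<^sup>1\<^sup>/\<^sup>d\<close> is with high probability at most about \<open>(d / \<nu>) ln t\<close>. The rest is a
  deterministic compactness argument. Multiplication by a cut-off destroys solenoidality, so one works
  with fields whose divergence, and whose mass outside a set of volume \<open>V\<close>, are merely small.
  A minimising sequence for this relaxed problem, suitably translated, has a nonzero limit \<open>v\<close> which is
  solenoidal and supported on volume at most \<open>V\<close>. The part of the sequence far from the origin again belongs to the
  relaxed class, so its Rayleigh quotient is asymptotically no better than the infimum; hence the
  quotient of \<open>v\<close> is no worse than the infimum, and the relaxed infimum is at least
  \<open>V\<^sup>-\<^sup>2\<^sup>/\<^sup>d\<close> times the Stokes constant.\<close>

section \<open>Smooth functions and cut-offs\<close>

text \<open>The constant balances two exponents. With R = (ln t)^(1/d) there are about t^d windows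
  of side of order R, and a given set of v ln t cells has a small \<open>\<xi>\<close>-sum with
  probability at most t^(- v \<nu>') for any \<nu>' < \<nu>, so the union bound closes as soon as v
  > d / \<nu>. Scaling lengths by R turns volume v ln t into v. Blocks of side L are forced by
  entropy: subsets of the unit cells of a window number exp of order R^d = ln t, a power of t
  comparable to the gain. With blocks the exponent is (R / L)^d, negligible for a large fixed L,
  while the Poincare constant of a block vanishes after division by R^2. The whole cube may contain
  far more sparse volume than one window, so the inequality is averaged over translated cut-offs,
  and the error, quadratically small in the inverse cut-off scale, is absorbed by \<epsilon>. Hence
  the order of choices: v, the tolerance \<delta>, the level \<eta>, the side L, and last t. The
  event estimated depends on \<open>\<xi>\<close> only and is measurable; up to a null set the
  eigenvalue event contains it.\<close>

definition smooth :: "(real^'n \<Rightarrow> 'b::real_normed_vector) \<Rightarrow> bool" where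
  "smooth f \<longleftrightarrow> (\<forall>k. C_k k f)"

lemma partial_deriv_eqI:
  "(f has_derivative f') (at x) \<Longrightarrow> partial_deriv j f x = f' (axis j 1)"
  unfolding partial_deriv_def using frechet_derivative_at by metis

lemma has_derivative_frechet:
  "f differentiable (at x) \<Longrightarrow> (f has_derivative frechet_derivative f (at x)) (at x)"
  using frechet_derivative_works by blast

lemma C_k_Suc_D: "C_k (Suc k) f \<Longrightarrow> C_k k f"
proof (induction k arbitrary: f)
  case 0
  then show ?case
    by (auto simp: continuous_on_eq_continuous_at intro: differentiable_imp_continuous_within)
next
  case (Suc k)
  then show ?case by (metis C_k.simps(2))
qed

lemma C_k_const:
  fixes c :: "'b::real_normed_vector"
  shows "C_k k (\<lambda>x::real^'n. c)"
proof (induction k arbitrary: c)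
  case (Suc k)
  have "partial_deriv j (\<lambda>x::real^'n. c) = (\<lambda>x. 0)" for j
    by (simp add: partial_deriv_def fun_eq_iff)
  with Suc show ?case by simp
qed simp

lemma C_k_add: "C_k k f \<Longrightarrow> C_k k g \<Longrightarrow> C_k k (\<lambda>x. f x + g x)"
proof (induction k arbitrary: f g)
  case (Suc k)
  have "partial_deriv j (\<lambda>x. f x + g x) = (\<lambda>x. partial_deriv j f x + partial_deriv j g x)" for j
  proof
    fix x
    have "((\<lambda>x. f x + g x) has_derivative (\<lambda>h. frechet_derivative f (at x) h + frechet_derivative g (at x) h)) (at x)"
      using Suc.prems by (auto intro!: has_derivative_add has_derivative_frechet)
    from partial_deriv_eqI[OF this]
    show "partial_deriv j (\<lambda>x. f x + g x) x = partial_deriv j f x + partial_deriv j g x"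
      by (simp add: partial_deriv_def)
  qed
  with Suc show ?case by simp
qed (auto intro: continuous_intros)

lemma C_k_scaleR: 
  fixes f :: "real^'n \<Rightarrow> real"
  shows "C_k k f \<Longrightarrow> C_k k g \<Longrightarrow> C_k k (\<lambda>x. f x *\<^sub>R g x)"
proof (induction k arbitrary: f g)
  case (Suc k)
  have "partial_deriv j (\<lambda>x. f x *\<^sub>R g x) = (\<lambda>x. f x *\<^sub>R partial_deriv j g x + partial_deriv j f x *\<^sub>R g x)" for j
  proof
    fix x
    have "((\<lambda>x. f x *\<^sub>R g x) has_derivative (\<lambda>h. f x *\<^sub>R frechet_derivative g (at x) h + frechet_derivative f (at x) h *\<^sub>R g x)) (at x)"
      using Suc.prems by (auto intro!: has_derivative_scaleR has_derivative_frechet)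
    from partial_deriv_eqI[OF this]
    show "partial_deriv j (\<lambda>x. f x *\<^sub>R g x) x = f x *\<^sub>R partial_deriv j g x + partial_deriv j f x *\<^sub>R g x"
      by (simp add: partial_deriv_def)
  qed
  moreover have "C_k k (\<lambda>x. f x *\<^sub>R partial_deriv j g x + partial_deriv j f x *\<^sub>R g x)" for j
    using Suc.prems C_k_Suc_D[OF Suc.prems(1)] C_k_Suc_D[OF Suc.prems(2)]
    by (intro C_k_add Suc.IH) auto
  ultimately show ?case using Suc.prems by (simp add: differentiable_scaleR)
qed (auto intro: continuous_intros)

lemma C_k_affine: "C_k k f \<Longrightarrow> C_k k (\<lambda>x. f (r *\<^sub>R x + a))"
proof (induction k arbitrary: f)
  case 0
  have "continuous_on UNIV (f \<circ> (\<lambda>x. r *\<^sub>R x + a))"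
    by (rule continuous_on_compose) (use 0 in \<open>auto intro!: continuous_intros elim: continuous_on_subset\<close>)
  then show ?case by (simp add: o_def)
next
  case (Suc k)
  have der: "((\<lambda>x. f (r *\<^sub>R x + a)) has_derivative (\<lambda>h. frechet_derivative f (at (r *\<^sub>R x + a)) (r *\<^sub>R h))) (at x)" for x
  proof -
    have "((\<lambda>x. r *\<^sub>R x + a) has_derivative (\<lambda>h. r *\<^sub>R h)) (at x)"
      by (auto intro!: derivative_eq_intros)
    moreover have "(f has_derivative frechet_derivative f (at (r *\<^sub>R x + a))) (at (r *\<^sub>R x + a))"
      using Suc.prems by (auto intro!: has_derivative_frechet)
    ultimately show ?thesis
      using diff_chain_at by (fastforce simp: o_def)
  qed
  have "partial_deriv j (\<lambda>x. f (r *\<^sub>R x + a)) = (\<lambda>x. r *\<^sub>R partial_deriv j f (r *\<^sub>R x + a))" for j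
  proof
    fix x
    have "linear (frechet_derivative f (at (r *\<^sub>R x + a)))"
      using Suc.prems by (auto intro!: linear_frechet_derivative)
    then show "partial_deriv j (\<lambda>x. f (r *\<^sub>R x + a)) x = r *\<^sub>R partial_deriv j f (r *\<^sub>R x + a)"
      using partial_deriv_eqI[OF der[of x]] by (simp add: partial_deriv_def linear_scale)
  qed
  with Suc der C_k_const show ?case by (auto intro!: C_k_scaleR simp: differentiable_def)
qed

lemma C_k_linear:
  assumes L: "bounded_linear L"
  shows "C_k k f \<Longrightarrow> C_k k (\<lambda>x. L (f x))"
proof (induction k arbitrary: f)
  case 0
  then show ?case by (auto intro: bounded_linear.continuous_on[OF L])
next
  case (Suc k)
  have der: "((\<lambda>x. L (f x)) has_derivative (\<lambda>h. L (frechet_derivative f (at x) h))) (at x)" for x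
    using Suc.prems by (intro bounded_linear.has_derivative[OF L] has_derivative_frechet) auto
  have "partial_deriv j (\<lambda>x. L (f x)) = (\<lambda>x. L (partial_deriv j f x))" for j
    using partial_deriv_eqI[OF der] by (auto simp: partial_deriv_def)
  with Suc der show ?case by (auto simp: differentiable_def)
qed

text \<open>All derivatives of \<open>G 0\<close> are supplied at once as a sequence, so the
  induction can generalise over \<open>n\<close>: a partial derivative of \<open>G n\<close>
  composed with a coordinate is a constant times \<open>G (Suc n)\<close> composed with it.\<close>

lemma C_k_coord:
  fixes G :: "nat \<Rightarrow> real \<Rightarrow> real" and i :: "'n::finite"
  assumes G: "\<And>n x. (G n has_real_derivative G (Suc n) x) (at x)"
  shows "C_k k (\<lambda>x::real^'n. G n (x $ i))"
proof (induction k arbitrary: n)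
  case 0
  have "continuous_on UNIV (G n)"
    using G DERIV_isCont by (blast intro: continuous_at_imp_continuous_on)
  then have "continuous_on UNIV (G n \<circ> (\<lambda>x::real^'n. x $ i))"
    by (intro continuous_on_compose continuous_intros) (auto elim: continuous_on_subset)
  then show ?case by (simp add: o_def)
next
  case (Suc k)
  have der: "((\<lambda>x::real^'n. G n (x $ i)) has_derivative (\<lambda>h. G (Suc n) (x $ i) * (h $ i))) (at x)" for x
  proof -
    have "((\<lambda>x::real^'n. x $ i) has_derivative (\<lambda>h. h $ i)) (at x)"
      by (rule bounded_linear_imp_has_derivative[OF bounded_linear_vec_nth])
    from diff_chain_at[OF this, of "G n"] G[of n "x $ i"] 
    show ?thesis by (auto simp: o_def has_field_derivative_def)
  qed
  have "partial_deriv j (\<lambda>x::real^'n. G n (x $ i)) = (\<lambda>x. (if i = j then 1 else 0) *\<^sub>R G (Suc n) (x $ i))" for j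
    using partial_deriv_eqI[OF der] by (auto simp: axis_def)
  with Suc der show ?case by (auto intro!: C_k_scaleR C_k_const simp: differentiable_def)
qed

text \<open>The derivatives of \<open>exp (- 1 / x)\<close> on the positive axis, extended by \<open>0\<close>, stay in the family
  \<open>p (1 / x) exp (- 1 / x)\<close> with \<open>p\<close> a polynomial.\<close>

definition flat_fn :: "real poly \<Rightarrow> real \<Rightarrow> real" where
  "flat_fn p x = (if x > 0 then poly p (1 / x) * exp (- (1 / x)) else 0)"

lemma poly_exp_tendsto_0: "((\<lambda>y. poly p y * exp (- y)) \<longlongrightarrow> (0::real)) at_top"
proof -
  have "((\<lambda>y. \<Sum>i\<le>degree p. coeff p i * (y ^ i / exp y)) \<longlongrightarrow> (\<Sum>i\<le>degree p. coeff p i * 0)) at_top"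
    by (intro tendsto_sum tendsto_mult tendsto_const tendsto_power_div_exp_0)
  then show ?thesis
    by (simp add: poly_altdef sum_distrib_right sum_divide_distrib exp_minus field_simps)
qed

text \<open>With y = 1 / x, the derivative of p(y) exp(- y) in x is y^2 (p(y) - p'(y)) exp(- y);
  this is the origin of the polynomial \<open>[:0,0,1:] * (p - pderiv p)\<close>. The origin
  requires a separate argument.\<close>

lemma flat_deriv:
  "(flat_fn p has_real_derivative flat_fn ([:0,0,1:] * (p - pderiv p)) x) (at x)"
proof -
  consider "x > 0" | "x < 0" | "x = 0" by linarith
  then show ?thesis
  proof cases
    case 1
    have "((\<lambda>x. poly p (1 / x) * exp (- (1 / x))) has_real_derivative
        flat_fn ([:0,0,1:] * (p - pderiv p)) x) (at x)"
      using 1 unfolding flat_fn_def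
      by (auto intro!: derivative_eq_intros DERIV_chain2[OF poly_DERIV] simp: field_simps power2_eq_square)
    then show ?thesis
      by (rule DERIV_cong_ev[THEN iffD1, rotated 3])
         (use 1 in \<open>auto simp: flat_fn_def intro!: eventually_mono[OF eventually_gt_at_top]
             eventually_nhds_in_open[of "{0<..}", THEN eventually_mono]\<close>)
  next
    case 2
    have "((\<lambda>x. 0) has_real_derivative flat_fn ([:0,0,1:] * (p - pderiv p)) x) (at x)"
      using 2 by (simp add: flat_fn_def)
    then show ?thesis
      by (rule DERIV_cong_ev[THEN iffD1, rotated 3])
         (use 2 in \<open>auto simp: flat_fn_def intro!: 
             eventually_nhds_in_open[of "{..<0}", THEN eventually_mono]\<close>)
  next
    case 3
    \<comment> \<open>The difference quotient at 0 is again of the decaying form, with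
      \<open>pCons 0 p\<close> in place of \<open>p\<close>: dividing by h is one more factor of the
      variable 1 / h.\<close>
    have "((\<lambda>h. flat_fn p h / h) \<longlongrightarrow> 0) (at_right 0)"
    proof -
      have "((\<lambda>h. poly (pCons 0 p) (inverse h) * exp (- inverse h)) \<longlongrightarrow> 0) (at_right 0)"
        by (rule filterlim_compose[OF poly_exp_tendsto_0 filterlim_inverse_at_top_right])
      moreover have "eventually (\<lambda>h. poly (pCons 0 p) (inverse h) * exp (- inverse h) = flat_fn p h / h) (at_right 0)"
      proof (rule eventually_mono[OF eventually_at_right_less[of 0]])
        fix h :: real assume "0 < h"
        then have "flat_fn p h = poly p (inverse h) * exp (- inverse h)"
          by (simp only: flat_fn_def if_True inverse_eq_divide)
        then show "poly (pCons 0 p) (inverse h) * exp (- inverse h) = flat_fn p h / h"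
          by (simp only: poly_pCons divide_inverse mult_ac add_0)
      qed
      ultimately show ?thesis by (rule Lim_transform_eventually)
    qed
    moreover have "((\<lambda>h. flat_fn p h / h) \<longlongrightarrow> 0) (at_left 0)"
    proof -
      have "eventually (\<lambda>h. 0 = flat_fn p h / h) (at_left 0)"
        by (rule eventually_mono[OF eventually_at_left_real[of "-1" 0]]) (simp_all add: flat_fn_def)
      then show ?thesis by (rule Lim_transform_eventually[OF tendsto_const])
    qed
    ultimately have "((\<lambda>h. flat_fn p h / h) \<longlongrightarrow> 0) (at 0)"
      by (simp add: filterlim_split_at_real)
    then show ?thesis using 3 by (simp add: DERIV_def flat_fn_def)
  qed
qed

lemma smooth_coord_flat:
  "smooth (\<lambda>x::real^'n. flat_fn p (x $ i))"
  unfolding smooth_def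
proof
  fix k
  define P where "P n = ((\<lambda>p. [:0,0,1:] * (p - pderiv p)) ^^ n) p" for n
  have "C_k k (\<lambda>x::real^'n. flat_fn (P 0) (x $ i))"
    by (rule C_k_coord[of "\<lambda>n. flat_fn (P n)"]) (simp only: P_def funpow.simps o_apply flat_deriv)
  then show "C_k k (\<lambda>x::real^'n. flat_fn p (x $ i))" by (simp add: P_def)
qed

section \<open>Closure properties of smooth functions and of test functions\<close>

lemma smooth_const [simp, intro]: "smooth (\<lambda>x. c)"
  by (simp add: smooth_def C_k_const)

lemma smooth_add [intro]: "smooth f \<Longrightarrow> smooth g \<Longrightarrow> smooth (\<lambda>x. f x + g x)"
  by (simp add: smooth_def C_k_add)

lemma smooth_scaleR [intro]:
  fixes f :: "real^'n \<Rightarrow> real"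
  shows "smooth f \<Longrightarrow> smooth g \<Longrightarrow> smooth (\<lambda>x. f x *\<^sub>R g x)"
  by (simp add: smooth_def C_k_scaleR)

lemma smooth_mult [intro]:
  fixes f g :: "real^'n \<Rightarrow> real"
  shows "smooth f \<Longrightarrow> smooth g \<Longrightarrow> smooth (\<lambda>x. f x * g x)"
  using smooth_scaleR[of f g] by simp

lemma smooth_prod:
  fixes f :: "'i \<Rightarrow> real^'n \<Rightarrow> real"
  shows "finite I \<Longrightarrow> (\<And>i. smooth (f i)) \<Longrightarrow> smooth (\<lambda>x. \<Prod>i\<in>I. f i x)"
  by (induction I rule: finite_induct) auto

lemma smooth_affine: "smooth f \<Longrightarrow> smooth (\<lambda>x. f (r *\<^sub>R x + a))"
  by (simp add: smooth_def C_k_affine)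

lemma smooth_linear: "bounded_linear L \<Longrightarrow> smooth f \<Longrightarrow> smooth (\<lambda>x. L (f x))"
  by (simp add: smooth_def C_k_linear)

lemma smooth_diff [intro]: "smooth f \<Longrightarrow> smooth g \<Longrightarrow> smooth (\<lambda>x. f x - g x)"
  using smooth_add[of f "\<lambda>x. - g x"] smooth_linear[OF bounded_linear_minus[OF bounded_linear_ident], of g] by simp

lemma smooth_continuous: "smooth f \<Longrightarrow> continuous_on UNIV f"
  unfolding smooth_def using C_k.simps(1) by blast

lemma smooth_differentiable: "smooth f \<Longrightarrow> f differentiable (at x)"
  unfolding smooth_def using C_k.simps(2)[of 0] by blast

lemma smooth_partial_deriv: "smooth f \<Longrightarrow> smooth (partial_deriv j f)"
  unfolding smooth_def using C_k.simps(2) by blast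

lemma smooth_borel:
  fixes f :: "real^'n \<Rightarrow> 'b::euclidean_space"
  shows "smooth f \<Longrightarrow> f \<in> borel_measurable borel"
  using smooth_continuous borel_measurable_continuous_onI by blast

lemma smooth_has_derivative:
  fixes f :: "real^'n \<Rightarrow> 'b::real_normed_vector"
  assumes "smooth f"
  shows "(f has_derivative (\<lambda>h. \<Sum>j\<in>UNIV. h $ j *\<^sub>R partial_deriv j f x)) (at x)"
proof -
  let ?D = "frechet_derivative f (at x)"
  have D: "(f has_derivative ?D) (at x)"
    using smooth_differentiable[OF assms] by (rule has_derivative_frechet)
  then interpret D: bounded_linear ?D by (rule has_derivative_bounded_linear)
  have "?D h = (\<Sum>j\<in>UNIV. h $ j *\<^sub>R partial_deriv j f x)" for h
  proof -
    have "h = (\<Sum>j\<in>UNIV. h $ j *\<^sub>R axis j 1)"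
      by (simp add: vec_eq_iff axis_def if_distrib[of "(*) _"] sum.delta cong: if_cong)
    then have "?D h = ?D (\<Sum>j\<in>UNIV. h $ j *\<^sub>R axis j 1)" by simp
    also have "\<dots> = (\<Sum>j\<in>UNIV. h $ j *\<^sub>R partial_deriv j f x)"
      by (simp add: D.sum D.scaleR partial_deriv_def)
    finally show ?thesis .
  qed
  then have "?D = (\<lambda>h. \<Sum>j\<in>UNIV. h $ j *\<^sub>R partial_deriv j f x)" by auto
  with D show ?thesis by simp
qed

lemma partial_deriv_scaleR:
  fixes f :: "real^'n \<Rightarrow> real"
  assumes "smooth f" "smooth g"
  shows "partial_deriv j (\<lambda>x. f x *\<^sub>R g x) x = f x *\<^sub>R partial_deriv j g x + partial_deriv j f x *\<^sub>R g x"
proof -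
  have "((\<lambda>x. f x *\<^sub>R g x) has_derivative (\<lambda>h. f x *\<^sub>R frechet_derivative g (at x) h + frechet_derivative f (at x) h *\<^sub>R g x)) (at x)"
    using assms by (intro has_derivative_scaleR has_derivative_frechet smooth_differentiable)
  from partial_deriv_eqI[OF this] show ?thesis by (simp add: partial_deriv_def)
qed

lemma partial_deriv_add:
  assumes "smooth f" "smooth g"
  shows "partial_deriv j (\<lambda>x. f x + g x) x = partial_deriv j f x + partial_deriv j g x"
proof -
  have "((\<lambda>x. f x + g x) has_derivative (\<lambda>h. frechet_derivative f (at x) h + frechet_derivative g (at x) h)) (at x)"
    using assms by (intro has_derivative_add has_derivative_frechet smooth_differentiable)
  from partial_deriv_eqI[OF this] show ?thesis by (simp add: partial_deriv_def)
qed

lemma partial_deriv_linear: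
  assumes "bounded_linear L" "smooth f"
  shows "partial_deriv j (\<lambda>x. L (f x)) x = L (partial_deriv j f x)"
proof -
  have "((\<lambda>x. L (f x)) has_derivative (\<lambda>h. L (frechet_derivative f (at x) h))) (at x)"
    using assms by (intro bounded_linear.has_derivative[of L] has_derivative_frechet smooth_differentiable)
  from partial_deriv_eqI[OF this] show ?thesis by (simp add: partial_deriv_def)
qed

lemma partial_deriv_affine:
  assumes "smooth f"
  shows "partial_deriv j (\<lambda>x. f (r *\<^sub>R x + a)) x = r *\<^sub>R partial_deriv j f (r *\<^sub>R x + a)"
proof -
  let ?D = "frechet_derivative f (at (r *\<^sub>R x + a))"
  have "((\<lambda>x. r *\<^sub>R x + a) has_derivative (\<lambda>h. r *\<^sub>R h)) (at x)"
    by (auto intro!: derivative_eq_intros)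
  moreover have D: "(f has_derivative ?D) (at (r *\<^sub>R x + a))"
    using assms by (intro has_derivative_frechet smooth_differentiable)
  ultimately have "((\<lambda>x. f (r *\<^sub>R x + a)) has_derivative (\<lambda>h. ?D (r *\<^sub>R h))) (at x)"
    using diff_chain_at by (fastforce simp: o_def)
  from partial_deriv_eqI[OF this] has_derivative_linear[OF D] show ?thesis
    by (simp add: partial_deriv_def linear_scale)
qed

text \<open>Any compact set outside which f vanishes can replace the closure of the nonzero set, so
  sums, products and linear images are handled by exhibiting a compact set.\<close>

lemma test_functions_iff:
  fixes f :: "real^'n \<Rightarrow> 'b::real_normed_vector"
  shows "f \<in> test_functions G \<longleftrightarrow> smooth f \<and> (\<exists>K. compact K \<and> K \<subseteq> G \<and> (\<forall>x. x \<notin> K \<longrightarrow> f x = 0))"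
proof
  assume "f \<in> test_functions G"
  then have "smooth f" "compact (closure {x. f x \<noteq> 0})" "closure {x. f x \<noteq> 0} \<subseteq> G"
    by (simp_all add: test_functions_def smooth_def)
  moreover have "f x = 0" if "x \<notin> closure {x. f x \<noteq> 0}" for x
    using that closure_subset[of "{x. f x \<noteq> 0}"] by (metis (mono_tags) mem_Collect_eq subsetD)
  ultimately show "smooth f \<and> (\<exists>K. compact K \<and> K \<subseteq> G \<and> (\<forall>x. x \<notin> K \<longrightarrow> f x = 0))"
    by metis
next
  assume "smooth f \<and> (\<exists>K. compact K \<and> K \<subseteq> G \<and> (\<forall>x. x \<notin> K \<longrightarrow> f x = 0))"
  then obtain K where K: "smooth f" "compact K" "K \<subseteq> G" "\<And>x. x \<notin> K \<Longrightarrow> f x = 0" by metis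
  then have "{x. f x \<noteq> 0} \<subseteq> K" by blast
  then have "closure {x. f x \<noteq> 0} \<subseteq> K"
    using compact_imp_closed[OF K(2)] by (rule closure_minimal)
  moreover from this have "compact (closure {x. f x \<noteq> 0})"
    using K(2) closed_closure by (metis Int_absorb1 compact_Int_closed)
  ultimately show "f \<in> test_functions G"
    unfolding test_functions_def using K by (simp add: smooth_def)
qed

lemma test_smooth: "f \<in> test_functions G \<Longrightarrow> smooth f"
  by (simp add: test_functions_iff)

lemma test_mono: "f \<in> test_functions G \<Longrightarrow> G \<subseteq> H \<Longrightarrow> f \<in> test_functions H"
  by (force simp: test_functions_def)

lemma test_UNIV: "f \<in> test_functions G \<Longrightarrow> f \<in> test_functions UNIV"
  by (erule test_mono) simp

lemma test_eq_0: "f \<in> test_functions G \<Longrightarrow> x \<notin> G \<Longrightarrow> f x = 0"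
  by (auto simp: test_functions_iff)

lemma test_add:
  assumes "f \<in> test_functions G" "g \<in> test_functions G"
  shows "(\<lambda>x. f x + g x) \<in> test_functions G"
proof -
  obtain K where "compact K" "K \<subseteq> G" "\<forall>x. x \<notin> K \<longrightarrow> f x = 0" using assms(1) by (auto simp: test_functions_iff)
  moreover obtain L where "compact L" "L \<subseteq> G" "\<forall>x. x \<notin> L \<longrightarrow> g x = 0" using assms(2) by (auto simp: test_functions_iff)
  ultimately have "compact (K \<union> L) \<and> K \<union> L \<subseteq> G \<and> (\<forall>x. x \<notin> K \<union> L \<longrightarrow> f x + g x = 0)"
    by (simp add: compact_Un)
  moreover have "smooth (\<lambda>x. f x + g x)" using assms by (auto simp: test_functions_iff)
  ultimately show ?thesis unfolding test_functions_iff by blast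
qed

lemma test_scaleR:
  fixes f :: "real^'n \<Rightarrow> real"
  assumes "smooth f" "g \<in> test_functions G"
  shows "(\<lambda>x. f x *\<^sub>R g x) \<in> test_functions G"
  using assms unfolding test_functions_iff by force

lemma test_linear:
  assumes "bounded_linear L" "g \<in> test_functions G"
  shows "(\<lambda>x. L (g x)) \<in> test_functions G"
proof -
  obtain K where K: "compact K" "K \<subseteq> G" "\<forall>x. x \<notin> K \<longrightarrow> g x = 0" "smooth g"
    using assms(2) by (auto simp: test_functions_iff)
  have "\<forall>x. x \<notin> K \<longrightarrow> L (g x) = 0" using K(3) linear_simps(3)[OF assms(1)] by simp
  with K smooth_linear[OF assms(1) K(4)] show ?thesis unfolding test_functions_iff by blast
qed

lemma test_diff:
  assumes "f \<in> test_functions G" "g \<in> test_functions G"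
  shows "(\<lambda>x. f x - g x) \<in> test_functions G"
  using test_add[OF assms(1) test_linear[OF bounded_linear_minus[OF bounded_linear_ident] assms(2)]] by simp

lemma partial_deriv_eq_0:
  assumes "open U" "x \<in> U" "\<And>y. y \<in> U \<Longrightarrow> f y = 0"
  shows "partial_deriv j f x = 0"
proof -
  have "(f has_derivative (\<lambda>_. 0)) (at x)"
    by (rule has_derivative_transform_within_open[of "\<lambda>_. 0" _ x UNIV U])
       (use assms in auto)
  from partial_deriv_eqI[OF this] show ?thesis by simp
qed

lemma test_partial_deriv:
  assumes "f \<in> test_functions G"
  shows "partial_deriv j f \<in> test_functions G"
proof -
  obtain K where K: "compact K" "K \<subseteq> G" "\<forall>x. x \<notin> K \<longrightarrow> f x = 0" "smooth f"
    using assms by (auto simp: test_functions_iff)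
  have "partial_deriv j f x = 0" if "x \<notin> K" for x
    by (rule partial_deriv_eq_0[of "- K"]) (use K that in \<open>auto simp: compact_imp_closed open_Compl\<close>)
  with K show ?thesis by (auto simp: test_functions_iff smooth_partial_deriv)
qed

lemma test_affine:
  assumes "f \<in> test_functions UNIV" "r \<noteq> 0"
  shows "(\<lambda>x. f (r *\<^sub>R x + a)) \<in> test_functions UNIV"
proof -
  obtain K where K: "compact K" "\<forall>x. x \<notin> K \<longrightarrow> f x = 0" "smooth f"
    using assms by (auto simp: test_functions_iff)
  have "f (r *\<^sub>R x + a) = 0" if "x \<notin> (\<lambda>y. (1 / r) *\<^sub>R (y - a)) ` K" for x
  proof -
    have "r *\<^sub>R x + a \<notin> K"
    proof
      assume "r *\<^sub>R x + a \<in> K"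
      moreover have "x = (1 / r) *\<^sub>R ((r *\<^sub>R x + a) - a)" using assms(2) by simp
      ultimately show False using that by blast
    qed
    with K show ?thesis by simp
  qed
  moreover have "compact ((\<lambda>y. (1 / r) *\<^sub>R (y - a)) ` K)"
    by (intro compact_continuous_image K continuous_intros)
  ultimately show ?thesis using K smooth_affine[of f r a] unfolding test_functions_iff by blast
qed

section \<open>A smooth bump and smooth approximations of boxes\<close>

definition hump :: "real^'n \<Rightarrow> real" where
  "hump x = (\<Prod>i\<in>UNIV. exp 2 * (flat_fn 1 (1 - x $ i) * flat_fn 1 (1 + x $ i)))"

lemma smooth_flat_affine: "smooth (\<lambda>x::real^'n. flat_fn p (r * x $ i + a))"
  using smooth_affine[OF smooth_coord_flat[of p i], of r "\<chi> i. a"] by simp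

text \<open>On (-1, 1) the factor equals exp(2 - 2 / (1 - s^2)), which explains the normalisation
  \<open>exp 2\<close>: the maximum, attained at s = 0, is 1.\<close>

lemma hump_factor:
  fixes s :: real
  defines "b \<equiv> exp 2 * (flat_fn 1 (1 - s) * flat_fn 1 (1 + s))"
  shows "0 \<le> b" "b \<le> 1" "s = 0 \<Longrightarrow> b = 1" "\<bar>s\<bar> \<ge> 1 \<Longrightarrow> b = 0"
proof -
  show "b \<le> 1"
  proof (cases "\<bar>s\<bar> < 1")
    case True
    then have p: "1 - s > 0" "1 + s > 0" by auto
    have "1 / (1 - s) + 1 / (1 + s) \<ge> 2"
    proof -
      have "(1 - s) * (1 + s) > 0" using p by (rule mult_pos_pos)
      moreover have "1 / (1 - s) + 1 / (1 + s) = 2 / ((1 - s) * (1 + s))"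
        using p by (simp add: field_simps)
      moreover have "(1 - s) * (1 + s) \<le> 1" by (simp add: algebra_simps)
      ultimately show ?thesis by (simp only: le_divide_eq) simp
    qed
    moreover have "b = exp (2 - (1 / (1 - s) + 1 / (1 + s)))"
      using p by (simp add: b_def flat_fn_def flip: exp_add)
    ultimately show ?thesis by simp
  qed (auto simp: b_def flat_fn_def)
  show "s = 0 \<Longrightarrow> b = 1" by (simp add: b_def flat_fn_def flip: exp_add)
qed (auto simp: b_def flat_fn_def)

lemma smooth_hump: "smooth hump"
proof -
  have "smooth (\<lambda>x::real^'n. \<Prod>i\<in>UNIV. exp 2 * (flat_fn 1 ((-1) * x $ i + 1) * flat_fn 1 (1 * x $ i + 1)))"
    by (intro smooth_prod smooth_mult smooth_const smooth_flat_affine) simp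
  then show ?thesis by (simp add: hump_def[abs_def] add.commute)
qed

lemma hump_bounds: "0 \<le> hump x" "hump x \<le> 1" "hump 0 = 1"
  using hump_factor(3)[of 0]
  unfolding hump_def by (auto intro!: prod_nonneg prod_le_1 hump_factor)

lemma hump_support: "x \<notin> cbox (\<chi> i. -1) (\<chi> i. 1) \<Longrightarrow> hump (x::real^'n) = 0"
proof -
  assume "x \<notin> cbox (\<chi> i. -1) (\<chi> i. 1)"
  then obtain i where "\<not> (-1 \<le> x $ i \<and> x $ i \<le> 1)" by (auto simp: mem_box_cart)
  then have "\<bar>x $ i\<bar> \<ge> 1" by linarith
  then show ?thesis unfolding hump_def using hump_factor(4) by (intro prod_zero) auto
qed

lemma hump_test: "hump \<in> test_functions UNIV"
  using smooth_hump hump_support compact_cbox unfolding test_functions_iff by blast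

text \<open>Vanishes outside the open box and increases to 1 inside as m grows, since
  \<open>flat_fn 1 (k * s)\<close> is exp(- 1 / (k s)) for s > 0. It transfers statements about test
  functions to indicators of boxes.\<close>

definition box_approx :: "real^'n \<Rightarrow> real^'n \<Rightarrow> nat \<Rightarrow> real^'n \<Rightarrow> real" where
  "box_approx a b m x = (\<Prod>i\<in>UNIV. flat_fn 1 (real (Suc m) * (x $ i - a $ i)) * flat_fn 1 (real (Suc m) * (b $ i - x $ i)))"

lemma flat_1_bounds: "0 \<le> flat_fn 1 s" "flat_fn 1 s \<le> 1"
  by (auto simp: flat_fn_def)

lemma box_approx_bounds: "0 \<le> box_approx a b m x" "box_approx a b m x \<le> 1"
  unfolding box_approx_def by (auto intro!: prod_nonneg prod_le_1 flat_1_bounds mult_le_one mult_nonneg_nonneg)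

lemma box_approx_outside: "x \<notin> box a b \<Longrightarrow> box_approx a b m x = 0"
proof -
  assume "x \<notin> box a b"
  then obtain i where "x $ i \<le> a $ i \<or> b $ i \<le> x $ i" by (auto simp: mem_box_cart not_less)
  then have "real (Suc m) * (x $ i - a $ i) \<le> 0 \<or> real (Suc m) * (b $ i - x $ i) \<le> 0"
    by (simp add: mult_le_0_iff)
  then have "flat_fn 1 (real (Suc m) * (x $ i - a $ i)) * flat_fn 1 (real (Suc m) * (b $ i - x $ i)) = 0"
    by (auto simp: flat_fn_def)
  then show ?thesis unfolding box_approx_def by (intro prod_zero bexI[of _ i]) auto
qed

lemma box_approx_test:
  fixes a b :: "real^'n"
  shows "box_approx a b m \<in> test_functions UNIV"
proof -
  have "smooth (\<lambda>x::real^'n. \<Prod>i\<in>UNIV. flat_fn 1 (real (Suc m) * x $ i + (- real (Suc m) * a $ i))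
     * flat_fn 1 ((- real (Suc m)) * x $ i + real (Suc m) * b $ i))"
    by (intro smooth_prod smooth_mult smooth_flat_affine) simp
  then have "smooth (box_approx a b m)"
    unfolding box_approx_def[abs_def] by (rule back_subst[of smooth]) (simp add: algebra_simps)
  moreover have "x \<notin> cbox a b \<Longrightarrow> box_approx a b m x = 0" for x
    using box_subset_cbox box_approx_outside by blast
  ultimately show ?thesis using compact_cbox unfolding test_functions_iff by blast
qed

lemma box_approx_tendsto:
  fixes a b x :: "real^'n"
  shows "(\<lambda>m. box_approx a b m x) \<longlonglongrightarrow> indicator (box a b) x"
proof (cases "x \<in> box a b")
  case True
  have f: "(\<lambda>m. flat_fn 1 (real (Suc m) * s)) \<longlonglongrightarrow> 1" if "s > 0" for s
  proof -
    have "(\<lambda>m. exp (- (1 / s) * (1 / real (Suc m)))) \<longlonglongrightarrow> exp (- (1 / s) * 0)"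
      by (intro tendsto_intros) (use LIMSEQ_inverse_real_of_nat in \<open>simp add: inverse_eq_divide\<close>)
    moreover have "flat_fn 1 (real (Suc m) * s) = exp (- (1 / s) * (1 / real (Suc m)))" for m
      using that by (simp add: flat_fn_def mult.commute)
    ultimately show ?thesis by simp
  qed
  have "(\<lambda>m. box_approx a b m x) \<longlonglongrightarrow> (\<Prod>i\<in>(UNIV::'n set). 1 * 1)"
    unfolding box_approx_def by (intro tendsto_prod tendsto_mult f) (use True in \<open>auto simp: mem_box_cart\<close>)
  then show ?thesis using True by simp
qed (simp add: box_approx_outside)

section \<open>Integration by parts\<close>

lemma integrable_continuous_compact_support:
  fixes f :: "real^'n \<Rightarrow> 'b::euclidean_space"
  assumes "continuous_on UNIV f" "compact K" "\<And>x. x \<notin> K \<Longrightarrow> f x = 0"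
  shows "integrable lborel f" "integrable lebesgue f"
proof -
  have "integrable lborel (\<lambda>x. indicator K x *\<^sub>R f x)"
    using assms by (intro borel_integrable_compact) (auto elim: continuous_on_subset)
  moreover have "(\<lambda>x. indicator K x *\<^sub>R f x) = f"
    using assms(3) by (auto simp: indicator_def)
  ultimately show "integrable lborel f" by simp
  then show "integrable lebesgue f"
    by (simp add: integrable_completion borel_measurable_integrable)
qed

lemma test_support:
  assumes "f \<in> test_functions G"
  obtains r where "r > 0" "\<And>x. norm x \<ge> r \<Longrightarrow> f x = 0"
proof -
  obtain K where K: "compact K" "\<forall>x. x \<notin> K \<longrightarrow> f x = 0"
    using assms by (auto simp: test_functions_iff)
  then obtain r where "r > 0" "\<forall>x\<in>K. norm x < r"
    using compact_imp_bounded bounded_pos_less by blast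
  with K that show ?thesis by (metis leD)
qed

lemma test_continuous: "f \<in> test_functions G \<Longrightarrow> continuous_on UNIV f"
  using test_smooth smooth_continuous by blast

lemma test_borel:
  fixes f :: "real^'n \<Rightarrow> 'b::euclidean_space"
  shows "f \<in> test_functions G \<Longrightarrow> f \<in> borel_measurable borel"
  using test_smooth smooth_borel by blast

lemma test_bounded:
  fixes f :: "real^'n \<Rightarrow> 'b::real_normed_vector"
  assumes "f \<in> test_functions G"
  obtains B where "B > 0" "\<And>x. norm (f x) \<le> B"
proof -
  obtain K where K: "compact K" "\<forall>x. x \<notin> K \<longrightarrow> f x = 0"
    using assms by (auto simp: test_functions_iff)
  have "compact (f ` K)"
    using K test_continuous[OF assms] by (intro compact_continuous_image) (auto elim: continuous_on_subset)
  then obtain B where "B > 0" "\<forall>y\<in>f ` K. norm y \<le> B"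
    using compact_imp_bounded bounded_pos by blast
  with K that[of B] show ?thesis
    by (metis image_eqI less_imp_le norm_zero)
qed

lemma test_integrable:
  fixes f :: "real^'n \<Rightarrow> 'b::euclidean_space"
  assumes "f \<in> test_functions G"
  shows "integrable lborel f" "integrable lebesgue f"
proof -
  obtain K where K: "compact K" "\<forall>x. x \<notin> K \<longrightarrow> f x = 0"
    using assms by (auto simp: test_functions_iff)
  with integrable_continuous_compact_support[OF test_continuous[OF assms] K(1)]
  show "integrable lborel f" "integrable lebesgue f" by auto
qed

lemma lborel_integral_translate:
  fixes f :: "real^'n \<Rightarrow> real"
  assumes [measurable]: "f \<in> borel_measurable borel"
  shows "(LINT x|lborel. f (x + a)) = (LINT x|lborel. f x)"
proof -
  have "(LINT x|lborel. f x) = (LINT x|distr lborel borel ((+) a). f x)"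
    by (simp add: lborel_distr_plus)
  also have "\<dots> = (LINT x|lborel. f (x + a))"
    by (subst integral_distr) (auto simp: add.commute)
  finally show ?thesis ..
qed

lemma smooth_DERIV_line:
  fixes f :: "real^'n \<Rightarrow> real"
  assumes "smooth f"
  shows "((\<lambda>s. f (x + s *\<^sub>R axis j 1)) has_real_derivative partial_deriv j f (x + s *\<^sub>R axis j 1)) (at s)"
proof -
  let ?y = "x + s *\<^sub>R axis j 1"
  have "((\<lambda>s. x + s *\<^sub>R axis j 1) has_derivative (\<lambda>h. h *\<^sub>R axis j 1)) (at s)"
    by (auto intro!: derivative_eq_intros)
  moreover have D: "(f has_derivative frechet_derivative f (at ?y)) (at ?y)"
    using assms by (intro has_derivative_frechet smooth_differentiable)
  ultimately have "((\<lambda>s. f (x + s *\<^sub>R axis j 1)) has_derivative (\<lambda>h. frechet_derivative f (at ?y) (h *\<^sub>R axis j 1))) (at s)"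
    using diff_chain_at by (fastforce simp: o_def)
  moreover have "(\<lambda>h. frechet_derivative f (at ?y) (h *\<^sub>R axis j 1)) = (*) (partial_deriv j f ?y)"
    using has_derivative_linear[OF D] by (auto simp: partial_deriv_def linear_scale)
  ultimately show ?thesis by (simp add: has_field_derivative_def)
qed

text \<open>The difference quotients of f in direction j have integral zero by translation
  invariance, and they converge to the derivative under a common integrable bound.\<close>

lemma integral_partial_deriv_test:
  fixes f :: "real^'n \<Rightarrow> real"
  assumes f: "f \<in> test_functions UNIV"
  shows "(LINT x|lebesgue. partial_deriv j f x) = 0"
proof -
  let ?e = "axis j 1 :: real^'n"
  define h where "h n = 1 / real (Suc n)" for n
  define q where "q n x = (f (x + h n *\<^sub>R ?e) - f x) / h n" for n x
  have h: "0 < h n" "h n \<le> 1" for n by (auto simp: h_def)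
  obtain r where r: "r > 0" "\<And>x. norm x \<ge> r \<Longrightarrow> f x = 0" using test_support[OF f] by metis
  obtain B where B: "B > 0" "\<And>x. norm (partial_deriv j f x) \<le> B"
    using test_bounded[OF test_partial_deriv[OF f]] by metis
  note [measurable] = test_borel[OF f] test_borel[OF test_partial_deriv[OF f]]
  have lim: "(\<lambda>n. q n x) \<longlonglongrightarrow> partial_deriv j f x" for x
  proof -
    have "((\<lambda>h. (f (x + h *\<^sub>R ?e) - f x) / h) \<longlongrightarrow> partial_deriv j f x) (at 0)"
      using smooth_DERIV_line[OF test_smooth[OF f], of x j 0] by (simp add: DERIV_def)
    moreover have "filterlim h (at 0) sequentially"
      using LIMSEQ_inverse_real_of_nat h
      by (auto simp: filterlim_at h_def[abs_def] inverse_eq_divide)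
    ultimately show ?thesis unfolding q_def by (rule filterlim_compose)
  qed
  \<comment> \<open>The mean value theorem bounds the quotient by the bound \<open>B\<close> for the
    derivative; the steps \<open>h n\<close> are at most 1, so everything lives in the ball of
    radius \<open>r + 1\<close>.\<close>
  have bound: "norm (q n x) \<le> B * indicator (cball 0 (r + 1)) x" for n x
  proof (cases "norm x \<le> r + 1")
    case True
    obtain z where "f (x + h n *\<^sub>R ?e) - f (x + 0 *\<^sub>R ?e) = (h n - 0) * partial_deriv j f (x + z *\<^sub>R ?e)"
      using MVT2[of 0 "h n" "\<lambda>s. f (x + s *\<^sub>R ?e)" "\<lambda>s. partial_deriv j f (x + s *\<^sub>R ?e)"]
        smooth_DERIV_line[OF test_smooth[OF f]] h by blast
    then have "q n x = partial_deriv j f (x + z *\<^sub>R ?e)" using h(1)[of n] by (simp add: q_def)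
    then show ?thesis using B True by simp
  next
    case False
    have "norm x \<le> norm (x + h n *\<^sub>R ?e) + norm (h n *\<^sub>R ?e)"
      using norm_triangle_ineq4[of "x + h n *\<^sub>R ?e" "h n *\<^sub>R ?e"] by simp
    then have "norm (x + h n *\<^sub>R ?e) \<ge> r" using False h[of n] by (simp add: norm_axis_1)
    then show ?thesis using r False by (simp add: q_def)
  qed
  have "(\<lambda>n. LINT x|lborel. q n x) \<longlonglongrightarrow> (LINT x|lborel. partial_deriv j f x)"
  proof (rule integral_dominated_convergence[where w="\<lambda>x. B * indicator (cball 0 (r + 1)) x"])
    show "integrable lborel (\<lambda>x. B * indicator (cball 0 (r + 1)) x :: real)"
      by (intro integrable_mult_right integrable_real_indicator emeasure_lborel_cball_finite) simp
  qed (use lim bound in \<open>auto simp: q_def\<close>)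
  moreover have "(LINT x|lborel. q n x) = 0" for n
  proof -
    have "integrable lborel (\<lambda>x. f (1 *\<^sub>R x + h n *\<^sub>R ?e))"
      by (rule test_integrable[OF test_affine[OF f]]) simp
    then show ?thesis
      using lborel_integral_translate[of f "h n *\<^sub>R ?e"] test_integrable(1)[OF f]
      by (simp add: q_def)
  qed
  ultimately have "(LINT x|lborel. partial_deriv j f x) = 0"
    by (simp add: LIMSEQ_const_iff)
  then show ?thesis by (simp add: integral_completion)
qed

definition gradient :: "(real^'n \<Rightarrow> real^'n) \<Rightarrow> real^'n \<Rightarrow> real^'n^'n" where
  "gradient u x = (\<chi> k j. partial_deriv j u x $ k)"

lemma smooth_component: "smooth u \<Longrightarrow> smooth (\<lambda>x. u x $ k)"
  by (rule smooth_linear[OF bounded_linear_vec_nth])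

lemma test_component: "u \<in> test_functions G \<Longrightarrow> (\<lambda>x. u x $ k) \<in> test_functions G"
  by (rule test_linear[OF bounded_linear_vec_nth])

lemma partial_deriv_component:
  "smooth u \<Longrightarrow> partial_deriv j (\<lambda>x. u x $ k) x = partial_deriv j u x $ k"
  by (rule partial_deriv_linear[OF bounded_linear_vec_nth])

lemma test_has_weak_gradient:
  fixes u :: "real^'n \<Rightarrow> real^'n"
  assumes u: "u \<in> test_functions UNIV"
  shows "has_weak_gradient u (gradient u)"
  unfolding has_weak_gradient_def
proof (intro ballI allI)
  fix \<eta> :: "real^'n \<Rightarrow> real" and j k assume \<eta>: "\<eta> \<in> test_functions UNIV"
  let ?u = "\<lambda>x. u x $ k"
  have uk: "?u \<in> test_functions UNIV" using u by (rule test_component)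
  have "(\<lambda>x. \<eta> x *\<^sub>R ?u x) \<in> test_functions UNIV"
    using test_scaleR[OF test_smooth[OF \<eta>] uk] .
  from integral_partial_deriv_test[OF this, of j]
  have "(LINT x|lebesgue. \<eta> x * partial_deriv j ?u x + partial_deriv j \<eta> x * ?u x) = 0"
    using partial_deriv_scaleR[OF test_smooth[OF \<eta>] test_smooth[OF uk], of j] by simp
  moreover have "integrable lebesgue (\<lambda>x. \<eta> x * partial_deriv j ?u x)"
    using test_integrable(2)[OF test_scaleR[OF test_smooth[OF \<eta>] test_partial_deriv[OF uk]]] by simp
  moreover have "integrable lebesgue (\<lambda>x. partial_deriv j \<eta> x * ?u x)"
    using test_integrable(2)[OF test_scaleR[OF smooth_partial_deriv[OF test_smooth[OF \<eta>]] uk]] by simp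
  ultimately have "(LINT x|lebesgue. \<eta> x * partial_deriv j ?u x) + (LINT x|lebesgue. partial_deriv j \<eta> x * ?u x) = 0"
    by simp
  then show "(LINT x|lebesgue. u x $ k * partial_deriv j \<eta> x) = - (LINT x|lebesgue. gradient u x $ k $ j * \<eta> x)"
    using partial_deriv_component[OF test_smooth[OF u]]
    by (simp add: gradient_def mult.commute)
qed

text \<open>The sets over which h integrates to zero form a Dynkin system: complements are covered
  because h is supported in one box, so its total integral is zero as well. Boxes are stable under
  intersection and generate the Borel sets.\<close>

lemma AE_zero_if_integral_box_zero:
  fixes h :: "real^'n \<Rightarrow> real"
  assumes h: "integrable lebesgue h"
    and supp: "\<And>x. x \<notin> box a0 b0 \<Longrightarrow> h x = 0"
    and zero: "\<And>a b. (LINT x|lebesgue. indicator (box a b) x * h x) = 0"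
  shows "AE x in lebesgue. h x = 0"
proof -
  let ?I = "\<lambda>A. LINT x:A|lebesgue. h x"
  have seth: "set_integrable lebesgue A h" if "A \<in> sets lebesgue" for A
    unfolding set_integrable_def using that h by (rule integrable_mult_indicator)
  have basic: "?I (box a b) = 0" for a b
    using zero[of a b] by (simp add: set_lebesgue_integral_def)
  have "?I (box a0 b0) = (LINT x|lebesgue. h x)"
    unfolding set_lebesgue_integral_def
    by (rule Bochner_Integration.integral_cong) (auto simp: indicator_def supp)
  then have total: "(LINT x|lebesgue. h x) = 0" using basic by simp
  have I0: "?I A = 0" if "A \<in> sets borel" for A
  proof -
    have 1: "A \<in> sigma_sets UNIV (range (\<lambda>(a, b). box a b))"
      using that unfolding borel_eq_box[where 'a="real^'n"] by simp
    have 2: "Int_stable (range (\<lambda>(a, b). box a b :: (real^'n) set))"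
      by (auto simp: Int_stable_def box_Int_box)
    have 3: "range (\<lambda>(a, b). box a b :: (real^'n) set) \<subseteq> Pow UNIV" by simp
    from 2 3 1 show ?thesis
    proof (induct rule: sigma_sets_induct_disjoint)
      case (basic A)
      then show ?case using \<open>\<And>a b. ?I (box a b) = 0\<close> by auto
    next
      case (compl A)
      then have A: "A \<in> sets borel" unfolding borel_eq_box[where 'a="real^'n"] by simp
      have "?I (UNIV - A) + ?I A = ?I ((UNIV - A) \<union> A)"
        using A by (intro set_integral_Un[symmetric] seth) auto
      also have "\<dots> = 0" using total by (simp add: set_lebesgue_integral_def)
      finally show ?case using compl by simp
    next
      case (union A)
      then have A: "A i \<in> sets borel" for i unfolding borel_eq_box[where 'a="real^'n"] by auto
      have "?I (\<Union>i. A i) = (\<Sum>i. ?I (A i))"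
        using A union(1) by (intro lebesgue_integral_countable_add seth)
           (auto simp: disjoint_family_on_def sets.countable_UN)
      then show ?case using union by simp
    qed (auto simp: set_lebesgue_integral_def)
  qed
  \<comment> \<open>The sets where h is positive or negative must be Borel for \<open>I0\<close> to
    apply, hence the passage to a Borel representative.\<close>
  obtain h' where h': "h' \<in> borel_measurable lborel" "AE x in lborel. h x = h' x"
    using completion_ex_borel_measurable_real[OF borel_measurable_integrable[OF h]] by blast
  have AE: "AE x in lebesgue. h x = h' x" using h'(2) by (rule AE_completion)
  have [measurable]: "h' \<in> borel_measurable borel" using h' by simp
  have h'_int: "integrable lebesgue h'"
    by (rule integrable_cong_AE_imp[OF h _ AE]) (simp add: measurable_completion)
  have "?I A = (LINT x:A|lebesgue. h' x)" if "A \<in> sets borel" for A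
    unfolding set_lebesgue_integral_def
    using that AE borel_measurable_integrable[OF h]
    by (intro integral_cong_AE borel_measurable_scaleR borel_measurable_indicator) (auto simp: measurable_completion)
  then have I0': "(LINT x:A|lebesgue. h' x) = 0" if "A \<in> sets borel" for A using I0 that by simp
  have "AE x in lebesgue. indicator {x. 0 < h' x} x * h' x = 0"
  proof (subst integral_nonneg_eq_0_iff_AE[symmetric])
    show "integrable lebesgue (\<lambda>x. indicator {x. 0 < h' x} x * h' x)"
      using integrable_mult_indicator[OF _ h'_int, of "{x. 0 < h' x}"] by simp
    show "(LINT x|lebesgue. indicator {x. 0 < h' x} x * h' x) = 0"
      using I0'[of "{x. 0 < h' x}"] by (simp add: set_lebesgue_integral_def)
  qed (auto simp: indicator_def)
  moreover have "AE x in lebesgue. indicator {x. h' x < 0} x * (- h' x) = 0"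
  proof (subst integral_nonneg_eq_0_iff_AE[symmetric])
    show "integrable lebesgue (\<lambda>x. indicator {x. h' x < 0} x * (- h' x))"
      using integrable_mult_indicator[OF _ h'_int, of "{x. h' x < 0}"] by simp
    show "(LINT x|lebesgue. indicator {x. h' x < 0} x * (- h' x)) = 0"
      using I0'[of "{x. h' x < 0}"] by (simp add: set_lebesgue_integral_def)
  qed (auto simp: indicator_def)
  ultimately show ?thesis using AE
    by eventually_elim (auto simp: indicator_def split: if_splits)
qed

section \<open>Square-integrable functions\<close>

definition sqint :: "(real^'n \<Rightarrow> 'b::euclidean_space) \<Rightarrow> real" where
  "sqint f = (LINT x|lebesgue. (norm (f x))\<^sup>2)"

lemma sqint_nonneg [simp]: "0 \<le> sqint f"
  unfolding sqint_def by (intro integral_nonneg_AE) auto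

lemma L2_norm_power2: "(L2_norm f)\<^sup>2 = sqint f"
  unfolding L2_norm_def sqint_def by (simp add: integral_nonneg_AE)

lemma square_integrableD:
  assumes "square_integrable f"
  shows "f \<in> borel_measurable lebesgue" "integrable lebesgue (\<lambda>x. (norm (f x))\<^sup>2)"
  using assms by (auto simp: square_integrable_def)

text \<open>Young's inequality with a free parameter: a small \<open>\<theta>\<close> keeps the
  coefficient of the leading term near 1, while the commutator term of a cut-off takes the large
  factor \<open>1 + 1 / \<theta>\<close>.\<close>

lemma norm_add_sq_le:
  fixes a b :: "'a::real_normed_vector"
  assumes "\<theta> > 0"
  shows "(norm (a + b))\<^sup>2 \<le> (1 + \<theta>) * (norm a)\<^sup>2 + (1 + 1 / \<theta>) * (norm b)\<^sup>2"
proof -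
  have "(norm (a + b))\<^sup>2 \<le> (norm a + norm b)\<^sup>2"
    by (intro power_mono norm_triangle_ineq) auto
  also have "\<dots> = (norm a)\<^sup>2 + (norm b)\<^sup>2 + 2 * norm a * norm b"
    by (simp add: power2_sum)
  also have "2 * norm a * norm b \<le> \<theta> * (norm a)\<^sup>2 + (norm b)\<^sup>2 / \<theta>"
  proof -
    have "0 \<le> (\<theta> * norm a - norm b)\<^sup>2 / \<theta>" using assms by simp
    also have "\<dots> = \<theta> * (norm a)\<^sup>2 + (norm b)\<^sup>2 / \<theta> - 2 * norm a * norm b"
      using assms by (simp add: power2_diff field_simps power2_eq_square)
    finally show ?thesis by simp
  qed
  finally show ?thesis by (simp add: algebra_simps)
qed

lemma square_integrable_add:
  assumes "square_integrable f" "square_integrable g"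
  shows "square_integrable (\<lambda>x. f x + g x)"
  unfolding square_integrable_def
proof
  note [measurable] = square_integrableD(1)[OF assms(1)] square_integrableD(1)[OF assms(2)]
  show "(\<lambda>x. f x + g x) \<in> borel_measurable lebesgue" by measurable
  show "integrable lebesgue (\<lambda>x. (norm (f x + g x))\<^sup>2)"
  proof (rule Bochner_Integration.integrable_bound)
    show "integrable lebesgue (\<lambda>x. 2 * (norm (f x))\<^sup>2 + 2 * (norm (g x))\<^sup>2)"
      using assms by (simp add: square_integrable_def)
    show "AE x in lebesgue. norm ((norm (f x + g x))\<^sup>2) \<le> norm (2 * (norm (f x))\<^sup>2 + 2 * (norm (g x))\<^sup>2)"
      using norm_add_sq_le[of 1] by (intro AE_I2) simp
  qed measurable
qed

lemma square_integrable_scaleR: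
  assumes "square_integrable f" shows "square_integrable (\<lambda>x. c *\<^sub>R f x)"
  using assms unfolding square_integrable_def by (auto simp: power_mult_distrib)

lemma square_integrable_diff:
  assumes "square_integrable f" "square_integrable g"
  shows "square_integrable (\<lambda>x. f x - g x)"
  using square_integrable_add[OF assms(1) square_integrable_scaleR[OF assms(2), of "-1"]] by simp

lemma square_integrable_bound:
  fixes f :: "real^'n \<Rightarrow> 'b::euclidean_space" and g :: "real^'n \<Rightarrow> 'c::euclidean_space"
  assumes "square_integrable g" "f \<in> borel_measurable lebesgue" "\<And>x. norm (f x) \<le> C * norm (g x)"
  shows "square_integrable f" "sqint f \<le> C\<^sup>2 * sqint g"
proof -
  have le: "(norm (f x))\<^sup>2 \<le> C\<^sup>2 * (norm (g x))\<^sup>2" for x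
    using power_mono[OF assms(3), of x 2] by (simp add: power_mult_distrib)
  have ig: "integrable lebesgue (\<lambda>x. C\<^sup>2 * (norm (g x))\<^sup>2)"
    using square_integrableD(2)[OF assms(1)] by simp
  have "integrable lebesgue (\<lambda>x. (norm (f x))\<^sup>2)"
    by (rule Bochner_Integration.integrable_bound[OF ig]) (use assms(2) le in auto)
  then show "square_integrable f" using assms by (simp add: square_integrable_def)
  have "sqint f \<le> (LINT x|lebesgue. C\<^sup>2 * (norm (g x))\<^sup>2)"
    unfolding sqint_def by (intro integral_mono \<open>integrable lebesgue (\<lambda>x. (norm (f x))\<^sup>2)\<close> ig le)
  then show "sqint f \<le> C\<^sup>2 * sqint g" by (simp add: sqint_def)
qed

lemma sqint_add_le:
  assumes "square_integrable f" "square_integrable g" "\<theta> > 0"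
  shows "sqint (\<lambda>x. f x + g x) \<le> (1 + \<theta>) * sqint f + (1 + 1 / \<theta>) * sqint g"
proof -
  have "sqint (\<lambda>x. f x + g x) \<le> (LINT x|lebesgue. (1 + \<theta>) * (norm (f x))\<^sup>2 + (1 + 1 / \<theta>) * (norm (g x))\<^sup>2)"
    unfolding sqint_def
    by (intro integral_mono Bochner_Integration.integrable_add integrable_mult_right square_integrableD(2)
        square_integrable_add assms norm_add_sq_le)
  also have "\<dots> = (1 + \<theta>) * sqint f + (1 + 1 / \<theta>) * sqint g"
    using assms by (simp add: sqint_def square_integrable_def)
  finally show ?thesis .
qed

lemma sqint_scaleR: "sqint (\<lambda>x. c *\<^sub>R f x) = c\<^sup>2 * sqint f"
  by (simp add: sqint_def power_mult_distrib)

lemma sqint_minus_commute: "sqint (\<lambda>x. f x - g x) = sqint (\<lambda>x. g x - f x)"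
  by (simp add: sqint_def norm_minus_commute)

lemma sqint_add_le2:
  assumes "square_integrable f" "square_integrable g"
  shows "sqint (\<lambda>x. f x + g x) \<le> 2 * sqint f + 2 * sqint g"
  using sqint_add_le[OF assms, of 1] by simp

lemma sqint_diff_le2:
  assumes "square_integrable f" "square_integrable g"
  shows "sqint (\<lambda>x. f x - g x) \<le> 2 * sqint f + 2 * sqint g"
  using sqint_add_le2[OF assms(1) square_integrable_scaleR[OF assms(2), of "-1"]]
    sqint_scaleR[of "-1" g] by simp

text \<open>Taking \<open>\<theta> = b / a\<close> in the quadratic estimate gives (a + b)^2 for any
  positive upper bounds a, b of the two norms. The shift by e / 2 keeps them positive when a norm
  vanishes.\<close>

lemma sqrt_sqint_triangle:
  assumes "square_integrable f" "square_integrable g"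
  shows "sqrt (sqint (\<lambda>x. f x + g x)) \<le> sqrt (sqint f) + sqrt (sqint g)"
proof -
  have le: "sqint (\<lambda>x. f x + g x) \<le> (a + b)\<^sup>2" if "a > 0" "b > 0" "sqint f \<le> a\<^sup>2" "sqint g \<le> b\<^sup>2" for a b
  proof -
    have "sqint (\<lambda>x. f x + g x) \<le> (1 + b / a) * sqint f + (1 + a / b) * sqint g"
      using sqint_add_le[OF assms, of "b / a"] that by simp
    also have "\<dots> \<le> (1 + b / a) * a\<^sup>2 + (1 + a / b) * b\<^sup>2"
      using that by (intro add_mono mult_left_mono) auto
    also have "\<dots> = (a + b)\<^sup>2" using that by (simp add: power2_eq_square field_simps)
    finally show ?thesis .
  qed
  have "sqrt (sqint (\<lambda>x. f x + g x)) \<le> sqrt (sqint f) + sqrt (sqint g) + e" if "e > 0" for e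
  proof -
    have "sqint f \<le> (sqrt (sqint f) + e / 2)\<^sup>2" "sqint g \<le> (sqrt (sqint g) + e / 2)\<^sup>2"
      using that by (simp_all add: power2_sum)
    then have "sqint (\<lambda>x. f x + g x) \<le> (sqrt (sqint f) + e / 2 + (sqrt (sqint g) + e / 2))\<^sup>2"
      using that by (intro le add_nonneg_pos) auto
    then have "sqrt (sqint (\<lambda>x. f x + g x)) \<le> \<bar>sqrt (sqint f) + e / 2 + (sqrt (sqint g) + e / 2)\<bar>"
      using real_sqrt_le_mono by fastforce
    also have "\<dots> = sqrt (sqint f) + sqrt (sqint g) + e"
      using that by (subst abs_of_nonneg) (auto intro!: add_nonneg_nonneg)
    finally show ?thesis .
  qed
  then show ?thesis by (rule field_le_epsilon)
qed

lemma sqrt_sqint_diff: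
  assumes "square_integrable f" "square_integrable g"
  shows "\<bar>sqrt (sqint f) - sqrt (sqint g)\<bar> \<le> sqrt (sqint (\<lambda>x. f x - g x))"
  using sqrt_sqint_triangle[OF square_integrable_diff[OF assms] assms(2)]
    sqrt_sqint_triangle[OF square_integrable_diff[OF assms(2,1)] assms(1)]
    sqint_minus_commute[of f g] by simp

lemma sqint_tendsto:
  assumes "\<And>n. square_integrable (f n)" "square_integrable g" "(\<lambda>n. sqint (\<lambda>x. f n x - g x)) \<longlonglongrightarrow> 0"
  shows "(\<lambda>n. sqint (f n)) \<longlonglongrightarrow> sqint g"
proof -
  have "(\<lambda>n. sqrt (sqint (\<lambda>x. f n x - g x))) \<longlonglongrightarrow> 0"
    using tendsto_real_sqrt[OF assms(3)] by simp
  then have "(\<lambda>n. sqrt (sqint (f n)) - sqrt (sqint g)) \<longlonglongrightarrow> 0"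
    by (rule Lim_null_comparison[rotated]) (use sqrt_sqint_diff[OF assms(1,2)] in auto)
  then have "(\<lambda>n. sqrt (sqint (f n))) \<longlonglongrightarrow> sqrt (sqint g)" by (rule LIM_zero_cancel)
  from tendsto_power[OF this, of 2] show ?thesis by simp
qed

lemma integrable_mult_L2:
  fixes f g :: "real^'n \<Rightarrow> real"
  assumes "square_integrable f" "square_integrable g"
  shows "integrable lebesgue (\<lambda>x. f x * g x)"
proof (rule Bochner_Integration.integrable_bound)
  show "integrable lebesgue (\<lambda>x. (norm (f x))\<^sup>2 + (norm (g x))\<^sup>2)"
    using assms by (simp add: square_integrable_def)
  show "(\<lambda>x. f x * g x) \<in> borel_measurable lebesgue"
    using assms by (auto simp: square_integrable_def)
  have "\<bar>a * b\<bar> \<le> a\<^sup>2 + b\<^sup>2" for a b :: real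
    using sum_squares_bound[of "\<bar>a\<bar>" "\<bar>b\<bar>"] mult_nonneg_nonneg[of "\<bar>a\<bar>" "\<bar>b\<bar>"]
    by (simp only: abs_mult power2_abs) linarith
  then show "AE x in lebesgue. norm (f x * g x) \<le> norm ((norm (f x))\<^sup>2 + (norm (g x))\<^sup>2)"
    by (intro AE_I2) simp
qed

lemma Cauchy_Schwarz_L2:
  fixes f g :: "real^'n \<Rightarrow> real"
  assumes "square_integrable f" "square_integrable g"
  shows "(LINT x|lebesgue. f x * g x)\<^sup>2 \<le> sqint f * sqint g"
proof -
  let ?b = "LINT x|lebesgue. f x * g x"
  have q: "0 \<le> sqint f - 2 * t * ?b + t\<^sup>2 * sqint g" for t
  proof -
    have "0 \<le> (LINT x|lebesgue. (f x - t * g x)\<^sup>2)" by (intro integral_nonneg_AE) auto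
    also have "\<dots> = (LINT x|lebesgue. (norm (f x))\<^sup>2 - 2 * t * (f x * g x) + t\<^sup>2 * (norm (g x))\<^sup>2)"
      by (intro Bochner_Integration.integral_cong) (auto simp: power2_diff power_mult_distrib)
    also have "\<dots> = sqint f - 2 * t * ?b + t\<^sup>2 * sqint g"
      using assms integrable_mult_L2[OF assms] by (simp add: sqint_def square_integrable_def)
    finally show ?thesis .
  qed
  show ?thesis
  proof (cases "sqint g = 0")
    case True
    have "?b = 0"
    proof (rule ccontr)
      assume "?b \<noteq> 0"
      \<comment> \<open>At this parameter the expression in \<open>q\<close>, linear in t because
        \<open>sqint g = 0\<close>, takes the value -1.\<close>
      then show False using q[of "(sqint f + 1) / (2 * ?b)"] True by simp
    qed
    then show ?thesis by simp
  next
    case False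
    then have "sqint g > 0" using sqint_nonneg[of g] by linarith
    then show ?thesis using q[of "?b / sqint g"] by (simp add: power2_eq_square field_simps)
  qed
qed

lemma integral_mult_tendsto:
  fixes g :: "real^'n \<Rightarrow> real"
  assumes "\<And>n. square_integrable (f n)" "square_integrable h" "square_integrable g"
    "(\<lambda>n. sqint (\<lambda>x. f n x - h x)) \<longlonglongrightarrow> 0"
  shows "(\<lambda>n. LINT x|lebesgue. f n x * g x) \<longlonglongrightarrow> (LINT x|lebesgue. h x * g x)"
proof -
  have "(\<lambda>n. sqrt (sqint (\<lambda>x. f n x - h x) * sqint g)) \<longlonglongrightarrow> sqrt (0 * sqint g)"
    by (intro tendsto_intros assms)
  then have 1: "(\<lambda>n. sqrt (sqint (\<lambda>x. f n x - h x) * sqint g)) \<longlonglongrightarrow> 0" by simp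
  have "norm ((LINT x|lebesgue. f n x * g x) - (LINT x|lebesgue. h x * g x)) \<le> sqrt (sqint (\<lambda>x. f n x - h x) * sqint g)" for n
  proof -
    have "(LINT x|lebesgue. f n x * g x) - (LINT x|lebesgue. h x * g x) = (LINT x|lebesgue. (f n x - h x) * g x)"
      using integrable_mult_L2[OF assms(1)[of n] assms(3)] integrable_mult_L2[OF assms(2,3)]
      by (simp add: left_diff_distrib)
    then show ?thesis
      using Cauchy_Schwarz_L2[OF square_integrable_diff[OF assms(1)[of n] assms(2)] assms(3)]
      by (simp add: real_le_rsqrt)
  qed
  then have "(\<lambda>n. (LINT x|lebesgue. f n x * g x) - (LINT x|lebesgue. h x * g x)) \<longlonglongrightarrow> 0"
    by (intro Lim_null_comparison[OF _ 1]) auto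
  then show ?thesis by (rule LIM_zero_cancel)
qed

text \<open>Written with the midpoint, so that a lower bound for the midpoint becomes an upper bound
  for the distance; this drives the Cauchy argument in \<open>H1_compactness\<close>.\<close>

lemma sqint_parallelogram:
  assumes "square_integrable f" "square_integrable g"
  shows "sqint (\<lambda>x. f x - g x) = 2 * sqint f + 2 * sqint g - 4 * sqint (\<lambda>x. (1/2) *\<^sub>R (f x + g x))"
proof -
  have "sqint (\<lambda>x. f x - g x) + sqint (\<lambda>x. f x + g x) = (LINT x|lebesgue. (norm (f x - g x))\<^sup>2 + (norm (f x + g x))\<^sup>2)"
    unfolding sqint_def using square_integrable_add[OF assms] square_integrable_diff[OF assms]
    by (simp add: square_integrable_def)
  also have "\<dots> = (LINT x|lebesgue. 2 * (norm (f x))\<^sup>2 + 2 * (norm (g x))\<^sup>2)"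
    by (intro Bochner_Integration.integral_cong)
       (auto simp: power2_norm_eq_inner inner_add inner_diff inner_commute)
  also have "\<dots> = 2 * sqint f + 2 * sqint g"
    using assms by (simp add: sqint_def square_integrable_def)
  finally show ?thesis by (simp add: sqint_scaleR power2_eq_square)
qed

lemma test_square_integrable:
  fixes f :: "real^'n \<Rightarrow> 'b::euclidean_space"
  assumes "f \<in> test_functions G"
  shows "square_integrable f"
proof -
  obtain K where K: "compact K" "\<forall>x. x \<notin> K \<longrightarrow> f x = 0" "smooth f"
    using assms by (auto simp: test_functions_iff)
  have "integrable lebesgue (\<lambda>x. (norm (f x))\<^sup>2)"
    by (rule integrable_continuous_compact_support[OF _ K(1)])
       (use K test_continuous[OF assms] in \<open>auto intro!: continuous_intros\<close>)
  then show ?thesis using test_borel[OF assms] by (simp add: square_integrable_def measurable_completion)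
qed

lemma sqint_eq_0:
  assumes "square_integrable f"
  shows "sqint f = 0 \<longleftrightarrow> (AE x in lebesgue. f x = 0)"
  unfolding sqint_def using square_integrableD[OF assms] by (subst integral_nonneg_eq_0_iff_AE) auto

lemma sqint_cong_AE:
  assumes "AE x in lebesgue. f x = g x" "f \<in> borel_measurable lebesgue" "g \<in> borel_measurable lebesgue"
  shows "sqint f = sqint g"
  unfolding sqint_def using assms by (intro integral_cong_AE) auto

text \<open>Riesz--Fischer: a subsequence whose increments are bounded by \<open>8\<^sup>-\<^sup>k\<close> converges almost
  everywhere, and Fatou's lemma identifies the limit.\<close>

lemma L2_complete:
  fixes f :: "nat \<Rightarrow> real^'n \<Rightarrow> 'b::euclidean_space"
  assumes f: "\<And>n. square_integrable (f n)"
    and Cauchy: "\<And>e. e > 0 \<Longrightarrow> \<exists>N. \<forall>m\<ge>N. \<forall>n\<ge>N. sqint (\<lambda>x. f m x - f n x) < e"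
  obtains g where "square_integrable g" "(\<lambda>n. sqint (\<lambda>x. f n x - g x)) \<longlonglongrightarrow> 0"
proof -
  note [measurable] = square_integrableD(1)[OF f]
  have nn: "(\<integral>\<^sup>+x. ennreal ((norm (f m x - f n x))\<^sup>2) \<partial>lebesgue) = ennreal (sqint (\<lambda>x. f m x - f n x))" for m n
    unfolding sqint_def by (intro nn_integral_eq_integral square_integrableD square_integrable_diff f) auto
  have "\<forall>k. \<exists>N. \<forall>m\<ge>N. \<forall>n\<ge>N. sqint (\<lambda>x. f m x - f n x) < (1/8)^k"
    using Cauchy by simp
  then obtain N where N: "\<And>k m n. m \<ge> N k \<Longrightarrow> n \<ge> N k \<Longrightarrow> sqint (\<lambda>x. f m x - f n x) < (1/8)^k"
    by metis
  \<comment> \<open>The partial sums of \<open>N\<close> make the indices monotone and at least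
    \<open>N k\<close>; the summand \<open>k\<close> makes them tend to infinity.\<close>
  define r where "r k = k + (\<Sum>i\<le>k. N i)" for k
  have rN: "N k \<le> r k" for k
    unfolding r_def by (simp add: sum.atMost_Suc member_le_sum[of k "{..k}" N] trans_le_add2)
  have r_mono: "r k \<le> r (Suc k)" "k \<le> r k" for k by (auto simp: r_def)
  define \<Delta> where "\<Delta> k x = f (r (Suc k)) x - f (r k) x" for k x
  have [measurable]: "\<Delta> k \<in> borel_measurable lebesgue" for k unfolding \<Delta>_def by measurable
  have \<Delta>: "(\<integral>\<^sup>+x. ennreal ((norm (\<Delta> k x))\<^sup>2) \<partial>lebesgue) \<le> ennreal ((1/8)^k)" for k
    unfolding \<Delta>_def nn using N[of k "r (Suc k)" "r k"] rN[of k] r_mono(1)[of k]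
    by (intro ennreal_leI) auto
  \<comment> \<open>The weight \<open>4^k\<close> leaves the integrals summable against the rate
    \<open>8^-k\<close>, and finiteness of the weighted series at x bounds the k-th increment by a
    multiple of \<open>2^-k\<close>.\<close>
  have "(\<integral>\<^sup>+x. (\<Sum>k. ennreal (4^k * (norm (\<Delta> k x))\<^sup>2)) \<partial>lebesgue) = (\<Sum>k. \<integral>\<^sup>+x. ennreal (4^k * (norm (\<Delta> k x))\<^sup>2) \<partial>lebesgue)"
    by (intro nn_integral_suminf) measurable
  also have "\<dots> \<le> (\<Sum>k. ennreal ((1/2)^k))"
  proof (rule suminf_le)
    fix k
    have "(\<integral>\<^sup>+x. ennreal (4^k * (norm (\<Delta> k x))\<^sup>2) \<partial>lebesgue) = ennreal (4^k) * (\<integral>\<^sup>+x. ennreal ((norm (\<Delta> k x))\<^sup>2) \<partial>lebesgue)"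
      by (simp add: ennreal_mult nn_integral_cmult)
    also have "\<dots> \<le> ennreal (4^k) * ennreal ((1/8)^k)" by (intro mult_left_mono \<Delta>) auto
    also have "\<dots> = ennreal ((1/2)^k)" by (simp flip: ennreal_mult power_mult_distrib)
    finally show "(\<integral>\<^sup>+x. ennreal (4^k * (norm (\<Delta> k x))\<^sup>2) \<partial>lebesgue) \<le> ennreal ((1/2)^k)" .
  qed auto
  also have "\<dots> = ennreal (\<Sum>k. (1/2)^k)" by (intro suminf_ennreal2) (auto intro: summable_geometric)
  also have "\<dots> < \<infinity>" by simp
  finally have "AE x in lebesgue. (\<Sum>k. ennreal (4^k * (norm (\<Delta> k x))\<^sup>2)) \<noteq> \<infinity>"
    by (intro nn_integral_PInf_AE) auto
  moreover have term_le: "a k \<le> (\<Sum>k. a k)" for a :: "nat \<Rightarrow> ennreal" and k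
    using sum_le_suminf[of a "{k}"] by simp
  ultimately have conv: "AE x in lebesgue. convergent (\<lambda>k. f (r k) x)"
  proof (elim eventually_mono)
    fix x assume fin: "(\<Sum>k. ennreal (4^k * (norm (\<Delta> k x))\<^sup>2)) \<noteq> \<infinity>"
    define C where "C = enn2real (\<Sum>k. ennreal (4^k * (norm (\<Delta> k x))\<^sup>2))"
    have "norm (\<Delta> k x) \<le> sqrt C * (1/2)^k" for k
    proof -
      have "ennreal (4^k * (norm (\<Delta> k x))\<^sup>2) \<le> (\<Sum>k. ennreal (4^k * (norm (\<Delta> k x))\<^sup>2))"
        by (rule term_le[of "\<lambda>k. ennreal (4^k * (norm (\<Delta> k x))\<^sup>2)"])
      also have "\<dots> = ennreal C"
        unfolding C_def using fin by (subst ennreal_enn2real) (simp_all add: top.not_eq_extremum)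
      finally have "4^k * (norm (\<Delta> k x))\<^sup>2 \<le> C"
        by (subst (asm) ennreal_le_iff) (simp_all only: C_def enn2real_nonneg)
      moreover have "(4::real)^k = (2^k)\<^sup>2" by (simp add: power2_eq_square flip: power_mult_distrib)
      ultimately have "(2^k * norm (\<Delta> k x))\<^sup>2 \<le> C" by (simp only: power_mult_distrib)
      then have "2^k * norm (\<Delta> k x) \<le> sqrt C" by (rule real_le_rsqrt)
      then show ?thesis by (simp add: field_simps power_one_over)
    qed
    moreover have "summable (\<lambda>k. sqrt C * (1/2)^k :: real)"
      by (intro summable_mult summable_geometric) simp
    ultimately have "summable (\<lambda>k. \<Delta> k x)"
      by (intro summable_comparison_test'[of "\<lambda>k. sqrt C * (1/2)^k" 0 "\<lambda>k. \<Delta> k x"])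
    then have "convergent (\<lambda>n. \<Sum>k<n. \<Delta> k x)" by (simp add: summable_iff_convergent)
    then have "convergent (\<lambda>n. (\<Sum>k<n. \<Delta> k x) + f (r 0) x)"
      by (intro convergent_add convergent_const)
    moreover have "(\<Sum>k<n. \<Delta> k x) + f (r 0) x = f (r n) x" for n
      unfolding \<Delta>_def by (simp add: sum_lessThan_telescope[of "\<lambda>k. f (r k) x"])
    ultimately show "convergent (\<lambda>k. f (r k) x)" by simp
  qed
  define g where "g x = lim (\<lambda>k. f (r k) x)" for x
  have g_meas[measurable]: "g \<in> borel_measurable lebesgue" unfolding g_def by measurable
  have bound: "(\<integral>\<^sup>+x. ennreal ((norm (f n x - g x))\<^sup>2) \<partial>lebesgue) \<le> ennreal e"
    if "e > 0" "\<And>m n. m \<ge> M \<Longrightarrow> n \<ge> M \<Longrightarrow> sqint (\<lambda>x. f m x - f n x) < e" "n \<ge> M" for e M n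
  proof -
    have "(\<integral>\<^sup>+x. ennreal ((norm (f n x - g x))\<^sup>2) \<partial>lebesgue) = (\<integral>\<^sup>+x. liminf (\<lambda>k. ennreal ((norm (f n x - f (r k) x))\<^sup>2)) \<partial>lebesgue)"
    proof (rule nn_integral_cong_AE)
      show "AE x in lebesgue. ennreal ((norm (f n x - g x))\<^sup>2) = liminf (\<lambda>k. ennreal ((norm (f n x - f (r k) x))\<^sup>2))"
        using conv
      proof eventually_elim
        fix x assume "convergent (\<lambda>k. f (r k) x)"
        then have "(\<lambda>k. f (r k) x) \<longlonglongrightarrow> g x" by (simp add: g_def convergent_LIMSEQ_iff)
        then have "(\<lambda>k. ennreal ((norm (f n x - f (r k) x))\<^sup>2)) \<longlonglongrightarrow> ennreal ((norm (f n x - g x))\<^sup>2)"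
          by (intro tendsto_intros tendsto_ennrealI)
        then show "ennreal ((norm (f n x - g x))\<^sup>2) = liminf (\<lambda>k. ennreal ((norm (f n x - f (r k) x))\<^sup>2))"
          using lim_imp_Liminf[OF sequentially_bot] by force
      qed
    qed
    also have "\<dots> \<le> liminf (\<lambda>k. \<integral>\<^sup>+x. ennreal ((norm (f n x - f (r k) x))\<^sup>2) \<partial>lebesgue)"
      by (intro nn_integral_liminf) measurable
    also have "\<dots> \<le> liminf (\<lambda>k. ennreal e)"
    proof (rule Liminf_mono)
      show "\<forall>\<^sub>F k in sequentially. (\<integral>\<^sup>+x. ennreal ((norm (f n x - f (r k) x))\<^sup>2) \<partial>lebesgue) \<le> ennreal e"
        using eventually_ge_at_top[of M]
      proof eventually_elim
        case (elim k)
        then have "r k \<ge> M" using r_mono(2)[of k] by linarith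
        from that(2)[OF that(3) this] show ?case by (simp add: nn ennreal_leI)
      qed
    qed
    also have "\<dots> = ennreal e" by (simp add: Liminf_const)
    finally show ?thesis .
  qed
  obtain M1 where M1: "\<And>m n. m \<ge> M1 \<Longrightarrow> n \<ge> M1 \<Longrightarrow> sqint (\<lambda>x. f m x - f n x) < 1" using Cauchy[of 1] by auto
  have "integrable lebesgue (\<lambda>x. (norm (f M1 x - g x))\<^sup>2)"
  proof (rule integrableI_bounded)
    have "(\<integral>\<^sup>+x. ennreal ((norm (f M1 x - g x))\<^sup>2) \<partial>lebesgue) \<le> ennreal 1" using bound[of 1 M1 M1] M1 by simp
    also have "\<dots> < \<infinity>" by simp
    finally show "(\<integral>\<^sup>+x. ennreal (norm ((norm (f M1 x - g x))\<^sup>2)) \<partial>lebesgue) < \<infinity>" by simp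
  qed measurable
  then have "square_integrable (\<lambda>x. f M1 x - g x)" by (simp add: square_integrable_def)
  from square_integrable_diff[OF f[of M1] this] have g: "square_integrable g" by simp
  have "(\<lambda>n. sqint (\<lambda>x. f n x - g x)) \<longlonglongrightarrow> 0"
  proof (rule LIMSEQ_I)
    fix e :: real assume "e > 0"
    then obtain M where M: "\<And>m n. m \<ge> M \<Longrightarrow> n \<ge> M \<Longrightarrow> sqint (\<lambda>x. f m x - f n x) < e/2" using Cauchy[of "e/2"] by auto
    have "sqint (\<lambda>x. f n x - g x) \<le> e / 2" if "n \<ge> M" for n
    proof -
      have "ennreal (sqint (\<lambda>x. f n x - g x)) = (\<integral>\<^sup>+x. ennreal ((norm (f n x - g x))\<^sup>2) \<partial>lebesgue)"
        unfolding sqint_def by (intro nn_integral_eq_integral[symmetric] square_integrableD square_integrable_diff f g) auto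
      also have "\<dots> \<le> ennreal (e / 2)" using bound[of "e/2" M n] M \<open>e > 0\<close> that by simp
      finally show ?thesis using \<open>e > 0\<close> by (simp add: ennreal_le_iff)
    qed
    then show "\<exists>M. \<forall>n\<ge>M. norm (sqint (\<lambda>x. f n x - g x) - 0) < e"
      using \<open>e > 0\<close> by (intro exI[of _ M]) fastforce
  qed
  with g that show ?thesis by blast
qed

section \<open>Weak gradients\<close>

lemma square_integrable_indicator_box:
  "square_integrable (\<lambda>x::real^'n. indicator (box a b) x :: real)"
proof -
  have "integrable lebesgue (\<lambda>x::real^'n. indicator (box a b) x :: real)"
    using emeasure_lborel_box_finite[of a b] by (intro integrable_real_indicator) auto
  moreover have "(\<lambda>x::real^'n. (norm (indicator (box a b) x :: real))\<^sup>2) = (\<lambda>x. indicator (box a b) x)"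
    by (auto simp: indicator_def)
  ultimately show ?thesis by (simp add: square_integrable_def)
qed

text \<open>Test functions approximate indicators of boxes boundedly, so g integrates to zero over
  every box. As g is square integrable but perhaps not integrable, it is first restricted to boxes
  exhausting the space.\<close>

lemma AE_zero_if_test_integral_zero:
  fixes g :: "real^'n \<Rightarrow> real"
  assumes g: "square_integrable g"
    and zero: "\<And>\<eta>. \<eta> \<in> test_functions UNIV \<Longrightarrow> (LINT x|lebesgue. g x * \<eta> x) = 0"
  shows "AE x in lebesgue. g x = 0"
proof -
  have int: "integrable lebesgue (\<lambda>x. indicator (box a b) x * g x)" for a b
    by (rule integrable_mult_L2[OF square_integrable_indicator_box g])
  have box0: "(LINT x|lebesgue. indicator (box a b) x * g x) = 0" for a b
  proof -
    have "(\<lambda>m. LINT x|lebesgue. box_approx a b m x * g x) \<longlonglongrightarrow> (LINT x|lebesgue. indicator (box a b) x * g x)"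
    proof (rule integral_dominated_convergence[where w="\<lambda>x. norm (indicator (box a b) x * g x)"])
      show "(\<lambda>x. indicator (box a b) x * g x) \<in> borel_measurable lebesgue"
        using int by (rule borel_measurable_integrable)
      show "(\<lambda>x. box_approx a b m x * g x) \<in> borel_measurable lebesgue" for m
        using integrable_mult_L2[OF test_square_integrable[OF box_approx_test] g] by (rule borel_measurable_integrable)
      show "integrable lebesgue (\<lambda>x. norm (indicator (box a b) x * g x))" using int by (rule integrable_norm)
      show "AE x in lebesgue. (\<lambda>m. box_approx a b m x * g x) \<longlonglongrightarrow> indicator (box a b) x * g x"
        by (intro AE_I2 tendsto_mult box_approx_tendsto tendsto_const)
      have "norm (box_approx a b m x * g x) \<le> norm (indicator (box a b) x * g x)" for m x
        using box_approx_bounds[of a b m x] box_approx_outside[of x a b m]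
        by (cases "x \<in> box a b") (auto simp: abs_mult mult_left_le_one_le)
      then show "AE x in lebesgue. norm (box_approx a b m x * g x) \<le> norm (indicator (box a b) x * g x)" for m
        by simp
    qed
    moreover have "(LINT x|lebesgue. box_approx a b m x * g x) = 0" for m
      using zero[OF box_approx_test] by (simp add: mult.commute)
    ultimately show ?thesis by (simp add: LIMSEQ_const_iff)
  qed
  have "AE x in lebesgue. indicator (box (\<chi> i. - real R) (\<chi> i. real R)) x * g x = 0" for R
  proof (rule AE_zero_if_integral_box_zero[of _ "\<chi> i. - real R" "\<chi> i. real R", OF int])
    fix a b :: "real^'n"
    let ?c = "(\<chi> i. - real R) :: real^'n" and ?d = "(\<chi> i. real R) :: real^'n"
    obtain a' b' where ab: "box a b \<inter> box ?c ?d = box a' b'" by (rule that) (rule box_Int_box)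
    have "(\<lambda>x. indicator (box a b) x * (indicator (box ?c ?d) x * g x)) = (\<lambda>x. indicator (box a' b') x * g x)"
      unfolding ab[symmetric] by (auto simp: indicator_def)
    then show "(LINT x|lebesgue. indicator (box a b) x * (indicator (box ?c ?d) x * g x)) = 0"
      using box0 by simp
  qed simp
  then have "AE x in lebesgue. \<forall>R. indicator (box (\<chi> i. - real R) (\<chi> i. real R)) x * g x = 0"
    by (subst AE_all_countable) simp
  then show ?thesis
  proof (rule eventually_mono)
    fix x assume *: "\<forall>R. indicator (box (\<chi> i. - real R) (\<chi> i. real R)) x * g x = 0"
    obtain R :: nat where "norm x < real R" using reals_Archimedean2 by blast
    then have "\<bar>x $ i\<bar> < real R" for i using component_le_norm_cart[of x i] by linarith
    then have "x \<in> box (\<chi> i. - real R) (\<chi> i. real R)" by (auto simp: mem_box_cart abs_less_iff minus_less_iff)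
    with *[rule_format, of R] show "g x = 0" by simp
  qed
qed

lemma square_integrable_component:
  fixes f :: "real^'n \<Rightarrow> real^'m"
  assumes "square_integrable f"
  shows "square_integrable (\<lambda>x. f x $ k)" "sqint (\<lambda>x. f x $ k) \<le> sqint f"
proof -
  have m: "(\<lambda>x. f x $ k) \<in> borel_measurable lebesgue"
    by (rule measurable_compose[OF square_integrableD(1)[OF assms] borel_measurable_continuous_onI])
       (intro continuous_intros)
  show "square_integrable (\<lambda>x. f x $ k)" "sqint (\<lambda>x. f x $ k) \<le> sqint f"
    using square_integrable_bound[OF assms m, of 1] component_le_norm_cart by auto
qed

lemma square_integrable_entry:
  fixes D :: "real^'n \<Rightarrow> real^'m^'l"
  assumes "square_integrable D"
  shows "square_integrable (\<lambda>x. D x $ k $ j)" "sqint (\<lambda>x. D x $ k $ j) \<le> sqint D"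
proof -
  have m: "(\<lambda>x. D x $ k $ j) \<in> borel_measurable lebesgue"
    by (rule measurable_compose[OF square_integrableD(1)[OF assms] borel_measurable_continuous_onI])
       (intro continuous_intros)
  have "\<bar>D x $ k $ j\<bar> \<le> norm (D x)" for x
    using component_le_norm_cart[of "D x $ k" j] Finite_Cartesian_Product.norm_nth_le[of "D x" k] by linarith
  then show "square_integrable (\<lambda>x. D x $ k $ j)" "sqint (\<lambda>x. D x $ k $ j) \<le> sqint D"
    using square_integrable_bound[OF assms m, of 1] by auto
qed

lemma weak_gradient_unique:
  assumes "square_integrable D" "square_integrable E" "has_weak_gradient \<phi> D" "has_weak_gradient \<phi> E"
  shows "AE x in lebesgue. D x = E x"
proof -
  have "AE x in lebesgue. D x $ k $ j - E x $ k $ j = 0" for k j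
  proof (rule AE_zero_if_test_integral_zero)
    show "square_integrable (\<lambda>x. D x $ k $ j - E x $ k $ j)"
      using assms by (intro square_integrable_diff square_integrable_entry)
    fix \<eta> :: "real^'a \<Rightarrow> real" assume \<eta>: "\<eta> \<in> test_functions UNIV"
    have "(LINT x|lebesgue. D x $ k $ j * \<eta> x) = (LINT x|lebesgue. E x $ k $ j * \<eta> x)"
      using assms(3,4) \<eta> unfolding has_weak_gradient_def by (metis (no_types, lifting) neg_equal_iff_equal)
    then show "(LINT x|lebesgue. (D x $ k $ j - E x $ k $ j) * \<eta> x) = 0"
      using assms(1,2) by (simp add: left_diff_distrib integrable_mult_L2 square_integrable_entry test_square_integrable[OF \<eta>])
  qed
  then have "AE x in lebesgue. \<forall>k j. D x $ k $ j - E x $ k $ j = 0"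
    by (simp add: AE_all_countable)
  then show ?thesis by (rule eventually_mono) (simp add: vec_eq_iff)
qed

lemma weak_gradient_props:
  assumes "\<phi> \<in> weakly_diff_L2"
  shows "square_integrable \<phi>" "square_integrable (weak_gradient \<phi>)" "has_weak_gradient \<phi> (weak_gradient \<phi>)"
proof -
  obtain D where "square_integrable D \<and> has_weak_gradient \<phi> D" "square_integrable \<phi>"
    using assms by (auto simp: weakly_diff_L2_def)
  from this someI[of "\<lambda>D. square_integrable D \<and> has_weak_gradient \<phi> D", OF this(1)]
  show "square_integrable \<phi>" "square_integrable (weak_gradient \<phi>)" "has_weak_gradient \<phi> (weak_gradient \<phi>)"
    by (auto simp: weak_gradient_def)
qed

text \<open>Lets the gradient picked by choice be replaced, up to a null set, by any concrete weak
  gradient at hand.\<close>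

lemma weak_gradient_AE:
  assumes "square_integrable \<phi>" "square_integrable D" "has_weak_gradient \<phi> D"
  shows "\<phi> \<in> weakly_diff_L2" "AE x in lebesgue. weak_gradient \<phi> x = D x"
proof -
  show "\<phi> \<in> weakly_diff_L2" using assms by (auto simp: weakly_diff_L2_def)
  from weak_gradient_props[OF this] show "AE x in lebesgue. weak_gradient \<phi> x = D x"
    using assms weak_gradient_unique by blast
qed

lemma gradient_borel: "smooth u \<Longrightarrow> gradient u \<in> borel_measurable borel"
  unfolding gradient_def
  by (intro borel_measurable_continuous_onI continuous_intros smooth_continuous smooth_partial_deriv smooth_component)

lemma gradient_square_integrable:
  fixes u :: "real^'n \<Rightarrow> real^'n"
  assumes u: "u \<in> test_functions G"
  shows "square_integrable (gradient u)"
proof -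
  obtain K where K: "compact K" "\<forall>x. x \<notin> K \<longrightarrow> (\<forall>j. partial_deriv j u x = 0)"
  proof -
    obtain K where K: "compact K" "\<forall>x. x \<notin> K \<longrightarrow> u x = 0" "smooth u" using u by (auto simp: test_functions_iff)
    have "partial_deriv j u x = 0" if "x \<notin> K" for x j
      by (rule partial_deriv_eq_0[of "- K"]) (use K that in \<open>auto simp: compact_imp_closed open_Compl\<close>)
    with K that show ?thesis by blast
  qed
  have cont: "continuous_on UNIV (gradient u)"
    unfolding gradient_def
    by (intro continuous_intros smooth_continuous smooth_partial_deriv test_smooth[OF u])
  have "integrable lebesgue (\<lambda>x. (norm (gradient u x))\<^sup>2)"
    by (rule integrable_continuous_compact_support[OF _ K(1)])
       (use K cont in \<open>auto intro!: continuous_intros simp: gradient_def zero_vec_def[symmetric]\<close>)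
  then show ?thesis
    using gradient_borel[OF test_smooth[OF u]] by (simp add: square_integrable_def measurable_completion)
qed

lemma has_weak_gradient_diff:
  assumes "has_weak_gradient f D" "has_weak_gradient g E"
    "square_integrable f" "square_integrable g" "square_integrable D" "square_integrable E"
  shows "has_weak_gradient (\<lambda>x. f x - g x) (\<lambda>x. D x - E x)"
  unfolding has_weak_gradient_def
proof (intro ballI allI)
  fix \<eta> :: "real^'a \<Rightarrow> real" and j k assume \<eta>: "\<eta> \<in> test_functions UNIV"
  note L = test_square_integrable[OF \<eta>] test_square_integrable[OF test_partial_deriv[OF \<eta>]]
  have "(LINT x|lebesgue. (f x - g x) $ k * partial_deriv j \<eta> x) =
    (LINT x|lebesgue. f x $ k * partial_deriv j \<eta> x) - (LINT x|lebesgue. g x $ k * partial_deriv j \<eta> x)"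
    using assms L by (simp add: left_diff_distrib integrable_mult_L2 square_integrable_component)
  also have "\<dots> = - (LINT x|lebesgue. D x $ k $ j * \<eta> x) + (LINT x|lebesgue. E x $ k $ j * \<eta> x)"
    using assms(1,2) \<eta> unfolding has_weak_gradient_def by simp
  also have "\<dots> = - (LINT x|lebesgue. (D x - E x) $ k $ j * \<eta> x)"
    using assms L by (simp add: left_diff_distrib integrable_mult_L2 square_integrable_entry)
  finally show "(LINT x|lebesgue. (f x - g x) $ k * partial_deriv j \<eta> x) = - (LINT x|lebesgue. (D x - E x) $ k $ j * \<eta> x)" .
qed

lemma H1_norm_eq:
  assumes "square_integrable \<phi>" "square_integrable D" "has_weak_gradient \<phi> D"
  shows "H1_norm \<phi> = sqrt (sqint \<phi> + sqint D)"
proof -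
  note w = weak_gradient_AE[OF assms]
  have "sqint (weak_gradient \<phi>) = sqint D"
    by (rule sqint_cong_AE[OF w(2)]) (use weak_gradient_props[OF w(1)] assms in \<open>auto dest: square_integrableD\<close>)
  then show ?thesis by (simp add: H1_norm_def L2_norm_power2)
qed

text \<open>The defining identity of a weak gradient is tested against a fixed function, so both
  sides pass to the L2 limit; the approximants themselves witness membership in the closure
  \<open>H1\<close>.\<close>

lemma H1_limit:
  fixes f :: "nat \<Rightarrow> real^'n \<Rightarrow> real^'n"
  assumes f: "\<And>n. f n \<in> test_functions UNIV"
    and v: "square_integrable v" "(\<lambda>n. sqint (\<lambda>x. f n x - v x)) \<longlonglongrightarrow> 0"
    and D: "square_integrable D" "(\<lambda>n. sqint (\<lambda>x. gradient (f n) x - D x)) \<longlonglongrightarrow> 0"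
  shows "v \<in> H1" "AE x in lebesgue. weak_gradient v x = D x"
proof -
  note sf = test_square_integrable[OF f] and sg = gradient_square_integrable[OF f]
  have "has_weak_gradient v D"
    unfolding has_weak_gradient_def
  proof (intro ballI allI)
    fix \<eta> :: "real^'n \<Rightarrow> real" and j k assume \<eta>: "\<eta> \<in> test_functions UNIV"
    note L = test_square_integrable[OF \<eta>] test_square_integrable[OF test_partial_deriv[OF \<eta>]]
    have "(\<lambda>n. sqint (\<lambda>x. f n x $ k - v x $ k)) \<longlonglongrightarrow> 0"
    proof (rule Lim_null_comparison[OF _ v(2)])
      show "\<forall>\<^sub>F n in sequentially. norm (sqint (\<lambda>x. f n x $ k - v x $ k)) \<le> sqint (\<lambda>x. f n x - v x)"
        using square_integrable_component(2)[OF square_integrable_diff[OF sf v(1)], of _ k] by simp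
    qed
    then have 1: "(\<lambda>n. LINT x|lebesgue. f n x $ k * partial_deriv j \<eta> x) \<longlonglongrightarrow> (LINT x|lebesgue. v x $ k * partial_deriv j \<eta> x)"
      by (intro integral_mult_tendsto square_integrable_component sf v L)
    have "(\<lambda>n. sqint (\<lambda>x. gradient (f n) x $ k $ j - D x $ k $ j)) \<longlonglongrightarrow> 0"
    proof (rule Lim_null_comparison[OF _ D(2)])
      show "\<forall>\<^sub>F n in sequentially. norm (sqint (\<lambda>x. gradient (f n) x $ k $ j - D x $ k $ j)) \<le> sqint (\<lambda>x. gradient (f n) x - D x)"
        using square_integrable_entry(2)[OF square_integrable_diff[OF sg D(1)], of _ k j] by simp
    qed
    then have 2: "(\<lambda>n. LINT x|lebesgue. gradient (f n) x $ k $ j * \<eta> x) \<longlonglongrightarrow> (LINT x|lebesgue. D x $ k $ j * \<eta> x)"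
      by (intro integral_mult_tendsto square_integrable_entry sg D L)
    have "(LINT x|lebesgue. f n x $ k * partial_deriv j \<eta> x) = - (LINT x|lebesgue. gradient (f n) x $ k $ j * \<eta> x)" for n
      using test_has_weak_gradient[OF f] \<eta> unfolding has_weak_gradient_def by blast
    with 1 tendsto_minus[OF 2] show "(LINT x|lebesgue. v x $ k * partial_deriv j \<eta> x) = - (LINT x|lebesgue. D x $ k $ j * \<eta> x)"
      using LIMSEQ_unique by simp
  qed
  note w = weak_gradient_AE[OF v(1) D(1) this]
  show "AE x in lebesgue. weak_gradient v x = D x" by (rule w)
  have "H1_norm (\<lambda>x. f n x - v x) = sqrt (sqint (\<lambda>x. f n x - v x) + sqint (\<lambda>x. gradient (f n) x - D x))" for n
    by (intro H1_norm_eq square_integrable_diff has_weak_gradient_diff sf sg v D test_has_weak_gradient f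
        \<open>has_weak_gradient v D\<close>)
  moreover have "(\<lambda>n. sqrt (sqint (\<lambda>x. f n x - v x) + sqint (\<lambda>x. gradient (f n) x - D x))) \<longlonglongrightarrow> sqrt (0 + 0)"
    by (intro tendsto_intros v D)
  ultimately have "(\<lambda>n. H1_norm (\<lambda>x. f n x - v x)) \<longlonglongrightarrow> 0" by simp
  with w(1) f show "v \<in> H1" unfolding H1_0_def by blast
qed

text \<open>The bridge from Sobolev functions to test functions with classical gradients, on which
  the energy estimates are made.\<close>

lemma H1_0_approx:
  fixes \<phi> :: "real^'n \<Rightarrow> real^'n"
  assumes "\<phi> \<in> H1_0 G"
  obtains \<psi> where "\<And>m. \<psi> m \<in> test_functions G" "(\<lambda>m::nat. sqint (\<lambda>x. \<psi> m x - \<phi> x)) \<longlonglongrightarrow> 0"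
    "(\<lambda>m. sqint (\<lambda>x. gradient (\<psi> m) x - weak_gradient \<phi> x)) \<longlonglongrightarrow> 0"
proof -
  obtain \<psi> where \<psi>: "\<And>m. \<psi> m \<in> test_functions G" and lim: "(\<lambda>m::nat. H1_norm (\<lambda>x. \<psi> m x - \<phi> x)) \<longlonglongrightarrow> 0"
    and \<phi>: "\<phi> \<in> weakly_diff_L2"
    using assms by (auto simp: H1_0_def)
  note \<psi>U = test_UNIV[OF \<psi>] and w = weak_gradient_props[OF \<phi>]
  have "H1_norm (\<lambda>x. \<psi> n x - \<phi> x) = sqrt (sqint (\<lambda>x. \<psi> n x - \<phi> x) + sqint (\<lambda>x. gradient (\<psi> n) x - weak_gradient \<phi> x))" for n
    by (intro H1_norm_eq square_integrable_diff has_weak_gradient_diff w test_has_weak_gradient \<psi>U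
        test_square_integrable[OF \<psi>U] gradient_square_integrable[OF \<psi>U])
  with tendsto_power[OF lim, of 2]
  have sum: "(\<lambda>n. sqint (\<lambda>x. \<psi> n x - \<phi> x) + sqint (\<lambda>x. gradient (\<psi> n) x - weak_gradient \<phi> x)) \<longlonglongrightarrow> 0"
    by simp
  have "(\<lambda>m::nat. sqint (\<lambda>x. \<psi> m x - \<phi> x)) \<longlonglongrightarrow> 0"
    by (rule Lim_null_comparison[OF _ sum]) simp
  moreover have "(\<lambda>m. sqint (\<lambda>x. gradient (\<psi> m) x - weak_gradient \<phi> x)) \<longlonglongrightarrow> 0"
    by (rule Lim_null_comparison[OF _ sum]) simp
  ultimately show ?thesis using \<psi> that by blast
qed

lemma square_integrable_trace:
  fixes D :: "real^'n \<Rightarrow> real^'n^'n"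
  assumes "square_integrable D"
  shows "square_integrable (\<lambda>x. trace (D x))" "sqint (\<lambda>x. trace (D x)) \<le> (real CARD('n))\<^sup>2 * sqint D"
proof -
  have m: "(\<lambda>x. trace (D x)) \<in> borel_measurable lebesgue"
    unfolding trace_def
    by (intro borel_measurable_sum square_integrableD(1) square_integrable_entry assms)
  have "\<bar>trace (D x)\<bar> \<le> real CARD('n) * norm (D x)" for x
  proof -
    have "\<bar>D x $ k $ k\<bar> \<le> norm (D x)" for k
      using component_le_norm_cart[of "D x $ k" k] Finite_Cartesian_Product.norm_nth_le[of "D x" k] by linarith
    then have "\<bar>trace (D x)\<bar> \<le> (\<Sum>k\<in>(UNIV::'n set). norm (D x))"
      unfolding trace_def by (intro sum_abs[THEN order_trans] sum_mono)
    then show ?thesis by simp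
  qed
  then show "square_integrable (\<lambda>x. trace (D x))" "sqint (\<lambda>x. trace (D x)) \<le> (real CARD('n))\<^sup>2 * sqint D"
    using square_integrable_bound[OF assms m, of "real CARD('n)"] by auto
qed

lemma sqint_trace_tendsto:
  fixes D :: "real^'n \<Rightarrow> real^'n^'n"
  assumes "\<And>n. square_integrable (E n)" "square_integrable D" "(\<lambda>n. sqint (\<lambda>x. E n x - D x)) \<longlonglongrightarrow> 0"
  shows "(\<lambda>n. sqint (\<lambda>x. trace (E n x))) \<longlonglongrightarrow> sqint (\<lambda>x. trace (D x))"
proof (rule sqint_tendsto[OF square_integrable_trace(1) square_integrable_trace(1)])
  have "(\<lambda>n. (real CARD('n))\<^sup>2 * sqint (\<lambda>x. E n x - D x)) \<longlonglongrightarrow> (real CARD('n))\<^sup>2 * 0"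
    by (intro tendsto_intros assms)
  then have 0: "(\<lambda>n. (real CARD('n))\<^sup>2 * sqint (\<lambda>x. E n x - D x)) \<longlonglongrightarrow> 0" by simp
  show "(\<lambda>n. sqint (\<lambda>x. trace (E n x) - trace (D x))) \<longlonglongrightarrow> 0"
    using square_integrable_trace(2)[OF square_integrable_diff[OF assms(1,2)]]
    by (intro Lim_null_comparison[OF _ 0]) (simp add: trace_sub)
qed (use assms in auto)

section \<open>Poincare inequalities\<close>

lemma nn_integral_affine:
  fixes h :: "real^'n \<Rightarrow> ennreal"
  assumes [measurable]: "h \<in> borel_measurable borel" and c: "c > 0"
  shows "ennreal (c ^ CARD('n)) * (\<integral>\<^sup>+x. h (t + c *\<^sub>R x) \<partial>lborel) = (\<integral>\<^sup>+x. h x \<partial>lborel)"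
proof -
  have "(\<integral>\<^sup>+x. h x \<partial>lborel) = (\<integral>\<^sup>+x. h x \<partial>density (distr lborel borel (\<lambda>x. t + c *\<^sub>R x)) (\<lambda>_. ennreal (\<bar>c\<bar> ^ DIM(real^'n))))"
    using c by (subst lborel_affine[of c t]) auto
  also have "\<dots> = ennreal (c ^ CARD('n)) * (\<integral>\<^sup>+x. h (t + c *\<^sub>R x) \<partial>lborel)"
    using c by (simp add: nn_integral_density nn_integral_distr nn_integral_cmult)
  finally show ?thesis ..
qed

lemma nn_integral_translate:
  fixes h :: "real^'n \<Rightarrow> ennreal"
  assumes "h \<in> borel_measurable borel"
  shows "(\<integral>\<^sup>+x. h (x + t) \<partial>lborel) = (\<integral>\<^sup>+x. h x \<partial>lborel)"
  using nn_integral_affine[OF assms, of 1 t] by (simp add: add.commute)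

lemma norm_matrix_vector_mult_le:
  fixes A :: "real^'n^'m"
  shows "norm (A *v h) \<le> norm A * norm h"
proof -
  have "norm (A *v h) = L2_set (\<lambda>k. norm ((A *v h) $ k)) UNIV" by (simp add: norm_vec_def)
  also have "\<dots> \<le> L2_set (\<lambda>k. norm h * norm (A $ k)) UNIV"
  proof (rule L2_set_mono)
    fix k show "norm ((A *v h) $ k) \<le> norm h * norm (A $ k)"
      using Cauchy_Schwarz_ineq2[of "A $ k" h]
      by (simp add: matrix_vector_mul_component mult.commute)
  qed auto
  also have "\<dots> = norm A * norm h"
    by (simp add: L2_set_right_distrib[symmetric] norm_vec_def[of A] mult.commute)
  finally show ?thesis .
qed

lemma smooth_vector_derivative_segment:
  fixes u :: "real^'n \<Rightarrow> real^'n"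
  assumes "smooth u"
  shows "((\<lambda>s. u (x + s *\<^sub>R h)) has_vector_derivative (gradient u (x + s *\<^sub>R h) *v h)) (at s within S)"
proof -
  have "((\<lambda>s. x + s *\<^sub>R h) has_derivative (\<lambda>t. t *\<^sub>R h)) (at s)"
    by (auto intro!: derivative_eq_intros)
  from diff_chain_at[OF this smooth_has_derivative[OF assms]]
  have "((\<lambda>s. u (x + s *\<^sub>R h)) has_derivative (\<lambda>t. \<Sum>j\<in>UNIV. (t *\<^sub>R h) $ j *\<^sub>R partial_deriv j u (x + s *\<^sub>R h))) (at s)"
    by (simp add: o_def)
  moreover have "(\<Sum>j\<in>UNIV. (t *\<^sub>R h) $ j *\<^sub>R partial_deriv j u (x + s *\<^sub>R h)) = t *\<^sub>R (gradient u (x + s *\<^sub>R h) *v h)" for t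
    by (simp add: vec_eq_iff matrix_vector_mult_def gradient_def sum_distrib_left mult_ac)
  ultimately show ?thesis
    unfolding has_vector_derivative_def using has_derivative_at_withinI by auto
qed

lemma continuous_gradient: "smooth u \<Longrightarrow> continuous_on UNIV (gradient u)"
  unfolding gradient_def by (intro continuous_intros smooth_continuous smooth_partial_deriv)

lemma integral_square_le:
  fixes g :: "real \<Rightarrow> real"
  assumes "continuous_on {0..1} g"
  shows "(integral {0..1} g)\<^sup>2 \<le> integral {0..1} (\<lambda>s. (g s)\<^sup>2)"
proof -
  let ?m = "integral {0..1} g"
  have i: "g integrable_on {0..1}" "(\<lambda>s. (g s)\<^sup>2) integrable_on {0..1}"
    using assms by (auto intro!: integrable_continuous_real continuous_intros)
  have "((\<lambda>s. (g s)\<^sup>2 - 2 * ?m * g s + ?m\<^sup>2) has_integral (integral {0..1} (\<lambda>s. (g s)\<^sup>2) - 2 * ?m * ?m + ?m\<^sup>2)) {0..1}"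
    using has_integral_const_real[of "?m\<^sup>2" 0 1]
    by (intro has_integral_add has_integral_diff has_integral_mult_right integrable_integral i) simp
  then have "0 \<le> integral {0..1} (\<lambda>s. (g s)\<^sup>2) - 2 * ?m * ?m + ?m\<^sup>2"
  proof (rule has_integral_nonneg)
    fix s show "0 \<le> (g s)\<^sup>2 - 2 * ?m * g s + ?m\<^sup>2"
      using zero_le_power2[of "g s - ?m"] by (simp add: power2_diff algebra_simps)
  qed
  then show ?thesis by (simp add: power2_eq_square)
qed

text \<open>The fundamental theorem of calculus along the segment from x to y, followed by Jensen on
  [0, 1]. The nonnegative integral form prepares for Tonelli.\<close>

lemma segment_inequality:
  fixes u :: "real^'n \<Rightarrow> real^'n"
  assumes u: "smooth u"
  shows "ennreal ((norm (u x - u y))\<^sup>2) \<le>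
    (\<integral>\<^sup>+s. indicator {0..1} s * ennreal ((norm (y - x))\<^sup>2 * (norm (gradient u (x + s *\<^sub>R (y - x))))\<^sup>2) \<partial>lborel)"
proof -
  let ?h = "y - x" and ?g = "\<lambda>s. norm (gradient u (x + s *\<^sub>R (y - x))) * norm (y - x)"
  have cg: "continuous_on {0..1} (\<lambda>s. gradient u (x + s *\<^sub>R ?h))"
    by (rule continuous_on_compose2[OF continuous_gradient[OF u]]) (auto intro!: continuous_intros)
  have c: "continuous_on {0..1} ?g" by (intro continuous_intros cg)
  have ftc: "((\<lambda>s. gradient u (x + s *\<^sub>R ?h) *v ?h) has_integral (u (x + 1 *\<^sub>R ?h) - u (x + 0 *\<^sub>R ?h))) {0..1}"
    by (rule fundamental_theorem_of_calculus) (use smooth_vector_derivative_segment[OF u] in auto)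
  then have eq: "u y - u x = integral {0..1} (\<lambda>s. gradient u (x + s *\<^sub>R ?h) *v ?h)"
    by (simp add: integral_unique)
  have "norm (u y - u x) \<le> integral {0..1} ?g"
    unfolding eq
    by (intro integral_norm_bound_integral norm_matrix_vector_mult_le has_integral_integrable[OF ftc]
        integrable_continuous_real[OF c])
  then have "(norm (u x - u y))\<^sup>2 \<le> (integral {0..1} ?g)\<^sup>2"
    by (intro power_mono) (auto simp: norm_minus_commute)
  also have "\<dots> \<le> integral {0..1} (\<lambda>s. (?g s)\<^sup>2)" by (rule integral_square_le[OF c])
  finally have le: "(norm (u x - u y))\<^sup>2 \<le> integral {0..1} (\<lambda>s. (?g s)\<^sup>2)" .
  have "((\<lambda>s. (?g s)\<^sup>2) has_integral integral {0..1} (\<lambda>s. (?g s)\<^sup>2)) {0..1}"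
    by (intro integrable_integral integrable_continuous_real continuous_on_power c)
  from nn_integral_has_integral_lebesgue[OF _ this]
  have "(\<integral>\<^sup>+s. indicator {0..1} s * ennreal ((?g s)\<^sup>2) \<partial>lborel) = ennreal (integral {0..1} (\<lambda>s. (?g s)\<^sup>2))"
    by (simp add: ennreal_mult' ennreal_indicator)
  with le show ?thesis by (simp add: ennreal_leI power_mult_distrib mult.commute)
qed

text \<open>For fixed x the map from y to (1 - s) x + s y sends the convex set Q into itself and
  scales volume by s^d, which is at least 2^(-d) because s is at least 1/2.\<close>

lemma nn_integral_convex_combination_le:
  fixes Q :: "(real^'n) set" and g :: "real^'n \<Rightarrow> ennreal"
  assumes [measurable]: "Q \<in> sets borel" "g \<in> borel_measurable borel"
    and Q: "convex Q" and s: "1/2 \<le> s" "s \<le> 1"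
  shows "(\<integral>\<^sup>+x. \<integral>\<^sup>+y. indicator Q x * indicator Q y * g ((1 - s) *\<^sub>R x + s *\<^sub>R y) \<partial>lborel \<partial>lborel)
    \<le> 2 ^ CARD('n) * emeasure lborel Q * (\<integral>\<^sup>+z. indicator Q z * g z \<partial>lborel)"
proof -
  let ?G = "\<integral>\<^sup>+z. indicator Q z * g z \<partial>lborel"
  have inner: "(\<integral>\<^sup>+y. indicator Q x * indicator Q y * g ((1 - s) *\<^sub>R x + s *\<^sub>R y) \<partial>lborel) \<le> indicator Q x * (2 ^ CARD('n) * ?G)" for x
  proof (cases "x \<in> Q")
    case True
    have "(\<integral>\<^sup>+y. indicator Q x * indicator Q y * g ((1 - s) *\<^sub>R x + s *\<^sub>R y) \<partial>lborel)
      \<le> (\<integral>\<^sup>+y. indicator Q ((1 - s) *\<^sub>R x + s *\<^sub>R y) * g ((1 - s) *\<^sub>R x + s *\<^sub>R y) \<partial>lborel)" (is "?L \<le> ?R")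
      using True convexD_alt[OF Q True, of _ s] s by (intro nn_integral_mono) (simp add: indicator_def)
    also have "?R = 1 * ?R" by simp
    also have "\<dots> \<le> (2 ^ CARD('n) * ennreal (s ^ CARD('n))) * ?R"
    proof (rule mult_right_mono)
      have "1 \<le> 2 ^ CARD('n) * s ^ CARD('n)"
        using s one_le_power[of "2 * s" "CARD('n)"] by (simp add: power_mult_distrib)
      then have "ennreal 1 \<le> ennreal (2 ^ CARD('n) * s ^ CARD('n))" by (rule ennreal_leI)
      also have "\<dots> = 2 ^ CARD('n) * ennreal (s ^ CARD('n))"
        using s by (subst ennreal_mult) (simp_all add: ennreal_power[symmetric])
      finally show "1 \<le> (2::ennreal) ^ CARD('n) * ennreal (s ^ CARD('n))" by simp
    qed simp
    also have "\<dots> = 2 ^ CARD('n) * ?G"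
      using nn_integral_affine[of "\<lambda>z. indicator Q z * g z" s "(1 - s) *\<^sub>R x"] s by (simp add: mult.assoc)
    finally show ?thesis using True by simp
  qed simp
  have "(\<integral>\<^sup>+x. \<integral>\<^sup>+y. indicator Q x * indicator Q y * g ((1 - s) *\<^sub>R x + s *\<^sub>R y) \<partial>lborel \<partial>lborel)
     \<le> (\<integral>\<^sup>+x. indicator Q x * (2 ^ CARD('n) * ?G) \<partial>lborel)"
    by (intro nn_integral_mono inner)
  also have "\<dots> = 2 ^ CARD('n) * emeasure lborel Q * ?G"
    by (simp add: nn_integral_multc mult_ac)
  finally show ?thesis .
qed

text \<open>Integrating the segment estimate over pairs and exchanging integrals leaves, for each s,
  the gradient evaluated at a convex combination of x and y.\<close>

lemma double_integral_difference_le: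
  fixes u :: "real^'n \<Rightarrow> real^'n"
  assumes u: "smooth u" and Qm[measurable]: "Q \<in> sets borel" and Q: "convex Q"
    and \<rho>: "\<And>x y. x \<in> Q \<Longrightarrow> y \<in> Q \<Longrightarrow> norm (x - y) \<le> \<rho>"
  shows "(\<integral>\<^sup>+x. \<integral>\<^sup>+y. indicator Q x * indicator Q y * ennreal ((norm (u x - u y))\<^sup>2) \<partial>lborel \<partial>lborel)
    \<le> ennreal (\<rho>\<^sup>2) * 2 ^ CARD('n) * emeasure lborel Q * (\<integral>\<^sup>+z. indicator Q z * ennreal ((norm (gradient u z))\<^sup>2) \<partial>lborel)"
proof -
  define g where "g z = ennreal ((norm (gradient u z))\<^sup>2)" for z
  have [measurable]: "gradient u \<in> borel_measurable borel" by (rule gradient_borel[OF u])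
  have [measurable]: "g \<in> borel_measurable borel" unfolding g_def by measurable
  let ?C = "2 ^ CARD('n) * emeasure lborel Q * (\<integral>\<^sup>+z. indicator Q z * g z \<partial>lborel)"
  let ?F = "\<lambda>x y s. indicator Q x * indicator Q y * (indicator {0..1::real} s * g (x + s *\<^sub>R (y - x)))"
  have "(\<integral>\<^sup>+x. \<integral>\<^sup>+y. indicator Q x * indicator Q y * ennreal ((norm (u x - u y))\<^sup>2) \<partial>lborel \<partial>lborel)
    \<le> (\<integral>\<^sup>+x. \<integral>\<^sup>+y. \<integral>\<^sup>+s. ennreal (\<rho>\<^sup>2) * ?F x y s \<partial>lborel \<partial>lborel \<partial>lborel)"
  proof (intro nn_integral_mono)
    fix x y :: "real^'n"
    show "indicator Q x * indicator Q y * ennreal ((norm (u x - u y))\<^sup>2) \<le> (\<integral>\<^sup>+s. ennreal (\<rho>\<^sup>2) * ?F x y s \<partial>lborel)"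
    proof (cases "x \<in> Q \<and> y \<in> Q")
      case True
      then have "(norm (y - x))\<^sup>2 \<le> \<rho>\<^sup>2" using \<rho> by (intro power_mono) auto
      then have "ennreal ((norm (y - x))\<^sup>2 * (norm (gradient u (x + s *\<^sub>R (y - x))))\<^sup>2) \<le> ennreal (\<rho>\<^sup>2) * g (x + s *\<^sub>R (y - x))" for s
        unfolding g_def by (simp add: mult_right_mono ennreal_leI flip: ennreal_mult)
      then have "(\<integral>\<^sup>+s. indicator {0..1} s * ennreal ((norm (y - x))\<^sup>2 * (norm (gradient u (x + s *\<^sub>R (y - x))))\<^sup>2) \<partial>lborel)
         \<le> (\<integral>\<^sup>+s. ennreal (\<rho>\<^sup>2) * ?F x y s \<partial>lborel)"
        using True by (intro nn_integral_mono) (auto simp: indicator_def)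
      with segment_inequality[OF u, of x y] True show ?thesis by (auto intro: order_trans)
    qed auto
  qed
  also have "\<dots> = ennreal (\<rho>\<^sup>2) * (\<integral>\<^sup>+x. \<integral>\<^sup>+y. \<integral>\<^sup>+s. ?F x y s \<partial>lborel \<partial>lborel \<partial>lborel)"
    by (simp add: nn_integral_cmult)
  also have "(\<integral>\<^sup>+x. \<integral>\<^sup>+y. \<integral>\<^sup>+s. ?F x y s \<partial>lborel \<partial>lborel \<partial>lborel) = (\<integral>\<^sup>+x. \<integral>\<^sup>+s. \<integral>\<^sup>+y. ?F x y s \<partial>lborel \<partial>lborel \<partial>lborel)"
    by (intro nn_integral_cong lborel_pair.Fubini') measurable
  also have "\<dots> = (\<integral>\<^sup>+s. \<integral>\<^sup>+x. \<integral>\<^sup>+y. ?F x y s \<partial>lborel \<partial>lborel \<partial>lborel)"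
    by (intro lborel_pair.Fubini') measurable
  also have "\<dots> \<le> (\<integral>\<^sup>+s. indicator {0..1::real} s * ?C \<partial>lborel)"
  proof (intro nn_integral_mono)
    fix s :: real
    show "(\<integral>\<^sup>+x. \<integral>\<^sup>+y. ?F x y s \<partial>lborel \<partial>lborel) \<le> indicator {0..1::real} s * ?C"
    proof (cases "s \<in> {0..1}")
      case s: True
      have eq: "x + s *\<^sub>R (y - x) = (1 - s) *\<^sub>R x + s *\<^sub>R y" for x y :: "real^'n"
        by (simp add: algebra_simps)
      show ?thesis
      proof (cases "s \<ge> 1/2")
        case True
        then show ?thesis using s nn_integral_convex_combination_le[OF Qm _ Q, of g s]
          by (simp add: eq)
      next
        \<comment> \<open>For s below 1/2 the roles of x and y are exchanged, so that the
          coefficient 1 - s is the one bounded below.\<close>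
        case False
        have "(\<integral>\<^sup>+x. \<integral>\<^sup>+y. ?F x y s \<partial>lborel \<partial>lborel) = (\<integral>\<^sup>+y. \<integral>\<^sup>+x. ?F x y s \<partial>lborel \<partial>lborel)"
          by (intro lborel_pair.Fubini') measurable
        also have "\<dots> = (\<integral>\<^sup>+y. \<integral>\<^sup>+x. indicator Q y * indicator Q x * g ((1 - (1 - s)) *\<^sub>R y + (1 - s) *\<^sub>R x) \<partial>lborel \<partial>lborel)"
          using s by (intro nn_integral_cong) (simp add: eq mult_ac add.commute)
        also have "\<dots> \<le> ?C"
          using False s by (intro nn_integral_convex_combination_le Qm Q) auto
        finally show ?thesis using s by simp
      qed
    qed simp
  qed
  also have "\<dots> = ?C" by (simp add: nn_integral_multc)
  finally show ?thesis by (simp add: g_def mult.assoc mult_left_mono)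
qed

text \<open>With one variable restricted to S, where u vanishes, the double integral of |u x - u
  y|^2 dominates |S| times the mass of u on Q. For a block Q with obstacles S the constant is
  governed by the fraction of Q that S fills.\<close>

lemma poincare_vanishing:
  fixes u :: "real^'n \<Rightarrow> real^'n"
  assumes u: "smooth u" and Qm[measurable]: "Q \<in> sets borel" and Q: "convex Q"
    and \<rho>: "\<And>x y. x \<in> Q \<Longrightarrow> y \<in> Q \<Longrightarrow> norm (x - y) \<le> \<rho>"
    and S[measurable]: "S \<in> sets borel" "S \<subseteq> Q" "\<And>x. x \<in> S \<Longrightarrow> u x = 0"
  shows "emeasure lborel S * (\<integral>\<^sup>+x. indicator Q x * ennreal ((norm (u x))\<^sup>2) \<partial>lborel)
    \<le> ennreal (\<rho>\<^sup>2) * 2 ^ CARD('n) * emeasure lborel Q * (\<integral>\<^sup>+z. indicator Q z * ennreal ((norm (gradient u z))\<^sup>2) \<partial>lborel)"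
proof -
  have [measurable]: "u \<in> borel_measurable borel" by (rule smooth_borel[OF u])
  have "emeasure lborel S * (\<integral>\<^sup>+x. indicator Q x * ennreal ((norm (u x))\<^sup>2) \<partial>lborel)
     = (\<integral>\<^sup>+x. \<integral>\<^sup>+y. indicator S y * (indicator Q x * ennreal ((norm (u x))\<^sup>2)) \<partial>lborel \<partial>lborel)"
    by (simp add: nn_integral_multc nn_integral_cmult)
  also have "\<dots> \<le> (\<integral>\<^sup>+x. \<integral>\<^sup>+y. indicator Q x * indicator Q y * ennreal ((norm (u x - u y))\<^sup>2) \<partial>lborel \<partial>lborel)"
    using S by (intro nn_integral_mono) (auto simp: indicator_def)
  also note double_integral_difference_le[OF u Qm Q \<rho>]
  finally show ?thesis .
qed

definition mean :: "(real^'n) set \<Rightarrow> (real^'n \<Rightarrow> 'b::euclidean_space) \<Rightarrow> 'b" where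
  "mean Q u = (LINT x|lborel. indicator Q x *\<^sub>R u x) /\<^sub>R measure lborel Q"

text \<open>The double integral of |u x - u y|^2 equals 2 |Q| times the integral of |u - mean|^2
  over Q. The second claim says that this variance is nonnegative.\<close>

lemma poincare_mean:
  fixes u :: "real^'n \<Rightarrow> real^'n"
  assumes u: "u \<in> test_functions UNIV" and Qm[measurable]: "Q \<in> sets borel" and Q: "convex Q"
    and \<rho>: "\<And>x y. x \<in> Q \<Longrightarrow> y \<in> Q \<Longrightarrow> norm (x - y) \<le> \<rho>"
    and fin: "emeasure lborel Q < \<infinity>" and pos: "measure lborel Q > 0"
  shows "(\<integral>\<^sup>+x. indicator Q x * ennreal ((norm (u x - mean Q u))\<^sup>2) \<partial>lborel)
      \<le> ennreal (\<rho>\<^sup>2) * 2 ^ CARD('n) * (\<integral>\<^sup>+z. indicator Q z * ennreal ((norm (gradient u z))\<^sup>2) \<partial>lborel)"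
    and "ennreal (measure lborel Q * (norm (mean Q u))\<^sup>2) \<le> (\<integral>\<^sup>+x. indicator Q x * ennreal ((norm (u x))\<^sup>2) \<partial>lborel)"
proof -
  note [measurable] = test_borel[OF u]
  define q where "q = measure lborel Q"
  define m where "m = (LINT x|lborel. indicator Q x *\<^sub>R u x)"
  define M where "M = (LINT x|lborel. indicator Q x * (norm (u x))\<^sup>2)"
  define c where "c = m /\<^sub>R q"
  have mean: "mean Q u = c" by (simp add: mean_def c_def m_def q_def)
  have q: "q > 0" "emeasure lborel Q = ennreal q"
    using pos fin by (auto simp: q_def emeasure_eq_ennreal_measure)
  have m: "m = q *\<^sub>R c" using q by (simp add: c_def)
  obtain K where K: "compact K" "\<forall>x. x \<notin> K \<longrightarrow> u x = 0" using u by (auto simp: test_functions_iff)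
  have "integrable lborel (\<lambda>x. (norm (u x))\<^sup>2)"
    by (rule integrable_continuous_compact_support[OF _ K(1)])
       (use K test_continuous[OF u] in \<open>auto intro!: continuous_intros\<close>)
  then have iM: "integrable lborel (\<lambda>x. indicator Q x * (norm (u x))\<^sup>2)"
    using integrable_mult_indicator[of Q lborel "\<lambda>x. (norm (u x))\<^sup>2"] by simp
  have im: "integrable lborel (\<lambda>x. indicator Q x *\<^sub>R u x)"
    by (intro integrable_mult_indicator test_integrable[OF u]) simp
  have iq: "integrable lborel (\<lambda>x. indicator Q x :: real)"
    using fin by (intro integrable_real_indicator) auto
  have ia: "integrable lborel (\<lambda>x. (indicator Q x *\<^sub>R u x) \<bullet> a)" for a
    by (intro integrable_inner_left im)
  have M0: "M \<ge> 0" unfolding M_def by (intro integral_nonneg_AE) auto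
  have expand: "integrable lborel (\<lambda>x. indicator Q x * (norm (u x - a))\<^sup>2)"
    "(LINT x|lborel. indicator Q x * (norm (u x - a))\<^sup>2) = M - 2 * (m \<bullet> a) + q * (norm a)\<^sup>2" for a
  proof -
    have eq: "indicator Q x * (norm (u x - a))\<^sup>2 = indicator Q x * (norm (u x))\<^sup>2 - 2 * ((indicator Q x *\<^sub>R u x) \<bullet> a) + indicator Q x * (norm a)\<^sup>2" for x
      by (auto simp: power2_norm_eq_inner inner_diff inner_commute indicator_def)
    show "integrable lborel (\<lambda>x. indicator Q x * (norm (u x - a))\<^sup>2)"
      unfolding eq
      by (intro Bochner_Integration.integrable_add Bochner_Integration.integrable_diff integrable_mult_right
          integrable_mult_left integrable_inner_left iM im iq)
    show "(LINT x|lborel. indicator Q x * (norm (u x - a))\<^sup>2) = M - 2 * (m \<bullet> a) + q * (norm a)\<^sup>2"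
      unfolding eq using iM im iq ia[of a]
      by (simp add: M_def m_def q_def integral_inner_left del: inner_scaleR_left)
  qed
  have nn: "(\<integral>\<^sup>+x. indicator Q x * ennreal ((norm (u x - a))\<^sup>2) \<partial>lborel) = ennreal (M - 2 * (m \<bullet> a) + q * (norm a)\<^sup>2)" for a
    unfolding expand(2)[symmetric]
    by (subst nn_integral_eq_integral[symmetric, OF expand(1)]) (auto simp: ennreal_mult' ennreal_indicator)
  have var: "M - q * (norm c)\<^sup>2 = M - 2 * (m \<bullet> c) + q * (norm c)\<^sup>2"
    using m by (simp add: power2_norm_eq_inner)
  also have "\<dots> \<ge> 0" unfolding expand(2)[symmetric] by (intro integral_nonneg_AE) auto
  finally have var0: "q * (norm c)\<^sup>2 \<le> M" by simp
  from nn[of 0] have nnM: "(\<integral>\<^sup>+x. indicator Q x * ennreal ((norm (u x))\<^sup>2) \<partial>lborel) = ennreal M" by simp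
  show "ennreal (measure lborel Q * (norm (mean Q u))\<^sup>2) \<le> (\<integral>\<^sup>+x. indicator Q x * ennreal ((norm (u x))\<^sup>2) \<partial>lborel)"
    unfolding nnM mean q_def[symmetric] using var0 by (rule ennreal_leI)
  let ?G = "\<integral>\<^sup>+z. indicator Q z * ennreal ((norm (gradient u z))\<^sup>2) \<partial>lborel"
  have fx: "indicator Q x * (M - 2 * (m \<bullet> u x) + q * (norm (u x))\<^sup>2)
      = indicator Q x * M - 2 * ((indicator Q x *\<^sub>R u x) \<bullet> m) + q * (indicator Q x * (norm (u x))\<^sup>2)" for x
    by (simp add: algebra_simps inner_commute)
  have fint: "integrable lborel (\<lambda>x. indicator Q x * (M - 2 * (m \<bullet> u x) + q * (norm (u x))\<^sup>2))"
    unfolding fx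
    by (intro Bochner_Integration.integrable_add Bochner_Integration.integrable_diff integrable_mult_right
        integrable_mult_left ia iM iq)
  have f0: "0 \<le> M - 2 * (m \<bullet> u x) + q * (norm (u x))\<^sup>2" for x
    unfolding expand(2)[symmetric] by (intro integral_nonneg_AE) auto
  have "(\<integral>\<^sup>+x. \<integral>\<^sup>+y. indicator Q x * indicator Q y * ennreal ((norm (u x - u y))\<^sup>2) \<partial>lborel \<partial>lborel)
      = (\<integral>\<^sup>+x. indicator Q x * (\<integral>\<^sup>+y. indicator Q y * ennreal ((norm (u y - u x))\<^sup>2) \<partial>lborel) \<partial>lborel)"
    by (simp add: nn_integral_cmult mult.assoc norm_minus_commute)
  also have "\<dots> = (\<integral>\<^sup>+x. ennreal (indicator Q x * (M - 2 * (m \<bullet> u x) + q * (norm (u x))\<^sup>2)) \<partial>lborel)"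
    unfolding nn using f0 by (simp add: ennreal_mult ennreal_indicator)
  also have "\<dots> = ennreal (LINT x|lborel. indicator Q x * (M - 2 * (m \<bullet> u x) + q * (norm (u x))\<^sup>2))"
    by (rule nn_integral_eq_integral[OF fint]) (simp add: f0)
  also have "(LINT x|lborel. indicator Q x * (M - 2 * (m \<bullet> u x) + q * (norm (u x))\<^sup>2)) = 2 * q * (M - q * (norm c)\<^sup>2)"
    unfolding fx using iM im iq ia[of m]
    by (simp add: M_def[symmetric] m_def[symmetric] q_def[symmetric] integral_inner_left del: inner_scaleR_left)
       (simp add: m power2_norm_eq_inner algebra_simps)
  finally have eq: "(\<integral>\<^sup>+x. \<integral>\<^sup>+y. indicator Q x * indicator Q y * ennreal ((norm (u x - u y))\<^sup>2) \<partial>lborel \<partial>lborel)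
    = ennreal (2 * q * (M - q * (norm c)\<^sup>2))" .
  have "ennreal q * ennreal (M - q * (norm c)\<^sup>2) \<le> ennreal (2 * q * (M - q * (norm c)\<^sup>2))"
    using q var0 by (simp flip: ennreal_mult)
  also have "\<dots> \<le> ennreal (\<rho>\<^sup>2) * 2 ^ CARD('n) * ennreal q * ?G"
    unfolding eq[symmetric] q(2)[symmetric] by (rule double_integral_difference_le[OF test_smooth[OF u] Qm Q \<rho>])
  also have "\<dots> = ennreal q * (ennreal (\<rho>\<^sup>2) * 2 ^ CARD('n) * ?G)" by (simp add: mult_ac)
  finally have "ennreal (M - q * (norm c)\<^sup>2) \<le> ennreal (\<rho>\<^sup>2) * 2 ^ CARD('n) * ?G"
    using q(1) by (subst (asm) ennreal_mult_le_mult_iff) auto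
  then show "(\<integral>\<^sup>+x. indicator Q x * ennreal ((norm (u x - mean Q u))\<^sup>2) \<partial>lborel) \<le> ennreal (\<rho>\<^sup>2) * 2 ^ CARD('n) * ?G"
    unfolding mean nn var .
qed

section \<open>Half-open grids of cubes and integration cell by cell\<close>

definition grid_cell :: "real \<Rightarrow> real \<Rightarrow> int^'n \<Rightarrow> (real^'n) set" where
  "grid_cell a h z = {x. \<forall>i. a + h * of_int (z $ i) < x $ i \<and> x $ i \<le> a + h * of_int (z $ i) + h}"

text \<open>Cells are open on the left and closed on the right, hence the ceiling minus one. With
  \<open>a = -1/2\<close>, side 1 gives the unit cells and side \<open>L\<close> the blocks.\<close>

definition grid_index :: "real \<Rightarrow> real \<Rightarrow> real^'n \<Rightarrow> int^'n" where
  "grid_index a h x = (\<chi> i. \<lceil>(x $ i - a) / h\<rceil> - 1)"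

lemma grid_cell_iff:
  fixes x :: "real^'n"
  assumes "h > 0"
  shows "x \<in> grid_cell a h z \<longleftrightarrow> z = grid_index a h x"
proof -
  have "a + h * of_int (z $ i) < x $ i \<and> x $ i \<le> a + h * of_int (z $ i) + h \<longleftrightarrow> z $ i = \<lceil>(x $ i - a) / h\<rceil> - 1" for i
  proof -
    have "z $ i = \<lceil>(x $ i - a) / h\<rceil> - 1 \<longleftrightarrow> \<lceil>(x $ i - a) / h\<rceil> = z $ i + 1" by auto
    also have "\<dots> \<longleftrightarrow> of_int (z $ i) < (x $ i - a) / h \<and> (x $ i - a) / h \<le> of_int (z $ i) + 1"
      by (simp add: ceiling_eq_iff)
    also have "\<dots> \<longleftrightarrow> a + h * of_int (z $ i) < x $ i \<and> x $ i \<le> a + h * of_int (z $ i) + h"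
      using assms by (auto simp: field_simps)
    finally show ?thesis by simp
  qed
  then show ?thesis by (simp add: grid_cell_def grid_index_def vec_eq_iff)
qed

lemma grid_cell_borel [measurable]: "grid_cell a h z \<in> sets borel"
proof -
  have "grid_cell a h z = (\<Inter>i. {x. a + h * of_int (z $ i) < x $ i} \<inter> {x. x $ i \<le> a + h * of_int (z $ i) + h})"
    by (auto simp: grid_cell_def)
  moreover have "{x. a + h * of_int (z $ i) < x $ i} \<in> sets borel" for i
    by (intro borel_open open_Collect_less continuous_intros)
  moreover have "{x. x $ i \<le> a + h * of_int (z $ i) + h} \<in> sets borel" for i
    by (intro borel_closed closed_Collect_le continuous_intros)
  ultimately show ?thesis by (auto intro!: sets.finite_INT)
qed

lemma grid_cell_convex: "convex (grid_cell a h z)"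
proof -
  have "grid_cell a h z = (\<Inter>i. {x. axis i 1 \<bullet> x > a + h * of_int (z $ i)} \<inter> {x. axis i 1 \<bullet> x \<le> a + h * of_int (z $ i) + h})"
    by (auto simp: grid_cell_def inner_axis' )
  then show ?thesis
    by (auto intro!: convex_INT convex_Int convex_halfspace_gt convex_halfspace_le)
qed

lemma grid_cell_diam:
  fixes x y :: "real^'n"
  assumes "x \<in> grid_cell a h z" "y \<in> grid_cell a h z" "h \<ge> 0"
  shows "norm (x - y) \<le> h * real CARD('n)"
proof -
  have "\<bar>(x - y) $ i\<bar> \<le> h" for i
  proof -
    have "a + h * of_int (z $ i) < x $ i" "x $ i \<le> a + h * of_int (z $ i) + h"
      "a + h * of_int (z $ i) < y $ i" "y $ i \<le> a + h * of_int (z $ i) + h"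
      using assms(1,2) by (auto simp: grid_cell_def)
    then show ?thesis unfolding vector_minus_component by linarith
  qed
  then have "(\<Sum>i\<in>UNIV. \<bar>(x - y) $ i\<bar>) \<le> (\<Sum>i\<in>(UNIV::'n set). h)" by (intro sum_mono)
  then show ?thesis using norm_le_l1_cart[of "x - y"] by (simp add: mult.commute)
qed

lemma emeasure_grid_cell:
  assumes "h > 0"
  shows "emeasure lborel (grid_cell a h (z::int^'n)) = ennreal (h ^ CARD('n))"
proof -
  let ?l = "(\<chi> i. a + h * of_int (z $ i)) :: real^'n" and ?u = "(\<chi> i. a + h * of_int (z $ i) + h) :: real^'n"
  have lu: "?l \<bullet> b \<le> ?u \<bullet> b" if "b \<in> Basis" for b
    using that assms by (auto simp: Basis_vec_def inner_axis)
  have pr: "(\<Prod>b\<in>Basis. (?u - ?l) \<bullet> b) = h ^ CARD('n)"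
  proof -
    have "(\<Prod>b\<in>Basis. (?u - ?l) \<bullet> b) = (\<Prod>b\<in>(Basis :: (real^'n) set). h)"
      by (intro prod.cong) (auto simp: Basis_vec_def inner_axis)
    then show ?thesis by simp
  qed
  have "emeasure lborel (box ?l ?u) \<le> emeasure lborel (grid_cell a h z)"
    by (intro emeasure_mono) (auto simp: mem_box_cart grid_cell_def less_imp_le)
  moreover have "emeasure lborel (grid_cell a h z) \<le> emeasure lborel (cbox ?l ?u)"
    by (intro emeasure_mono) (auto simp: mem_box_cart grid_cell_def less_imp_le)
  moreover have "emeasure lborel (box ?l ?u) = ennreal (h ^ CARD('n))"
    using emeasure_lborel_box[OF lu] pr by simp
  moreover have "emeasure lborel (cbox ?l ?u) = ennreal (h ^ CARD('n))"
    using emeasure_lborel_cbox[OF lu] pr by simp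
  ultimately show ?thesis by simp
qed

lemma measure_grid_cell:
  assumes "h > 0"
  shows "measure lborel (grid_cell a h (z::int^'n)) = h ^ CARD('n)"
  using emeasure_grid_cell[OF assms, of a z] assms by (simp add: measure_def)

text \<open>Space is the disjoint union of the cells, so inequalities on cells add up; this is how
  Poincare inequalities on cubes become global.\<close>

lemma nn_integral_le_grid:
  fixes f g :: "real^'n \<Rightarrow> ennreal"
  assumes [measurable]: "f \<in> borel_measurable borel" "g \<in> borel_measurable borel" and h: "h > 0"
    and le: "\<And>z. (\<integral>\<^sup>+x. indicator (grid_cell a h z) x * f x \<partial>lborel) \<le> (\<integral>\<^sup>+x. indicator (grid_cell a h z) x * g x \<partial>lborel)"
  shows "(\<integral>\<^sup>+x. f x \<partial>lborel) \<le> (\<integral>\<^sup>+x. g x \<partial>lborel)"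
proof -
  \<comment> \<open>\<open>to_nat\<close> need not be onto; numbers that encode no index get the
    empty set, since \<open>from_nat\<close> is arbitrary there.\<close>
  define C where "C n = (if \<exists>z::int^'n. to_nat z = n then grid_cell a h (from_nat n :: int^'n) else {})" for n :: nat
  have [measurable]: "C n \<in> sets borel" for n by (simp add: C_def)
  have C: "x \<in> C n \<longleftrightarrow> n = to_nat (grid_index a h x)" for x n
  proof -
    have "x \<in> C n \<longleftrightarrow> (\<exists>z::int^'n. to_nat z = n) \<and> from_nat n = grid_index a h x"
      by (simp add: C_def grid_cell_iff[OF h])
    also have "\<dots> \<longleftrightarrow> n = to_nat (grid_index a h x)" by (metis from_nat_to_nat)
    finally show ?thesis .
  qed
  have split: "(\<integral>\<^sup>+x. k x \<partial>lborel) = (\<Sum>n. \<integral>\<^sup>+x. indicator (C n) x * k x \<partial>lborel)"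
    if [measurable]: "k \<in> borel_measurable borel" for k :: "real^'n \<Rightarrow> ennreal"
  proof -
    have "k x = (\<Sum>n. indicator (C n) x * k x)" for x
    proof -
      have "disjoint_family C" by (auto simp: disjoint_family_on_def C)
      from suminf_cmult_indicator[OF this, of x "to_nat (grid_index a h x)" "\<lambda>_. k x"]
      show ?thesis by (simp add: C mult.commute)
    qed
    then have "(\<integral>\<^sup>+x. k x \<partial>lborel) = (\<integral>\<^sup>+x. (\<Sum>n. indicator (C n) x * k x) \<partial>lborel)" by simp
    also have "\<dots> = (\<Sum>n. \<integral>\<^sup>+x. indicator (C n) x * k x \<partial>lborel)"
      by (intro nn_integral_suminf) measurable
    finally show ?thesis .
  qed
  show ?thesis
    unfolding split[OF assms(1)] split[OF assms(2)]
    by (intro suminf_le) (auto simp: C_def le)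
qed

section \<open>Compactness\<close>

text \<open>Cantor's diagonal argument over a countable index set; the stage property
  \<open>P k\<close> is vacuous when \<open>k\<close> encodes no index.\<close>

lemma pointwise_convergent_subsequence:
  fixes f :: "nat \<Rightarrow> 'i::countable \<Rightarrow> 'b::heine_borel"
  assumes "\<And>i. bounded (range (\<lambda>n. f n i))"
  obtains r where "strict_mono (r::nat \<Rightarrow> nat)" "\<And>i. convergent (\<lambda>n. f (r n) i)"
proof -
  define P where "P k s \<longleftrightarrow> (\<forall>i. to_nat i = k \<longrightarrow> convergent (\<lambda>n. f (s n) i))" for k and s :: "nat \<Rightarrow> nat"
  interpret subseqs P
  proof
    fix k and s :: "nat \<Rightarrow> nat" assume "strict_mono s"
    show "\<exists>r'. strict_mono r' \<and> P k (s \<circ> r')"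
    proof (cases "\<exists>i::'i. to_nat i = k")
      case True
      then obtain i :: 'i where i: "to_nat i = k" by blast
      have "bounded (range (\<lambda>n. f (s n) i))"
        using assms[of i] by (rule bounded_subset) auto
      from bounded_imp_convergent_subsequence[OF this]
      obtain l r where "strict_mono r" "((\<lambda>n. f (s n) i) \<circ> r) \<longlonglongrightarrow> l" by blast
      with i show ?thesis
        by (intro exI[of _ r]) (auto simp: P_def o_def convergent_def)
    qed (auto simp: P_def intro!: exI[of _ id] strict_mono_id)
  qed
  have *: "P k (diagseq \<circ> ((+) (Suc k)))" for k
  proof (rule diagseq_holds)
    fix r s :: "nat \<Rightarrow> nat" and n assume "strict_mono r" "P n s"
    then show "P n (s \<circ> r)"
      using convergent_subseq_convergent[of "\<lambda>n. f (s n) _" r] by (auto simp: P_def o_def)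
  qed
  have "convergent (\<lambda>n. f (diagseq (n + Suc (to_nat i))) i)" for i
    using *[of "to_nat i"] by (simp add: P_def o_def add.commute)
  then have "convergent (\<lambda>n. f (diagseq n) i)" for i
    using convergent_ignore_initial_segment[of "\<lambda>n. f (diagseq n) i"] by blast
  with subseq_diagseq that show ?thesis by blast
qed

lemma sqint_eq_nn_integral:
  fixes f :: "real^'n \<Rightarrow> 'b::euclidean_space"
  assumes "square_integrable f" and [measurable]: "f \<in> borel_measurable borel"
  shows "(\<integral>\<^sup>+x. ennreal ((norm (f x))\<^sup>2) \<partial>lborel) = ennreal (sqint f)"
proof -
  have "(\<integral>\<^sup>+x. ennreal ((norm (f x))\<^sup>2) \<partial>lborel) = (\<integral>\<^sup>+x. ennreal ((norm (f x))\<^sup>2) \<partial>lebesgue)"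
    by (simp add: nn_integral_completion)
  also have "\<dots> = ennreal (sqint f)"
    unfolding sqint_def by (intro nn_integral_eq_integral square_integrableD assms) auto
  finally show ?thesis .
qed

lemma square_integrable_indicator:
  assumes "square_integrable f" "A \<in> sets lebesgue"
  shows "square_integrable (\<lambda>x. indicator A x *\<^sub>R f x)" "sqint (\<lambda>x. indicator A x *\<^sub>R f x) \<le> sqint f"
proof -
  have m: "(\<lambda>x. indicator A x *\<^sub>R f x) \<in> borel_measurable lebesgue"
    using square_integrableD(1)[OF assms(1)] assms(2) by (intro borel_measurable_scaleR borel_measurable_indicator)
  show "square_integrable (\<lambda>x. indicator A x *\<^sub>R f x)" "sqint (\<lambda>x. indicator A x *\<^sub>R f x) \<le> sqint f"
    using square_integrable_bound[OF assms(1) m, of 1] by (auto simp: indicator_def)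
qed

lemma card_int_vec:
  fixes A :: "int set"
  assumes "finite A"
  shows "finite {z::int^'n. \<forall>i. z $ i \<in> A}" "card {z::int^'n. \<forall>i. z $ i \<in> A} = card A ^ CARD('n)"
proof -
  have eq: "{z::int^'n. \<forall>i. z $ i \<in> A} = vec_lambda ` (PiE UNIV (\<lambda>_. A))"
  proof (intro set_eqI iffI)
    fix z :: "int^'n" assume "z \<in> {z. \<forall>i. z $ i \<in> A}"
    then have "vec_nth z \<in> PiE UNIV (\<lambda>_. A)" "z = vec_lambda (vec_nth z)" by auto
    then show "z \<in> vec_lambda ` (PiE UNIV (\<lambda>_. A))" by blast
  qed auto
  have inj: "inj_on (vec_lambda :: ('n \<Rightarrow> int) \<Rightarrow> int^'n) X" for X
    by (auto simp: inj_on_def vec_lambda_inject)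
  show "finite {z::int^'n. \<forall>i. z $ i \<in> A}"
    unfolding eq using assms by (intro finite_imageI finite_PiE) auto
  show "card {z::int^'n. \<forall>i. z $ i \<in> A} = card A ^ CARD('n)"
    unfolding eq by (simp add: card_image[OF inj] card_PiE)
qed

lemma gradient_add:
  "smooth u \<Longrightarrow> smooth w \<Longrightarrow> gradient (\<lambda>x. u x + w x) x = gradient u x + gradient w x"
  by (simp add: gradient_def partial_deriv_add vec_eq_iff)

lemma gradient_linear:
  assumes "smooth u"
  shows "gradient (\<lambda>x. c *\<^sub>R u x) x = c *\<^sub>R gradient u x"
  using partial_deriv_linear[OF bounded_linear_scaleR_right assms] by (simp add: gradient_def vec_eq_iff)

lemma gradient_diff:
  assumes "smooth u" "smooth w"
  shows "gradient (\<lambda>x. u x - w x) x = gradient u x - gradient w x"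
  using gradient_add[OF assms(1) smooth_linear[OF bounded_linear_scaleR_right[of "-1"] assms(2)], of x]
    gradient_linear[OF assms(2), of "-1" x] by simp

lemma mean_diff:
  assumes "u \<in> test_functions UNIV" "w \<in> test_functions UNIV" "Q \<in> sets borel"
  shows "mean Q (\<lambda>x. u x - w x) = mean Q u - mean Q w"
proof -
  have "integrable lborel (\<lambda>x. indicator Q x *\<^sub>R u x)" "integrable lborel (\<lambda>x. indicator Q x *\<^sub>R w x)"
    using assms by (simp_all add: integrable_mult_indicator test_integrable(1))
  then show ?thesis by (simp add: mean_def scaleR_diff_right)
qed

text \<open>On each cell w splits into its deviation from the mean, controlled by the gradient with
  a factor h^2, and the mean itself. So the mass on a ball is controlled, up to a small gradient
  term, by finitely many numbers.\<close>

lemma local_L2_estimate: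
  fixes w :: "real^'n \<Rightarrow> real^'n"
  assumes w: "w \<in> test_functions UNIV" and h: "h > 0"
    and Z: "finite Z" "\<And>x. x \<in> ball 0 R \<Longrightarrow> grid_index 0 h x \<in> Z"
  shows "sqint (\<lambda>x. indicator (ball 0 R) x *\<^sub>R w x) \<le>
    2 * ((h * real CARD('n))\<^sup>2 * 2 ^ CARD('n)) * sqint (gradient w)
      + (\<Sum>z\<in>Z. 2 * (norm (mean (grid_cell 0 h z) w))\<^sup>2 * h ^ CARD('n))"
proof -
  note [measurable] = test_borel[OF w] gradient_borel[OF test_smooth[OF w]]
  let ?C = "(h * real CARD('n))\<^sup>2 * 2 ^ CARD('n)"
  define m where "m z = mean (grid_cell 0 h z) w" for z :: "int^'n"
  let ?f = "\<lambda>x. ennreal ((norm (indicator (ball 0 R) x *\<^sub>R w x))\<^sup>2)"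
  let ?g = "\<lambda>x. ennreal (2 * ?C) * ennreal ((norm (gradient w x))\<^sup>2) + (\<Sum>z\<in>Z. ennreal (2 * (norm (m z))\<^sup>2) * indicator (grid_cell 0 h z) x)"
  have [measurable]: "ball (0::real^'n) R \<in> sets borel" by simp
  have mf: "?f \<in> borel_measurable borel" by measurable
  have mg: "?g \<in> borel_measurable borel" by measurable
  have "(\<integral>\<^sup>+x. ?f x \<partial>lborel) \<le> (\<integral>\<^sup>+x. ?g x \<partial>lborel)"
  proof (rule nn_integral_le_grid[OF mf mg h])
    fix z :: "int^'n"
    let ?Q = "grid_cell 0 h z"
    show "(\<integral>\<^sup>+x. indicator ?Q x * ?f x \<partial>lborel) \<le> (\<integral>\<^sup>+x. indicator ?Q x * ?g x \<partial>lborel)"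
    proof (cases "z \<in> Z")
      case False
      have "indicator ?Q x * ?f x = 0" for x
        using False Z(2)[of x] grid_cell_iff[OF h, of x 0 z] by (auto simp: indicator_def)
      then show ?thesis by (intro nn_integral_mono) (simp only: zero_le)
    next
      case True
      have "(\<integral>\<^sup>+x. indicator ?Q x * ?f x \<partial>lborel) \<le>
        (\<integral>\<^sup>+x. 2 * (indicator ?Q x * ennreal ((norm (w x - m z))\<^sup>2)) + ennreal (2 * (norm (m z))\<^sup>2) * indicator ?Q x \<partial>lborel)"
      proof (rule nn_integral_mono)
        fix x
        have "(norm (w x))\<^sup>2 \<le> 2 * (norm (w x - m z))\<^sup>2 + 2 * (norm (m z))\<^sup>2"
          using norm_add_sq_le[of 1 "w x - m z" "m z"] by simp
        then have "ennreal ((norm (w x))\<^sup>2) \<le> 2 * ennreal ((norm (w x - m z))\<^sup>2) + ennreal (2 * (norm (m z))\<^sup>2)"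
          by (subst ennreal_numeral[symmetric], subst ennreal_mult[symmetric], simp, simp,
              subst ennreal_plus[symmetric], simp, simp, intro ennreal_leI)
        then show "indicator ?Q x * ?f x \<le> 2 * (indicator ?Q x * ennreal ((norm (w x - m z))\<^sup>2)) + ennreal (2 * (norm (m z))\<^sup>2) * indicator ?Q x"
          by (auto simp: indicator_def)
      qed
      also have "\<dots> = 2 * (\<integral>\<^sup>+x. indicator ?Q x * ennreal ((norm (w x - m z))\<^sup>2) \<partial>lborel) + ennreal (2 * (norm (m z))\<^sup>2) * emeasure lborel ?Q"
        by (simp add: nn_integral_add nn_integral_cmult)
      also have "\<dots> \<le> 2 * (ennreal ?C * (\<integral>\<^sup>+x. indicator ?Q x * ennreal ((norm (gradient w x))\<^sup>2) \<partial>lborel)) + ennreal (2 * (norm (m z))\<^sup>2) * emeasure lborel ?Q"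
      proof (intro add_mono mult_left_mono order_refl)
        have "(\<integral>\<^sup>+x. indicator ?Q x * ennreal ((norm (w x - m z))\<^sup>2) \<partial>lborel) \<le> ennreal ((h * real CARD('n))\<^sup>2) * 2 ^ CARD('n) * (\<integral>\<^sup>+x. indicator ?Q x * ennreal ((norm (gradient w x))\<^sup>2) \<partial>lborel)"
          unfolding m_def using h grid_cell_diam[of _ 0 h z] emeasure_grid_cell[OF h, of 0 z] measure_grid_cell[OF h, of 0 z]
          by (intro poincare_mean(1)[OF w grid_cell_borel grid_cell_convex]) auto
        then show "(\<integral>\<^sup>+x. indicator ?Q x * ennreal ((norm (w x - m z))\<^sup>2) \<partial>lborel) \<le> ennreal ?C * (\<integral>\<^sup>+x. indicator ?Q x * ennreal ((norm (gradient w x))\<^sup>2) \<partial>lborel)"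
          by (simp add: ennreal_mult flip: ennreal_power)
      qed auto
      also have "\<dots> = (\<integral>\<^sup>+x. ennreal (2 * ?C) * (indicator ?Q x * ennreal ((norm (gradient w x))\<^sup>2)) + ennreal (2 * (norm (m z))\<^sup>2) * indicator ?Q x \<partial>lborel)"
        by (simp add: nn_integral_add nn_integral_cmult ennreal_mult mult.assoc)
      also have "\<dots> \<le> (\<integral>\<^sup>+x. indicator ?Q x * ?g x \<partial>lborel)"
      proof (rule nn_integral_mono)
        fix x
        have "ennreal (2 * (norm (m z))\<^sup>2) * indicator ?Q x \<le> (\<Sum>z\<in>Z. ennreal (2 * (norm (m z))\<^sup>2) * indicator (grid_cell 0 h z) x)"
          using Z(1) True by (intro member_le_sum[where f="\<lambda>z. ennreal (2 * (norm (m z))\<^sup>2) * indicator (grid_cell 0 h z) x"]) auto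
        then show "ennreal (2 * ?C) * (indicator ?Q x * ennreal ((norm (gradient w x))\<^sup>2)) + ennreal (2 * (norm (m z))\<^sup>2) * indicator ?Q x \<le> indicator ?Q x * ?g x"
          by (cases "x \<in> ?Q") (auto intro!: add_left_mono)
      qed
      finally show ?thesis .
    qed
  qed
  also have "\<dots> = ennreal (2 * ?C) * ennreal (sqint (gradient w)) + (\<Sum>z\<in>Z. ennreal (2 * (norm (m z))\<^sup>2) * ennreal (h ^ CARD('n)))"
    using h by (simp add: nn_integral_add nn_integral_cmult nn_integral_sum emeasure_grid_cell
        sqint_eq_nn_integral gradient_square_integrable[OF w])
  also have "\<dots> = ennreal (2 * ?C * sqint (gradient w) + (\<Sum>z\<in>Z. 2 * (norm (m z))\<^sup>2 * h ^ CARD('n)))"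
    using h by (subst ennreal_plus) (auto simp: ennreal_mult sum_nonneg intro!: mult_nonneg_nonneg simp flip: sum_ennreal)
  also have "(\<integral>\<^sup>+x. ?f x \<partial>lborel) = ennreal (sqint (\<lambda>x. indicator (ball 0 R) x *\<^sub>R w x))"
    by (intro sqint_eq_nn_integral square_integrable_indicator test_square_integrable[OF w]) auto
  finally show ?thesis
    unfolding m_def
    by (subst (asm) ennreal_le_iff) (use h in \<open>auto intro!: add_nonneg_nonneg sum_nonneg mult_nonneg_nonneg\<close>)
qed

lemma finite_grid_indices: "finite (grid_index a h ` ball (0::real^'n) R)"
proof -
  let ?B = "\<lceil>(R + \<bar>a\<bar>) / \<bar>h\<bar>\<rceil> + 1"
  have "grid_index a h x $ i \<in> {-?B..?B}" if "x \<in> ball 0 R" for x :: "real^'n" and i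
  proof -
    have "\<bar>x $ i - a\<bar> \<le> R + \<bar>a\<bar>"
      using that component_le_norm_cart[of x i] by simp
    then have "\<bar>(x $ i - a) / h\<bar> \<le> (R + \<bar>a\<bar>) / \<bar>h\<bar>"
      by (simp add: abs_divide divide_right_mono)
    then have "(x $ i - a) / h \<le> (R + \<bar>a\<bar>) / \<bar>h\<bar>" "- ((R + \<bar>a\<bar>) / \<bar>h\<bar>) \<le> (x $ i - a) / h" by linarith+
    then have "\<lceil>(x $ i - a) / h\<rceil> \<le> \<lceil>(R + \<bar>a\<bar>) / \<bar>h\<bar>\<rceil>" "- ?B + 1 \<le> \<lceil>(x $ i - a) / h\<rceil>" by linarith+
    then show ?thesis by (simp add: grid_index_def)
  qed
  then have "grid_index a h ` ball (0::real^'n) R \<subseteq> {z. \<forall>i. z $ i \<in> {-?B..?B}}" by blast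
  then show ?thesis using card_int_vec(1) finite_subset by blast
qed

text \<open>Rellich compactness: the means over all cells of the meshes
  \<open>1 / real (Suc j)\<close> form countably many bounded sequences, made convergent by one
  diagonal subsequence. A fine mesh makes the gradient term small, and then finitely many means
  decide on a given ball.\<close>

lemma local_L2_Cauchy_subsequence:
  fixes u :: "nat \<Rightarrow> real^'n \<Rightarrow> real^'n"
  assumes u: "\<And>n. u n \<in> test_functions UNIV" "\<And>n. sqint (u n) \<le> 1" "\<And>n. sqint (gradient (u n)) \<le> \<Lambda>"
  obtains r where "strict_mono (r::nat \<Rightarrow> nat)"
    "\<And>R e. e > 0 \<Longrightarrow> \<exists>N. \<forall>m\<ge>N. \<forall>n\<ge>N. sqint (\<lambda>x. indicator (ball 0 R) x *\<^sub>R (u (r m) x - u (r n) x)) < e"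
proof -
  define H where "H j = 1 / real (Suc j)" for j
  have H: "H j > 0" for j by (simp add: H_def)
  define av where "av n = (\<lambda>(j, z). mean (grid_cell 0 (H j) z) (u n))" for n
  have "bounded (range (\<lambda>n. av n i))" for i
  proof -
    obtain j z where i: "i = (j, z)" by (cases i)
    let ?Q = "grid_cell 0 (H j) z" and ?q = "H j ^ CARD('n)"
    have "norm (av n i) \<le> sqrt (1 / ?q)" for n
    proof -
      note [measurable] = test_borel[OF u(1)[of n]]
      have "ennreal (measure lborel ?Q * (norm (av n i))\<^sup>2) \<le> (\<integral>\<^sup>+x. indicator ?Q x * ennreal ((norm (u n x))\<^sup>2) \<partial>lborel)"
        unfolding i av_def prod.case
        using H grid_cell_diam[of _ 0 "H j" z] emeasure_grid_cell[OF H[of j], of 0 z] measure_grid_cell[OF H[of j], of 0 z]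
        by (intro poincare_mean(2)[OF u(1) grid_cell_borel grid_cell_convex, where \<rho>="H j * real CARD('n)"]) (auto simp: less_imp_le)
      also have "\<dots> \<le> (\<integral>\<^sup>+x. ennreal ((norm (u n x))\<^sup>2) \<partial>lborel)"
        by (intro nn_integral_mono) (auto simp: indicator_def)
      also have "\<dots> = ennreal (sqint (u n))"
        by (intro sqint_eq_nn_integral test_square_integrable[OF u(1)]) measurable
      finally have "?q * (norm (av n i))\<^sup>2 \<le> sqint (u n)"
        using measure_grid_cell[OF H[of j], of 0 z] by (simp add: ennreal_le_iff)
      with u(2)[of n] have "(norm (av n i))\<^sup>2 \<le> 1 / ?q"
        using H[of j] by (simp add: field_simps)
      then show ?thesis by (rule real_le_rsqrt)
    qed
    then show ?thesis by (auto simp: bounded_iff)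
  qed
  then obtain r where r: "strict_mono r" "\<And>i. convergent (\<lambda>n. av (r n) i)"
    using pointwise_convergent_subsequence by blast
  have "\<exists>N. \<forall>m\<ge>N. \<forall>n\<ge>N. sqint (\<lambda>x. indicator (ball 0 R) x *\<^sub>R (u (r m) x - u (r n) x)) < e" if e: "e > 0" for R e
  proof -
    define c where "c = 2 * ((real CARD('n))\<^sup>2 * 2 ^ CARD('n)) * (4 * \<Lambda>)"
    have "(\<lambda>j. c * (H j)\<^sup>2) \<longlonglongrightarrow> c * 0\<^sup>2"
      unfolding H_def using LIMSEQ_inverse_real_of_nat by (intro tendsto_intros) (simp add: inverse_eq_divide)
    then have "eventually (\<lambda>j. c * (H j)\<^sup>2 < e / 2) sequentially"
      using e by (intro order_tendstoD(2)) auto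
    then obtain j where j: "c * (H j)\<^sup>2 < e / 2" by (auto simp: eventually_sequentially)
    let ?h = "H j"
    define Z where "Z = grid_index 0 ?h ` ball (0::real^'n) R"
    have Z: "finite Z" by (simp add: Z_def finite_grid_indices)
    define K where "K = real (card Z) + 1"
    have K: "K > 0" by (simp add: K_def)
    \<comment> \<open>Chosen so that the mean terms of at most \<open>K\<close> cells add up to at
      most e / 2; the added 1 in \<open>K\<close> avoids division by zero.\<close>
    define \<delta> where "\<delta> = e / (4 * K * ?h ^ CARD('n))"
    have \<delta>: "\<delta> > 0" using e K H[of j] by (simp add: \<delta>_def)
    have "\<exists>N. \<forall>m\<ge>N. \<forall>n\<ge>N. norm (av (r m) (j, z) - av (r n) (j, z)) < sqrt \<delta>" for z
      using CauchyD[OF convergent_Cauchy[OF r(2)[of "(j, z)"]], of "sqrt \<delta>"] \<delta> by simp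
    then obtain N where N: "\<And>z m n. m \<ge> N z \<Longrightarrow> n \<ge> N z \<Longrightarrow> norm (av (r m) (j, z) - av (r n) (j, z)) < sqrt \<delta>"
      by metis
    have "sqint (\<lambda>x. indicator (ball 0 R) x *\<^sub>R (u (r m) x - u (r n) x)) < e"
      if mn: "m \<ge> Max (insert 0 (N ` Z))" "n \<ge> Max (insert 0 (N ` Z))" for m n
    proof -
      let ?w = "\<lambda>x. u (r m) x - u (r n) x"
      have w: "?w \<in> test_functions UNIV" by (intro test_diff u)
      have "sqint (gradient ?w) \<le> 2 * sqint (gradient (u (r m))) + 2 * sqint (gradient (u (r n)))"
        using sqint_diff_le2[OF gradient_square_integrable[OF u(1)] gradient_square_integrable[OF u(1)]]
        by (simp only: gradient_diff[OF test_smooth[OF u(1)] test_smooth[OF u(1)]] ext[of "gradient ?w", OF gradient_diff[OF test_smooth[OF u(1)] test_smooth[OF u(1)]]])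
      then have g: "sqint (gradient ?w) \<le> 4 * \<Lambda>" using u(3)[of "r m"] u(3)[of "r n"] by simp
      have mz: "(norm (mean (grid_cell 0 ?h z) ?w))\<^sup>2 \<le> \<delta>" if "z \<in> Z" for z
      proof -
        have "N z \<le> Max (insert 0 (N ` Z))" using that Z by (intro Max_ge) auto
        with N[of z m n] mn have "norm (av (r m) (j, z) - av (r n) (j, z)) < sqrt \<delta>" by linarith
        then have "norm (mean (grid_cell 0 ?h z) ?w) \<le> sqrt \<delta>"
          by (simp add: mean_diff[OF u(1) u(1)] av_def)
        from power_mono[OF this, of 2] \<delta> show ?thesis by simp
      qed
      have "sqint (\<lambda>x. indicator (ball 0 R) x *\<^sub>R ?w x) \<le>
        2 * ((?h * real CARD('n))\<^sup>2 * 2 ^ CARD('n)) * sqint (gradient ?w)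
        + (\<Sum>z\<in>Z. 2 * (norm (mean (grid_cell 0 ?h z) ?w))\<^sup>2 * ?h ^ CARD('n))"
        by (rule local_L2_estimate[OF w H Z]) (simp add: Z_def)
      also have "\<dots> \<le> 2 * ((?h * real CARD('n))\<^sup>2 * 2 ^ CARD('n)) * (4 * \<Lambda>) + (\<Sum>z\<in>Z. 2 * \<delta> * ?h ^ CARD('n))"
        using H[of j] by (intro add_mono mult_left_mono sum_mono mult_right_mono g mz) (auto simp: less_imp_le)
      also have "\<dots> = c * ?h\<^sup>2 + real (card Z) * (2 * \<delta> * ?h ^ CARD('n))"
        by (simp add: c_def power_mult_distrib mult_ac)
      also have "real (card Z) * (2 * \<delta> * ?h ^ CARD('n)) \<le> K * (2 * \<delta> * ?h ^ CARD('n))"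
        using \<delta> H[of j] by (intro mult_right_mono) (auto simp: K_def)
      also have "K * (2 * \<delta> * ?h ^ CARD('n)) = e / 2"
        using K H[of j] by (simp add: \<delta>_def)
      finally show ?thesis using j by simp
    qed
    then show ?thesis by blast
  qed
  with r(1) that show ?thesis by blast
qed

text \<open>Iterated midpoints of the tail from N, that is, dyadic convex combinations: the
  operation that the parallelogram law can handle.\<close>

inductive_set midhull :: "(nat \<Rightarrow> real^'n \<Rightarrow> real^'n) \<Rightarrow> nat \<Rightarrow> (real^'n \<Rightarrow> real^'n) set"
  for u N where
  base: "k \<ge> N \<Longrightarrow> u k \<in> midhull u N"
| mid: "f \<in> midhull u N \<Longrightarrow> g \<in> midhull u N \<Longrightarrow> (\<lambda>x. (1/2) *\<^sub>R (f x + g x)) \<in> midhull u N"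

lemma midhull_mono: "f \<in> midhull u N \<Longrightarrow> M \<le> N \<Longrightarrow> f \<in> midhull u M"
  by (induction rule: midhull.induct) (auto intro: midhull.intros)

lemma test_mid:
  assumes "f \<in> test_functions G" "g \<in> test_functions G"
  shows "(\<lambda>x. (1/2) *\<^sub>R (f x + g x)) \<in> test_functions G"
  by (rule test_linear[OF bounded_linear_scaleR_right test_add[OF assms]])

lemma midhull_test:
  assumes "\<And>n. u n \<in> test_functions UNIV"
  shows "f \<in> midhull u N \<Longrightarrow> f \<in> test_functions UNIV"
  by (induction rule: midhull.induct) (auto intro: assms test_mid)

lemma gradient_mid:
  assumes "smooth f" "smooth g"
  shows "gradient (\<lambda>x. (1/2) *\<^sub>R (f x + g x)) x = (1/2) *\<^sub>R (gradient f x + gradient g x)"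
  using gradient_linear[OF smooth_add[OF assms], of "1/2" x] gradient_add[OF assms, of x] by simp

lemma sqint_mid_le:
  assumes "square_integrable f" "square_integrable g" "sqint f \<le> e" "sqint g \<le> e"
  shows "sqint (\<lambda>x. (1/2) *\<^sub>R (f x + g x)) \<le> e"
  using sqint_parallelogram[OF assms(1,2)] sqint_nonneg[of "\<lambda>x. f x - g x"] assms(3,4) by simp

text \<open>Balls of L2 are stable under midpoints, so a bound along the tail holds on the hull.
  \<open>T\<close> will be the identity, the gradient, its trace, a cut-off gradient, and a
  localised difference from a fixed function; the last is affine rather than linear, hence
  compatibility is phrased with midpoints.\<close>

lemma midhull_sqint_le:
  fixes T :: "(real^'n \<Rightarrow> real^'n) \<Rightarrow> real^'n \<Rightarrow> 'b::euclidean_space"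
  assumes u: "\<And>n. u n \<in> test_functions UNIV"
    and T: "\<And>f. f \<in> test_functions UNIV \<Longrightarrow> square_integrable (T f)"
    and mid: "\<And>f g. f \<in> test_functions UNIV \<Longrightarrow> g \<in> test_functions UNIV \<Longrightarrow>
      T (\<lambda>x. (1/2) *\<^sub>R (f x + g x)) = (\<lambda>x. (1/2) *\<^sub>R (T f x + T g x))"
    and le: "\<And>k. k \<ge> N \<Longrightarrow> sqint (T (u k)) \<le> e"
  shows "f \<in> midhull u N \<Longrightarrow> sqint (T f) \<le> e"
proof (induction rule: midhull.induct)
  case (mid f g)
  note t = midhull_test[OF u mid(1)] midhull_test[OF u mid(2)]
  show ?case unfolding assms(3)[OF t] by (intro sqint_mid_le T t mid)
qed (rule le)

text \<open>A substitute for weak sequential compactness: by the parallelogram law, near-minimisers of the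
  \<open>H\<^sup>1\<close> energy over the successive midpoint hulls of the tails form a Cauchy sequence.\<close>

lemma H1_compactness:
  fixes u :: "nat \<Rightarrow> real^'n \<Rightarrow> real^'n"
  assumes u: "\<And>n. u n \<in> test_functions UNIV" "\<And>n. sqint (u n) \<le> 1" "\<And>n. sqint (gradient (u n)) \<le> \<Lambda>"
  obtains r v D f where "strict_mono (r::nat \<Rightarrow> nat)" "square_integrable v" "square_integrable D"
    "\<And>n. f n \<in> midhull (\<lambda>k. u (r k)) n"
    "(\<lambda>n. sqint (\<lambda>x. f n x - v x)) \<longlonglongrightarrow> 0" "(\<lambda>n. sqint (\<lambda>x. gradient (f n) x - D x)) \<longlonglongrightarrow> 0"
    "\<And>R. (\<lambda>n. sqint (\<lambda>x. indicator (ball 0 R) x *\<^sub>R (u (r n) x - v x))) \<longlonglongrightarrow> 0"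
proof -
  obtain r :: "nat \<Rightarrow> nat" where r: "strict_mono r"
    and rC: "\<And>R e. e > 0 \<Longrightarrow> \<exists>N. \<forall>m\<ge>N. \<forall>n\<ge>N. sqint (\<lambda>x. indicator (ball 0 R) x *\<^sub>R (u (r m) x - u (r n) x)) < e"
    by (rule local_L2_Cauchy_subsequence[of u \<Lambda>, OF u]) blast
  define w where "w k = u (r k)" for k
  have w: "w n \<in> test_functions UNIV" "sqint (w n) \<le> 1" "sqint (gradient (w n)) \<le> \<Lambda>" for n
    using u by (auto simp: w_def)
  define E where "E f = sqint f + sqint (gradient f)" for f :: "real^'n \<Rightarrow> real^'n"
  have E0: "0 \<le> E f" for f by (simp add: E_def)
  have E_le: "E f \<le> 1 + \<Lambda>" if "f \<in> midhull w N" for f N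
  proof -
    have "sqint f \<le> 1"
      by (rule midhull_sqint_le[where T="\<lambda>f. f", OF w(1) _ _ _ that]) (auto intro: test_square_integrable w)
    moreover have "sqint (gradient f) \<le> \<Lambda>"
      by (rule midhull_sqint_le[where T=gradient, OF w(1) _ _ _ that])
         (auto intro: gradient_square_integrable w gradient_mid test_smooth)
    ultimately show ?thesis by (simp add: E_def)
  qed
  define m where "m N = Inf (E ` midhull w N)" for N
  have ne: "E ` midhull w N \<noteq> {}" for N using midhull.base[of N N w] by blast
  have bdd: "bdd_below (E ` midhull w N)" for N using E0 by (intro bdd_belowI2[where m=0])
  have m_le: "m N \<le> E f" if "f \<in> midhull w N" for f N
    unfolding m_def using that bdd by (intro cInf_lower) auto
  have "\<exists>f\<in>midhull w N. E f < m N + 1 / real (Suc N)" for N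
    using cInf_lessD[OF ne, of N "m N + 1 / real (Suc N)"] by (auto simp: m_def)
  then obtain f where f: "\<And>N. f N \<in> midhull w N" "\<And>N. E (f N) < m N + 1 / real (Suc N)" by metis
  note ft = midhull_test[OF w(1) f(1)]
  have m_mono: "m M \<le> m N" if "M \<le> N" for M N
    unfolding m_def
    by (intro cInf_superset_mono image_mono ne bdd subsetI) (auto intro: midhull_mono that)
  have "m N \<le> 1 + \<Lambda>" for N using m_le[OF f(1)] E_le[OF f(1)] order_trans by blast
  then have "convergent m"
    using m_mono incseq_convergent[of m "1 + \<Lambda>"] unfolding incseq_def convergent_def by metis
  then have mC: "\<exists>N. \<forall>i\<ge>N. \<forall>j\<ge>N. \<bar>m i - m j\<bar> < e" if "e > 0" for e
    using CauchyD[OF convergent_Cauchy that, of m] by simp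
  have diff: "sqint (\<lambda>x. f i x - f j x) + sqint (\<lambda>x. gradient (f i) x - gradient (f j) x)
     \<le> 2 * (m j - m i) + 4 / real (Suc i)" if "i \<le> j" for i j
  proof -
    let ?g = "\<lambda>x. (1/2) *\<^sub>R (f i x + f j x)"
    \<comment> \<open>The midpoint lies in the larger of the two hulls, so its energy is at least
      \<open>m i\<close>.\<close>
    have "?g \<in> midhull w i" using f(1) midhull_mono[OF f(1) that] by (intro midhull.mid) auto
    from m_le[OF this] have "m i \<le> sqint ?g + sqint (\<lambda>x. (1/2) *\<^sub>R (gradient (f i) x + gradient (f j) x))"
      by (simp only: E_def ext[of "gradient ?g", OF gradient_mid[OF test_smooth[OF ft] test_smooth[OF ft]]])
    moreover have "1 / real (Suc j) \<le> 1 / real (Suc i)" using that by (simp add: field_simps)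
    ultimately show ?thesis
      using sqint_parallelogram[OF test_square_integrable[OF ft] test_square_integrable[OF ft], of i j]
        sqint_parallelogram[OF gradient_square_integrable[OF ft] gradient_square_integrable[OF ft], of i j]
        f(2)[of i] f(2)[of j] by (simp add: E_def)
  qed
  have C: "\<exists>N. \<forall>i\<ge>N. \<forall>j\<ge>N. sqint (\<lambda>x. f i x - f j x) + sqint (\<lambda>x. gradient (f i) x - gradient (f j) x) < e" if e: "e > 0" for e
  proof -
    obtain N1 where N1: "\<And>i j. i \<ge> N1 \<Longrightarrow> j \<ge> N1 \<Longrightarrow> \<bar>m i - m j\<bar> < e / 4" using mC[of "e/4"] e by auto
    obtain N2 :: nat where N2: "8 / e < real N2" using reals_Archimedean2 by blast
    have *: "sqint (\<lambda>x. f i x - f j x) + sqint (\<lambda>x. gradient (f i) x - gradient (f j) x) < e"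
      if "i \<ge> max N1 N2" "j \<ge> i" for i j
    proof -
      have "8 / e < real (Suc i)" using N2 that by linarith
      then have "4 / real (Suc i) < e / 2" using e by (simp add: field_simps)
      moreover have "\<bar>m i - m j\<bar> < e / 4" using that by (intro N1) auto
      then have "2 * (m j - m i) < e / 2" using abs_ge_minus_self[of "m i - m j"] by argo
      ultimately have "2 * (m j - m i) + 4 / real (Suc i) < e / 2 + e / 2" by (intro add_strict_mono)
      with diff[OF that(2)] show ?thesis by simp
    qed
    have "sqint (\<lambda>x. f i x - f j x) + sqint (\<lambda>x. gradient (f i) x - gradient (f j) x) < e"
      if "i \<ge> max N1 N2" "j \<ge> max N1 N2" for i j
      using *[of i j] *[of j i] that sqint_minus_commute[of "f i" "f j"]
        sqint_minus_commute[of "gradient (f i)" "gradient (f j)"] by (cases "i \<le> j") auto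
    then show ?thesis by blast
  qed
  have "\<exists>N. \<forall>i\<ge>N. \<forall>j\<ge>N. sqint (\<lambda>x. f i x - f j x) < e" if "e > 0" for e
  proof -
    from C[OF that] obtain N where N: "\<forall>i\<ge>N. \<forall>j\<ge>N. sqint (\<lambda>x. f i x - f j x) + sqint (\<lambda>x. gradient (f i) x - gradient (f j) x) < e" ..
    have "sqint (\<lambda>x. f i x - f j x) < e" if "i \<ge> N" "j \<ge> N" for i j
      using N[rule_format, OF that] sqint_nonneg[of "\<lambda>x. gradient (f i) x - gradient (f j) x"] by linarith
    then show ?thesis by blast
  qed
  then obtain v where v: "square_integrable v" "(\<lambda>n. sqint (\<lambda>x. f n x - v x)) \<longlonglongrightarrow> 0"
    using L2_complete[of f] test_square_integrable[OF ft] by blast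
  have "\<exists>N. \<forall>i\<ge>N. \<forall>j\<ge>N. sqint (\<lambda>x. gradient (f i) x - gradient (f j) x) < e" if "e > 0" for e
  proof -
    from C[OF that] obtain N where N: "\<forall>i\<ge>N. \<forall>j\<ge>N. sqint (\<lambda>x. f i x - f j x) + sqint (\<lambda>x. gradient (f i) x - gradient (f j) x) < e" ..
    have "sqint (\<lambda>x. gradient (f i) x - gradient (f j) x) < e" if "i \<ge> N" "j \<ge> N" for i j
      using N[rule_format, OF that] sqint_nonneg[of "\<lambda>x. f i x - f j x"] by linarith
    then show ?thesis by blast
  qed
  then obtain D where D: "square_integrable D" "(\<lambda>n. sqint (\<lambda>x. gradient (f n) x - D x)) \<longlonglongrightarrow> 0"
    using L2_complete[of "\<lambda>n. gradient (f n)"] gradient_square_integrable[OF ft] by blast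
  \<comment> \<open>Links the two limits: the members of the tail of \<open>w\<close> are close to
    \<open>w n\<close> on the ball, hence so is the hull element \<open>f ?M\<close>, which is close
    to v. So the limit of the hull sequence is also the local strong limit of
    \<open>w\<close>.\<close>
  have loc: "(\<lambda>n. sqint (\<lambda>x. indicator (ball 0 R) x *\<^sub>R (w n x - v x))) \<longlonglongrightarrow> 0" for R
  proof (rule LIMSEQ_I)
    fix e :: real assume e: "e > 0"
    obtain N where N: "\<And>i j. i \<ge> N \<Longrightarrow> j \<ge> N \<Longrightarrow> sqint (\<lambda>x. indicator (ball 0 R) x *\<^sub>R (w i x - w j x)) < e / 8"
      using rC[of "e/8" R] e by (auto simp: w_def)
    have "eventually (\<lambda>n. sqint (\<lambda>x. f n x - v x) < e / 8) sequentially"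
      using v(2) e by (intro order_tendstoD(2)) auto
    then obtain N' where N': "\<And>n. n \<ge> N' \<Longrightarrow> sqint (\<lambda>x. f n x - v x) < e / 8"
      by (auto simp: eventually_sequentially)
    have "sqint (\<lambda>x. indicator (ball 0 R) x *\<^sub>R (w n x - v x)) < e" if n: "n \<ge> N" for n
    proof -
      let ?M = "max N N'" and ?I = "\<lambda>f x. indicator (ball 0 R) x *\<^sub>R (w n x - f x)"
      have "sqint (?I (f ?M)) \<le> e / 8"
      proof (rule midhull_sqint_le[where T="?I", OF w(1)])
        show "f ?M \<in> midhull w N" using midhull_mono[OF f(1), of N ?M] by simp
        fix g :: "real^'n \<Rightarrow> real^'n" assume "g \<in> test_functions UNIV"
        then show "square_integrable (?I g)"
          by (intro square_integrable_indicator square_integrable_diff test_square_integrable[OF w(1)] test_square_integrable) auto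
      next
        fix g h :: "real^'n \<Rightarrow> real^'n"
        show "?I (\<lambda>x. (1/2) *\<^sub>R (g x + h x)) = (\<lambda>x. (1/2) *\<^sub>R (?I g x + ?I h x))"
          by (auto simp: indicator_def vec_eq_iff field_simps)
      next
        fix k assume "N \<le> k"
        then show "sqint (?I (w k)) \<le> e / 8" using N[OF n] by (simp add: less_imp_le)
      qed
      moreover have "sqint (\<lambda>x. indicator (ball 0 R) x *\<^sub>R (f ?M x - v x)) \<le> e / 8"
        using square_integrable_indicator(2)[OF square_integrable_diff[OF test_square_integrable[OF ft] v(1)], of "ball 0 R" ?M]
          N'[of ?M] by simp
      moreover have "sqint (\<lambda>x. ?I (f ?M) x + indicator (ball 0 R) x *\<^sub>R (f ?M x - v x)) \<le>
         2 * sqint (?I (f ?M)) + 2 * sqint (\<lambda>x. indicator (ball 0 R) x *\<^sub>R (f ?M x - v x))"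
        by (intro sqint_add_le2 square_integrable_indicator square_integrable_diff test_square_integrable[OF ft] test_square_integrable[OF w(1)] v) auto
      ultimately show ?thesis using e by (simp flip: scaleR_add_right)
    qed
    then show "\<exists>N. \<forall>n\<ge>N. norm (sqint (\<lambda>x. indicator (ball 0 R) x *\<^sub>R (w n x - v x)) - 0) < e"
      by (auto intro!: exI[of _ N])
  qed
  show ?thesis
    by (rule that[OF r v(1) D(1) f(1)[unfolded w_def] v(2) D(2) loc[unfolded w_def]])
qed

section \<open>Cut-offs and the relaxed variational class\<close>

lemma
  fixes t :: "real^'n"
  assumes c: "c > 0"
  shows lebesgue_affine: "lebesgue = density (distr lebesgue lebesgue (\<lambda>x. c *\<^sub>R x + t)) (\<lambda>_. ennreal (c ^ CARD('n)))"
    and affine_measurable_lebesgue: "(\<lambda>x. c *\<^sub>R x + t) \<in> lebesgue \<rightarrow>\<^sub>M lebesgue"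
proof -
  have T: "(\<lambda>x::real^'n. t + (\<Sum>j\<in>Basis. (c * (x \<bullet> j)) *\<^sub>R j)) = (\<lambda>x. c *\<^sub>R x + t)"
    unfolding scaleR_scaleR[symmetric] scaleR_sum_right[symmetric] euclidean_representation by (simp add: add.commute)
  show "lebesgue = density (distr lebesgue lebesgue (\<lambda>x. c *\<^sub>R x + t)) (\<lambda>_. ennreal (c ^ CARD('n)))"
    using lebesgue_affine_euclidean[of "\<lambda>_. c" t] c unfolding T by simp
  show "(\<lambda>x. c *\<^sub>R x + t) \<in> lebesgue \<rightarrow>\<^sub>M lebesgue"
    using lebesgue_affine_measurable[of "\<lambda>_. c" t] c unfolding T by simp
qed

lemma nn_integral_lebesgue_affine:
  fixes f :: "real^'n \<Rightarrow> ennreal"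
  assumes f[measurable]: "f \<in> borel_measurable lebesgue" and c: "c > 0"
  shows "(\<integral>\<^sup>+x. f x \<partial>lebesgue) = ennreal (c ^ CARD('n)) * (\<integral>\<^sup>+x. f (c *\<^sub>R x + t) \<partial>lebesgue)"
proof -
  note [measurable] = affine_measurable_lebesgue[OF c, of t]
  have "(\<integral>\<^sup>+x. f x \<partial>lebesgue) = (\<integral>\<^sup>+x. f x \<partial>density (distr lebesgue lebesgue (\<lambda>x. c *\<^sub>R x + t)) (\<lambda>_. ennreal (c ^ CARD('n))))"
    using lebesgue_affine[OF c, of t] by simp
  also have "\<dots> = ennreal (c ^ CARD('n)) * (\<integral>\<^sup>+x. f (c *\<^sub>R x + t) \<partial>lebesgue)"
    by (simp add: nn_integral_density nn_integral_distr nn_integral_cmult)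
  finally show ?thesis .
qed

lemma
  fixes f :: "real^'n \<Rightarrow> 'b::euclidean_space"
  assumes f: "square_integrable f" and c: "c > 0"
  shows square_integrable_affine: "square_integrable (\<lambda>x. f (c *\<^sub>R x + t))"
    and sqint_affine: "sqint (\<lambda>x. f (c *\<^sub>R x + t)) = sqint f / c ^ CARD('n)"
proof -
  note [measurable] = affine_measurable_lebesgue[OF c, of t] square_integrableD(1)[OF f]
  have m: "(\<lambda>x. f (c *\<^sub>R x + t)) \<in> borel_measurable lebesgue" by measurable
  have eq: "ennreal (sqint f) = ennreal (c ^ CARD('n)) * (\<integral>\<^sup>+x. ennreal ((norm (f (c *\<^sub>R x + t)))\<^sup>2) \<partial>lebesgue)"
    unfolding sqint_def
    by (subst nn_integral_eq_integral[symmetric]) (auto intro: square_integrableD f nn_integral_lebesgue_affine c)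
  have "(\<integral>\<^sup>+x. ennreal ((norm (f (c *\<^sub>R x + t)))\<^sup>2) \<partial>lebesgue) < \<infinity>"
    using eq c by (metis ennreal_less_top ennreal_mult_eq_top_iff ennreal_eq_0_iff infinity_ennreal_def not_le top.not_eq_extremum zero_less_power)
  then have i: "integrable lebesgue (\<lambda>x. (norm (f (c *\<^sub>R x + t)))\<^sup>2)"
    by (intro integrableI_bounded) (auto intro: borel_measurable_power borel_measurable_norm m)
  then show "square_integrable (\<lambda>x. f (c *\<^sub>R x + t))" using m by (simp add: square_integrable_def)
  have "(\<integral>\<^sup>+x. ennreal ((norm (f (c *\<^sub>R x + t)))\<^sup>2) \<partial>lebesgue) = ennreal (sqint (\<lambda>x. f (c *\<^sub>R x + t)))"
    unfolding sqint_def using i by (intro nn_integral_eq_integral) auto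
  with eq c have "sqint f = c ^ CARD('n) * sqint (\<lambda>x. f (c *\<^sub>R x + t))"
    by (simp flip: ennreal_mult)
  with c show "sqint (\<lambda>x. f (c *\<^sub>R x + t)) = sqint f / c ^ CARD('n)" by (simp add: field_simps)
qed

lemma sqint_translate:
  fixes f :: "real^'n \<Rightarrow> 'b::euclidean_space"
  assumes "square_integrable f"
  shows "sqint (\<lambda>x. f (x + t)) = sqint f"
  using sqint_affine[OF assms, of 1 t] by simp

lemma gradient_affine:
  assumes "smooth u"
  shows "gradient (\<lambda>x. u (c *\<^sub>R x + t)) x = c *\<^sub>R gradient u (c *\<^sub>R x + t)"
  using partial_deriv_affine[OF assms] by (simp add: gradient_def vec_eq_iff)

section \<open>The product rule for a cut-off times a field\<close>

definition scalar_gradient :: "(real^'n \<Rightarrow> real) \<Rightarrow> real^'n \<Rightarrow> real^'n" where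
  "scalar_gradient g x = (\<chi> j. partial_deriv j g x)"

definition outer :: "real^'m \<Rightarrow> real^'n \<Rightarrow> real^'n^'m" where
  "outer a b = (\<chi> k j. a $ k * b $ j)"

lemma norm_outer: "norm (outer a b) = norm a * norm b"
proof -
  have "norm (outer a b) = L2_set (\<lambda>k. norm (a $ k *\<^sub>R b)) UNIV"
    unfolding norm_vec_def[of "outer a b"]
    by (intro L2_set_cong arg_cong[of _ _ norm]) (auto simp: outer_def vec_eq_iff)
  then show ?thesis by (simp add: L2_set_left_distrib[symmetric] norm_vec_def[of a])
qed

lemma trace_outer: "trace (outer a b) = a \<bullet> b"
  by (simp add: trace_def outer_def inner_vec_def)

lemma gradient_scaleR:
  assumes "smooth g" "smooth u"
  shows "gradient (\<lambda>x. g x *\<^sub>R u x) x = g x *\<^sub>R gradient u x + outer (u x) (scalar_gradient g x)"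
  using partial_deriv_scaleR[OF assms]
  by (simp add: gradient_def outer_def scalar_gradient_def vec_eq_iff mult.commute)

lemma trace_scaleR: "trace (c *\<^sub>R A) = c * trace A"
  by (simp add: trace_def sum_distrib_left)

text \<open>The inner product is the divergence created by a cut-off. It is proportional to the
  gradient of g, so slowly varying cut-offs create little.\<close>

lemma trace_gradient_scaleR:
  assumes "smooth g" "smooth u"
  shows "trace (gradient (\<lambda>x. g x *\<^sub>R u x) x) = g x * trace (gradient u x) + u x \<bullet> scalar_gradient g x"
  by (simp add: gradient_scaleR[OF assms] trace_add trace_scaleR trace_outer)

lemma norm_gradient_scaleR_le:
  assumes "smooth g" "smooth u" "\<theta> > 0"
  shows "(norm (gradient (\<lambda>x. g x *\<^sub>R u x) x))\<^sup>2 \<le>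
    (1 + \<theta>) * ((g x)\<^sup>2 * (norm (gradient u x))\<^sup>2) + (1 + 1 / \<theta>) * ((norm (scalar_gradient g x))\<^sup>2 * (norm (u x))\<^sup>2)"
  using norm_add_sq_le[OF assms(3), of "g x *\<^sub>R gradient u x" "outer (u x) (scalar_gradient g x)"]
  by (simp add: gradient_scaleR[OF assms(1,2)] norm_outer power_mult_distrib mult.commute)

lemma trace_gradient_scaleR_le:
  assumes "smooth g" "smooth u"
  shows "(trace (gradient (\<lambda>x. g x *\<^sub>R u x) x))\<^sup>2 \<le>
    2 * ((g x)\<^sup>2 * (trace (gradient u x))\<^sup>2) + 2 * ((norm (scalar_gradient g x))\<^sup>2 * (norm (u x))\<^sup>2)"
proof -
  have "(u x \<bullet> scalar_gradient g x)\<^sup>2 \<le> (norm (scalar_gradient g x))\<^sup>2 * (norm (u x))\<^sup>2"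
    using power_mono[OF Cauchy_Schwarz_ineq2[of "u x" "scalar_gradient g x"], of 2]
    by (simp add: power_mult_distrib mult.commute)
  then show ?thesis
    using norm_add_sq_le[of 1 "g x * trace (gradient u x)" "u x \<bullet> scalar_gradient g x"]
    by (simp add: trace_gradient_scaleR[OF assms] power_mult_distrib)
qed

text \<open>\<open>near_admissible V \<delta>\<close> relaxes the class defining the Stokes constant (for volume \<open>V\<close>) so that
  it becomes stable under smooth cut-offs: both the divergence and the part of the function outside
  a set of volume \<open>V\<close> need only be small.\<close>

definition near_admissible :: "real \<Rightarrow> real \<Rightarrow> (real^'n \<Rightarrow> real^'n) \<Rightarrow> bool" where
  "near_admissible V \<delta> u \<longleftrightarrow> u \<in> test_functions UNIV \<and>
     (\<exists>B\<in>sets borel. emeasure lborel B \<le> ennreal V \<and> sqint (\<lambda>x. indicator (- B) x *\<^sub>R u x) \<le> \<delta> * sqint u) \<and>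
     sqint (\<lambda>x. trace (gradient u x)) \<le> \<delta> * sqint u"

text \<open>The tolerance is quantified existentially, so the supremum of all such \<open>s\<close>
  is the limit of the relaxed infima as \<delta> tends to 0.\<close>

definition energy_bound :: "'n::finite itself \<Rightarrow> real \<Rightarrow> real \<Rightarrow> bool" where
  "energy_bound _ V s \<longleftrightarrow> (\<exists>\<delta>>0. \<forall>u :: real^'n \<Rightarrow> real^'n. near_admissible V \<delta> u \<longrightarrow> s * sqint u \<le> sqint (gradient u))"

lemma energy_bound_mono: "energy_bound TYPE('n::finite) V s \<Longrightarrow> s' \<le> s \<Longrightarrow> energy_bound TYPE('n) V s'"
  unfolding energy_bound_def by (meson mult_right_mono order_trans sqint_nonneg)

lemma energy_bound_0: "energy_bound TYPE('n::finite) V 0"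
  unfolding energy_bound_def by (auto intro!: exI[of _ 1])

lemma near_admissible_scaleR:
  assumes u: "near_admissible V \<delta> u"
  shows "near_admissible V \<delta> (\<lambda>x. c *\<^sub>R u x)"
proof -
  have t: "u \<in> test_functions UNIV" using u by (simp add: near_admissible_def)
  obtain B where B: "B \<in> sets borel" "emeasure lborel B \<le> ennreal V" "sqint (\<lambda>x. indicator (- B) x *\<^sub>R u x) \<le> \<delta> * sqint u"
    and d: "sqint (\<lambda>x. trace (gradient u x)) \<le> \<delta> * sqint u"
    using u by (auto simp: near_admissible_def)
  have "sqint (\<lambda>x. indicator (- B) x *\<^sub>R c *\<^sub>R u x) = c\<^sup>2 * sqint (\<lambda>x. indicator (- B) x *\<^sub>R u x)"
    by (simp only: scaleR_left_commute[of _ c] sqint_scaleR)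
  moreover have "sqint (\<lambda>x. trace (gradient (\<lambda>x. c *\<^sub>R u x) x)) = c\<^sup>2 * sqint (\<lambda>x. trace (gradient u x))"
    using sqint_scaleR[of c "\<lambda>x. trace (gradient u x)"]
    by (simp add: gradient_linear[OF test_smooth[OF t]] trace_scaleR)
  ultimately show ?thesis
    unfolding near_admissible_def using B d mult_left_mono[OF B(3), of "c\<^sup>2"] mult_left_mono[OF d, of "c\<^sup>2"]
    by (auto simp: sqint_scaleR mult.left_commute intro!: test_linear[OF bounded_linear_scaleR_right t] bexI[OF _ B(1)])
qed

lemma near_admissible_translate:
  assumes u: "near_admissible V \<delta> u"
  shows "near_admissible V \<delta> (\<lambda>x. u (x + t))"
proof -
  have ut: "u \<in> test_functions UNIV" using u by (simp add: near_admissible_def)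
  obtain B where B: "B \<in> sets borel" "emeasure lborel B \<le> ennreal V" "sqint (\<lambda>x. indicator (- B) x *\<^sub>R u x) \<le> \<delta> * sqint u"
    and d: "sqint (\<lambda>x. trace (gradient u x)) \<le> \<delta> * sqint u"
    using u by (auto simp: near_admissible_def)
  define C where "C = (\<lambda>x. x + t) -` B"
  have C: "C \<in> sets borel"
    using measurable_sets[of "\<lambda>x. x + t" borel borel B] B(1) by (simp add: C_def)
  have ind: "indicator B (x + t) = (indicator C x :: ennreal)" for x by (simp add: C_def indicator_def)
  have "emeasure lborel C = (\<integral>\<^sup>+x. indicator B (x + t) \<partial>lborel)"
    unfolding ind by (rule nn_integral_indicator[symmetric]) (simp add: C)
  also have "\<dots> = emeasure lborel B" using B(1) by (simp add: nn_integral_translate)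
  finally have C2: "emeasure lborel C \<le> ennreal V" using B by simp
  have su: "sqint (\<lambda>x. u (x + t)) = sqint u" by (rule sqint_translate[OF test_square_integrable[OF ut]])
  have "sqint (\<lambda>x. indicator (- B) (x + t) *\<^sub>R u (x + t)) = sqint (\<lambda>x. indicator (- B) x *\<^sub>R u x)"
    using B(1) by (intro sqint_translate[of "\<lambda>x. indicator (- B) x *\<^sub>R u x"] square_integrable_indicator test_square_integrable[OF ut]) auto
  moreover have "indicator (- B) (x + t) = (indicator (- C) x :: real)" for x by (auto simp: C_def indicator_def)
  ultimately have C3: "sqint (\<lambda>x. indicator (- C) x *\<^sub>R u (x + t)) \<le> \<delta> * sqint (\<lambda>x. u (x + t))"
    using B(3) su by simp
  have "gradient (\<lambda>x. u (x + t)) x = gradient u (x + t)" for x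
    using gradient_affine[OF test_smooth[OF ut], of 1 t x] by simp
  then have "sqint (\<lambda>x. trace (gradient (\<lambda>x. u (x + t)) x)) = sqint (\<lambda>x. trace (gradient u x))"
    using sqint_translate[OF square_integrable_trace(1)[OF gradient_square_integrable[OF ut]], of t] by simp
  with d su have "sqint (\<lambda>x. trace (gradient (\<lambda>x. u (x + t)) x)) \<le> \<delta> * sqint (\<lambda>x. u (x + t))" by simp
  moreover have "(\<lambda>x. u (x + t)) \<in> test_functions UNIV" using test_affine[OF ut, of 1 t] by simp
  ultimately show ?thesis unfolding near_admissible_def using C C2 C3 by blast
qed

lemma sqint_indicator_split:
  assumes "square_integrable f" "B \<in> sets lebesgue"
  shows "sqint f = sqint (\<lambda>x. indicator B x *\<^sub>R f x) + sqint (\<lambda>x. indicator (- B) x *\<^sub>R f x)"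
proof -
  have cB: "- B \<in> sets lebesgue"
    using sets.compl_sets[OF assms(2)] by (simp add: Compl_eq_Diff_UNIV)
  have "sqint (\<lambda>x. indicator B x *\<^sub>R f x) + sqint (\<lambda>x. indicator (- B) x *\<^sub>R f x)
     = (LINT x|lebesgue. (norm (indicator B x *\<^sub>R f x))\<^sup>2 + (norm (indicator (- B) x *\<^sub>R f x))\<^sup>2)"
    unfolding sqint_def using assms cB
    by (intro Bochner_Integration.integral_add[symmetric] square_integrableD square_integrable_indicator)
  also have "\<dots> = sqint f"
    unfolding sqint_def by (intro Bochner_Integration.integral_cong) (auto simp: indicator_def)
  finally show ?thesis ..
qed

text \<open>On small cubes the function is close to its mean, so a set of bounded volume
  carries little mass unless some cube does.\<close>

lemma no_vanishing:
  fixes V \<Lambda> :: real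
  assumes V: "V \<ge> 0" and \<Lambda>: "\<Lambda> \<ge> 0"
  obtains c R where "c > 0" "\<And>u :: real^'n \<Rightarrow> real^'n. near_admissible V (1/2) u \<Longrightarrow> sqint u = 1 \<Longrightarrow>
    sqint (gradient u) \<le> \<Lambda> \<Longrightarrow> \<exists>y. c \<le> sqint (\<lambda>x. indicator (ball 0 R) x *\<^sub>R u (x + y))"
proof -
  define A where "A = (real CARD('n))\<^sup>2 * 2 ^ CARD('n)"
  have A: "A > 0" by (simp add: A_def)
  \<comment> \<open>Small enough that twice the Poincare bound
    \<open>h\<^sup>2 * A * \<Lambda>\<close> is at most 1/8.\<close>
  define h where "h = 1 / (4 * sqrt (A * \<Lambda> + 1))"
  have h: "h > 0" using A \<Lambda> by (simp add: h_def add_nonneg_pos)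
  have hA: "2 * (h\<^sup>2 * A * \<Lambda>) \<le> 1/8"
  proof -
    have "h\<^sup>2 = 1 / (16 * (A * \<Lambda> + 1))" using A \<Lambda> by (simp add: h_def power_divide power_mult_distrib)
    then have "h\<^sup>2 * A * \<Lambda> = (A * \<Lambda>) / (16 * (A * \<Lambda> + 1))" by simp
    also have "\<dots> \<le> 1 / 16"
    proof -
      have "0 \<le> A * \<Lambda>" using A \<Lambda> by simp
      moreover have "x / (16 * (x + 1)) \<le> 1 / 16" if "x \<ge> 0" for x :: real
        using that by (simp add: divide_simps)
      ultimately show ?thesis by blast
    qed
    finally show ?thesis by simp
  qed
  define q where "q = h ^ CARD('n)"
  have q: "q > 0" using h by (simp add: q_def)
  \<comment> \<open>If every cell has mass at most c, the squared means are at most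
    \<open>c / q\<close>, and over volume V they contribute at most 1/8. With the gradient term and
    the mass at most 1/2 off \<open>B\<close>, the total stays below 1.\<close>
  define c where "c = q / (16 * (V + 1))"
  have c: "c > 0" using q V by (simp add: c_def)
  have cV: "2 * (c / q) * V \<le> 1/8" using q V by (simp add: c_def divide_simps)
  \<comment> \<open>Larger than the diameter of a cell, so a cell lies in the ball around any of its
    points.\<close>
  define R where "R = h * real CARD('n) + 1"
  have "\<exists>y. c \<le> sqint (\<lambda>x. indicator (ball 0 R) x *\<^sub>R u (x + y))"
    if adm: "near_admissible V (1/2) u" and u1: "sqint u = 1" and g: "sqint (gradient u) \<le> \<Lambda>" for u :: "real^'n \<Rightarrow> real^'n"
  proof (rule ccontr)
    assume "\<nexists>y. c \<le> sqint (\<lambda>x. indicator (ball 0 R) x *\<^sub>R u (x + y))"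
    then have small: "sqint (\<lambda>x. indicator (ball 0 R) x *\<^sub>R u (x + y)) < c" for y by (simp add: not_le)
    have u: "u \<in> test_functions UNIV" using adm by (simp add: near_admissible_def)
    obtain B where B[measurable]: "B \<in> sets borel" and B2: "emeasure lborel B \<le> ennreal V" "sqint (\<lambda>x. indicator (- B) x *\<^sub>R u x) \<le> 1/2"
      using adm u1 by (auto simp: near_admissible_def)
    note [measurable] = test_borel[OF u] gradient_borel[OF test_smooth[OF u]]
    have cell: "(\<integral>\<^sup>+x. indicator (grid_cell 0 h z) x * ennreal ((norm (u x))\<^sup>2) \<partial>lborel) \<le> ennreal c" for z :: "int^'n"
    proof (cases "grid_cell 0 h z = {}")
      case False
      then obtain y where y: "y \<in> grid_cell 0 h z" by blast
      have "(\<integral>\<^sup>+x. indicator (grid_cell 0 h z) x * ennreal ((norm (u x))\<^sup>2) \<partial>lborel)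
        = (\<integral>\<^sup>+x. indicator (grid_cell 0 h z) (x + y) * ennreal ((norm (u (x + y)))\<^sup>2) \<partial>lborel)"
        by (rule nn_integral_translate[symmetric]) measurable
      also have "\<dots> \<le> (\<integral>\<^sup>+x. ennreal ((norm (indicator (ball 0 R) x *\<^sub>R u (x + y)))\<^sup>2) \<partial>lborel)"
      proof (rule nn_integral_mono)
        fix x
        have "x \<in> ball 0 R" if "x + y \<in> grid_cell 0 h z"
          using grid_cell_diam[OF that y] h by (simp add: R_def)
        then show "indicator (grid_cell 0 h z) (x + y) * ennreal ((norm (u (x + y)))\<^sup>2)
           \<le> ennreal ((norm (indicator (ball 0 R) x *\<^sub>R u (x + y)))\<^sup>2)"
          by (auto simp: indicator_def)
      qed
      also have "\<dots> = ennreal (sqint (\<lambda>x. indicator (ball 0 R) x *\<^sub>R u (x + y)))"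
        using test_affine[OF u, of 1 y]
        by (intro sqint_eq_nn_integral square_integrable_indicator test_square_integrable
            borel_measurable_scaleR borel_measurable_indicator) auto
      also have "\<dots> \<le> ennreal c" using small[of y] by (intro ennreal_leI) simp
      finally show ?thesis .
    qed simp
    let ?f = "\<lambda>x. indicator B x * ennreal ((norm (u x))\<^sup>2)"
    let ?C = "(h * real CARD('n))\<^sup>2 * 2 ^ CARD('n)"
    let ?g = "\<lambda>x. ennreal (2 * ?C) * ennreal ((norm (gradient u x))\<^sup>2) + ennreal (2 * (c / q)) * indicator B x"
    have mf: "?f \<in> borel_measurable borel" by measurable
    have mg: "?g \<in> borel_measurable borel" by measurable
    have "(\<integral>\<^sup>+x. ?f x \<partial>lborel) \<le> (\<integral>\<^sup>+x. ?g x \<partial>lborel)"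
    proof (rule nn_integral_le_grid[OF mf mg h])
      fix z :: "int^'n"
      let ?Q = "grid_cell 0 h z"
      let ?m = "mean ?Q u"
      have diam: "\<And>x y. x \<in> ?Q \<Longrightarrow> y \<in> ?Q \<Longrightarrow> norm (x - y) \<le> h * real CARD('n)"
        by (rule grid_cell_diam) (use h in auto)
      have fin: "emeasure lborel ?Q < \<infinity>" "measure lborel ?Q > 0"
        using emeasure_grid_cell[OF h, of 0 z] measure_grid_cell[OF h, of 0 z] h by auto
      have "ennreal (q * (norm ?m)\<^sup>2) \<le> ennreal c"
        using poincare_mean(2)[OF u grid_cell_borel grid_cell_convex diam fin] cell[of z] measure_grid_cell[OF h, of 0 z]
        by (simp add: q_def)
      then have mc: "(norm ?m)\<^sup>2 \<le> c / q" using c q by (simp add: ennreal_le_iff field_simps)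
      have "(\<integral>\<^sup>+x. indicator ?Q x * ?f x \<partial>lborel) \<le>
        (\<integral>\<^sup>+x. 2 * (indicator ?Q x * ennreal ((norm (u x - ?m))\<^sup>2)) + ennreal (2 * (c / q)) * (indicator ?Q x * indicator B x) \<partial>lborel)"
      proof (rule nn_integral_mono)
        fix x
        have "(norm (u x))\<^sup>2 \<le> 2 * (norm (u x - ?m))\<^sup>2 + 2 * (c / q)"
          using norm_add_sq_le[of 1 "u x - ?m" "?m"] mc by simp
        then have "ennreal ((norm (u x))\<^sup>2) \<le> 2 * ennreal ((norm (u x - ?m))\<^sup>2) + ennreal (2 * (c / q))"
          using c q by (subst ennreal_numeral[symmetric], subst ennreal_mult[symmetric], simp, simp,
              subst ennreal_plus[symmetric], simp, simp, intro ennreal_leI)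
        then show "indicator ?Q x * ?f x \<le> 2 * (indicator ?Q x * ennreal ((norm (u x - ?m))\<^sup>2)) + ennreal (2 * (c / q)) * (indicator ?Q x * indicator B x)"
          by (auto simp: indicator_def)
      qed
      also have "\<dots> = 2 * (\<integral>\<^sup>+x. indicator ?Q x * ennreal ((norm (u x - ?m))\<^sup>2) \<partial>lborel) + ennreal (2 * (c / q)) * (\<integral>\<^sup>+x. indicator ?Q x * indicator B x \<partial>lborel)"
        by (simp add: nn_integral_add nn_integral_cmult)
      also have "\<dots> \<le> 2 * (ennreal ?C * (\<integral>\<^sup>+x. indicator ?Q x * ennreal ((norm (gradient u x))\<^sup>2) \<partial>lborel)) + ennreal (2 * (c / q)) * (\<integral>\<^sup>+x. indicator ?Q x * indicator B x \<partial>lborel)"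
      proof (intro add_mono mult_left_mono order_refl)
        show "(\<integral>\<^sup>+x. indicator ?Q x * ennreal ((norm (u x - ?m))\<^sup>2) \<partial>lborel) \<le> ennreal ?C * (\<integral>\<^sup>+x. indicator ?Q x * ennreal ((norm (gradient u x))\<^sup>2) \<partial>lborel)"
          using poincare_mean(1)[OF u grid_cell_borel grid_cell_convex diam fin]
          by (simp add: ennreal_mult flip: ennreal_power)
      qed auto
      also have "\<dots> = (\<integral>\<^sup>+x. ennreal (2 * ?C) * (indicator ?Q x * ennreal ((norm (gradient u x))\<^sup>2)) + ennreal (2 * (c / q)) * (indicator ?Q x * indicator B x) \<partial>lborel)"
        by (simp add: nn_integral_add nn_integral_cmult ennreal_mult mult.assoc)
      also have "\<dots> = (\<integral>\<^sup>+x. indicator ?Q x * ?g x \<partial>lborel)"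
        by (intro nn_integral_cong) (simp add: distrib_left mult_ac)
      finally show "(\<integral>\<^sup>+x. indicator ?Q x * ?f x \<partial>lborel) \<le> (\<integral>\<^sup>+x. indicator ?Q x * ?g x \<partial>lborel)" .
    qed
    also have "(\<integral>\<^sup>+x. ?f x \<partial>lborel) = (\<integral>\<^sup>+x. ennreal ((norm (indicator B x *\<^sub>R u x))\<^sup>2) \<partial>lborel)"
      by (intro nn_integral_cong) (auto simp: indicator_def)
    also have "\<dots> = ennreal (sqint (\<lambda>x. indicator B x *\<^sub>R u x))"
      by (intro sqint_eq_nn_integral square_integrable_indicator test_square_integrable[OF u]) auto
    also have "(\<integral>\<^sup>+x. ?g x \<partial>lborel) = ennreal (2 * ?C) * ennreal (sqint (gradient u)) + ennreal (2 * (c / q)) * emeasure lborel B"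
      by (simp add: nn_integral_add nn_integral_cmult sqint_eq_nn_integral gradient_square_integrable[OF u])
    also have "\<dots> \<le> ennreal (2 * ?C) * ennreal \<Lambda> + ennreal (2 * (c / q)) * ennreal V"
      by (intro add_mono mult_left_mono B2 ennreal_leI g) auto
    also have "\<dots> = ennreal (2 * ?C * \<Lambda> + 2 * (c / q) * V)"
      using c q \<Lambda> V by (simp flip: ennreal_mult ennreal_plus)
    finally have "sqint (\<lambda>x. indicator B x *\<^sub>R u x) \<le> 2 * ?C * \<Lambda> + 2 * (c / q) * V"
      using c q \<Lambda> V by (subst (asm) ennreal_le_iff) (auto intro!: add_nonneg_nonneg mult_nonneg_nonneg)
    also have "2 * ?C * \<Lambda> = 2 * (h\<^sup>2 * A * \<Lambda>)" by (simp add: A_def power_mult_distrib)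
    finally have "sqint (\<lambda>x. indicator B x *\<^sub>R u x) \<le> 1/8 + 1/8" using hA cV by linarith
    moreover have "1 = sqint (\<lambda>x. indicator B x *\<^sub>R u x) + sqint (\<lambda>x. indicator (- B) x *\<^sub>R u x)"
      using sqint_indicator_split[OF test_square_integrable[OF u], of B] u1 by simp
    ultimately show False using B2(2) by simp
  qed
  with c that show ?thesis by blast
qed

section \<open>Limits of minimising sequences\<close>

lemma sqint_le_combination:
  fixes f :: "real^'n \<Rightarrow> 'a::euclidean_space" and g :: "real^'n \<Rightarrow> 'b::euclidean_space" and h :: "real^'n \<Rightarrow> 'c::euclidean_space"
  assumes f: "f \<in> borel_measurable lebesgue" and g: "square_integrable g" and h: "square_integrable h"
    and le: "\<And>x. (norm (f x))\<^sup>2 \<le> a * (norm (g x))\<^sup>2 + b * (norm (h x))\<^sup>2"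
  shows "sqint f \<le> a * sqint g + b * sqint h"
proof -
  have i: "integrable lebesgue (\<lambda>x. a * (norm (g x))\<^sup>2 + b * (norm (h x))\<^sup>2)"
    using g h by (simp add: square_integrable_def)
  have "integrable lebesgue (\<lambda>x. (norm (f x))\<^sup>2)"
    by (rule Bochner_Integration.integrable_bound[OF i]) (use f le in \<open>auto intro!: AE_I2 order_trans[OF _ abs_ge_self]\<close>)
  then have "sqint f \<le> (LINT x|lebesgue. a * (norm (g x))\<^sup>2 + b * (norm (h x))\<^sup>2)"
    unfolding sqint_def by (intro integral_mono i le)
  also have "\<dots> = a * sqint g + b * sqint h"
    using g h by (simp add: square_integrable_def sqint_def)
  finally show ?thesis .
qed

lemma sqint_mono:
  assumes "f \<in> borel_measurable lebesgue" "square_integrable g" "\<And>x. norm (f x) \<le> norm (g x)"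
  shows "sqint f \<le> sqint g"
  using square_integrable_bound(2)[OF assms(2,1), of 1] assms(3) by simp

lemma borel_measurable_scaleR_lebesgue:
  fixes \<zeta> :: "real^'n \<Rightarrow> real" and f :: "real^'n \<Rightarrow> 'b::euclidean_space"
  assumes "\<zeta> \<in> borel_measurable borel" "square_integrable f"
  shows "(\<lambda>x. \<zeta> x *\<^sub>R f x) \<in> borel_measurable lebesgue"
  using square_integrableD(1)[OF assms(2)] measurable_completion[of \<zeta> lborel borel] assms(1)
  by (intro borel_measurable_scaleR) auto

lemma square_integrable_cutoff:
  fixes \<zeta> :: "real^'n \<Rightarrow> real"
  assumes "\<zeta> \<in> borel_measurable borel" "\<And>x. 0 \<le> \<zeta> x" "\<And>x. \<zeta> x \<le> 1" "square_integrable f"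
  shows "square_integrable (\<lambda>x. \<zeta> x *\<^sub>R f x)" "sqint (\<lambda>x. \<zeta> x *\<^sub>R f x) \<le> sqint f"
  using square_integrable_bound[OF assms(4) borel_measurable_scaleR_lebesgue[OF assms(1,4)], of 1] assms(2,3)
  by (auto simp: mult_left_le_one_le)

text \<open>If the exterior part \<open>w\<close> = (1 - \<zeta>) u has mass at least \<kappa>, it
  is near admissible and costs at least H - \<kappa> per unit mass. Since u as a whole costs at most
  H + \<eta>, the interior costs at most about H times the interior mass. If \<open>w\<close> has
  less mass, the trivial bound 0 for its energy is off by at most H \<kappa>.\<close>

lemma cutoff_energy:
  fixes u :: "real^'n \<Rightarrow> real^'n"
  assumes eb: "\<And>w::real^'n \<Rightarrow> real^'n. near_admissible V \<delta> w \<Longrightarrow> (H - \<kappa>) * sqint w \<le> sqint (gradient w)"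
    and \<kappa>: "0 < \<kappa>" "\<kappa> \<le> 1" and H: "H \<ge> 0" and \<delta>: "\<delta> > 0"
    and u: "near_admissible V \<eta> u" "sqint u = 1" "sqint (gradient u) \<le> H + \<eta>"
    and \<zeta>: "smooth \<zeta>" "\<And>x. 0 \<le> \<zeta> x" "\<And>x. \<zeta> x \<le> 1" "\<And>x. x \<notin> ball 0 \<rho> \<Longrightarrow> \<zeta> x = 0"
    and L: "\<And>x. norm (scalar_gradient (\<lambda>x. 1 - \<zeta> x) x) \<le> L" "L \<ge> 0"
    and small: "\<eta> \<le> \<delta> * \<kappa> / 4" "L\<^sup>2 \<le> \<delta> * \<kappa> / 4" "(1 + 1 / \<kappa>) * L\<^sup>2 \<le> \<kappa>" "\<eta> \<le> \<kappa>"
  shows "sqint (\<lambda>x. \<zeta> x *\<^sub>R gradient u x) \<le> H * sqint (\<lambda>x. indicator (ball 0 \<rho>) x *\<^sub>R u x) + \<kappa> * (2 * H + 5)"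
proof -
  have ut: "u \<in> test_functions UNIV" using u(1) by (simp add: near_admissible_def)
  note su = test_square_integrable[OF ut] and sg = gradient_square_integrable[OF ut]
  define \<psi> where "\<psi> x = 1 - \<zeta> x" for x
  have \<psi>s: "smooth \<psi>" unfolding \<psi>_def[abs_def] by (intro smooth_diff smooth_const \<zeta>)
  have \<psi>: "0 \<le> \<psi> x" "\<psi> x \<le> 1" for x using \<zeta>(2,3)[of x] by (auto simp: \<psi>_def)
  have L': "norm (scalar_gradient \<psi> x) \<le> L" for x using L(1)[of x] by (simp add: \<psi>_def[abs_def])
  note [simp] = smooth_borel[OF \<zeta>(1)] smooth_borel[OF \<psi>s]
  define w where "w x = \<psi> x *\<^sub>R u x" for x
  have w: "w \<in> test_functions UNIV" unfolding w_def[abs_def] by (rule test_scaleR[OF \<psi>s ut])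
  define M a b where "M = sqint w" and "a = sqint (\<lambda>x. \<psi> x *\<^sub>R gradient u x)" and "b = sqint (gradient w)"
  have Lsq: "(norm (scalar_gradient \<psi> x))\<^sup>2 * (norm (u x))\<^sup>2 \<le> L\<^sup>2 * (norm (u x))\<^sup>2" for x
    using L'[of x] by (intro mult_right_mono power_mono) auto
  have div: "sqint (\<lambda>x. trace (gradient w x)) \<le> 2 * sqint (\<lambda>x. trace (gradient u x)) + (2 * L\<^sup>2) * sqint u"
  proof (rule sqint_le_combination)
    show "(\<lambda>x. trace (gradient w x)) \<in> borel_measurable lebesgue"
      by (intro square_integrableD square_integrable_trace gradient_square_integrable[OF w])
    fix x
    have "(trace (gradient w x))\<^sup>2 \<le> 2 * ((\<psi> x)\<^sup>2 * (trace (gradient u x))\<^sup>2) + 2 * ((norm (scalar_gradient \<psi> x))\<^sup>2 * (norm (u x))\<^sup>2)"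
      unfolding w_def[abs_def] by (rule trace_gradient_scaleR_le[OF \<psi>s test_smooth[OF ut]])
    moreover have "(\<psi> x)\<^sup>2 * (trace (gradient u x))\<^sup>2 \<le> (trace (gradient u x))\<^sup>2"
      using \<psi>[of x] by (intro mult_left_le_one_le) (auto simp: power_le_one)
    ultimately show "(norm (trace (gradient w x)))\<^sup>2 \<le> 2 * (norm (trace (gradient u x)))\<^sup>2 + (2 * L\<^sup>2) * (norm (u x))\<^sup>2"
      using Lsq[of x] by simp
  qed (use square_integrable_trace(1)[OF sg] su in auto)
  have b_le: "b \<le> (1 + \<kappa>) * a + ((1 + 1 / \<kappa>) * L\<^sup>2) * sqint u"
    unfolding b_def a_def
  proof (rule sqint_le_combination)
    show "gradient w \<in> borel_measurable lebesgue"
      by (intro square_integrableD gradient_square_integrable[OF w])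
    fix x
    have "(norm (gradient w x))\<^sup>2 \<le> (1 + \<kappa>) * ((\<psi> x)\<^sup>2 * (norm (gradient u x))\<^sup>2) + (1 + 1 / \<kappa>) * ((norm (scalar_gradient \<psi> x))\<^sup>2 * (norm (u x))\<^sup>2)"
      unfolding w_def[abs_def] by (rule norm_gradient_scaleR_le[OF \<psi>s test_smooth[OF ut] \<kappa>(1)])
    moreover have "(1 + 1 / \<kappa>) * ((norm (scalar_gradient \<psi> x))\<^sup>2 * (norm (u x))\<^sup>2) \<le> (1 + 1 / \<kappa>) * (L\<^sup>2 * (norm (u x))\<^sup>2)"
      using \<kappa> by (intro mult_left_mono Lsq) auto
    ultimately show "(norm (gradient w x))\<^sup>2 \<le> (1 + \<kappa>) * (norm (\<psi> x *\<^sub>R gradient u x))\<^sup>2 + ((1 + 1 / \<kappa>) * L\<^sup>2) * (norm (u x))\<^sup>2"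
      by (simp add: power_mult_distrib mult.assoc)
  qed (use square_integrable_cutoff(1)[OF _ \<psi> sg] su in auto)
  have Mle: "M \<le> 1" unfolding M_def w_def[abs_def] u(2)[symmetric]
    by (rule square_integrable_cutoff(2)[OF _ \<psi> su]) simp
  have split: "sqint (\<lambda>x. \<zeta> x *\<^sub>R gradient u x) + a \<le> H + \<eta>"
  proof -
    have i: "square_integrable (\<lambda>x. \<zeta> x *\<^sub>R gradient u x)" "square_integrable (\<lambda>x. \<psi> x *\<^sub>R gradient u x)"
      using square_integrable_cutoff(1)[OF _ \<zeta>(2,3) sg] square_integrable_cutoff(1)[OF _ \<psi> sg] by auto
    have "sqint (\<lambda>x. \<zeta> x *\<^sub>R gradient u x) + a =
      (LINT x|lebesgue. (norm (\<zeta> x *\<^sub>R gradient u x))\<^sup>2 + (norm (\<psi> x *\<^sub>R gradient u x))\<^sup>2)"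
      unfolding sqint_def a_def by (intro Bochner_Integration.integral_add[symmetric] square_integrableD i)
    also have "\<dots> \<le> sqint (gradient u)"
      unfolding sqint_def
    proof (intro integral_mono Bochner_Integration.integrable_add square_integrableD i sg)
      fix x
      have "(\<zeta> x)\<^sup>2 + (\<psi> x)\<^sup>2 \<le> 1"
      proof -
        have "(\<zeta> x)\<^sup>2 \<le> \<zeta> x" "(\<psi> x)\<^sup>2 \<le> \<psi> x"
          using \<zeta>(2,3)[of x] \<psi>[of x] by (simp_all add: power2_eq_square mult_left_le_one_le)
        then show ?thesis by (simp add: \<psi>_def)
      qed
      from mult_right_mono[OF this, of "(norm (gradient u x))\<^sup>2"]
      show "(norm (\<zeta> x *\<^sub>R gradient u x))\<^sup>2 + (norm (\<psi> x *\<^sub>R gradient u x))\<^sup>2 \<le> (norm (gradient u x))\<^sup>2"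
        by (simp add: power_mult_distrib distrib_right)
    qed
    finally show ?thesis using u(3) by simp
  qed
  have mass: "1 - M \<le> sqint (\<lambda>x. indicator (ball 0 \<rho>) x *\<^sub>R u x)"
  proof -
    have "sqint u \<le> 1 * sqint w + 1 * sqint (\<lambda>x. indicator (ball 0 \<rho>) x *\<^sub>R u x)"
    proof (rule sqint_le_combination)
      fix x show "(norm (u x))\<^sup>2 \<le> 1 * (norm (w x))\<^sup>2 + 1 * (norm (indicator (ball 0 \<rho>) x *\<^sub>R u x))\<^sup>2"
        using \<zeta>(4)[of x] by (cases "x \<in> ball 0 \<rho>") (auto simp: w_def \<psi>_def)
    qed (use square_integrableD(1)[OF su] test_square_integrable[OF w] square_integrable_indicator(1)[OF su] in auto)
    then show ?thesis by (simp add: M_def u(2))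
  qed
  have low: "H * M - \<kappa> - H * \<kappa> \<le> b"
  proof (cases "\<kappa> \<le> M")
    case True
    \<comment> \<open>The defects of \<open>w\<close> are bounded by multiples of
      \<open>\<delta> * \<kappa>\<close>; mass at least \<kappa> makes them small relative to
      \<open>sqint w\<close>, as near admissibility demands.\<close>
    have \<delta>M: "\<delta> * \<kappa> \<le> \<delta> * M" using True \<delta> by simp
    have "near_admissible V \<delta> w"
    proof -
      obtain B where B: "B \<in> sets borel" "emeasure lborel B \<le> ennreal V" "sqint (\<lambda>x. indicator (- B) x *\<^sub>R u x) \<le> \<eta>"
        and d: "sqint (\<lambda>x. trace (gradient u x)) \<le> \<eta>"
        using u(1,2) by (auto simp: near_admissible_def)
      have "sqint (\<lambda>x. indicator (- B) x *\<^sub>R w x) \<le> sqint (\<lambda>x. indicator (- B) x *\<^sub>R u x)"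
        using B(1) \<psi>
        by (intro sqint_mono square_integrableD(1) square_integrable_indicator su test_square_integrable[OF w])
           (auto simp: w_def indicator_def mult_left_le_one_le)
      then have "sqint (\<lambda>x. indicator (- B) x *\<^sub>R w x) \<le> \<delta> * sqint w"
        using B(3) small(1) \<delta>M mult_pos_pos[OF \<delta> \<kappa>(1)] unfolding M_def[symmetric] by simp
      moreover have "sqint (\<lambda>x. trace (gradient w x)) \<le> \<delta> * sqint w"
        using div d small(1,2) \<delta>M u(2) unfolding M_def[symmetric] by simp
      ultimately show ?thesis using w B unfolding near_admissible_def by blast
    qed
    from eb[OF this] have "(H - \<kappa>) * M \<le> b" by (simp add: M_def b_def)
    moreover have "\<kappa> * M \<le> \<kappa>" using Mle \<kappa> by simp
    moreover have "0 \<le> H * \<kappa>" using H \<kappa> by simp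
    ultimately show ?thesis by (simp add: left_diff_distrib)
  next
    case False
    then have "H * M \<le> H * \<kappa>" using H by (intro mult_left_mono) auto
    moreover have "0 \<le> b" by (simp add: b_def)
    ultimately show ?thesis using \<kappa> by simp
  qed
  have "a \<le> H + \<kappa>" using split small(4) sqint_nonneg[of "\<lambda>x. \<zeta> x *\<^sub>R gradient u x"] by linarith
  then have "\<kappa> * a \<le> \<kappa> * (H + 1)" using \<kappa> by (intro mult_left_mono) auto
  then have "b \<le> a + \<kappa> * (H + 1) + \<kappa>" using b_le small(3) u(2) by (simp add: distrib_right)
  then have "sqint (\<lambda>x. \<zeta> x *\<^sub>R gradient u x) \<le> H * (1 - M) + \<kappa> * (2 * H + 5)"
    using split small(4) low \<kappa> by (simp add: algebra_simps)
  moreover have "H * (1 - M) \<le> H * sqint (\<lambda>x. indicator (ball 0 \<rho>) x *\<^sub>R u x)"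
    using H mass by (intro mult_left_mono)
  ultimately show ?thesis by linarith
qed

section \<open>Scaled cut-offs\<close>

definition cutoff :: "real \<Rightarrow> real^'n \<Rightarrow> real" where
  "cutoff R x = hump ((1 / R) *\<^sub>R x)"

lemma smooth_cutoff: "smooth (cutoff R)"
  using smooth_affine[OF smooth_hump, of "1 / R" 0] by (simp add: cutoff_def[abs_def])

lemma cutoff_bounds: "0 \<le> cutoff R x" "cutoff R x \<le> 1"
  by (simp_all add: cutoff_def hump_bounds)

lemma cutoff_support:
  fixes x :: "real^'n"
  assumes "R > 0" "cutoff R x \<noteq> 0"
  shows "\<And>i. \<bar>x $ i\<bar> \<le> R" "x \<in> ball 0 (R * (real CARD('n) + 1))"
proof -
  have "(1 / R) *\<^sub>R x \<in> cbox (\<chi> i. -1) (\<chi> i. 1)"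
    using assms(2) hump_support unfolding cutoff_def by blast
  then have "\<And>i. -1 \<le> x $ i / R \<and> x $ i / R \<le> 1" by (simp add: mem_box_cart)
  then show le: "\<And>i. \<bar>x $ i\<bar> \<le> R" using assms(1) by (simp add: field_simps abs_le_iff minus_le_iff)
  have "norm x \<le> (\<Sum>i\<in>(UNIV::'n set). R)"
    by (rule order_trans[OF norm_le_l1_cart]) (intro sum_mono le)
  then show "x \<in> ball 0 (R * (real CARD('n) + 1))" using assms(1) by (simp add: algebra_simps)
qed

lemma cutoff_tendsto_1:
  fixes x :: "real^'n"
  shows "(\<lambda>m. cutoff (real (Suc m)) x) \<longlonglongrightarrow> 1"
proof -
  have "isCont hump (0::real^'n)"
    by (rule differentiable_imp_continuous_within[OF smooth_differentiable[OF smooth_hump]])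
  moreover have "(\<lambda>m. (1 / real (Suc m)) *\<^sub>R x) \<longlonglongrightarrow> 0 *\<^sub>R x"
    using LIMSEQ_inverse_real_of_nat by (intro tendsto_intros) (simp add: inverse_eq_divide)
  then have "(\<lambda>m. (1 / real (Suc m)) *\<^sub>R x) \<longlonglongrightarrow> 0" by simp
  ultimately have "(\<lambda>m. hump ((1 / real (Suc m)) *\<^sub>R x)) \<longlonglongrightarrow> hump (0::real^'n)"
    by (rule isCont_tendsto_compose)
  then show ?thesis by (simp add: cutoff_def hump_bounds)
qed

text \<open>Stretching the bump to size R divides its gradient by R. The bump has no plateau, so the
  cut-offs are close to 1 on fixed bounded sets only for large R.\<close>

lemma scalar_gradient_cutoff:
  obtains C where "C > 0"
    "\<And>R x. R > 0 \<Longrightarrow> norm (scalar_gradient (cutoff R) (x::real^'n)) \<le> C / R"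
    "\<And>R x. R > 0 \<Longrightarrow> norm (scalar_gradient (\<lambda>x. 1 - cutoff R x) (x::real^'n)) \<le> C / R"
proof -
  have "\<exists>B. \<forall>x. \<bar>partial_deriv j hump (x::real^'n)\<bar> \<le> B" for j
    using test_bounded[OF test_partial_deriv[OF hump_test, of j]] by (metis real_norm_def)
  then obtain B where B: "\<And>j x. \<bar>partial_deriv j hump (x::real^'n)\<bar> \<le> B j" by metis
  define C where "C = (\<Sum>j\<in>UNIV. B j) + 1"
  have "0 \<le> B j" for j using B[of j 0] by linarith
  then have C: "C > 0" by (simp add: C_def add_nonneg_pos sum_nonneg)
  have 1: "norm (scalar_gradient (cutoff R) x) \<le> C / R" if R: "R > 0" for R and x :: "real^'n"
  proof -
    have "scalar_gradient (cutoff R) x = (1 / R) *\<^sub>R (\<chi> j. partial_deriv j hump ((1 / R) *\<^sub>R x))"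
      using partial_deriv_affine[OF smooth_hump, of _ "1 / R" 0 x]
      by (simp add: scalar_gradient_def cutoff_def[abs_def] vec_eq_iff)
    moreover have "norm (\<chi> j. partial_deriv j hump ((1 / R) *\<^sub>R x)) \<le> (\<Sum>j\<in>UNIV. B j)"
      by (rule order_trans[OF norm_le_l1_cart]) (auto intro!: sum_mono B)
    ultimately show ?thesis using R by (simp add: C_def divide_right_mono)
  qed
  have 2: "norm (scalar_gradient (\<lambda>x. 1 - cutoff R x) x) \<le> C / R" if R: "R > 0" for R and x :: "real^'n"
  proof -
    have "partial_deriv j (\<lambda>x. 1 - cutoff R x) x = - partial_deriv j (cutoff R) x" for j
    proof -
      have "partial_deriv j (\<lambda>x. 1 + (- cutoff R x)) x = partial_deriv j (\<lambda>x. 1) x + partial_deriv j (\<lambda>x. - cutoff R x) x"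
        by (rule partial_deriv_add[OF smooth_const smooth_linear[OF bounded_linear_minus[OF bounded_linear_ident] smooth_cutoff]])
      also have "partial_deriv j (\<lambda>x. - cutoff R x) x = - partial_deriv j (cutoff R) x"
        by (rule partial_deriv_linear[OF bounded_linear_minus[OF bounded_linear_ident] smooth_cutoff])
      finally show ?thesis by (simp add: partial_deriv_def)
    qed
    then have "scalar_gradient (\<lambda>x. 1 - cutoff R x) x = - scalar_gradient (cutoff R) x"
      by (simp add: scalar_gradient_def vec_eq_iff)
    with 1[OF R] show ?thesis by simp
  qed
  from that[OF C 1 2] show ?thesis .
qed

text \<open>Chebyshev on the part of a ball where |v| exceeds a threshold: off \<open>B n\<close>
  the function \<open>u n\<close> is small in L2, and it is close to v on the ball, so little of
  this part misses \<open>B n\<close>. The sets \<open>B n\<close> may vary with n; what passes to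
  the limit is their volume bound.\<close>

lemma support_of_limit:
  fixes u :: "nat \<Rightarrow> real^'n \<Rightarrow> real^'n"
  assumes v: "square_integrable v" and u: "\<And>n. square_integrable (u n)" and V: "V \<ge> 0"
    and loc: "\<And>R. (\<lambda>n. sqint (\<lambda>x. indicator (ball 0 R) x *\<^sub>R (u n x - v x))) \<longlonglongrightarrow> 0"
    and B: "\<And>n. B n \<in> sets borel" "\<And>n. emeasure lborel (B n) \<le> ennreal V"
    and out: "(\<lambda>n. sqint (\<lambda>x. indicator (- B n) x *\<^sub>R u n x)) \<longlonglongrightarrow> 0"
  shows "emeasure lebesgue {x. v x \<noteq> 0} \<le> ennreal V"
proof -
  note [measurable] = square_integrableD(1)[OF v]
  have Bm: "B n \<in> sets lebesgue" for n using B(1) by simp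
  define A where "A k = {x. 1 / real (Suc k) < norm (v x)} \<inter> ball 0 (real k)" for k
  have Am: "A k \<in> sets lebesgue" for k
  proof -
    have "{x \<in> space lebesgue. 1 / real (Suc k) < norm (v x)} \<in> sets lebesgue" by measurable
    then show ?thesis by (auto simp: A_def)
  qed
  have A_le: "emeasure lebesgue (A k) \<le> ennreal V" for k
  proof -
    define t where "t = 1 / real (Suc k)"
    have t: "t > 0" by (simp add: t_def)
    define e where "e n = 2 * sqint (\<lambda>x. indicator (ball 0 (real k)) x *\<^sub>R (u n x - v x)) + 2 * sqint (\<lambda>x. indicator (- B n) x *\<^sub>R u n x)" for n
    have e0: "(\<lambda>n. V + e n / t\<^sup>2) \<longlonglongrightarrow> V + (2 * 0 + 2 * 0) / t\<^sup>2"
      unfolding e_def using t by (intro tendsto_intros loc out) auto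
    have ennonneg: "e n \<ge> 0" for n by (simp add: e_def)
    have bound: "emeasure lebesgue (A k) \<le> ennreal (V + e n / t\<^sup>2)" for n
    proof -
      have cB: "- B n \<in> sets lebesgue" using sets.compl_sets[OF Bm[of n]] by (simp add: Compl_eq_Diff_UNIV)
      have m: "A k - B n \<in> sets lebesgue" using Am Bm by auto
      have "sqint (\<lambda>x. indicator (A k - B n) x *\<^sub>R v x) \<le> e n"
        unfolding e_def
      proof (rule sqint_le_combination)
        fix x
        show "(norm (indicator (A k - B n) x *\<^sub>R v x))\<^sup>2 \<le> 2 * (norm (indicator (ball 0 (real k)) x *\<^sub>R (u n x - v x)))\<^sup>2
           + 2 * (norm (indicator (- B n) x *\<^sub>R u n x))\<^sup>2"
          using norm_add_sq_le[of 1 "v x - u n x" "u n x"]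
          by (auto simp: A_def indicator_def norm_minus_commute)
      qed (use m cB v u in \<open>auto intro!: square_integrable_indicator square_integrable_diff square_integrableD(1)\<close>)
      moreover have "ennreal (t\<^sup>2) * emeasure lebesgue (A k - B n) \<le> ennreal (sqint (\<lambda>x. indicator (A k - B n) x *\<^sub>R v x))"
      proof -
        have "ennreal (t\<^sup>2) * emeasure lebesgue (A k - B n) = (\<integral>\<^sup>+x. ennreal (t\<^sup>2) * indicator (A k - B n) x \<partial>lebesgue)"
          using m by (simp add: nn_integral_cmult)
        also have "\<dots> \<le> (\<integral>\<^sup>+x. ennreal ((norm (indicator (A k - B n) x *\<^sub>R v x))\<^sup>2) \<partial>lebesgue)"
        proof (rule nn_integral_mono)
          fix x show "ennreal (t\<^sup>2) * indicator (A k - B n) x \<le> ennreal ((norm (indicator (A k - B n) x *\<^sub>R v x))\<^sup>2)"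
            using t by (cases "x \<in> A k - B n") (auto simp: A_def t_def intro!: ennreal_leI power_mono)
        qed
        also have "\<dots> = ennreal (sqint (\<lambda>x. indicator (A k - B n) x *\<^sub>R v x))"
          unfolding sqint_def using m v
          by (intro nn_integral_eq_integral square_integrableD square_integrable_indicator) auto
        finally show ?thesis .
      qed
      ultimately have "ennreal (t\<^sup>2) * emeasure lebesgue (A k - B n) \<le> ennreal (e n)"
        by (meson ennreal_leI order_trans)
      also have "\<dots> = ennreal (t\<^sup>2) * ennreal (e n / t\<^sup>2)" using t ennonneg by (simp flip: ennreal_mult)
      finally have "emeasure lebesgue (A k - B n) \<le> ennreal (e n / t\<^sup>2)"
        using t by (subst (asm) ennreal_mult_le_mult_iff) auto
      moreover have "emeasure lebesgue (A k) \<le> emeasure lebesgue (B n) + emeasure lebesgue (A k - B n)"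
        using m Bm Am by (intro order_trans[OF emeasure_mono emeasure_subadditive]) auto
      moreover have "emeasure lebesgue (B n) \<le> ennreal V" using B by simp
      ultimately have "emeasure lebesgue (A k) \<le> ennreal V + ennreal (e n / t\<^sup>2)"
        by (meson add_mono order_trans)
      then show ?thesis using V ennonneg by (simp add: ennreal_plus)
    qed
    have "(\<lambda>n. ennreal (V + e n / t\<^sup>2)) \<longlonglongrightarrow> ennreal V" using e0 by (intro tendsto_ennrealI) simp
    then show ?thesis by (rule LIMSEQ_le_const) (use bound in auto)
  qed
  have "incseq A"
  proof (rule incseq_SucI)
    fix k
    have "1 / real (Suc (Suc k)) \<le> 1 / real (Suc k)" by (intro divide_left_mono) auto
    then show "A k \<subseteq> A (Suc k)" by (auto simp: A_def)
  qed
  moreover have "(\<Union>k. A k) = {x. v x \<noteq> 0}"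
  proof (intro set_eqI iffI)
    fix x assume "x \<in> {x. v x \<noteq> 0}"
    then have nv: "norm (v x) > 0" by simp
    obtain k1 :: nat where k1: "1 / norm (v x) < real k1" using reals_Archimedean2 by blast
    obtain k2 :: nat where k2: "norm x < real k2" using reals_Archimedean2 by blast
    let ?k = "max k1 k2"
    have "1 / norm (v x) < real (Suc ?k)" using k1 by linarith
    then have "1 / real (Suc ?k) < norm (v x)" using nv by (simp add: field_simps)
    then have "x \<in> A ?k" using k2 by (auto simp: A_def)
    then show "x \<in> (\<Union>k. A k)" by blast
  qed (auto simp: A_def)
  ultimately have "(\<lambda>k. emeasure lebesgue (A k)) \<longlonglongrightarrow> emeasure lebesgue {x. v x \<noteq> 0}"
    using Lim_emeasure_incseq[of A lebesgue] Am by auto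
  then show ?thesis by (rule LIMSEQ_le_const2) (use A_le in auto)
qed

text \<open>\<open>ok\<close> and \<open>bad\<close> say that H is the threshold of
  \<open>energy_bound\<close>. The energy of the limit is bounded by three limits in this order:
  along the sequence with a fixed cut-off, then in the cut-off radius, then in \<kappa>. The
  localised estimate passes to the hull by convexity and from there to \<open>D\<close>.\<close>

lemma energy_limit:
  assumes V: "V \<ge> 0" and H: "H \<ge> 0"
    and ok: "\<And>\<kappa>. \<kappa> > 0 \<Longrightarrow> energy_bound TYPE('n::finite) V (H - \<kappa>)"
    and bad: "\<And>n. \<not> energy_bound TYPE('n) V (H + 1 / real (Suc n))"
  obtains f and v :: "real^'n \<Rightarrow> real^'n" and D where
    "\<And>n::nat. f n \<in> test_functions UNIV" "square_integrable v" "square_integrable D"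
    "(\<lambda>n. sqint (\<lambda>x. f n x - v x)) \<longlonglongrightarrow> 0" "(\<lambda>n. sqint (\<lambda>x. gradient (f n) x - D x)) \<longlonglongrightarrow> 0"
    "sqint v > 0" "sqint D \<le> H * sqint v" "sqint (\<lambda>x. trace (D x)) = 0"
    "emeasure lebesgue {x. v x \<noteq> 0} \<le> ennreal V"
proof -
  have \<Lambda>: "H + 1 \<ge> 0" using H by simp
  obtain c R0 where c: "c > 0" and nv: "\<And>u :: real^'n \<Rightarrow> real^'n. near_admissible V (1/2) u \<Longrightarrow> sqint u = 1 \<Longrightarrow>
    sqint (gradient u) \<le> H + 1 \<Longrightarrow> \<exists>y. c \<le> sqint (\<lambda>x. indicator (ball 0 R0) x *\<^sub>R u (x + y))"
    by (rule no_vanishing[OF V \<Lambda>]) blast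
  \<comment> \<open>The shift by 2 gives tolerances at most 1/2, as \<open>no_vanishing\<close>
    asks, and matches \<open>bad\<close> at \<open>Suc n\<close>.\<close>
  define \<eta> where "\<eta> n = 1 / real (n + 2)" for n
  have \<eta>: "\<eta> n > 0" "\<eta> n \<le> 1/2" "\<eta> n \<le> 1 / real (Suc n)" for n by (auto simp: \<eta>_def field_simps)
  have \<eta>_anti: "\<eta> m \<le> \<eta> n" if "n \<le> m" for m n using that by (simp add: \<eta>_def field_simps)
  have \<eta>_lim: "\<eta> \<longlonglongrightarrow> 0"
    using LIMSEQ_ignore_initial_segment[OF LIMSEQ_inverse_real_of_nat, of 1] by (simp add: \<eta>_def[abs_def] inverse_eq_divide)
  have "\<exists>u::real^'n \<Rightarrow> real^'n. near_admissible V (\<eta> n) u \<and> sqint u = 1 \<and> sqint (gradient u) \<le> H + \<eta> n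
     \<and> c \<le> sqint (\<lambda>x. indicator (ball 0 R0) x *\<^sub>R u x)" for n
  proof -
    obtain u :: "real^'n \<Rightarrow> real^'n" where u: "near_admissible V (\<eta> n) u" "sqint (gradient u) < (H + \<eta> n) * sqint u"
    proof -
      have "\<not> energy_bound TYPE('n) V (H + \<eta> n)" using bad[of "Suc n"] by (simp add: \<eta>_def)
      with \<eta>(1)[of n] that show ?thesis unfolding energy_bound_def by (meson not_le)
    qed
    have ut: "u \<in> test_functions UNIV" using u by (simp add: near_admissible_def)
    have pos: "sqint u > 0"
    proof (rule ccontr)
      assume "\<not> sqint u > 0"
      then have "sqint u = 0" using sqint_nonneg[of u] by linarith
      then show False using u(2) sqint_nonneg[of "gradient u"] by simp
    qed
    define s where "s = 1 / sqrt (sqint u)"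
    have s2: "s\<^sup>2 = 1 / sqint u" using pos by (simp add: s_def power_divide)
    define w where "w x = s *\<^sub>R u x" for x
    have w: "near_admissible V (\<eta> n) w" unfolding w_def[abs_def] by (rule near_admissible_scaleR[OF u(1)])
    have wt: "w \<in> test_functions UNIV" using w by (simp add: near_admissible_def)
    have w1: "sqint w = 1" using pos by (simp add: w_def[abs_def] sqint_scaleR s2)
    have wg: "sqint (gradient w) \<le> H + \<eta> n"
    proof -
      have "gradient w = (\<lambda>x. s *\<^sub>R gradient u x)"
        unfolding w_def[abs_def] by (rule ext) (rule gradient_linear[OF test_smooth[OF ut]])
      then have "sqint (gradient w) = sqint (gradient u) / sqint u" by (simp add: sqint_scaleR s2)
      also have "\<dots> \<le> H + \<eta> n" using u(2) pos by (subst pos_divide_le_eq) auto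
      finally show ?thesis .
    qed
    have "near_admissible V (1/2) w"
      using w \<eta>(2)[of n] w1 unfolding near_admissible_def by (auto intro: order_trans)
    from nv[OF this w1] wg \<eta>(2)[of n] obtain y where y: "c \<le> sqint (\<lambda>x. indicator (ball 0 R0) x *\<^sub>R w (x + y))" by auto
    have "gradient (\<lambda>x. w (x + y)) = (\<lambda>x. gradient w (x + y))"
      using gradient_affine[OF test_smooth[OF wt], of 1 y] by auto
    then have "sqint (gradient (\<lambda>x. w (x + y))) = sqint (gradient w)"
      using sqint_translate[OF gradient_square_integrable[OF wt]] by simp
    moreover have "sqint (\<lambda>x. w (x + y)) = 1" using w1 sqint_translate[OF test_square_integrable[OF wt]] by simp
    ultimately show ?thesis
      using near_admissible_translate[OF w, of y] wg y by (intro exI[of _ "\<lambda>x. w (x + y)"]) simp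
  qed
  then obtain u where u: "\<And>n. near_admissible V (\<eta> n) (u n :: real^'n \<Rightarrow> real^'n)" "\<And>n. sqint (u n) = 1"
     "\<And>n. sqint (gradient (u n)) \<le> H + \<eta> n" "\<And>n. c \<le> sqint (\<lambda>x. indicator (ball 0 R0) x *\<^sub>R u n x)" by metis
  have ut: "u n \<in> test_functions UNIV" for n using u(1) by (simp add: near_admissible_def)
  have ug: "sqint (gradient (u n)) \<le> H + 1" for n using u(3)[of n] \<eta>(2)[of n] by linarith
  obtain r v D f where r: "strict_mono (r::nat \<Rightarrow> nat)" and v: "square_integrable v" and D: "square_integrable D"
    and f: "\<And>n. f n \<in> midhull (\<lambda>k. u (r k)) n"
    and fv: "(\<lambda>n. sqint (\<lambda>x. f n x - v x)) \<longlonglongrightarrow> 0" and fD: "(\<lambda>n. sqint (\<lambda>x. gradient (f n) x - D x)) \<longlonglongrightarrow> 0"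
    and loc: "\<And>R. (\<lambda>n. sqint (\<lambda>x. indicator (ball 0 R) x *\<^sub>R (u (r n) x - v x))) \<longlonglongrightarrow> 0"
    by (rule H1_compactness[of u "H + 1"]) (use ut u(2) ug in auto)
  have rn: "n \<le> r n" for n using r by (rule seq_suble)
  have \<eta>r: "\<eta> (r n) \<le> \<eta> n" for n by (rule \<eta>_anti[OF rn])
  note ft = midhull_test[of "\<lambda>k. u (r k)", OF ut f]
  have locv: "(\<lambda>n. sqint (\<lambda>x. indicator (ball 0 R) x *\<^sub>R u (r n) x)) \<longlonglongrightarrow> sqint (\<lambda>x. indicator (ball 0 R) x *\<^sub>R v x)" for R
    using loc[of R]
    by (intro sqint_tendsto square_integrable_indicator test_square_integrable[OF ut] v) (auto simp: scaleR_diff_right)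
  have locv_le: "sqint (\<lambda>x. indicator (ball 0 R) x *\<^sub>R v x) \<le> sqint v" for R
    by (rule square_integrable_indicator(2)[OF v]) auto
  have "c \<le> sqint (\<lambda>x. indicator (ball 0 R0) x *\<^sub>R v x)"
    by (rule LIMSEQ_le_const[OF locv]) (use u(4) in auto)
  with locv_le[of R0] c have vpos: "sqint v > 0" by linarith
  have "sqint (\<lambda>x. trace (gradient (f n) x)) \<le> \<eta> n" for n
  proof (rule midhull_sqint_le[where T="\<lambda>f x. trace (gradient f x)", OF ut _ _ _ f])
    fix k assume "n \<le> k"
    have "sqint (\<lambda>x. trace (gradient (u (r k)) x)) \<le> \<eta> (r k)"
      using u(1)[of "r k"] u(2)[of "r k"] by (simp add: near_admissible_def)
    with \<eta>r[of k] \<eta>_anti[OF \<open>n \<le> k\<close>] show "sqint (\<lambda>x. trace (gradient (u (r k)) x)) \<le> \<eta> n" by linarith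
  qed (auto intro!: square_integrable_trace gradient_square_integrable simp: gradient_mid test_smooth trace_scaleR trace_add)
  then have "(\<lambda>n. sqint (\<lambda>x. trace (gradient (f n) x))) \<longlonglongrightarrow> 0"
    by (intro Lim_null_comparison[OF _ \<eta>_lim]) auto
  then have div0: "sqint (\<lambda>x. trace (D x)) = 0"
    using LIMSEQ_unique[OF sqint_trace_tendsto[OF gradient_square_integrable[OF ft] D fD]] by blast
  have supp: "emeasure lebesgue {x. v x \<noteq> 0} \<le> ennreal V"
  proof -
    have "\<forall>n. \<exists>B\<in>sets borel. emeasure lborel B \<le> ennreal V \<and> sqint (\<lambda>x. indicator (- B) x *\<^sub>R u (r n) x) \<le> \<eta> (r n)"
      using u(1,2) by (auto simp: near_admissible_def)
    then obtain B where B: "\<And>n. B n \<in> sets borel" "\<And>n. emeasure lborel (B n) \<le> ennreal V"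
      "\<And>n. sqint (\<lambda>x. indicator (- B n) x *\<^sub>R u (r n) x) \<le> \<eta> (r n)" by metis
    have "sqint (\<lambda>x. indicator (- B n) x *\<^sub>R u (r n) x) \<le> \<eta> n" for n
      using B(3)[of n] \<eta>r[of n] by linarith
    then have "(\<lambda>n. sqint (\<lambda>x. indicator (- B n) x *\<^sub>R u (r n) x)) \<longlonglongrightarrow> 0"
      by (intro Lim_null_comparison[OF _ \<eta>_lim]) auto
    then show ?thesis
      by (rule support_of_limit[OF v test_square_integrable[OF ut] V loc B(1,2)])
  qed
  obtain C where C: "C > 0" "\<And>R x. R > 0 \<Longrightarrow> norm (scalar_gradient (\<lambda>x. 1 - cutoff R x) (x::real^'n)) \<le> C / R"
    using scalar_gradient_cutoff by metis
  have main: "sqint D \<le> H * sqint v + \<kappa> * (2 * H + 6)" if \<kappa>: "0 < \<kappa>" "\<kappa> \<le> 1" for \<kappa>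
  proof -
    obtain \<delta> where \<delta>: "\<delta> > 0" and eb: "\<And>w::real^'n \<Rightarrow> real^'n. near_admissible V \<delta> w \<Longrightarrow> (H - \<kappa>) * sqint w \<le> sqint (gradient w)"
      using ok[OF \<kappa>(1)] unfolding energy_bound_def by blast
    have Llim: "(\<lambda>m. (C / real (Suc m))\<^sup>2) \<longlonglongrightarrow> 0"
      using tendsto_power[OF tendsto_mult[OF tendsto_const[of C] LIMSEQ_inverse_real_of_nat], of 2]
      by (simp add: divide_inverse)
    have "eventually (\<lambda>m. (C / real (Suc m))\<^sup>2 < min (\<delta> * \<kappa> / 4) (\<kappa> / (1 + 1 / \<kappa>))) sequentially"
      using \<delta> \<kappa> by (intro order_tendstoD(2)[OF Llim]) (auto intro!: divide_pos_pos add_pos_pos)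
    then obtain m0 where m0: "\<And>m. m \<ge> m0 \<Longrightarrow> (C / real (Suc m))\<^sup>2 < min (\<delta> * \<kappa> / 4) (\<kappa> / (1 + 1 / \<kappa>))"
      by (auto simp: eventually_sequentially)
    have cutD: "sqint (\<lambda>x. cutoff (real (Suc m)) x *\<^sub>R D x) \<le> H * sqint v + \<kappa> * (2 * H + 6)" if m: "m \<ge> m0" for m
    proof -
      let ?\<zeta> = "cutoff (real (Suc m)) :: real^'n \<Rightarrow> real" and ?L = "C / real (Suc m)"
      define \<rho> where "\<rho> = real (Suc m) * (real CARD('n) + 1)"
      have Lk: "?L\<^sup>2 \<le> \<delta> * \<kappa> / 4" "(1 + 1 / \<kappa>) * ?L\<^sup>2 \<le> \<kappa>"
      proof -
        have "?L\<^sup>2 < \<kappa> / (1 + 1 / \<kappa>)" using m0[OF m] by simp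
        then show "(1 + 1 / \<kappa>) * ?L\<^sup>2 \<le> \<kappa>" using \<kappa> by (simp add: pos_less_divide_eq mult.commute add_pos_pos less_imp_le)
      qed (use m0[OF m] in simp)
      have "eventually (\<lambda>n. \<eta> n < min (\<delta> * \<kappa> / 4) \<kappa>) sequentially"
        using \<delta> \<kappa> by (intro order_tendstoD(2)[OF \<eta>_lim]) auto
      moreover have "eventually (\<lambda>n. H * sqint (\<lambda>x. indicator (ball 0 \<rho>) x *\<^sub>R u (r n) x) < H * sqint (\<lambda>x. indicator (ball 0 \<rho>) x *\<^sub>R v x) + \<kappa>) sequentially"
        using \<kappa> by (intro order_tendstoD(2)[OF tendsto_mult[OF tendsto_const locv]]) auto
      ultimately have "eventually (\<lambda>n. sqint (\<lambda>x. ?\<zeta> x *\<^sub>R gradient (u (r n)) x) \<le> H * sqint v + \<kappa> * (2 * H + 6)) sequentially"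
      proof eventually_elim
        case (elim n)
        have "sqint (\<lambda>x. ?\<zeta> x *\<^sub>R gradient (u (r n)) x) \<le> H * sqint (\<lambda>x. indicator (ball 0 \<rho>) x *\<^sub>R u (r n) x) + \<kappa> * (2 * H + 5)"
        proof (rule cutoff_energy[where V=V and \<delta>=\<delta> and \<eta>="\<eta> (r n)" and L="?L"])
          show "\<And>x. x \<notin> ball 0 \<rho> \<Longrightarrow> ?\<zeta> x = 0" using cutoff_support(2)[of "real (Suc m)"] by (auto simp: \<rho>_def)
        qed (use eb \<kappa> H \<delta> u elim \<eta>r[of n] C Lk smooth_cutoff cutoff_bounds in auto)
        moreover have "H * sqint (\<lambda>x. indicator (ball 0 \<rho>) x *\<^sub>R v x) \<le> H * sqint v"
          using H locv_le by (intro mult_left_mono)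
        ultimately show ?case using elim(2) by (simp add: algebra_simps)
      qed
      then obtain N where N: "\<And>n. n \<ge> N \<Longrightarrow> sqint (\<lambda>x. ?\<zeta> x *\<^sub>R gradient (u (r n)) x) \<le> H * sqint v + \<kappa> * (2 * H + 6)"
        by (auto simp: eventually_sequentially)
      note \<zeta>b = smooth_borel[OF smooth_cutoff[of "real (Suc m)"]]
      have "sqint (\<lambda>x. ?\<zeta> x *\<^sub>R gradient (f n) x) \<le> H * sqint v + \<kappa> * (2 * H + 6)" if "n \<ge> N" for n
      proof (rule midhull_sqint_le[where T="\<lambda>f x. ?\<zeta> x *\<^sub>R gradient f x", OF ut _ _ _ midhull_mono[OF f that]])
        fix g :: "real^'n \<Rightarrow> real^'n" assume "g \<in> test_functions UNIV"
        then show "square_integrable (\<lambda>x. ?\<zeta> x *\<^sub>R gradient g x)"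
          by (intro square_integrable_cutoff \<zeta>b cutoff_bounds gradient_square_integrable)
      next
        fix g h :: "real^'n \<Rightarrow> real^'n" assume "g \<in> test_functions UNIV" "h \<in> test_functions UNIV"
        from gradient_mid[OF test_smooth[OF this(1)] test_smooth[OF this(2)]]
        show "(\<lambda>x. ?\<zeta> x *\<^sub>R gradient (\<lambda>x. (1/2) *\<^sub>R (g x + h x)) x)
          = (\<lambda>x. (1/2) *\<^sub>R (?\<zeta> x *\<^sub>R gradient g x + ?\<zeta> x *\<^sub>R gradient h x))"
          by (simp only: scaleR_add_right scaleR_left_commute)
      qed (rule N)
      moreover have "(\<lambda>n. sqint (\<lambda>x. ?\<zeta> x *\<^sub>R gradient (f n) x)) \<longlonglongrightarrow> sqint (\<lambda>x. ?\<zeta> x *\<^sub>R D x)"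
      proof (rule sqint_tendsto)
        show "(\<lambda>n. sqint (\<lambda>x. ?\<zeta> x *\<^sub>R gradient (f n) x - ?\<zeta> x *\<^sub>R D x)) \<longlonglongrightarrow> 0"
          using square_integrable_cutoff(2)[OF \<zeta>b cutoff_bounds square_integrable_diff[OF gradient_square_integrable[OF ft] D]]
          by (intro Lim_null_comparison[OF _ fD]) (simp add: scaleR_diff_right)
      qed (intro square_integrable_cutoff \<zeta>b cutoff_bounds gradient_square_integrable[OF ft] D)+
      ultimately show ?thesis by (intro LIMSEQ_le_const2) auto
    qed
    have "(\<lambda>m. sqint (\<lambda>x. cutoff (real (Suc m)) x *\<^sub>R D x)) \<longlonglongrightarrow> sqint D"
      unfolding sqint_def
    proof (rule integral_dominated_convergence[where w="\<lambda>x. (norm (D x))\<^sup>2"])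
      show "AE x in lebesgue. (\<lambda>m. (norm (cutoff (real (Suc m)) x *\<^sub>R D x))\<^sup>2) \<longlonglongrightarrow> (norm (D x))\<^sup>2"
      proof (rule AE_I2)
        fix x
        have "(\<lambda>m. (norm (cutoff (real (Suc m)) x *\<^sub>R D x))\<^sup>2) \<longlonglongrightarrow> (norm (1 *\<^sub>R D x))\<^sup>2"
          by (intro tendsto_power tendsto_norm tendsto_scaleR cutoff_tendsto_1 tendsto_const)
        then show "(\<lambda>m. (norm (cutoff (real (Suc m)) x *\<^sub>R D x))\<^sup>2) \<longlonglongrightarrow> (norm (D x))\<^sup>2" by simp
      qed
      fix m
      show "AE x in lebesgue. norm ((norm (cutoff (real (Suc m)) x *\<^sub>R D x))\<^sup>2) \<le> (norm (D x))\<^sup>2"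
        by (intro AE_I2) (simp add: power_mult_distrib mult_left_le_one_le power_le_one cutoff_bounds)
      show "(\<lambda>x. (norm (cutoff (real (Suc m)) x *\<^sub>R D x))\<^sup>2) \<in> borel_measurable lebesgue"
        using borel_measurable_scaleR_lebesgue[OF smooth_borel[OF smooth_cutoff[of "real (Suc m)"]] D] by measurable
    qed (use square_integrableD[OF D] in auto)
    then show ?thesis by (rule LIMSEQ_le_const2) (use cutD in auto)
  qed
  have "sqint D \<le> H * sqint v + e" if e: "e > 0" for e
  proof -
    define \<kappa> where "\<kappa> = min 1 (e / (2 * H + 6))"
    have \<kappa>: "0 < \<kappa>" "\<kappa> \<le> 1" using e H by (auto simp: \<kappa>_def)
    have "\<kappa> * (2 * H + 6) \<le> e / (2 * H + 6) * (2 * H + 6)"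
      using H by (intro mult_right_mono) (auto simp: \<kappa>_def)
    also have "\<dots> = e" using H by simp
    finally show ?thesis using main[OF \<kappa>] by linarith
  qed
  then have "sqint D \<le> H * sqint v" by (rule field_le_epsilon)
  from that[OF ft v D fv fD vpos this div0 supp] show ?thesis .
qed

lemma square_integrable_nonzero_set:
  assumes "square_integrable f"
  shows "{x. f x \<noteq> 0} \<in> sets lebesgue"
proof -
  note [measurable] = square_integrableD(1)[OF assms]
  have "{x \<in> space lebesgue. f x \<noteq> 0} \<in> sets lebesgue" by measurable
  then show ?thesis by simp
qed

lemma sqint_pos_continuous:
  fixes f :: "real^'n \<Rightarrow> 'b::euclidean_space"
  assumes "square_integrable f" "continuous_on UNIV f" "f x \<noteq> 0"
  shows "sqint f > 0"
proof (rule ccontr)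
  assume "\<not> sqint f > 0"
  then have "AE x in lebesgue. f x = 0" using sqint_nonneg[of f] sqint_eq_0[OF assms(1)] by linarith
  then have "{x. f x \<noteq> 0} \<in> null_sets lebesgue"
    using square_integrable_nonzero_set[OF assms(1)] by (subst (asm) AE_iff_null) auto
  then have "negligible {x. f x \<noteq> 0}" by (simp add: negligible_iff_null_sets)
  moreover have "open {x. f x \<noteq> 0}" using assms(2) by (intro open_Collect_neq continuous_intros)
  ultimately show False using open_not_negligible assms(3) by blast
qed

section \<open>The Stokes constant\<close>

text \<open>Dilating by \<open>c\<close>, the d-th root of the volume \<open>a\<close> of the
  support, makes this volume exactly 1 and multiplies the Rayleigh quotient by c^2. Replacing
  \<open>a\<close> by its bound V can only increase the right-hand side, the quotient being
  nonnegative.\<close>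

lemma stokes_const_le:
  fixes f :: "nat \<Rightarrow> real^'n \<Rightarrow> real^'n"
  assumes f: "\<And>n. f n \<in> test_functions UNIV" and v: "square_integrable v" and D: "square_integrable D"
    and fv: "(\<lambda>n. sqint (\<lambda>x. f n x - v x)) \<longlonglongrightarrow> 0" and fD: "(\<lambda>n. sqint (\<lambda>x. gradient (f n) x - D x)) \<longlonglongrightarrow> 0"
    and pos: "sqint v > 0" and div: "sqint (\<lambda>x. trace (D x)) = 0"
    and supp: "emeasure lebesgue {x. v x \<noteq> 0} \<le> ennreal V" and V: "V > 0"
  shows "stokes_const TYPE('n) \<le> ereal (V powr (2 / real CARD('n)) * (sqint D / sqint v))"
proof -
  note m = square_integrable_nonzero_set[OF v]
  define a where "a = measure lebesgue {x. v x \<noteq> 0}"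
  have "emeasure lebesgue {x. v x \<noteq> 0} < \<infinity>" using supp by (auto intro: order_le_less_trans)
  then have ea: "emeasure lebesgue {x. v x \<noteq> 0} = ennreal a"
    by (simp add: a_def emeasure_eq_ennreal_measure)
  have "emeasure lebesgue {x. v x \<noteq> 0} \<noteq> 0"
  proof
    assume "emeasure lebesgue {x. v x \<noteq> 0} = 0"
    then have "AE x in lebesgue. v x = 0" using m by (subst AE_iff_null) auto
    then show False using sqint_eq_0[OF v] pos by simp
  qed
  then have a: "a > 0" using ea by (simp add: a_def zero_less_measure_iff)
  have aV: "a \<le> V" using supp V unfolding ea by (simp add: ennreal_le_iff)
  define c where "c = a powr (1 / real CARD('n))"
  have c: "c > 0" using a by (simp add: c_def)
  have cd: "c ^ CARD('n) = a"
    using a by (simp add: c_def powr_powr flip: powr_realpow)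
  have c2: "c\<^sup>2 = a powr (2 / real CARD('n))"
    using a by (simp add: c_def powr_powr flip: powr_realpow powr_numeral)
  define g where "g n x = f n (c *\<^sub>R x + 0)" for n x
  define w where "w x = v (c *\<^sub>R x + 0)" for x
  define E where "E x = c *\<^sub>R D (c *\<^sub>R x + 0)" for x
  have gt: "g n \<in> test_functions UNIV" for n
    unfolding g_def[abs_def] using c by (intro test_affine f) auto
  have w: "square_integrable w" unfolding w_def[abs_def] by (rule square_integrable_affine[OF v c])
  have E: "square_integrable E" unfolding E_def[abs_def] by (intro square_integrable_scaleR square_integrable_affine D c)
  have gw: "(\<lambda>n. sqint (\<lambda>x. g n x - w x)) \<longlonglongrightarrow> 0"
  proof -
    have "sqint (\<lambda>x. g n x - w x) = sqint (\<lambda>x. f n x - v x) / c ^ CARD('n)" for n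
      unfolding g_def w_def
      using sqint_affine[OF square_integrable_diff[OF test_square_integrable[OF f] v] c, of n 0] by simp
    with tendsto_divide[OF fv tendsto_const[of "c ^ CARD('n)"]] c show ?thesis by simp
  qed
  have gE: "(\<lambda>n. sqint (\<lambda>x. gradient (g n) x - E x)) \<longlonglongrightarrow> 0"
  proof -
    have "sqint (\<lambda>x. gradient (g n) x - E x) = c\<^sup>2 * (sqint (\<lambda>x. gradient (f n) x - D x) / c ^ CARD('n))" for n
    proof -
      have "gradient (g n) x - E x = c *\<^sub>R (gradient (f n) (c *\<^sub>R x + 0) - D (c *\<^sub>R x + 0))" for x
        unfolding g_def[abs_def] E_def by (subst gradient_affine[OF test_smooth[OF f]]) (simp add: scaleR_diff_right)
      then have "sqint (\<lambda>x. gradient (g n) x - E x) = c\<^sup>2 * sqint (\<lambda>x. gradient (f n) (c *\<^sub>R x + 0) - D (c *\<^sub>R x + 0))"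
        by (simp only: sqint_scaleR)
      also have "sqint (\<lambda>x. gradient (f n) (c *\<^sub>R x + 0) - D (c *\<^sub>R x + 0)) = sqint (\<lambda>x. gradient (f n) x - D x) / c ^ CARD('n)"
        by (rule sqint_affine[OF square_integrable_diff[OF gradient_square_integrable[OF f] D] c])
      finally show ?thesis .
    qed
    with tendsto_mult[OF tendsto_const[of "c\<^sup>2"] tendsto_divide[OF fD tendsto_const[of "c ^ CARD('n)"]]] c
    show ?thesis by simp
  qed
  note lim = H1_limit[OF gt w gw E gE]
  have sw: "sqint w = sqint v / a" unfolding w_def[abs_def] by (simp only: sqint_affine[OF v c] cd)
  have sE: "sqint E = c\<^sup>2 * (sqint D / a)" unfolding E_def[abs_def] by (simp only: sqint_scaleR sqint_affine[OF D c] cd)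
  have "sqint (weak_gradient w) = sqint E"
    using weak_gradient_props(2)[of w] lim(1) E
    by (intro sqint_cong_AE lim(2) square_integrableD(1)) (auto simp: H1_0_def)
  then have ray: "rayleigh_quotient w = c\<^sup>2 * (sqint D / sqint v)"
    using a pos by (simp add: rayleigh_quotient_def L2_norm_power2 sw sE)
  have "div_free w"
  proof -
    have "sqint (\<lambda>x. trace (E x)) = c\<^sup>2 * (sqint (\<lambda>x. trace (D x)) / c ^ CARD('n))"
      unfolding E_def[abs_def] trace_scaleR
      using sqint_scaleR[of c "\<lambda>x. trace (D (c *\<^sub>R x + 0))"] sqint_affine[OF square_integrable_trace(1)[OF D] c, of 0] by simp
    then have "AE x in lebesgue. trace (E x) = 0"
      using sqint_eq_0[OF square_integrable_trace(1)[OF E]] div by simp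
    with lim(2) show ?thesis unfolding div_free_def by eventually_elim simp
  qed
  moreover have "emeasure lebesgue {x. norm (w x) > 0} = 1"
  proof -
    note mw = square_integrable_nonzero_set[OF w]
    have "ennreal a = (\<integral>\<^sup>+x. indicator {x. v x \<noteq> 0} x \<partial>lebesgue)" using ea m by simp
    also have "\<dots> = ennreal (c ^ CARD('n)) * (\<integral>\<^sup>+x. indicator {x. v x \<noteq> 0} (c *\<^sub>R x + 0) \<partial>lebesgue)"
      by (rule nn_integral_lebesgue_affine[OF _ c]) (use m in simp)
    also have "(\<integral>\<^sup>+x. indicator {x. v x \<noteq> 0} (c *\<^sub>R x + 0) \<partial>lebesgue) = (\<integral>\<^sup>+x. indicator {x. w x \<noteq> 0} x \<partial>lebesgue)"
      by (intro nn_integral_cong) (simp add: w_def indicator_def)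
    also have "\<dots> = emeasure lebesgue {x. w x \<noteq> 0}" using mw by simp
    finally have "ennreal a * 1 = ennreal a * emeasure lebesgue {x. w x \<noteq> 0}" by (simp add: cd)
    then have "1 = emeasure lebesgue {x. w x \<noteq> 0}" using a by (subst (asm) ennreal_mult_cancel_left) auto
    then show ?thesis by simp
  qed
  ultimately have "stokes_const TYPE('n) \<le> ereal (rayleigh_quotient w)"
    unfolding stokes_const_def using lim(1) by (intro INF_lower) auto
  also have "\<dots> \<le> ereal (V powr (2 / real CARD('n)) * (sqint D / sqint v))"
    unfolding ray c2 ereal_less_eq using a aV by (intro mult_right_mono powr_mono2 divide_nonneg_nonneg) auto
  finally show ?thesis .
qed

lemma stokes_const_nonneg: "0 \<le> stokes_const TYPE('n::finite)"
  unfolding stokes_const_def by (intro INF_greatest) (simp add: rayleigh_quotient_def)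

section \<open>A solenoidal field with compact support\<close>

lemma smooth_id: "smooth (\<lambda>x::real^'n. x)"
  unfolding smooth_def
proof
  fix k
  have "partial_deriv j (\<lambda>x::real^'n. x) = (\<lambda>x. axis j 1)" for j
    by (simp add: partial_deriv_def fun_eq_iff)
  then show "C_k k (\<lambda>x::real^'n. x)" by (cases k) (simp_all add: C_k_const)
qed

text \<open>A rotation field with radial amplitude is solenoidal.\<close>

lemma stokes_const_finite:
  assumes "CARD('n::finite) \<ge> 2"
  obtains S where "stokes_const TYPE('n) = ereal S" "S \<ge> 0"
proof -
  obtain i j :: 'n where ij: "i \<noteq> j"
  proof -
    have "card (UNIV :: 'n set) \<noteq> 1" using assms by simp
    then show ?thesis using that by (metis UNIV_I card_1_singleton_iff is_singletonI' is_singleton_altdef empty_iff)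
  qed
  \<comment> \<open>The generator of rotations in the plane of coordinates i and j: antisymmetric,
    so \<open>A x\<close> is orthogonal to x and the trace is zero.\<close>
  define A :: "real^'n \<Rightarrow> real^'n" where "A x = (\<chi> k. if k = i then x $ j else if k = j then - x $ i else 0)" for x
  have A: "bounded_linear A"
    by (intro linear_conv_bounded_linear[THEN iffD1] linearI) (auto simp: A_def vec_eq_iff)
  have As: "smooth A" using smooth_linear[OF A smooth_id] .
  \<comment> \<open>A function of 1 - |x|^2 is radial, and \<open>flat_fn\<close> lets it vanish
    smoothly at the unit sphere.\<close>
  define q :: "real^'n \<Rightarrow> real" where "q x = 1 - x \<bullet> x" for x
  define F :: "real^'n \<Rightarrow> real" where "F x = flat_fn 1 (q x)" for x
  have qd: "(q has_derivative (\<lambda>h. - 2 * (x \<bullet> h))) (at x)" for x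
    unfolding q_def[abs_def] by (auto intro!: derivative_eq_intros simp: inner_commute)
  have pdq: "partial_deriv k q x = (- 2) *\<^sub>R (x $ k)" for k x
    using partial_deriv_eqI[OF qd, of k] by (simp add: inner_axis)
  have dflat: "((\<lambda>x. flat_fn p (q x)) has_derivative (\<lambda>h. flat_fn ([:0,0,1:] * (p - pderiv p)) (q x) * (- 2 * (x \<bullet> h)))) (at x)" for p x
    using diff_chain_at[OF qd flat_deriv[unfolded has_field_derivative_def], of p x] by (simp only: o_def)
  have dF: "(F has_derivative (\<lambda>h. flat_fn ([:0,0,1:] * (1 - pderiv 1)) (q x) * (- 2 * (x \<bullet> h)))) (at x)" for x
    unfolding F_def[abs_def] by (rule dflat)
  have qs: "smooth q"
  proof -
    have "smooth (\<lambda>x::real^'n. 1 - (\<Sum>k\<in>UNIV. x $ k * x $ k))"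
    proof (intro smooth_diff smooth_const)
      have "smooth (\<lambda>x::real^'n. \<Sum>k\<in>I. x $ k * x $ k)" if "finite I" for I
        using that by (induction I rule: finite_induct) (auto intro!: smooth_add smooth_mult smooth_component smooth_id)
      then show "smooth (\<lambda>x::real^'n. \<Sum>k\<in>UNIV. x $ k * x $ k)" by simp
    qed
    then show ?thesis by (simp add: q_def[abs_def] inner_vec_def)
  qed
  have Fs: "smooth F"
    unfolding smooth_def
  proof
    fix k
    have "C_k k (\<lambda>x. flat_fn p (q x))" for p
    proof (induction k arbitrary: p)
      case 0
      have "continuous_on UNIV (flat_fn p)"
        using flat_deriv DERIV_isCont by (blast intro: continuous_at_imp_continuous_on)
      then have "continuous_on UNIV (flat_fn p \<circ> q)"
        using smooth_continuous[OF qs] by (intro continuous_on_compose) (auto elim: continuous_on_subset)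
      then show ?case by (simp add: o_def)
    next
      case (Suc k)
      let ?p = "[:0,0,1:] * (p - pderiv p)"
      note der = dflat[of p]
      have "partial_deriv l (\<lambda>x. flat_fn p (q x)) = (\<lambda>x. flat_fn ?p (q x) *\<^sub>R partial_deriv l q x)" for l
        using partial_deriv_eqI[OF der, of l] by (auto simp: pdq inner_axis)
      moreover have "C_k k (partial_deriv l q)" for l
        using smooth_partial_deriv[OF qs] by (simp add: smooth_def)
      ultimately have "C_k k (partial_deriv l (\<lambda>x. flat_fn p (q x)))" for l
        by (simp only: C_k_scaleR[OF Suc.IH])
      moreover have "(\<lambda>x. flat_fn p (q x)) differentiable (at x)" for x
        using der by (rule differentiableI)
      ultimately show ?case by simp
    qed
    then show "C_k k F" by (simp add: F_def[abs_def])
  qed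
  define u where "u x = F x *\<^sub>R A x" for x
  have F0: "F x = 0" if "x \<notin> cball 0 1" for x
  proof -
    have "1 < norm x" using that by simp
    then have "1 < x \<bullet> x" using power_strict_mono[of 1 "norm x" 2] by (simp add: power2_norm_eq_inner)
    then show ?thesis by (simp add: F_def q_def flat_fn_def)
  qed
  have ut: "u \<in> test_functions UNIV"
    unfolding test_functions_iff
  proof (intro conjI exI[of _ "cball 0 1"] allI impI)
    show "smooth u" unfolding u_def[abs_def] by (intro smooth_scaleR Fs As)
  qed (auto simp: u_def F0)
  note su = test_square_integrable[OF ut] and sg = gradient_square_integrable[OF ut]
  \<comment> \<open>The divergence of the product is \<open>F\<close> times the trace of
    \<open>A\<close> plus the inner product of \<open>A x\<close> with the radial gradient of
    \<open>F\<close>; both vanish.\<close>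
  have div: "trace (gradient u x) = 0" for x
  proof -
    have "partial_deriv k F x = flat_fn ([:0,0,1:] * (1 - pderiv 1)) (q x) * (- 2) * (x $ k)" for k
      using partial_deriv_eqI[OF dF, of k] by (simp add: inner_axis)
    then have sgF: "scalar_gradient F x = (flat_fn ([:0,0,1:] * (1 - pderiv 1)) (q x) * (- 2)) *\<^sub>R x"
      by (simp add: scalar_gradient_def vec_eq_iff)
    have "(\<Sum>k\<in>UNIV. A x $ k * x $ k) = (\<Sum>k\<in>{i, j}. A x $ k * x $ k)"
      by (rule sum.mono_neutral_right) (auto simp: A_def)
    then have Axx: "A x \<bullet> x = 0" using ij by (simp add: inner_vec_def A_def)
    have "partial_deriv k A x = A (axis k 1)" for k
      by (rule partial_deriv_eqI[OF bounded_linear_imp_has_derivative[OF A]])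
    then have "trace (gradient A x) = 0"
      using ij by (auto simp: trace_def gradient_def A_def axis_def intro!: sum.neutral)
    then show ?thesis
      unfolding u_def[abs_def] by (simp add: trace_gradient_scaleR[OF Fs As] sgF Axx)
  qed
  have pos: "sqint u > 0"
  proof (rule sqint_pos_continuous[OF su test_continuous[OF ut]])
    let ?x = "axis j (1/2) :: real^'n"
    have "?x \<bullet> ?x < 1" by (simp add: inner_axis_axis)
    then have "F ?x > 0" by (simp add: F_def q_def flat_fn_def)
    moreover have "A ?x $ i = 1/2" by (simp add: A_def)
    ultimately have "u ?x $ i \<noteq> 0" by (simp add: u_def)
    then show "u ?x \<noteq> 0" by force
  qed
  have "emeasure lebesgue {x. u x \<noteq> 0} \<le> emeasure lebesgue (cball (0::real^'n) 1)"
  proof (rule emeasure_mono)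
    show "{x. u x \<noteq> 0} \<subseteq> cball 0 1"
    proof
      fix x assume "x \<in> {x. u x \<noteq> 0}"
      then show "x \<in> cball 0 1" using F0[of x] by (cases "x \<in> cball 0 1") (simp_all add: u_def)
    qed
  qed simp
  also have "\<dots> < \<infinity>" using emeasure_lborel_cball_finite[of "0::real^'n" 1] by simp
  finally have fin: "emeasure lebesgue {x. u x \<noteq> 0} < \<infinity>" .
  \<comment> \<open>The added 1 makes V positive by construction; any finite bound serves, since
    only finiteness of the constant is at stake.\<close>
  define V where "V = measure lebesgue {x. u x \<noteq> 0} + 1"
  have V: "V > 0" by (simp add: V_def add_nonneg_pos)
  have "emeasure lebesgue {x. u x \<noteq> 0} \<le> ennreal V"
    using fin by (simp add: emeasure_eq_ennreal_measure V_def ennreal_leI)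
  then have "stokes_const TYPE('n) \<le> ereal (V powr (2 / real CARD('n)) * (sqint (gradient u) / sqint u))"
    using pos div V by (intro stokes_const_le[of "\<lambda>_. u"] ut su sg) (auto simp: sqint_def)
  moreover note stokes_const_nonneg[where 'n='n]
  ultimately show ?thesis using that by (cases "stokes_const TYPE('n)") auto
qed

text \<open>If s fails, the valid constants are bounded by s, and their supremum H is a threshold in
  the sense of \<open>energy_limit\<close>. The limit field then has quotient at most H, and
  \<open>stokes_const_le\<close> contradicts the choice of s.\<close>

theorem energy_bound_stokes_const:
  assumes S: "stokes_const TYPE('n::finite) = ereal S" and V: "V > 0"
    and s: "s < S * V powr (- 2 / real CARD('n))"
  shows "energy_bound TYPE('n) V s"
proof (rule ccontr)
  assume neg: "\<not> energy_bound TYPE('n) V s"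
  define X where "X = {s. energy_bound TYPE('n) V s}"
  have ub: "x \<le> s" if "x \<in> X" for x
    using that neg energy_bound_mono[where 'n='n, of V x s] unfolding X_def by (metis linear mem_Collect_eq)
  have X0: "0 \<in> X" by (simp add: X_def energy_bound_0)
  have bdd: "bdd_above X" using ub by (rule bdd_aboveI)
  define H where "H = Sup X"
  have H0: "H \<ge> 0" unfolding H_def using X0 bdd by (rule cSup_upper)
  have Hs: "H \<le> s" unfolding H_def using X0 ub by (intro cSup_least) auto
  have ok: "energy_bound TYPE('n) V (H - \<kappa>)" if "\<kappa> > 0" for \<kappa>
  proof -
    have "H - \<kappa> < Sup X" using that by (simp add: H_def)
    then obtain x where "x \<in> X" "H - \<kappa> < x" using X0 bdd less_cSup_iff[of X] by blast
    then show ?thesis using energy_bound_mono[where 'n='n, of V x "H - \<kappa>"] by (simp add: X_def)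
  qed
  have bad: "\<not> energy_bound TYPE('n) V (H + 1 / real (Suc n))" for n
  proof
    assume "energy_bound TYPE('n) V (H + 1 / real (Suc n))"
    then have "H + 1 / real (Suc n) \<le> Sup X" using bdd by (intro cSup_upper) (auto simp: X_def)
    then show False by (simp add: H_def)
  qed
  have V0: "V \<ge> 0" using V by simp
  obtain f and v :: "real^'n \<Rightarrow> real^'n" and D where l:
    "\<And>n::nat. f n \<in> test_functions UNIV" "square_integrable v" "square_integrable D"
    "(\<lambda>n. sqint (\<lambda>x. f n x - v x)) \<longlonglongrightarrow> 0" "(\<lambda>n. sqint (\<lambda>x. gradient (f n) x - D x)) \<longlonglongrightarrow> 0"
    "sqint v > 0" "sqint D \<le> H * sqint v" "sqint (\<lambda>x. trace (D x)) = 0"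
    "emeasure lebesgue {x. v x \<noteq> 0} \<le> ennreal V"
    by (rule energy_limit[OF V0 H0 ok bad]) (assumption, rule that)
  have "S \<le> V powr (2 / real CARD('n)) * (sqint D / sqint v)"
    using stokes_const_le[OF l(1-6,8,9) V] S by simp
  also have "\<dots> \<le> V powr (2 / real CARD('n)) * s"
    using l(6) order_trans[OF l(7) mult_right_mono[OF Hs sqint_nonneg]]
    by (intro mult_left_mono) (auto simp: pos_divide_le_eq)
  also have "\<dots> < V powr (2 / real CARD('n)) * (S * V powr (- 2 / real CARD('n)))"
    using s V by (intro mult_strict_left_mono) auto
  also have "\<dots> = S" using V by (simp add: powr_minus field_simps)
  finally show False by simp
qed

section \<open>Localisation\<close>

lemma nn_integral_reflect:
  fixes w :: "real^'n \<Rightarrow> ennreal"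
  assumes [measurable]: "w \<in> borel_measurable borel"
  shows "(\<integral>\<^sup>+y. w (t - y) \<partial>lborel) = (\<integral>\<^sup>+y. w y \<partial>lborel)"
proof -
  have "(\<integral>\<^sup>+y. w y \<partial>lborel) = (\<integral>\<^sup>+y. w y \<partial>density (distr lborel borel (\<lambda>x. t + (- 1) *\<^sub>R x)) (\<lambda>_. ennreal (\<bar>- 1\<bar> ^ DIM(real^'n))))"
    by (subst lborel_affine[of "- 1" t]) auto
  also have "\<dots> = (\<integral>\<^sup>+y. w (t - y) \<partial>lborel)"
    by (simp add: nn_integral_density nn_integral_distr)
  finally show ?thesis ..
qed

text \<open>Tonelli and invariance of Lebesgue measure under y to x - y. It integrates a localised
  inequality over all centres y.\<close>

lemma nn_integral_convolution:
  fixes w f :: "real^'n \<Rightarrow> ennreal"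
  assumes [measurable]: "w \<in> borel_measurable borel" "f \<in> borel_measurable borel"
  shows "(\<integral>\<^sup>+y. \<integral>\<^sup>+x. w (x - y) * f x \<partial>lborel \<partial>lborel) = (\<integral>\<^sup>+x. w x \<partial>lborel) * (\<integral>\<^sup>+x. f x \<partial>lborel)"
proof -
  have "(\<integral>\<^sup>+y. \<integral>\<^sup>+x. w (x - y) * f x \<partial>lborel \<partial>lborel) = (\<integral>\<^sup>+x. \<integral>\<^sup>+y. w (x - y) * f x \<partial>lborel \<partial>lborel)"
    by (rule lborel_pair.Fubini') measurable
  also have "\<dots> = (\<integral>\<^sup>+x. (\<integral>\<^sup>+y. w y \<partial>lborel) * f x \<partial>lborel)"
    by (simp add: nn_integral_multc nn_integral_reflect)
  also have "\<dots> = (\<integral>\<^sup>+x. w x \<partial>lborel) * (\<integral>\<^sup>+x. f x \<partial>lborel)"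
    by (simp add: nn_integral_cmult)
  finally show ?thesis .
qed

text \<open>A closed ball of the maximum norm, matched to the cut-off of scale K: this function and
  its gradient vanish outside \<open>cube K 0\<close>.\<close>

definition cube :: "real \<Rightarrow> real^'n \<Rightarrow> (real^'n) set" where
  "cube \<rho> y = {x. \<forall>i. \<bar>x $ i - y $ i\<bar> \<le> \<rho>}"

lemma cube_eq_cbox: "cube \<rho> y = cbox (\<chi> i. y $ i - \<rho>) (\<chi> i. y $ i + \<rho>)"
proof -
  have "\<bar>x $ i - y $ i\<bar> \<le> \<rho> \<longleftrightarrow> y $ i - \<rho> \<le> x $ i \<and> x $ i \<le> y $ i + \<rho>" for x i by linarith
  then show ?thesis by (auto simp: cube_def mem_box_cart)
qed

lemma cube_borel [measurable]: "cube \<rho> y \<in> sets borel"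
  by (simp add: cube_eq_cbox)

lemma emeasure_cube_0:
  assumes "\<rho> \<ge> 0"
  shows "emeasure lborel (cube \<rho> (0::real^'n)) = ennreal ((2 * \<rho>) ^ CARD('n))"
proof -
  let ?l = "(\<chi> i. 0 $ i - \<rho>) :: real^'n" and ?u = "(\<chi> i. 0 $ i + \<rho>) :: real^'n"
  have "?l \<bullet> b \<le> ?u \<bullet> b" if "b \<in> Basis" for b
    using that assms by (auto simp: Basis_vec_def inner_axis)
  then have "emeasure lborel (cbox ?l ?u) = ennreal (\<Prod>b\<in>Basis. (?u - ?l) \<bullet> b)"
    by (rule emeasure_lborel_cbox)
  also have "(\<Prod>b\<in>Basis. (?u - ?l) \<bullet> b) = (\<Prod>b\<in>(Basis :: (real^'n) set). 2 * \<rho>)"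
    by (intro prod.cong) (auto simp: Basis_vec_def inner_axis)
  finally show ?thesis by (simp add: cube_eq_cbox)
qed

lemma sqint_cutoff:
  assumes "K > 0"
  shows "sqint (cutoff K :: real^'n \<Rightarrow> real) = K ^ CARD('n) * sqint (hump :: real^'n \<Rightarrow> real)"
  using sqint_affine[OF test_square_integrable[OF hump_test], of "1 / K" 0] assms
  by (simp add: cutoff_def[abs_def] power_one_over field_simps)

lemma trace_gradient_borel:
  assumes "smooth u"
  shows "(\<lambda>x. trace (gradient u x)) \<in> borel_measurable borel"
proof -
  have "smooth (\<lambda>x. \<Sum>k\<in>I. partial_deriv k u x $ k)" if "finite I" for I
    using that by (induction I rule: finite_induct)
      (auto intro!: smooth_add smooth_component smooth_partial_deriv assms)
  from smooth_borel[OF this[of UNIV]] show ?thesis by (simp add: trace_def gradient_def)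
qed

text \<open>Averaging the inequality for \<open>cutoff K (x - y) u x\<close> over all \<open>y\<close> trades the bound on the total
  volume for a bound on the volume in every cube of side \<open>2 K\<close>.\<close>

theorem local_energy_bound:
  assumes eb: "energy_bound TYPE('n::finite) V s" and s': "0 \<le> s'" "s' < s"
  obtains \<delta> where "\<delta> > 0" "\<And>(u :: real^'n \<Rightarrow> real^'n) B. u \<in> test_functions UNIV \<Longrightarrow> B \<in> sets borel \<Longrightarrow>
    (\<And>y. emeasure lborel (B \<inter> cube (1 / \<delta>) y) \<le> ennreal V) \<Longrightarrow>
    sqint (\<lambda>x. indicator (- B) x *\<^sub>R u x) \<le> \<delta> * sqint u \<Longrightarrow>
    sqint (\<lambda>x. trace (gradient u x)) \<le> \<delta> * sqint u \<Longrightarrow> s' * sqint u \<le> sqint (gradient u)"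
proof -
  obtain \<delta>0 where \<delta>0: "\<delta>0 > 0" and eb0: "\<And>w :: real^'n \<Rightarrow> real^'n. near_admissible V \<delta>0 w \<Longrightarrow> s * sqint w \<le> sqint (gradient w)"
    using eb unfolding energy_bound_def by blast
  obtain C where C: "C > 0" "\<And>R x. R > 0 \<Longrightarrow> norm (scalar_gradient (cutoff R) (x::real^'n)) \<le> C / R"
    using scalar_gradient_cutoff by metis
  define m where "m = sqint (hump :: real^'n \<Rightarrow> real)"
  have m: "m > 0" unfolding m_def
    by (rule sqint_pos_continuous[OF test_square_integrable[OF hump_test] test_continuous[OF hump_test], of 0])
       (simp add: hump_bounds)
  have spos: "s > 0" using s' by simp
  \<comment> \<open>A quarter of the gap between s' and s: the three error terms at the end cost at
    most e each.\<close>
  define e where "e = (s - s') / 4"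
  have e: "e > 0" using s' by (simp add: e_def)
  define \<theta> where "\<theta> = e / (s' + 1)"
  have \<theta>: "\<theta> > 0" "\<theta> * s' \<le> e" using e s' by (auto simp: \<theta>_def field_simps)
  \<comment> \<open>The penalty that removes a case distinction: if the divergence or the outside
    mass of a localised field exceeds \<open>\<delta>0 * sqint w\<close>, then M times this defect
    already exceeds \<open>s * sqint w\<close>.\<close>
  define M where "M = s / \<delta>0"
  have M: "M > 0" "M * \<delta>0 = s" using spos \<delta>0 by (auto simp: M_def)
  \<comment> \<open>The factor 2^d / m is the ratio of the volume of \<open>cube K 0\<close> to the
    integral of the squared cut-off, as both scale like K^d; the relative gradient error is
    therefore c1 / K^2.\<close>
  define c1 where "c1 = (1 + 1 / \<theta> + 2 * M) * C\<^sup>2 * 2 ^ CARD('n) / m"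
  have c1: "c1 > 0" using \<theta> M C m by (auto simp: c1_def intro!: divide_pos_pos mult_pos_pos add_pos_pos)
  define \<delta> where "\<delta> = min 1 (min (e / c1) (e / (3 * M)))"
  have \<delta>: "\<delta> > 0" "\<delta> \<le> 1" "c1 * \<delta> \<le> e" "3 * M * \<delta> \<le> e"
  proof -
    show "\<delta> > 0" using e c1 M by (simp add: \<delta>_def)
    show "\<delta> \<le> 1" by (simp add: \<delta>_def)
    have "\<delta> \<le> e / c1" by (simp add: \<delta>_def)
    then show "c1 * \<delta> \<le> e" using c1 by (simp add: pos_le_divide_eq mult.commute)
    have "\<delta> \<le> e / (3 * M)" by (simp add: \<delta>_def)
    then show "3 * M * \<delta> \<le> e" using M by (simp add: pos_le_divide_eq mult.commute)
  qed
  define K where "K = 1 / \<delta>"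
  have K: "K > 0" using \<delta> by (simp add: K_def)
  have "s' * sqint u \<le> sqint (gradient u)"
    if u: "u \<in> test_functions UNIV" and B[measurable]: "B \<in> sets borel"
      and vol: "\<And>y. emeasure lborel (B \<inter> cube (1 / \<delta>) y) \<le> ennreal V"
      and out: "sqint (\<lambda>x. indicator (- B) x *\<^sub>R u x) \<le> \<delta> * sqint u"
      and div: "sqint (\<lambda>x. trace (gradient u x)) \<le> \<delta> * sqint u" for u :: "real^'n \<Rightarrow> real^'n" and B
  proof (rule ccontr)
    assume "\<not> s' * sqint u \<le> sqint (gradient u)"
    then have neg: "sqint (gradient u) < s' * sqint u" by simp
    have N: "sqint u > 0"
    proof (rule ccontr)
      assume "\<not> sqint u > 0"
      then have "sqint u = 0" using sqint_nonneg[of u] by linarith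
      then show False using neg sqint_nonneg[of "gradient u"] by simp
    qed
    note su = test_square_integrable[OF u] and sg = gradient_square_integrable[OF u]
    have bg: "gradient u \<in> borel_measurable borel" by (rule gradient_borel[OF test_smooth[OF u]])
    note [measurable] = trace_gradient_borel[OF test_smooth[OF u]]
    note [measurable] = test_borel[OF u] bg
    let ?\<zeta> = "cutoff K :: real^'n \<Rightarrow> real"
    have [measurable]: "?\<zeta> \<in> borel_measurable borel" by (rule smooth_borel[OF smooth_cutoff])
    define W where "W x = ennreal ((?\<zeta> x)\<^sup>2)" for x :: "real^'n"
    define W' where "W' x = (indicator (cube K 0) x :: ennreal)" for x :: "real^'n"
    have [measurable]: "W \<in> borel_measurable borel" "W' \<in> borel_measurable borel"
      unfolding W_def[abs_def] W'_def[abs_def] by measurable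
    define f1 f2 f3 f4 where "f1 x = ennreal ((norm (u x))\<^sup>2)" and "f2 x = ennreal ((norm (gradient u x))\<^sup>2)"
      and "f3 x = ennreal ((norm (trace (gradient u x)))\<^sup>2)" and "f4 x = ennreal ((norm (indicator (- B) x *\<^sub>R u x))\<^sup>2)" for x
    have [measurable]: "f1 \<in> borel_measurable borel" "f2 \<in> borel_measurable borel" "f3 \<in> borel_measurable borel" "f4 \<in> borel_measurable borel"
      unfolding f1_def[abs_def] f2_def[abs_def] f3_def[abs_def] f4_def[abs_def] by measurable
    \<comment> \<open>A convolution in the centre y of the cut-off, so that its integral over y
      factorises.\<close>
    define I where "I w f y = (\<integral>\<^sup>+x. w (x - y) * f x \<partial>lborel)" for w f :: "real^'n \<Rightarrow> ennreal" and y
    have Im[measurable]: "I w f \<in> borel_measurable borel"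
      if [measurable]: "w \<in> borel_measurable borel" "f \<in> borel_measurable borel" for w f
      unfolding I_def[abs_def] by measurable
    define a where "a = (1 + 1 / \<theta> + 2 * M) * (C / K)\<^sup>2"
    have a: "a \<ge> 0" using \<theta> M by (simp add: a_def)
    have key: "ennreal s * I W f1 y \<le> ennreal (1 + \<theta>) * I W f2 y + ennreal a * I W' f1 y
       + ennreal (2 * M) * I W f3 y + ennreal M * I W f4 y" for y
    proof -
      define \<psi> where "\<psi> x = ?\<zeta> (x - y)" for x
      have \<psi>s: "smooth \<psi>"
        using smooth_affine[OF smooth_cutoff[of K], of 1 "- y"] by (simp add: \<psi>_def[abs_def])
      note [measurable] = smooth_borel[OF \<psi>s]
      have \<psi>g: "norm (scalar_gradient \<psi> x) \<le> C / K * indicator (cube K 0) (x - y)" for x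
      proof -
        have pd: "partial_deriv j \<psi> x = partial_deriv j ?\<zeta> (x - y)" for j
          using partial_deriv_affine[OF smooth_cutoff[of K], of j 1 "- y" x] by (simp add: \<psi>_def[abs_def])
        show ?thesis
        proof (cases "x - y \<in> cube K 0")
          case True
          then show ?thesis using C(2)[OF K, of "x - y"] pd by (simp add: scalar_gradient_def)
        next
          case False
          have "partial_deriv j ?\<zeta> (x - y) = 0" for j
          proof (rule partial_deriv_eq_0[of "- cube K 0"])
            show "open (- cube K (0::real^'n))" by (simp add: cube_eq_cbox open_Compl closed_cbox)
            fix z :: "real^'n" assume "z \<in> - cube K 0"
            then show "?\<zeta> z = 0" using cutoff_support(1)[OF K, of z] by (auto simp: cube_def)
          qed (use False in simp)
          then show ?thesis using False pd by (simp add: scalar_gradient_def zero_vec_def[symmetric])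
        qed
      qed
      have \<psi>g2: "(norm (scalar_gradient \<psi> x))\<^sup>2 \<le> (C / K)\<^sup>2 * indicator (cube K 0) (x - y)" for x
      proof (cases "x - y \<in> cube K 0")
        case True
        then show ?thesis using power_mono[OF \<psi>g[of x], of 2] by simp
      next
        case False
        then show ?thesis using \<psi>g[of x] by simp
      qed
      define w where "w x = \<psi> x *\<^sub>R u x" for x
      have w: "w \<in> test_functions UNIV" unfolding w_def[abs_def] by (rule test_scaleR[OF \<psi>s u])
      note sw = test_square_integrable[OF w] and sgw = gradient_square_integrable[OF w]
      note [measurable] = test_borel[OF w] gradient_borel[OF test_smooth[OF w]]
      note [measurable] = trace_gradient_borel[OF test_smooth[OF w]]
      have dich: "s * sqint w \<le> sqint (gradient w) + M * sqint (\<lambda>x. trace (gradient w x)) + M * sqint (\<lambda>x. indicator (- B) x *\<^sub>R w x)"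
      proof (cases "sqint (\<lambda>x. trace (gradient w x)) \<le> \<delta>0 * sqint w \<and> sqint (\<lambda>x. indicator (- B) x *\<^sub>R w x) \<le> \<delta>0 * sqint w")
        case True
        \<comment> \<open>The localised field lives in \<open>cube K y\<close>, so the part of B in
          this cube can serve as its set of bounded volume.\<close>
        have ind: "indicator (- (B \<inter> cube K y)) x *\<^sub>R w x = indicator (- B) x *\<^sub>R w x" for x
        proof (cases "x \<in> cube K y")
          case False
          then have "\<psi> x = 0" using cutoff_support(1)[OF K, of "x - y"] by (auto simp: cube_def \<psi>_def)
          then show ?thesis by (simp add: w_def)
        qed (auto simp: indicator_def)
        have "sqint (\<lambda>x. indicator (- (B \<inter> cube K y)) x *\<^sub>R w x) \<le> \<delta>0 * sqint w" unfolding ind using True by blast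
        moreover have "emeasure lborel (B \<inter> cube K y) \<le> ennreal V" using vol[of y] by (simp add: K_def)
        moreover have "B \<inter> cube K y \<in> sets borel" by measurable
        ultimately have "near_admissible V \<delta>0 w"
          unfolding near_admissible_def using w True by blast
        from eb0[OF this] have "s * sqint w \<le> sqint (gradient w)" .
        moreover have "0 \<le> M * sqint (\<lambda>x. trace (gradient w x))" "0 \<le> M * sqint (\<lambda>x. indicator (- B) x *\<^sub>R w x)"
          using M by (simp_all only: mult_nonneg_nonneg less_imp_le sqint_nonneg)
        ultimately show ?thesis by linarith
      next
        case False
        then have "M * (\<delta>0 * sqint w) \<le> M * sqint (\<lambda>x. trace (gradient w x)) + M * sqint (\<lambda>x. indicator (- B) x *\<^sub>R w x)"
        proof -
          have "\<delta>0 * sqint w \<le> sqint (\<lambda>x. trace (gradient w x)) + sqint (\<lambda>x. indicator (- B) x *\<^sub>R w x)"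
            using False sqint_nonneg[of "\<lambda>x. trace (gradient w x)"] sqint_nonneg[of "\<lambda>x. indicator (- B) x *\<^sub>R w x"] by linarith
          from mult_left_mono[OF this, of M] show ?thesis using M by (simp add: distrib_left)
        qed
        moreover have "M * (\<delta>0 * sqint w) = s * sqint w" using M(2) by simp
        ultimately show ?thesis using sqint_nonneg[of "gradient w"] by linarith
      qed
      have "ennreal s * I W f1 y = ennreal (s * sqint w)"
      proof -
        have "I W f1 y = (\<integral>\<^sup>+x. ennreal ((norm (w x))\<^sup>2) \<partial>lborel)"
          unfolding I_def W_def f1_def w_def \<psi>_def by (intro nn_integral_cong) (simp add: power_mult_distrib ennreal_mult)
        then show ?thesis using spos by (simp add: sqint_eq_nn_integral[OF sw] ennreal_mult)
      qed
      also have "\<dots> \<le> ennreal (sqint (gradient w)) + ennreal M * ennreal (sqint (\<lambda>x. trace (gradient w x))) + ennreal M * ennreal (sqint (\<lambda>x. indicator (- B) x *\<^sub>R w x))"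
        using dich M by (simp flip: ennreal_mult ennreal_plus)
      also have "\<dots> = (\<integral>\<^sup>+x. ennreal ((norm (gradient w x))\<^sup>2) + ennreal M * ennreal ((norm (trace (gradient w x)))\<^sup>2)
          + ennreal M * ennreal ((norm (indicator (- B) x *\<^sub>R w x))\<^sup>2) \<partial>lborel)"
      proof -
        have [measurable]: "(\<lambda>x. indicator (- B) x *\<^sub>R w x) \<in> borel_measurable borel" by measurable
        have "square_integrable (\<lambda>x. indicator (- B) x *\<^sub>R w x)" by (rule square_integrable_indicator[OF sw]) simp
        then show ?thesis
          by (simp add: nn_integral_add nn_integral_cmult sqint_eq_nn_integral sgw square_integrable_trace(1) del: norm_scaleR real_norm_def)
      qed
      also have "\<dots> \<le> (\<integral>\<^sup>+x. ennreal (1 + \<theta>) * (W (x - y) * f2 x) + ennreal a * (W' (x - y) * f1 x)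
          + ennreal (2 * M) * (W (x - y) * f3 x) + ennreal M * (W (x - y) * f4 x) \<partial>lborel)"
      proof (rule nn_integral_mono)
        fix x
        let ?i = "indicator (cube K 0) (x - y) :: real"
        have up: "(norm (scalar_gradient \<psi> x))\<^sup>2 * (norm (u x))\<^sup>2 \<le> (C / K)\<^sup>2 * (?i * (norm (u x))\<^sup>2)"
          using mult_right_mono[OF \<psi>g2[of x], of "(norm (u x))\<^sup>2"] by (simp add: mult.assoc)
        have 1: "(norm (gradient w x))\<^sup>2 \<le> (1 + \<theta>) * ((\<psi> x)\<^sup>2 * (norm (gradient u x))\<^sup>2) + (1 + 1 / \<theta>) * ((C / K)\<^sup>2 * (?i * (norm (u x))\<^sup>2))"
        proof -
          have "(norm (gradient w x))\<^sup>2 \<le> (1 + \<theta>) * ((\<psi> x)\<^sup>2 * (norm (gradient u x))\<^sup>2) + (1 + 1 / \<theta>) * ((norm (scalar_gradient \<psi> x))\<^sup>2 * (norm (u x))\<^sup>2)"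
            unfolding w_def[abs_def] by (rule norm_gradient_scaleR_le[OF \<psi>s test_smooth[OF u] \<theta>(1)])
          moreover have "(1 + 1 / \<theta>) * ((norm (scalar_gradient \<psi> x))\<^sup>2 * (norm (u x))\<^sup>2) \<le> (1 + 1 / \<theta>) * ((C / K)\<^sup>2 * (?i * (norm (u x))\<^sup>2))"
            using \<theta> by (intro mult_left_mono up) auto
          ultimately show ?thesis by linarith
        qed
        have 2: "M * (trace (gradient w x))\<^sup>2 \<le> 2 * M * ((\<psi> x)\<^sup>2 * (trace (gradient u x))\<^sup>2) + 2 * M * ((C / K)\<^sup>2 * (?i * (norm (u x))\<^sup>2))"
        proof -
          have "(trace (gradient w x))\<^sup>2 \<le> 2 * ((\<psi> x)\<^sup>2 * (trace (gradient u x))\<^sup>2) + 2 * ((norm (scalar_gradient \<psi> x))\<^sup>2 * (norm (u x))\<^sup>2)"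
            unfolding w_def[abs_def] by (rule trace_gradient_scaleR_le[OF \<psi>s test_smooth[OF u]])
          also have "\<dots> \<le> 2 * ((\<psi> x)\<^sup>2 * (trace (gradient u x))\<^sup>2) + 2 * ((C / K)\<^sup>2 * (?i * (norm (u x))\<^sup>2))"
            using up by simp
          finally have "M * (trace (gradient w x))\<^sup>2 \<le> M * (2 * ((\<psi> x)\<^sup>2 * (trace (gradient u x))\<^sup>2) + 2 * ((C / K)\<^sup>2 * (?i * (norm (u x))\<^sup>2)))"
            using M by (intro mult_left_mono) auto
          then show ?thesis by (simp add: algebra_simps)
        qed
        have 3: "(norm (indicator (- B) x *\<^sub>R w x))\<^sup>2 = (\<psi> x)\<^sup>2 * (norm (indicator (- B) x *\<^sub>R u x))\<^sup>2"
          by (simp add: w_def power_mult_distrib mult_ac)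
        have a_eq: "a * (?i * (norm (u x))\<^sup>2) = (1 + 1 / \<theta>) * ((C / K)\<^sup>2 * (?i * (norm (u x))\<^sup>2)) + 2 * M * ((C / K)\<^sup>2 * (?i * (norm (u x))\<^sup>2))"
          by (simp add: a_def algebra_simps)
        have "(norm (gradient w x))\<^sup>2 + M * (norm (trace (gradient w x)))\<^sup>2 + M * (norm (indicator (- B) x *\<^sub>R w x))\<^sup>2
           \<le> (1 + \<theta>) * ((\<psi> x)\<^sup>2 * (norm (gradient u x))\<^sup>2) + a * (?i * (norm (u x))\<^sup>2)
             + 2 * M * ((\<psi> x)\<^sup>2 * (norm (trace (gradient u x)))\<^sup>2) + M * ((\<psi> x)\<^sup>2 * (norm (indicator (- B) x *\<^sub>R u x))\<^sup>2)"
          unfolding a_eq 3 real_norm_def power2_abs using 1 2 by linarith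
        from ennreal_leI[OF this]
        show "ennreal ((norm (gradient w x))\<^sup>2) + ennreal M * ennreal ((norm (trace (gradient w x)))\<^sup>2)
          + ennreal M * ennreal ((norm (indicator (- B) x *\<^sub>R w x))\<^sup>2)
          \<le> ennreal (1 + \<theta>) * (W (x - y) * f2 x) + ennreal a * (W' (x - y) * f1 x)
          + ennreal (2 * M) * (W (x - y) * f3 x) + ennreal M * (W (x - y) * f4 x)"
          unfolding W_def W'_def f1_def f2_def f3_def f4_def \<psi>_def[symmetric] ennreal_indicator[symmetric]
          using M \<theta> a by (simp add: ennreal_mult ennreal_plus del: norm_scaleR real_norm_def ennreal_indicator)
      qed
      also have "\<dots> = ennreal (1 + \<theta>) * I W f2 y + ennreal a * I W' f1 y + ennreal (2 * M) * I W f3 y + ennreal M * I W f4 y"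
        unfolding I_def by (simp add: nn_integral_add nn_integral_cmult)
      finally show ?thesis .
    qed
    have total: "(\<integral>\<^sup>+y. I w f y \<partial>lborel) = (\<integral>\<^sup>+x. w x \<partial>lborel) * (\<integral>\<^sup>+x. f x \<partial>lborel)"
      if "w \<in> borel_measurable borel" "f \<in> borel_measurable borel" for w f
      unfolding I_def using that by (rule nn_integral_convolution)
    define k where "k = K ^ CARD('n) * m"
    have k: "k > 0" using K m by (simp add: k_def)
    have W_int: "(\<integral>\<^sup>+x. W x \<partial>lborel) = ennreal k"
    proof -
      have "square_integrable ?\<zeta>"
        using square_integrable_affine[OF test_square_integrable[OF hump_test], of "1 / K" 0] K by (simp add: cutoff_def[abs_def])
      from sqint_eq_nn_integral[OF this] show ?thesis
        by (simp add: W_def sqint_cutoff[OF K] k_def m_def)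
    qed
    have W'_int: "(\<integral>\<^sup>+x. W' x \<partial>lborel) = ennreal (2 ^ CARD('n) * K ^ CARD('n))"
      using emeasure_cube_0[of K, where 'n='n] K by (simp add: W'_def power_mult_distrib)
    have F1: "(\<integral>\<^sup>+x. f1 x \<partial>lborel) = ennreal (sqint u)"
      unfolding f1_def by (rule sqint_eq_nn_integral[OF su]) measurable
    have F2: "(\<integral>\<^sup>+x. f2 x \<partial>lborel) = ennreal (sqint (gradient u))"
      unfolding f2_def by (rule sqint_eq_nn_integral[OF sg]) measurable
    have F3: "(\<integral>\<^sup>+x. f3 x \<partial>lborel) = ennreal (sqint (\<lambda>x. trace (gradient u x)))"
      unfolding f3_def by (rule sqint_eq_nn_integral[OF square_integrable_trace(1)[OF sg]]) measurable
    have F4: "(\<integral>\<^sup>+x. f4 x \<partial>lborel) = ennreal (sqint (\<lambda>x. indicator (- B) x *\<^sub>R u x))"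
      unfolding f4_def by (rule sqint_eq_nn_integral[OF square_integrable_indicator(1)[OF su]]) (simp, measurable)
    have "(\<integral>\<^sup>+y. ennreal s * I W f1 y \<partial>lborel) \<le> (\<integral>\<^sup>+y. ennreal (1 + \<theta>) * I W f2 y + ennreal a * I W' f1 y
       + ennreal (2 * M) * I W f3 y + ennreal M * I W f4 y \<partial>lborel)"
      by (intro nn_integral_mono key)
    then have "ennreal s * (ennreal k * ennreal (sqint u)) \<le> ennreal (1 + \<theta>) * (ennreal k * ennreal (sqint (gradient u)))
       + ennreal a * (ennreal (2 ^ CARD('n) * K ^ CARD('n)) * ennreal (sqint u))
       + ennreal (2 * M) * (ennreal k * ennreal (sqint (\<lambda>x. trace (gradient u x))))
       + ennreal M * (ennreal k * ennreal (sqint (\<lambda>x. indicator (- B) x *\<^sub>R u x)))"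
      by (simp add: nn_integral_add nn_integral_cmult total W_int W'_int F1 F2 F3 F4)
    then have "ennreal (s * (k * sqint u)) \<le> ennreal ((1 + \<theta>) * (k * sqint (gradient u))
       + a * (2 ^ CARD('n) * K ^ CARD('n) * sqint u)
       + 2 * M * (k * sqint (\<lambda>x. trace (gradient u x)))
       + M * (k * sqint (\<lambda>x. indicator (- B) x *\<^sub>R u x)))"
      using spos k \<theta> a M K by (simp add: ennreal_mult ennreal_plus)
    then have "s * (k * sqint u) \<le> (1 + \<theta>) * (k * sqint (gradient u))
       + a * (2 ^ CARD('n) * K ^ CARD('n) * sqint u)
       + 2 * M * (k * sqint (\<lambda>x. trace (gradient u x)))
       + M * (k * sqint (\<lambda>x. indicator (- B) x *\<^sub>R u x))"
      using spos k \<theta> a M K by (subst (asm) ennreal_le_iff) (auto intro!: add_nonneg_nonneg mult_nonneg_nonneg)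
    also have "\<dots> \<le> (1 + \<theta>) * (k * (s' * sqint u)) + (c1 * \<delta>) * (k * sqint u)
       + 2 * M * (k * (\<delta> * sqint u)) + M * (k * (\<delta> * sqint u))"
    proof (intro add_mono mult_left_mono)
      have "a * (2 ^ CARD('n) * K ^ CARD('n) * sqint u) = (c1 * (1 / K)\<^sup>2) * (k * sqint u)"
        using m by (simp add: a_def c1_def k_def power_divide mult_ac)
      also have "(1 / K)\<^sup>2 \<le> \<delta>"
        using \<delta> by (simp add: K_def power2_eq_square mult_left_le)
      finally show "a * (2 ^ CARD('n) * K ^ CARD('n) * sqint u) \<le> (c1 * \<delta>) * (k * sqint u)"
        using c1 k by (simp add: mult_right_mono mult_left_mono)
    qed (use neg div out \<theta> M k in auto)
    also have "\<dots> = ((1 + \<theta>) * s' + c1 * \<delta> + 3 * M * \<delta>) * (k * sqint u)" by (simp add: algebra_simps)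
    finally have "s * (k * sqint u) \<le> ((1 + \<theta>) * s' + c1 * \<delta> + 3 * M * \<delta>) * (k * sqint u)" .
    then have "s \<le> (1 + \<theta>) * s' + c1 * \<delta> + 3 * M * \<delta>" using k N by (simp add: mult_le_cancel_right)
    also have "\<dots> \<le> s' + 3 * e" using \<theta>(2) \<delta>(3,4) by (simp add: distrib_right)
    also have "\<dots> < s" using s' by (simp add: e_def field_simps)
    finally show False by simp
  qed
  with \<delta>(1) that show ?thesis by blast
qed

section \<open>Sparse blocks\<close>

context prob_space begin

text \<open>Chernoff's method: the Laplace transform E exp(- n \<xi>) tends to P(\<xi> = 0), which
  is at most p, so some n brings it below a number p1 between p and p'. The level \<eta> is set so
  that the Markov factor exp(n \<eta>) equals p' / p1 and the bound per variable is p'.\<close>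

lemma sum_lower_tail:
  fixes \<xi> :: "'i \<Rightarrow> 'a \<Rightarrow> real"
  assumes indep: "indep_vars (\<lambda>_. borel) \<xi> UNIV"
    and ident: "\<And>z z'. distr M borel (\<xi> z) = distr M borel (\<xi> z')"
    and nonneg: "\<And>z. AE \<omega> in M. 0 \<le> \<xi> z \<omega>"
    and zero: "\<And>z. prob {\<omega> \<in> space M. \<xi> z \<omega> = 0} \<le> p"
    and p: "0 \<le> p" "p < p'"
  obtains \<eta> where "\<eta> > 0"
    "\<And>C. finite C \<Longrightarrow> prob {\<omega> \<in> space M. (\<Sum>z\<in>C. \<xi> z \<omega>) \<le> \<eta> * real (card C)} \<le> p' ^ card C"
proof -
  have rv[measurable]: "\<xi> z \<in> borel_measurable M" for z
    using indep unfolding indep_vars_def by simp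
  define \<phi> where "\<phi> n z = expectation (\<lambda>\<omega>. exp (- (real n * \<xi> z \<omega>)))" for n :: nat and z
  have int: "integrable M (\<lambda>\<omega>. exp (- (real n * \<xi> z \<omega>)))" for n z
  proof (rule integrable_const_bound[of _ 1])
    show "AE \<omega> in M. norm (exp (- (real n * \<xi> z \<omega>))) \<le> 1"
      using nonneg[of z] by eventually_elim simp
  qed measurable
  have \<phi>_eq: "\<phi> n z = \<phi> n z'" for n z z'
  proof -
    have "\<phi> n z = (LINT x|distr M borel (\<xi> z). exp (- (real n * x)))" for z
      unfolding \<phi>_def by (subst integral_distr) auto
    then show ?thesis using ident[of z z'] by simp
  qed
  define z0 :: 'i where "z0 = undefined"
  have \<phi>_lim: "(\<lambda>n. \<phi> n z0) \<longlonglongrightarrow> expectation (indicator {\<omega> \<in> space M. \<xi> z0 \<omega> = 0})"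
    unfolding \<phi>_def
  proof (rule integral_dominated_convergence[where w="\<lambda>_. 1"])
    show "AE \<omega> in M. (\<lambda>n. exp (- (real n * \<xi> z0 \<omega>))) \<longlonglongrightarrow> indicator {\<omega> \<in> space M. \<xi> z0 \<omega> = 0} \<omega>"
      using nonneg[of z0] AE_space
    proof eventually_elim
      case (elim \<omega>)
      show ?case
      proof (cases "\<xi> z0 \<omega> = 0")
        case False
        then have "\<xi> z0 \<omega> > 0" using elim by simp
        then have "(\<lambda>n. exp (- \<xi> z0 \<omega>) ^ n) \<longlonglongrightarrow> 0" by (intro LIMSEQ_power_zero) simp
        then show ?thesis using False by (simp add: exp_of_nat_mult[symmetric])
      qed (use elim in simp)
    qed
    show "AE \<omega> in M. norm (exp (- (real n * \<xi> z0 \<omega>))) \<le> 1" for n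
      using nonneg[of z0] by eventually_elim simp
  qed auto
  have zp: "expectation (indicator {\<omega> \<in> space M. \<xi> z0 \<omega> = 0}) \<le> p"
    using zero[of z0] by simp
  define p1 where "p1 = (p + p') / 2"
  have p1: "p < p1" "p1 < p'" "p1 > 0" using p by (auto simp: p1_def)
  have "expectation (indicator {\<omega> \<in> space M. \<xi> z0 \<omega> = 0}) < p1" using zp p1 by linarith
  from order_tendstoD(2)[OF \<phi>_lim this]
  have "eventually (\<lambda>n. \<phi> n z0 < p1) sequentially" .
  then obtain N where N: "\<And>n. n \<ge> N \<Longrightarrow> \<phi> n z0 < p1" by (auto simp: eventually_sequentially)
  define n where "n = max N 1"
  have n: "\<phi> n z0 < p1" "n \<ge> 1" using N[of n] by (auto simp: n_def)
  define \<eta> where "\<eta> = ln (p' / p1) / real n"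
  have \<eta>: "\<eta> > 0" using n p1 by (simp add: \<eta>_def)
  have exp\<eta>: "exp (real n * \<eta>) = p' / p1" using n p1 by (simp add: \<eta>_def)
  have "prob {\<omega> \<in> space M. (\<Sum>z\<in>C. \<xi> z \<omega>) \<le> \<eta> * real (card C)} \<le> p' ^ card C" if C: "finite C" for C
  proof -
    let ?X = "\<lambda>\<omega>. \<Prod>z\<in>C. exp (- (real n * \<xi> z \<omega>))"
    have X: "?X \<omega> = exp (- (real n * (\<Sum>z\<in>C. \<xi> z \<omega>)))" for \<omega>
      using C by (simp add: exp_sum[symmetric] sum_distrib_left sum_negf)
    have ind: "indep_vars (\<lambda>_. borel) (\<lambda>z \<omega>. exp (- (real n * \<xi> z \<omega>))) C"
      by (rule indep_vars_compose2[OF indep_vars_subset[OF indep subset_UNIV], where Y="\<lambda>_ x. exp (- (real n * x))"]) simp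
    have EX: "expectation ?X = (\<Prod>z\<in>C. \<phi> n z)"
      unfolding \<phi>_def by (rule indep_vars_lebesgue_integral[OF C ind int])
    have iX: "integrable M ?X" by (rule indep_vars_integrable[OF C ind int])
    define a where "a = exp (- (real n * (\<eta> * real (card C))))"
    have "prob {\<omega> \<in> space M. (\<Sum>z\<in>C. \<xi> z \<omega>) \<le> \<eta> * real (card C)} = prob {\<omega> \<in> space M. ?X \<omega> \<ge> a}"
      unfolding X a_def using n by simp
    also have "\<dots> \<le> expectation ?X / a"
      by (rule integral_Markov_inequality_measure[OF iX, of "{}"]) (auto simp: a_def intro!: prod_nonneg)
    also have "\<dots> = (\<Prod>z\<in>C. \<phi> n z) * exp (real n * \<eta>) ^ card C"
    proof -
      have "inverse a = exp (real n * \<eta>) ^ card C"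
        by (simp add: a_def exp_minus mult_ac flip: exp_of_nat_mult)
      then show ?thesis by (simp only: EX divide_inverse)
    qed
    also have "(\<Prod>z\<in>C. \<phi> n z) = \<phi> n z0 ^ card C" by (subst \<phi>_eq[of n _ z0]) simp
    also have "\<phi> n z0 ^ card C * exp (real n * \<eta>) ^ card C \<le> p1 ^ card C * (p' / p1) ^ card C"
      unfolding exp\<eta> using n(1) p1 p
      by (intro mult_right_mono power_mono) (auto simp: \<phi>_def intro!: integral_nonneg_AE)
    also have "\<dots> = p' ^ card C" using p1 by (simp flip: power_mult_distrib)
    finally show ?thesis .
  qed
  with \<eta> show ?thesis by (rule that)
qed

end

section \<open>Blocks, windows and the union bound\<close>

definition block_cells :: "nat \<Rightarrow> int^'n \<Rightarrow> (int^'n) set" where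
  "block_cells L w = {z. \<forall>i. z $ i \<in> {int L * w $ i ..< int L * w $ i + int L}}"

lemma block_cells:
  fixes w :: "int^'n"
  shows "finite (block_cells L w)" "card (block_cells L w) = L ^ CARD('n)"
proof -
  let ?A = "\<lambda>i. {int L * w $ i ..< int L * w $ i + int L}"
  have eq: "block_cells L w = vec_lambda ` (PiE UNIV ?A)"
  proof (intro set_eqI iffI)
    fix z :: "int^'n" assume "z \<in> block_cells L w"
    then have "vec_nth z \<in> PiE UNIV ?A" "z = vec_lambda (vec_nth z)" by (auto simp: block_cells_def)
    then show "z \<in> vec_lambda ` (PiE UNIV ?A)" by blast
  qed (auto simp: block_cells_def PiE_iff)
  have inj: "inj_on (vec_lambda :: ('n \<Rightarrow> int) \<Rightarrow> int^'n) X" for X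
    by (auto simp: inj_on_def vec_lambda_inject)
  show "finite (block_cells L w)" unfolding eq by (intro finite_imageI finite_PiE) auto
  show "card (block_cells L w) = L ^ CARD('n)" unfolding eq by (simp add: card_image[OF inj] card_PiE)
qed

lemma block_cells_disjoint:
  fixes w w' :: "int^'n"
  assumes "w \<noteq> w'" "L > 0"
  shows "block_cells L w \<inter> block_cells L w' = {}"
proof (rule ccontr)
  assume "block_cells L w \<inter> block_cells L w' \<noteq> {}"
  then obtain z where z: "z \<in> block_cells L w" "z \<in> block_cells L w'" by blast
  have "w $ i = z $ i div int L" if "z \<in> block_cells L w" for w :: "int^'n" and i
  proof -
    have "int L * w $ i \<le> z $ i" "z $ i < int L * w $ i + int L"
      using that by (auto simp: block_cells_def)
    then show ?thesis
      by (intro int_div_pos_eq[of _ _ _ "z $ i - int L * w $ i", symmetric]) auto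
  qed
  from this[OF z(1)] this[OF z(2)] assms(1) show False by (simp add: vec_eq_iff)
qed

definition window :: "nat \<Rightarrow> int^'n \<Rightarrow> (int^'n) set" where
  "window m a = {w. \<forall>i. w $ i \<in> {a $ i ..< a $ i + int m}}"

lemma window:
  fixes a :: "int^'n"
  shows "finite (window m a)" "card (window m a) = m ^ CARD('n)"
proof -
  have eq: "window m a = (\<lambda>w. w + a) ` {w. \<forall>i. w $ i \<in> {0..<int m}}"
  proof (intro set_eqI iffI)
    fix w assume "w \<in> window m a"
    then have "w - a \<in> {w. \<forall>i. w $ i \<in> {0..<int m}}" by (auto simp: window_def algebra_simps)
    then show "w \<in> (\<lambda>w. w + a) ` {w. \<forall>i. w $ i \<in> {0..<int m}}" by (rule image_eqI[rotated]) simp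
  qed (auto simp: window_def)
  show "finite (window m a)" unfolding eq by (intro finite_imageI card_int_vec) simp
  show "card (window m a) = m ^ CARD('n)"
    unfolding eq using card_int_vec(2)[of "{0..<int m}", where 'n='n]
    by (subst card_image) (auto simp: inj_on_def)
qed

text \<open>Sparseness is measured by \<open>\<xi>\<close> rather than by obstacle volume, since
  independence is assumed of \<open>\<xi>\<close>. For almost every \<omega>, the obstacles fill
  more than the fraction \<eta> of a block that is not sparse.\<close>

definition sparse_blocks :: "(int^'n \<Rightarrow> 'w \<Rightarrow> real) \<Rightarrow> real \<Rightarrow> nat \<Rightarrow> 'w \<Rightarrow> (int^'n) set" where
  "sparse_blocks \<xi> \<eta> L \<omega> = {w. (\<Sum>z\<in>block_cells L w. \<xi> z \<omega>) \<le> \<eta> * real (L ^ CARD('n))}"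

text \<open>Windows consist of m^d blocks, their lowest corners range over [-T, T]^d in block
  coordinates, and v bounds volume: the number of blocks is multiplied by L^d. Depending on
  \<open>\<xi>\<close> alone, this is a genuine event.\<close>

definition few_sparse :: "'w measure \<Rightarrow> (int^'n \<Rightarrow> 'w \<Rightarrow> real) \<Rightarrow> real \<Rightarrow> nat \<Rightarrow> nat \<Rightarrow> int \<Rightarrow> real \<Rightarrow> 'w set" where
  "few_sparse M \<xi> \<eta> L m T v = {\<omega> \<in> space M. \<forall>a. (\<forall>i. a $ i \<in> {-T..T}) \<longrightarrow>
     real (card (window m a \<inter> sparse_blocks \<xi> \<eta> L \<omega>) * L ^ CARD('n)) \<le> v}"

context prob_space begin

text \<open>If a window has sparse volume above v, the set A of its sparse blocks has a
  \<open>\<xi>\<close>-sum over cells of at most \<eta> times their number, which has probability at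
  most p'^v. The union bound runs over (2 T + 1)^d corners and at most 2^(m^d) subsets A.\<close>

lemma few_sparse_prob:
  fixes \<xi> :: "int^'n \<Rightarrow> 'a \<Rightarrow> real"
  assumes rv[measurable]: "\<And>z. \<xi> z \<in> borel_measurable M"
    and tail: "\<And>C. finite C \<Longrightarrow> prob {\<omega> \<in> space M. (\<Sum>z\<in>C. \<xi> z \<omega>) \<le> \<eta> * real (card C)} \<le> p' ^ card C"
    and p': "0 < p'" "p' < 1" and L: "L > 0" and T: "T \<ge> 0"
  shows "few_sparse M \<xi> \<eta> L m T v \<in> sets M"
    "1 - real_of_int (2 * T + 1) ^ CARD('n) * 2 ^ (m ^ CARD('n)) * p' powr v \<le> prob (few_sparse M \<xi> \<eta> L m T v)"
proof -
  let ?I = "{a::int^'n. \<forall>i. a $ i \<in> {-T..T}}"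
  have fI: "finite ?I" and cI: "card ?I = nat (2 * T + 1) ^ CARD('n)"
    using card_int_vec[of "{-T..T}", where 'n='n] by (auto simp: algebra_simps)
  define Bad where "Bad A = {\<omega> \<in> space M. A \<subseteq> sparse_blocks \<xi> \<eta> L \<omega>}" for A
  have Bad_sets: "Bad A \<in> sets M" if "finite A" for A
  proof -
    have "Bad A = {\<omega> \<in> space M. \<forall>w\<in>A. (\<Sum>z\<in>block_cells L w. \<xi> z \<omega>) \<le> \<eta> * real (L ^ CARD('n))}"
      by (auto simp: Bad_def sparse_blocks_def)
    also have "\<dots> \<in> sets M" using that by measurable
    finally show ?thesis .
  qed
  have Bad_prob: "prob (Bad A) \<le> p' powr v" if A: "finite A" "v < real (card A * L ^ CARD('n))" for A
  proof -
    \<comment> \<open>Blocks are disjoint, so the number of cells is the volume and the block sums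
      add up to one sum to which \<open>tail\<close> applies.\<close>
    define C where "C = (\<Union>w\<in>A. block_cells L w)"
    have fC: "finite C" using A by (auto simp: C_def block_cells)
    have cC: "card C = card A * L ^ CARD('n)"
      unfolding C_def using A block_cells_disjoint[OF _ L]
      by (subst card_UN_disjoint) (auto simp: block_cells)
    have "Bad A \<subseteq> {\<omega> \<in> space M. (\<Sum>z\<in>C. \<xi> z \<omega>) \<le> \<eta> * real (card C)}"
    proof
      fix \<omega> assume \<omega>: "\<omega> \<in> Bad A"
      have "(\<Sum>z\<in>C. \<xi> z \<omega>) = (\<Sum>w\<in>A. \<Sum>z\<in>block_cells L w. \<xi> z \<omega>)"
        unfolding C_def using A block_cells_disjoint[OF _ L]
        by (intro sum.UNION_disjoint) (auto simp: block_cells)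
      also have "\<dots> \<le> (\<Sum>w\<in>A. \<eta> * real (L ^ CARD('n)))"
        using \<omega> by (intro sum_mono) (auto simp: Bad_def sparse_blocks_def)
      also have "\<dots> = \<eta> * real (card C)" by (simp add: cC)
      finally show "\<omega> \<in> {\<omega> \<in> space M. (\<Sum>z\<in>C. \<xi> z \<omega>) \<le> \<eta> * real (card C)}"
        using \<omega> by (simp add: Bad_def)
    qed
    then have "prob (Bad A) \<le> prob {\<omega> \<in> space M. (\<Sum>z\<in>C. \<xi> z \<omega>) \<le> \<eta> * real (card C)}"
      by (intro finite_measure_mono) measurable
    also have "\<dots> \<le> p' ^ card C" by (rule tail[OF fC])
    also have "\<dots> = p' powr real (card C)" using p' by (simp add: powr_realpow)
    also have "\<dots> \<le> p' powr v" using p' A(2) cC by (intro powr_mono') auto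
    finally show ?thesis .
  qed
  define \<A> where "\<A> a = {A. A \<subseteq> window m a \<and> v < real (card A * L ^ CARD('n))}" for a :: "int^'n"
  have f\<A>: "finite (\<A> a)" and c\<A>: "card (\<A> a) \<le> 2 ^ (m ^ CARD('n))" for a
  proof -
    have "\<A> a \<subseteq> Pow (window m a)" by (auto simp: \<A>_def)
    moreover have "finite (Pow (window m a))" using window(1)[of m a] by simp
    ultimately show "finite (\<A> a)" "card (\<A> a) \<le> 2 ^ (m ^ CARD('n))"
      using finite_subset[of "\<A> a" "Pow (window m a)"] card_mono[of "Pow (window m a)" "\<A> a"]
      by (auto simp: card_Pow window)
  qed
  have finA: "finite A" if "A \<in> \<A> a" for A a
    using that finite_subset[OF _ window(1)[of m a], of A] by (auto simp: \<A>_def)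
  let ?N = "\<Union>a\<in>?I. \<Union>A\<in>\<A> a. Bad A"
  have eq: "few_sparse M \<xi> \<eta> L m T v = space M - ?N"
  proof (intro set_eqI iffI)
    fix \<omega> assume \<omega>: "\<omega> \<in> few_sparse M \<xi> \<eta> L m T v"
    have False if a: "a \<in> ?I" and A: "A \<in> \<A> a" "\<omega> \<in> Bad A" for a A
    proof -
      have "A \<subseteq> window m a \<inter> sparse_blocks \<xi> \<eta> L \<omega>" using A by (auto simp: \<A>_def Bad_def)
      then have "card A \<le> card (window m a \<inter> sparse_blocks \<xi> \<eta> L \<omega>)"
        by (intro card_mono finite_Int) (auto simp: window)
      then have "card A * L ^ CARD('n) \<le> card (window m a \<inter> sparse_blocks \<xi> \<eta> L \<omega>) * L ^ CARD('n)" by simp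
      then have "real (card A * L ^ CARD('n)) \<le> real (card (window m a \<inter> sparse_blocks \<xi> \<eta> L \<omega>) * L ^ CARD('n))"
        by (rule of_nat_mono)
      also have "\<dots> \<le> v" using \<omega> a unfolding few_sparse_def by blast
      finally show False using A by (simp add: \<A>_def)
    qed
    then show "\<omega> \<in> space M - ?N" using \<omega> by (auto simp: few_sparse_def)
  next
    fix \<omega> assume \<omega>: "\<omega> \<in> space M - ?N"
    have "real (card (window m a \<inter> sparse_blocks \<xi> \<eta> L \<omega>) * L ^ CARD('n)) \<le> v" if "a \<in> ?I" for a
    proof (rule ccontr)
      assume "\<not> real (card (window m a \<inter> sparse_blocks \<xi> \<eta> L \<omega>) * L ^ CARD('n)) \<le> v"
      then have "window m a \<inter> sparse_blocks \<xi> \<eta> L \<omega> \<in> \<A> a" by (auto simp: \<A>_def)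
      moreover have "\<omega> \<in> Bad (window m a \<inter> sparse_blocks \<xi> \<eta> L \<omega>)" using \<omega> by (auto simp: Bad_def)
      ultimately show False using \<omega> that by blast
    qed
    then show "\<omega> \<in> few_sparse M \<xi> \<eta> L m T v" using \<omega> by (simp add: few_sparse_def)
  qed
  have Na: "(\<Union>A\<in>\<A> a. Bad A) \<in> sets M" for a
    using f\<A> finA Bad_sets by (intro sets.finite_UN) auto
  have N: "?N \<in> sets M" by (rule sets.finite_UN[OF fI Na])
  show "few_sparse M \<xi> \<eta> L m T v \<in> sets M" unfolding eq using N by auto
  have "prob ?N \<le> (\<Sum>a\<in>?I. prob (\<Union>A\<in>\<A> a. Bad A))"
    by (rule finite_measure_subadditive_finite[OF fI]) (intro image_subsetI Na)
  also have "\<dots> \<le> (\<Sum>a\<in>?I. 2 ^ (m ^ CARD('n)) * p' powr v)"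
  proof (rule sum_mono)
    fix a
    have "prob (\<Union>A\<in>\<A> a. Bad A) \<le> (\<Sum>A\<in>\<A> a. prob (Bad A))"
      by (rule finite_measure_subadditive_finite[OF f\<A>]) (intro image_subsetI Bad_sets finA)
    also have "\<dots> \<le> (\<Sum>A\<in>\<A> a. p' powr v)"
      using finA by (intro sum_mono Bad_prob) (auto simp: \<A>_def)
    also have "\<dots> = real (card (\<A> a)) * p' powr v" by simp
    also have "\<dots> \<le> 2 ^ (m ^ CARD('n)) * p' powr v"
    proof (rule mult_right_mono)
      have "real (card (\<A> a)) \<le> real (2 ^ (m ^ CARD('n)))" using c\<A> by (rule of_nat_mono)
      then show "real (card (\<A> a)) \<le> 2 ^ (m ^ CARD('n))" by simp
    qed simp
    finally show "prob (\<Union>A\<in>\<A> a. Bad A) \<le> 2 ^ (m ^ CARD('n)) * p' powr v" .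
  qed
  also have "\<dots> = real_of_int (2 * T + 1) ^ CARD('n) * 2 ^ (m ^ CARD('n)) * p' powr v"
    using T by (simp only: sum_constant cI) simp
  finally show "1 - real_of_int (2 * T + 1) ^ CARD('n) * 2 ^ (m ^ CARD('n)) * p' powr v \<le> prob (few_sparse M \<xi> \<eta> L m T v)"
    unfolding eq using N by (simp add: prob_compl)
qed

end

section \<open>Comparison with the sparse region\<close>

lemma unit_cell_eq: "unit_cell z = grid_cell (-1/2) 1 z"
  unfolding unit_cell_def grid_cell_def
  by (intro Collect_cong all_cong1) (auto simp: algebra_simps)

text \<open>Unit cells are centred at integer points, hence the offset -1/2 of the grid of
  blocks.\<close>

lemma unit_cell_subset_block:
  assumes "z \<in> block_cells L w"
  shows "unit_cell z \<subseteq> grid_cell (-1/2) (real L) w"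
proof
  fix x assume x: "x \<in> unit_cell z"
  have "- 1/2 + real L * of_int (w $ i) < x $ i \<and> x $ i \<le> - 1/2 + real L * of_int (w $ i) + real L" for i
  proof -
    have z: "int L * w $ i \<le> z $ i" "z $ i < int L * w $ i + int L"
      using assms by (auto simp: block_cells_def)
    from z(2) have "z $ i + 1 \<le> int L * w $ i + int L" by linarith
    with z(1) have "real_of_int (int L * w $ i) \<le> of_int (z $ i)" "real_of_int (z $ i + 1) \<le> of_int (int L * w $ i + int L)"
      by (simp_all only: of_int_le_iff)
    moreover have "- 1/2 < x $ i - of_int (z $ i)" "x $ i - of_int (z $ i) \<le> 1/2"
      using x by (auto simp: unit_cell_def)
    ultimately show ?thesis by simp
  qed
  then show "x \<in> grid_cell (-1/2) (real L) w" by (simp add: grid_cell_def)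
qed

lemma measure_obstacles_block:
  fixes S :: "(real^'n) set"
  assumes S: "S \<in> sets borel" and vol: "\<And>z. \<xi> z \<omega> \<le> measure lebesgue (S \<inter> unit_cell z)" and L: "L > 0"
  shows "(\<Sum>z\<in>block_cells L w. \<xi> z \<omega>) \<le> measure lborel (S \<inter> grid_cell (-1/2) (real L) w)"
proof -
  have disj: "unit_cell z \<inter> unit_cell z' = {}" if "z \<noteq> z'" for z z' :: "int^'n"
    using that by (auto simp: unit_cell_eq grid_cell_iff)
  have fin: "emeasure lborel (grid_cell a h w) \<noteq> \<infinity>" if "h > 0" for a h and w :: "int^'n"
    using emeasure_grid_cell[OF that, of a w] by simp
  have finS: "emeasure lborel (S \<inter> grid_cell a h w) \<noteq> \<infinity>" if "h > 0" for a h and w :: "int^'n"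
    using emeasure_mono[of "S \<inter> grid_cell a h w" "grid_cell a h w" lborel] fin[OF that]
    by (metis Int_lower2 grid_cell_borel infinity_ennreal_def sets_lborel top.extremum_unique)
  have "(\<Sum>z\<in>block_cells L w. \<xi> z \<omega>) \<le> (\<Sum>z\<in>block_cells L w. measure lborel (S \<inter> unit_cell z))"
  proof (rule sum_mono)
    fix z
    have "S \<inter> unit_cell z \<in> sets borel" using S by (simp add: unit_cell_eq)
    then show "\<xi> z \<omega> \<le> measure lborel (S \<inter> unit_cell z)" using vol[of z] by simp
  qed
  also have "\<dots> = measure lborel (\<Union>z\<in>block_cells L w. S \<inter> unit_cell z)"
    using S disj finS[of 1] block_cells[of L w]
    by (intro measure_UNION'[symmetric]) (auto simp: unit_cell_eq fmeasurable_def pairwise_def disjnt_def top.not_eq_extremum)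
  also have "\<dots> \<le> measure lborel (S \<inter> grid_cell (-1/2) (real L) w)"
  proof (rule measure_mono_fmeasurable)
    show "(\<Union>z\<in>block_cells L w. S \<inter> unit_cell z) \<subseteq> S \<inter> grid_cell (-1/2) (real L) w"
      using unit_cell_subset_block by blast
    show "(\<Union>z\<in>block_cells L w. S \<inter> unit_cell z) \<in> sets lborel"
      using S block_cells[of L w] by (intro sets.finite_UN) (auto simp: unit_cell_eq)
    show "S \<inter> grid_cell (-1/2) (real L) w \<in> fmeasurable lborel"
      using S finS[of "real L"] L by (auto simp: fmeasurable_def top.not_eq_extremum)
  qed
  finally show ?thesis .
qed

text \<open>Blocks that miss the open cube are dropped: a test field in the cube vanishes on them,
  and the remaining ones lie in the range of corners that \<open>few_sparse\<close>
  controls.\<close>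

definition sparse_region :: "(int^'n) set \<Rightarrow> nat \<Rightarrow> real \<Rightarrow> (real^'n) set" where
  "sparse_region W L t = (\<Union>w\<in>{w\<in>W. grid_cell (-1/2) (real L) w \<inter> open_cube t \<noteq> {}}. grid_cell (-1/2) (real L) w)"

lemma sparse_region_borel [measurable]: "sparse_region W L t \<in> sets borel"
  unfolding sparse_region_def by (intro sets.countable_UN') (auto intro: countable_subset[OF subset_UNIV])

text \<open>On a block that is not sparse, u vanishes on obstacles filling at least the fraction
  \<eta>, so \<open>poincare_vanishing\<close> applies with diameter bound L d; the factor 1 /
  \<eta> is the volume ratio. A sparse block outside the region misses the cube, and u is zero
  there.\<close>

lemma mass_outside_sparse_region:
  fixes u :: "real^'n \<Rightarrow> real^'n"
  assumes u: "u \<in> test_functions (open_cube t - S)" and S: "S \<in> sets borel"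
    and vol: "\<And>z. \<xi> z \<omega> \<le> measure lebesgue (S \<inter> unit_cell z)" and L: "L > 0" and \<eta>: "\<eta> > 0"
  shows "sqint (\<lambda>x. indicator (- sparse_region (sparse_blocks \<xi> \<eta> L \<omega>) L t) x *\<^sub>R u x) \<le>
    ((real L * real CARD('n))\<^sup>2 * 2 ^ CARD('n) / \<eta>) * sqint (gradient u)"
proof -
  define W where "W = sparse_blocks \<xi> \<eta> L \<omega>"
  define B where "B = sparse_region W L t"
  have [measurable]: "B \<in> sets borel" by (simp add: B_def)
  define C where "C = (real L * real CARD('n))\<^sup>2 * 2 ^ CARD('n) / \<eta>"
  have C: "C \<ge> 0" using \<eta> by (simp add: C_def)
  have us: "smooth u" by (rule test_smooth[OF u])
  note [measurable] = test_borel[OF u] gradient_borel[OF us]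
  have L0: "real L > 0" using L by simp
  let ?f = "\<lambda>x. ennreal ((norm (indicator (- B) x *\<^sub>R u x))\<^sup>2)"
  let ?g = "\<lambda>x. ennreal C * ennreal ((norm (gradient u x))\<^sup>2)"
  have mf: "?f \<in> borel_measurable borel" by measurable
  have mg: "?g \<in> borel_measurable borel" by measurable
  have "(\<integral>\<^sup>+x. ?f x \<partial>lborel) \<le> (\<integral>\<^sup>+x. ?g x \<partial>lborel)"
  proof (rule nn_integral_le_grid[OF mf mg L0, of "-1/2"])
    fix w :: "int^'n"
    let ?Q = "grid_cell (-1/2) (real L) w"
    show "(\<integral>\<^sup>+x. indicator ?Q x * ?f x \<partial>lborel) \<le> (\<integral>\<^sup>+x. indicator ?Q x * ?g x \<partial>lborel)"
    proof (cases "w \<in> W")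
      case True
      have "indicator ?Q x * ?f x = 0" for x
      proof (cases "x \<in> ?Q \<and> x \<notin> B")
        case 1: True
        then have "x \<notin> open_cube t" using True by (auto simp: B_def sparse_region_def)
        then have "u x = 0" using test_eq_0[OF u, of x] by simp
        then show ?thesis by simp
      qed (auto simp: indicator_def)
      then show ?thesis by (intro nn_integral_mono) (simp only: zero_le)
    next
      case False
      have "\<eta> * real L ^ CARD('n) \<le> measure lborel (S \<inter> ?Q)"
        using measure_obstacles_block[of S \<xi> \<omega> L w, OF S vol L] False by (simp add: W_def sparse_blocks_def)
      moreover have "emeasure lborel (S \<inter> ?Q) = ennreal (measure lborel (S \<inter> ?Q))"
      proof (rule emeasure_eq_ennreal_measure)
        have "emeasure lborel (S \<inter> ?Q) \<le> emeasure lborel ?Q" using S by (intro emeasure_mono) auto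
        also have "\<dots> < top" by (simp add: emeasure_grid_cell[OF L0])
        finally show "emeasure lborel (S \<inter> ?Q) \<noteq> top" by simp
      qed
      ultimately have eS: "ennreal (\<eta> * real L ^ CARD('n)) \<le> emeasure lborel (S \<inter> ?Q)"
        by (simp only: ennreal_leI)
      let ?U = "\<integral>\<^sup>+x. indicator ?Q x * ennreal ((norm (u x))\<^sup>2) \<partial>lborel"
      let ?G = "\<integral>\<^sup>+x. indicator ?Q x * ennreal ((norm (gradient u x))\<^sup>2) \<partial>lborel"
      let ?k = "\<eta> * real L ^ CARD('n)"
      have k: "?k > 0" using \<eta> L by simp
      have "ennreal ?k * ?U \<le> emeasure lborel (S \<inter> ?Q) * ?U" by (rule mult_right_mono[OF eS]) simp
      also have "\<dots> \<le> ennreal ((real L * real CARD('n))\<^sup>2) * 2 ^ CARD('n) * emeasure lborel ?Q * ?G"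
      proof (rule poincare_vanishing[OF us grid_cell_borel grid_cell_convex])
        show "\<And>x y. x \<in> ?Q \<Longrightarrow> y \<in> ?Q \<Longrightarrow> norm (x - y) \<le> real L * real CARD('n)"
          by (rule grid_cell_diam) auto
        show "\<And>x. x \<in> S \<inter> ?Q \<Longrightarrow> u x = 0" using test_eq_0[OF u] by auto
      qed (use S in auto)
      also have "\<dots> = ennreal ?k * (ennreal C * ?G)"
      proof -
        have "(real L * real CARD('n))\<^sup>2 * 2 ^ CARD('n) * real L ^ CARD('n) = ?k * C"
          using \<eta> by (simp add: C_def)
        then have "ennreal ((real L * real CARD('n))\<^sup>2) * ennreal (2 ^ CARD('n)) * ennreal (real L ^ CARD('n)) = ennreal ?k * ennreal C"
          using k C by (simp only: ennreal_mult[symmetric] zero_le_power2 zero_le_power zero_le_numeral of_nat_0_le_iff mult_nonneg_nonneg less_imp_le)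
        then show ?thesis
          by (simp add: emeasure_grid_cell[OF L0] ennreal_power[symmetric] mult.assoc[symmetric])
      qed
      finally have le: "?U \<le> ennreal C * ?G" using k L by (subst (asm) ennreal_mult_le_mult_iff) auto
      have "(\<integral>\<^sup>+x. indicator ?Q x * ?f x \<partial>lborel) \<le> ?U"
        by (intro nn_integral_mono mult_left_mono) (auto simp: indicator_def)
      also have "\<dots> \<le> ennreal C * ?G" by (rule le)
      also have "\<dots> = (\<integral>\<^sup>+x. indicator ?Q x * ?g x \<partial>lborel)"
        by (subst nn_integral_cmult[symmetric]) (auto simp: mult.left_commute)
      finally show ?thesis .
    qed
  qed
  also have "(\<integral>\<^sup>+x. ?f x \<partial>lborel) = ennreal (sqint (\<lambda>x. indicator (- B) x *\<^sub>R u x))"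
    by (intro sqint_eq_nn_integral square_integrable_indicator test_square_integrable[OF u]) auto
  also have "(\<integral>\<^sup>+x. ?g x \<partial>lborel) = ennreal C * ennreal (sqint (gradient u))"
    by (simp add: nn_integral_cmult sqint_eq_nn_integral gradient_square_integrable[OF u])
  also have "\<dots> = ennreal (C * sqint (gradient u))" using C by (simp add: ennreal_mult)
  finally show ?thesis unfolding B_def W_def C_def[symmetric] using C by (subst (asm) ennreal_le_iff) auto
qed

text \<open>The blocks meeting a cube of half-side \<rho> fit into one window of m blocks per
  coordinate. If one of them also meets the open cube, the corner of this window is within the range
  T; otherwise the intersection is empty.\<close>

lemma volume_sparse_region:
  fixes y :: "real^'n"
  assumes \<omega>: "\<omega> \<in> few_sparse M \<xi> \<eta> L m T v" and L: "L > 0" and \<rho>: "\<rho> \<ge> 0"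
    and m: "2 * \<rho> / real L + 1 \<le> real m" and T: "t + 2 + real m \<le> real_of_int T" and t: "t \<ge> 0" and v: "v \<ge> 0"
  shows "emeasure lborel (sparse_region (sparse_blocks \<xi> \<eta> L \<omega>) L t \<inter> cube \<rho> y) \<le> ennreal v"
proof -
  define A where "A = {w \<in> sparse_blocks \<xi> \<eta> L \<omega>. grid_cell (-1/2) (real L) w \<inter> open_cube t \<noteq> {} \<and> grid_cell (-1/2) (real L) w \<inter> cube \<rho> y \<noteq> {}}"
  \<comment> \<open>The index of the block containing the lower corner of the cube; minus one
    because blocks are open on the left.\<close>
  define a :: "int^'n" where "a = (\<chi> i. \<lceil>(y $ i - \<rho> + 1/2) / real L\<rceil> - 1)"
  have L0: "real L > 0" "real L \<ge> 1" using L by auto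
  have win: "a $ i \<le> w $ i \<and> w $ i < a $ i + int m" if w: "w \<in> A" for w i
  proof -
    obtain x where "x \<in> grid_cell (-1/2) (real L) w" "x \<in> cube \<rho> y" using w by (auto simp: A_def)
    then have x: "-1/2 + real L * of_int (w $ i) < x $ i" "x $ i \<le> -1/2 + real L * of_int (w $ i) + real L" "\<bar>x $ i - y $ i\<bar> \<le> \<rho>"
      by (auto simp: grid_cell_def cube_def)
    let ?q = "(y $ i - \<rho> + 1/2) / real L"
    have "y $ i - \<rho> + 1/2 \<le> (of_int (w $ i) + 1) * real L" using x by (simp add: algebra_simps abs_le_iff)
    then have "?q \<le> of_int (w $ i) + 1" using L0 by (simp add: pos_divide_le_eq)
    then have "\<lceil>?q\<rceil> \<le> w $ i + 1" by (simp add: ceiling_le_iff)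
    then have 1: "a $ i \<le> w $ i" by (simp add: a_def)
    have "of_int (w $ i) * real L < y $ i + \<rho> + 1/2" using x by (simp add: algebra_simps abs_le_iff)
    then have "of_int (w $ i) < (y $ i + \<rho> + 1/2) / real L" using L0 by (simp add: pos_less_divide_eq)
    also have "\<dots> = ?q + 2 * \<rho> / real L" using L0 by (simp add: field_simps)
    also have "\<dots> \<le> of_int (a $ i) + 1 + (real m - 1)"
    proof (rule add_mono)
      show "?q \<le> of_int (a $ i) + 1" by (simp add: a_def)
      show "2 * \<rho> / real L \<le> real m - 1" using m by simp
    qed
    finally have "real_of_int (w $ i) < of_int (a $ i + int m)" by simp
    then have "w $ i < a $ i + int m" by (simp only: of_int_less_iff)
    with 1 show ?thesis by simp
  qed
  have sub: "A \<subseteq> window m a \<inter> sparse_blocks \<xi> \<eta> L \<omega>"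
    using win by (auto simp: window_def A_def)
  have finA: "finite A" using sub window(1)[of m a] by (meson finite_Int finite_subset)
  have card: "real (card A * L ^ CARD('n)) \<le> v"
  proof (cases "A = {}")
    case False
    then obtain w where w: "w \<in> A" by blast
    have "a $ i \<in> {-T..T}" for i
    proof -
      obtain x where "x \<in> grid_cell (-1/2) (real L) w" "x \<in> open_cube t" using w by (auto simp: A_def)
      then have x: "-1/2 + real L * of_int (w $ i) < x $ i" "x $ i \<le> -1/2 + real L * of_int (w $ i) + real L" "- t/2 < x $ i" "x $ i < t/2"
        by (auto simp: grid_cell_def open_cube_def)
      \<comment> \<open>Since L is at least 1, a block meeting the open cube has indices of modulus
        at most t + 2, a generous bound; the window corner is at most m away.\<close>
      have up: "real_of_int (w $ i) \<le> t + 2"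
      proof (rule ccontr)
        assume "\<not> real_of_int (w $ i) \<le> t + 2"
        then have "t + 2 < real_of_int (w $ i)" by simp
        moreover from this have "1 * real_of_int (w $ i) \<le> real L * of_int (w $ i)" using L0 t by (intro mult_right_mono) auto
        ultimately show False using x(1,4) t by simp
      qed
      have lo: "- (t + 2) \<le> real_of_int (w $ i)"
      proof (rule ccontr)
        assume "\<not> - (t + 2) \<le> real_of_int (w $ i)"
        then have neg: "real_of_int (w $ i) + 1 < - (t + 1)" by simp
        then have "real L * (of_int (w $ i) + 1) \<le> 1 * (of_int (w $ i) + 1)" using L0 t by (intro mult_right_mono_neg) auto
        then show False using x(2,3) neg t by (simp add: distrib_left)
      qed
      have "real_of_int (a $ i) \<le> of_int (w $ i)" "real_of_int (w $ i) \<le> of_int (a $ i + int m)"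
        using win[OF w, of i] by (simp_all only: of_int_le_iff) auto
      then have "real_of_int (a $ i) \<le> of_int T" "real_of_int (- T) \<le> of_int (a $ i)" using up lo T by auto
      then show ?thesis by (simp only: of_int_le_iff) simp
    qed
    then have "real (card (window m a \<inter> sparse_blocks \<xi> \<eta> L \<omega>) * L ^ CARD('n)) \<le> v"
      using \<omega> unfolding few_sparse_def by blast
    moreover have "card A \<le> card (window m a \<inter> sparse_blocks \<xi> \<eta> L \<omega>)"
      using sub by (intro card_mono finite_Int) (auto simp: window)
    then have "real (card A * L ^ CARD('n)) \<le> real (card (window m a \<inter> sparse_blocks \<xi> \<eta> L \<omega>) * L ^ CARD('n))"
      by (intro of_nat_mono mult_right_mono) auto
    ultimately show ?thesis by linarith
  qed (use v in simp)
  have "emeasure lborel (sparse_region (sparse_blocks \<xi> \<eta> L \<omega>) L t \<inter> cube \<rho> y) \<le> emeasure lborel (\<Union>w\<in>A. grid_cell (-1/2) (real L) w)"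
    using finA by (intro emeasure_mono sets.finite_UN) (auto simp: sparse_region_def A_def)
  also have "\<dots> \<le> (\<Sum>w\<in>A. emeasure lborel (grid_cell (-1/2) (real L) w))"
    using finA by (intro emeasure_subadditive_finite) auto
  also have "\<dots> = ennreal (real (card A * L ^ CARD('n)))"
    by (simp add: emeasure_grid_cell[OF L0(1)] ennreal_mult ennreal_of_nat_eq_real_of_nat flip: ennreal_power)
  also have "\<dots> \<le> ennreal v" by (rule ennreal_leI[OF card])
  finally show ?thesis .
qed

text \<open>Dilation by R: volumes scale by R^d, energy and squared divergence relative to mass by
  R^2, so the inequality with window 1 / \<delta> at unit scale becomes one with window R /
  \<delta>.\<close>

lemma scaled_energy_bound:
  fixes u :: "real^'n \<Rightarrow> real^'n"
  assumes eb: "\<And>(u :: real^'n \<Rightarrow> real^'n) B. u \<in> test_functions UNIV \<Longrightarrow> B \<in> sets borel \<Longrightarrow>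
      (\<And>y. emeasure lborel (B \<inter> cube (1 / \<delta>) y) \<le> ennreal V) \<Longrightarrow>
      sqint (\<lambda>x. indicator (- B) x *\<^sub>R u x) \<le> \<delta> * sqint u \<Longrightarrow>
      sqint (\<lambda>x. trace (gradient u x)) \<le> \<delta> * sqint u \<Longrightarrow> s * sqint u \<le> sqint (gradient u)"
    and R: "R > 0" and u: "u \<in> test_functions UNIV" and B[measurable]: "B \<in> sets borel"
    and vol: "\<And>y. emeasure lborel (B \<inter> cube (R / \<delta>) y) \<le> ennreal (V * R ^ CARD('n))" and V: "V \<ge> 0"
    and out: "sqint (\<lambda>x. indicator (- B) x *\<^sub>R u x) \<le> \<delta> * sqint u"
    and div: "R\<^sup>2 * sqint (\<lambda>x. trace (gradient u x)) \<le> \<delta> * sqint u"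
  shows "s * sqint u \<le> R\<^sup>2 * sqint (gradient u)"
proof -
  define k where "k = R ^ CARD('n)"
  have k: "k > 0" using R by (simp add: k_def)
  note su = test_square_integrable[OF u] and sg = gradient_square_integrable[OF u]
  define w where "w x = u (R *\<^sub>R x + 0)" for x
  have w: "w \<in> test_functions UNIV" unfolding w_def[abs_def] using R by (intro test_affine u) auto
  have w1: "sqint w = sqint u / k" unfolding w_def[abs_def] k_def by (rule sqint_affine[OF su R])
  have gw: "gradient w x = R *\<^sub>R gradient u (R *\<^sub>R x + 0)" for x
    unfolding w_def[abs_def] by (rule gradient_affine[OF test_smooth[OF u]])
  have w2: "sqint (gradient w) = R\<^sup>2 * (sqint (gradient u) / k)"
    unfolding ext[of "gradient w", OF gw] sqint_scaleR k_def by (simp only: sqint_affine[OF sg R])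
  have w3: "sqint (\<lambda>x. trace (gradient w x)) = R\<^sup>2 * (sqint (\<lambda>x. trace (gradient u x)) / k)"
    unfolding gw trace_scaleR k_def sqint_affine[OF square_integrable_trace(1)[OF sg] R, of 0, symmetric]
    using sqint_scaleR[of R "\<lambda>x. trace (gradient u (R *\<^sub>R x + 0))"] by simp
  define C where "C = (\<lambda>x. R *\<^sub>R x + 0) -` B"
  have C[measurable]: "C \<in> sets borel"
    using measurable_sets[of "\<lambda>x::real^'n. R *\<^sub>R x + 0" borel borel B] by (simp add: C_def)
  have w4: "sqint (\<lambda>x. indicator (- C) x *\<^sub>R w x) = sqint (\<lambda>x. indicator (- B) x *\<^sub>R u x) / k"
  proof -
    have "(\<lambda>x. indicator (- C) x *\<^sub>R w x) = (\<lambda>x. indicator (- B) (R *\<^sub>R x + 0) *\<^sub>R u (R *\<^sub>R x + 0))"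
      by (auto simp: C_def w_def indicator_def)
    then show ?thesis
      unfolding k_def using sqint_affine[OF square_integrable_indicator(1)[OF su, of "- B"] R, of 0] by simp
  qed
  have volC: "emeasure lborel (C \<inter> cube (1 / \<delta>) y) \<le> ennreal V" for y
  proof -
    have "emeasure lborel (C \<inter> cube (1 / \<delta>) y) = (\<integral>\<^sup>+x. indicator (C \<inter> cube (1 / \<delta>) y) x \<partial>lborel)"
      by simp
    also have "\<dots> \<le> (\<integral>\<^sup>+x. indicator (B \<inter> cube (R / \<delta>) (R *\<^sub>R y)) (0 + R *\<^sub>R x) \<partial>lborel)"
    proof (rule nn_integral_mono)
      fix x
      have "R *\<^sub>R x \<in> cube (R / \<delta>) (R *\<^sub>R y)" if "x \<in> cube (1 / \<delta>) y"
      proof -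
        have "\<bar>(R *\<^sub>R x) $ i - (R *\<^sub>R y) $ i\<bar> \<le> R / \<delta>" for i
        proof -
          have "\<bar>(R *\<^sub>R x) $ i - (R *\<^sub>R y) $ i\<bar> = R * \<bar>x $ i - y $ i\<bar>"
            using R by (simp add: right_diff_distrib[symmetric] abs_mult)
          also have "\<dots> \<le> R * (1 / \<delta>)" using that R by (intro mult_left_mono) (auto simp: cube_def)
          finally show ?thesis by simp
        qed
        then show ?thesis by (simp add: cube_def)
      qed
      then show "indicator (C \<inter> cube (1 / \<delta>) y) x \<le> (indicator (B \<inter> cube (R / \<delta>) (R *\<^sub>R y)) (0 + R *\<^sub>R x) :: ennreal)"
        by (auto simp: indicator_def C_def)
    qed
    finally have 1: "emeasure lborel (C \<inter> cube (1 / \<delta>) y) \<le> (\<integral>\<^sup>+x. indicator (B \<inter> cube (R / \<delta>) (R *\<^sub>R y)) (0 + R *\<^sub>R x) \<partial>lborel)" .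
    have "ennreal k * emeasure lborel (C \<inter> cube (1 / \<delta>) y) \<le> ennreal k * (\<integral>\<^sup>+x. indicator (B \<inter> cube (R / \<delta>) (R *\<^sub>R y)) (0 + R *\<^sub>R x) \<partial>lborel)"
      by (rule mult_left_mono[OF 1]) simp
    also have "\<dots> = (\<integral>\<^sup>+x. indicator (B \<inter> cube (R / \<delta>) (R *\<^sub>R y)) x \<partial>lborel)"
      unfolding k_def by (rule nn_integral_affine[OF _ R]) measurable
    also have "\<dots> = emeasure lborel (B \<inter> cube (R / \<delta>) (R *\<^sub>R y))" by simp
    also have "\<dots> \<le> ennreal (V * R ^ CARD('n))" by (rule vol)
    also have "\<dots> = ennreal k * ennreal V" using V k by (simp add: k_def ennreal_mult mult.commute)
    finally show ?thesis using k by (subst (asm) ennreal_mult_le_mult_iff) auto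
  qed
  have "s * sqint w \<le> sqint (gradient w)"
  proof (rule eb[OF w C volC])
    show "sqint (\<lambda>x. indicator (- C) x *\<^sub>R w x) \<le> \<delta> * sqint w"
      unfolding w4 w1 using divide_right_mono[OF out, of k] k by simp
    show "sqint (\<lambda>x. trace (gradient w x)) \<le> \<delta> * sqint w"
      unfolding w3 w1 using divide_right_mono[OF div, of k] k by simp
  qed
  then show ?thesis unfolding w1 w2 using k by (simp add: divide_le_cancel)
qed

text \<open>Test functions with small energy and small divergence are the only ones to bound: if the
  claim failed for some \<phi>, the approximants of \<open>H1_0_approx\<close> would eventually
  satisfy both premises and violate the conclusion, as their divergence tends to zero while their
  mass does not.\<close>

lemma stokes_eigenvalue_ge:
  fixes G :: "(real^'n) set"
  assumes R: "R > 0" and \<delta>: "\<delta> > 0"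
    and bound: "\<And>u. u \<in> test_functions G \<Longrightarrow> R\<^sup>2 * sqint (gradient u) \<le> s * sqint u \<Longrightarrow>
      R\<^sup>2 * sqint (\<lambda>x. trace (gradient u x)) \<le> \<delta> * sqint u \<Longrightarrow> s * sqint u \<le> R\<^sup>2 * sqint (gradient u)"
  shows "ereal (s / R\<^sup>2) \<le> stokes_eigenvalue G"
  unfolding stokes_eigenvalue_def
proof (rule INF_greatest)
  fix \<phi> assume "\<phi> \<in> {\<phi> \<in> H1_0 G. div_free \<phi> \<and> \<not> (AE x in lebesgue. \<phi> x = 0)}"
  then have \<phi>: "\<phi> \<in> H1_0 G" "div_free \<phi>" "\<not> (AE x in lebesgue. \<phi> x = 0)" by auto
  note wd = weak_gradient_props[of \<phi>]
  have wl: "\<phi> \<in> weakly_diff_L2" using \<phi>(1) by (simp add: H1_0_def)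
  note s\<phi> = wd(1)[OF wl] and sw = wd(2)[OF wl]
  obtain \<psi> where \<psi>: "\<And>m. \<psi> m \<in> test_functions G" "(\<lambda>m::nat. sqint (\<lambda>x. \<psi> m x - \<phi> x)) \<longlonglongrightarrow> 0"
    "(\<lambda>m. sqint (\<lambda>x. gradient (\<psi> m) x - weak_gradient \<phi> x)) \<longlonglongrightarrow> 0"
    using H1_0_approx[OF \<phi>(1)] by blast
  have N: "sqint \<phi> > 0" using \<phi>(3) sqint_eq_0[OF s\<phi>] sqint_nonneg[of \<phi>] by linarith
  have l1: "(\<lambda>m. sqint (\<psi> m)) \<longlonglongrightarrow> sqint \<phi>"
    by (rule sqint_tendsto[OF test_square_integrable[OF \<psi>(1)] s\<phi> \<psi>(2)])
  have l2: "(\<lambda>m. sqint (gradient (\<psi> m))) \<longlonglongrightarrow> sqint (weak_gradient \<phi>)"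
    by (rule sqint_tendsto[OF gradient_square_integrable[OF \<psi>(1)] sw \<psi>(3)])
  have l3: "(\<lambda>m. sqint (\<lambda>x. trace (gradient (\<psi> m) x))) \<longlonglongrightarrow> 0"
  proof -
    have "sqint (\<lambda>x. trace (weak_gradient \<phi> x)) = 0"
      using \<phi>(2) sqint_eq_0[OF square_integrable_trace(1)[OF sw]] by (simp add: div_free_def)
    with sqint_trace_tendsto[OF gradient_square_integrable[OF \<psi>(1)] sw \<psi>(3)] show ?thesis by simp
  qed
  have "s * sqint \<phi> \<le> R\<^sup>2 * sqint (weak_gradient \<phi>)"
  proof (rule ccontr)
    assume "\<not> s * sqint \<phi> \<le> R\<^sup>2 * sqint (weak_gradient \<phi>)"
    then have "0 < s * sqint \<phi> - R\<^sup>2 * sqint (weak_gradient \<phi>)" by simp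
    moreover have "(\<lambda>m. s * sqint (\<psi> m) - R\<^sup>2 * sqint (gradient (\<psi> m))) \<longlonglongrightarrow> s * sqint \<phi> - R\<^sup>2 * sqint (weak_gradient \<phi>)"
      by (intro tendsto_intros l1 l2)
    ultimately have e1: "eventually (\<lambda>m. 0 < s * sqint (\<psi> m) - R\<^sup>2 * sqint (gradient (\<psi> m))) sequentially"
      by (intro order_tendstoD(1))
    have "(\<lambda>m. \<delta> * sqint (\<psi> m) - R\<^sup>2 * sqint (\<lambda>x. trace (gradient (\<psi> m) x))) \<longlonglongrightarrow> \<delta> * sqint \<phi> - R\<^sup>2 * 0"
      by (intro tendsto_intros l1 l3)
    moreover have "0 < \<delta> * sqint \<phi> - R\<^sup>2 * 0" using \<delta> N by simp
    ultimately have e2: "eventually (\<lambda>m. 0 < \<delta> * sqint (\<psi> m) - R\<^sup>2 * sqint (\<lambda>x. trace (gradient (\<psi> m) x))) sequentially"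
      by (rule order_tendstoD(1))
    obtain m where "0 < s * sqint (\<psi> m) - R\<^sup>2 * sqint (gradient (\<psi> m))"
      "0 < \<delta> * sqint (\<psi> m) - R\<^sup>2 * sqint (\<lambda>x. trace (gradient (\<psi> m) x))"
      using eventually_happens[OF eventually_conj[OF e1 e2]] by auto
    then show False using bound[OF \<psi>(1)[of m]] by simp
  qed
  then have "s / R\<^sup>2 \<le> sqint (weak_gradient \<phi>) / sqint \<phi>"
    using R N by (simp add: field_simps)
  then show "ereal (s / R\<^sup>2) \<le> ereal (rayleigh_quotient \<phi>)"
    by (simp add: rayleigh_quotient_def L2_norm_power2)
qed

lemma stokes_eigenvalue_nonneg: "0 \<le> stokes_eigenvalue G"
  unfolding stokes_eigenvalue_def by (intro INF_greatest) (simp add: rayleigh_quotient_def)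

text \<open>Lower bounds come from measurable subsets, whatever the measurability of A.\<close>

lemma inner_prob_bounds:
  assumes "prob_space M"
  shows "inner_prob M A \<le> 1" "\<And>B. B \<in> sets M \<Longrightarrow> B \<subseteq> A \<Longrightarrow> measure M B \<le> inner_prob M A"
proof -
  interpret prob_space M by fact
  show "inner_prob M A \<le> 1"
    unfolding inner_prob_def by (rule cSUP_least) (auto intro: exI[of _ "{}"])
  show "measure M B \<le> inner_prob M A" if "B \<in> sets M" "B \<subseteq> A" for B
    unfolding inner_prob_def by (rule cSUP_upper) (use that in \<open>auto intro!: bdd_aboveI2[where M=1]\<close>)
qed

section \<open>The limit theorem\<close>

text \<open>The exponents of t are d from the corners, at most \<kappa> from the subsets of a window
  and - V \<nu> = - d - 2 \<kappa> from the tail: in total at most - \<kappa>.\<close>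

lemma (in prob_space) few_sparse_prob_asymptotic:
  fixes \<xi> :: "int^'n \<Rightarrow> 'a \<Rightarrow> real"
  assumes rv: "\<And>z. \<xi> z \<in> borel_measurable M"
    and tail: "\<And>C. finite C \<Longrightarrow> prob {\<omega> \<in> space M. (\<Sum>z\<in>C. \<xi> z \<omega>) \<le> \<eta> * real (card C)} \<le> exp (- \<nu>) ^ card C"
    and \<nu>: "\<nu> > 0" and \<kappa>: "\<kappa> > 0" "V * \<nu> = real CARD('n) + 2 * \<kappa>"
    and L: "L > 0" and t: "t \<ge> 5" "ln t \<ge> 1"
    and m: "real m ^ CARD('n) \<le> \<kappa> * ln t" "real m \<le> ln t"
  shows "1 - 5 ^ CARD('n) * t powr (- \<kappa>) \<le> prob (few_sparse M \<xi> \<eta> L m (\<lceil>t\<rceil> + 2 + int m) (V * ln t))"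
proof -
  let ?T = "\<lceil>t\<rceil> + 2 + int m"
  have ln_le: "ln t \<le> t - 1" using t by (intro ln_le_minus_one) simp
  have ceil: "real_of_int \<lceil>t\<rceil> \<le> t + 1" "0 \<le> \<lceil>t\<rceil>" using t by linarith+
  have eqT: "real_of_int (2 * ?T + 1) = 2 * real_of_int \<lceil>t\<rceil> + 5 + 2 * real m" by simp
  \<comment> \<open>2 T + 1 is 2 \<lceil>t\<rceil> + 5 + 2 m; with m \<le> ln t \<le> t - 1 and t
    \<ge> 5 it is at most 5 t, the origin of the constant 5.\<close>
  have T: "0 \<le> ?T" "real_of_int (2 * ?T + 1) \<le> 5 * t" "0 \<le> real_of_int (2 * ?T + 1)"
    using ceil(2) ln_le ceil(1) m(2) t unfolding eqT by linarith+
  have p: "0 < exp (- \<nu>)" "exp (- \<nu>) < 1" using \<nu> by auto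
  have 1: "real_of_int (2 * ?T + 1) ^ CARD('n) \<le> 5 ^ CARD('n) * t powr real CARD('n)"
  proof -
    have "real_of_int (2 * ?T + 1) ^ CARD('n) \<le> (5 * t) ^ CARD('n)" by (rule power_mono[OF T(2,3)])
    also have "\<dots> = 5 ^ CARD('n) * t powr real CARD('n)" using t by (simp add: power_mult_distrib powr_realpow)
    finally show ?thesis .
  qed
  have 2: "(2::real) ^ (m ^ CARD('n)) \<le> t powr \<kappa>"
  proof -
    have "(2::real) ^ (m ^ CARD('n)) \<le> exp 1 ^ (m ^ CARD('n))"
      using exp_ge_add_one_self[of 1] by (intro power_mono) auto
    also have "\<dots> = exp (real (m ^ CARD('n)))" by (simp add: exp_of_nat_mult[symmetric])
    also have "\<dots> \<le> exp (\<kappa> * ln t)" using m(1) by simp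
    also have "\<dots> = t powr \<kappa>" using t by (simp add: powr_def)
    finally show ?thesis .
  qed
  have 3: "exp (- \<nu>) powr (V * ln t) = t powr (- (V * \<nu>))"
    using t by (simp add: powr_def mult_ac)
  have "real_of_int (2 * ?T + 1) ^ CARD('n) * 2 ^ (m ^ CARD('n)) * exp (- \<nu>) powr (V * ln t)
     \<le> 5 ^ CARD('n) * t powr real CARD('n) * t powr \<kappa> * t powr (- (V * \<nu>))"
    unfolding 3 using t T(3) by (intro mult_mono 1 2) (auto intro!: mult_nonneg_nonneg zero_le_power)
  also have "\<dots> = 5 ^ CARD('n) * t powr (- \<kappa>)"
    using t \<kappa>(2) by (simp add: mult.assoc flip: powr_add)
  finally show ?thesis
    using few_sparse_prob(2)[OF rv tail p L T(1), of m "V * ln t"] by linarith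
qed

theorem theorem1p1:
  fixes M :: "'w measure"
    and V :: "real^'n \<Rightarrow> 'w \<Rightarrow> real"
    and \<xi> :: "int^'n \<Rightarrow> 'w \<Rightarrow> real"
    and p \<mu> \<epsilon> :: real
  assumes dim: "CARD('n) \<ge> 2"
    and prob: "prob_space M"
    and V_meas: "(\<lambda>(x, \<omega>). V x \<omega>) \<in> borel_measurable (borel \<Otimes>\<^sub>M M)"
    and V_range: "\<And>x \<omega>. \<omega> \<in> space M \<Longrightarrow> V x \<omega> \<in> {0, 1}"
    and closed: "\<And>\<omega>. \<omega> \<in> space M \<Longrightarrow> closed (obstacles V \<omega>)"
    and indep: "prob_space.indep_vars M (\<lambda>_. borel) \<xi> UNIV"
    and ident: "\<And>z z'. distr M borel (\<xi> z) = distr M borel (\<xi> z')"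
    and range: "\<And>z. AE \<omega> in M. 0 \<le> \<xi> z \<omega> \<and> \<xi> z \<omega> \<le> 1"
    and vol: "\<And>z. AE \<omega> in M. measure lebesgue (obstacles V \<omega> \<inter> unit_cell z) \<ge> \<xi> z \<omega>"
    and p: "0 < p" "p < 1"
    and zero: "\<And>z. prob_space.prob M {\<omega> \<in> space M. \<xi> z \<omega> = 0} \<le> p"
    and mean: "\<And>z. prob_space.expectation M (\<xi> z) = \<mu>" "\<mu> > 0"
    and eps: "\<epsilon> > 0"
  defines "d \<equiv> real CARD('n)" and "\<nu> \<equiv> ln (1 / p)"
  shows "((\<lambda>t. inner_prob M {\<omega> \<in> space M.
            ereal (ln t powr (2 / d)) * stokes_eigenvalue (flow_region V t \<omega>)
              > ereal ((\<nu> / d) powr (2 / d)) * stokes_const TYPE('n) - ereal \<epsilon>}) \<longlongrightarrow> 1) at_top"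
proof -
  interpret prob_space M by (rule prob)
  have d: "d \<ge> 2" "d > 0" using dim by (auto simp: d_def)
  have \<nu>: "\<nu> > 0" "p = exp (- \<nu>)" using p by (auto simp: \<nu>_def ln_div)
  obtain S where S: "stokes_const TYPE('n) = ereal S" "S \<ge> 0"
    using stokes_const_finite[OF dim] by blast
  define X where "X = (\<nu> / d) powr (2 / d) * S"
  define Ev where "Ev t = {\<omega> \<in> space M. ereal (ln t powr (2 / d)) * stokes_eigenvalue (flow_region V t \<omega>) > ereal (X - \<epsilon>)}" for t
  have target: "ereal ((\<nu> / d) powr (2 / d)) * stokes_const TYPE('n) - ereal \<epsilon> = ereal (X - \<epsilon>)"
    by (simp add: S X_def)
  \<comment> \<open>A rate is obtained: the lower bound for the inner probability approaches 1 like
    a negative power of t.\<close>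
  have main: "\<exists>\<kappa>>0. eventually (\<lambda>t. 1 - 5 ^ CARD('n) * t powr (- \<kappa>) \<le> inner_prob M (Ev t)) at_top"
  proof (cases "X < \<epsilon>")
    case True
    \<comment> \<open>The threshold is negative and the eigenvalue nonnegative. Excluding this case
      makes \<open>s'\<close> nonnegative below.\<close>
    have "Ev t = space M" for t
    proof -
      have "ereal (X - \<epsilon>) < ereal (ln t powr (2 / d)) * stokes_eigenvalue (flow_region V t \<omega>)" for \<omega>
      proof -
        have "ereal (X - \<epsilon>) < 0" using True by simp
        also have "0 \<le> ereal (ln t powr (2 / d)) * stokes_eigenvalue (flow_region V t \<omega>)"
          by (intro ereal_0_le_mult stokes_eigenvalue_nonneg) simp
        finally show ?thesis .
      qed
      then show ?thesis by (auto simp: Ev_def)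
    qed
    then have "1 \<le> inner_prob M (Ev t)" for t
      using inner_prob_bounds(2)[OF prob, of "space M" "Ev t"] by (simp add: prob_space)
    then have "1 - 5 ^ CARD('n) * t powr (- 1) \<le> inner_prob M (Ev t)" for t
      by (rule order_trans[rotated]) simp
    then show ?thesis by (intro exI[of _ 1]) simp
  next
    case False
    \<comment> \<open>\<epsilon> is split up: a quarter pays for enlarging the volume from
      \<open>V0\<close> to \<open>v\<close>, a quarter for the localisation from \<open>s\<close> to
      \<open>s'\<close>, and the rest makes the final inequality strict.\<close>
    define s where "s = X - \<epsilon> / 4"
    define s' where "s' = X - \<epsilon> / 2"
    have s': "0 \<le> s'" "s' < s" "X - \<epsilon> < s'" using False eps by (auto simp: s_def s'_def)
    \<comment> \<open>The critical volume in units of ln t, at which t^d windows balance a tail of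
      t^(- d); S times its power - 2 / d is \<open>X\<close>.\<close>
    define V0 where "V0 = d / \<nu>"
    have V0: "V0 > 0" using d \<nu> by (simp add: V0_def)
    have X: "S * V0 powr (- 2 / d) = X"
    proof -
      have "V0 powr (- 2 / d) = (\<nu> / d) powr (2 / d)"
        using d \<nu> by (simp add: V0_def powr_divide powr_minus_divide)
      then show ?thesis by (simp add: X_def)
    qed
    \<comment> \<open>\<open>v\<close> is taken slightly above \<open>V0\<close>: the union bound
      then gains a power of t, while continuity keeps the constant above \<open>s\<close>.\<close>
    have "((\<lambda>v. S * v powr (- 2 / d)) \<longlongrightarrow> S * V0 powr (- 2 / d)) (at_right V0)"
      using V0 by (intro tendsto_intros) auto
    then have "eventually (\<lambda>v. s < S * v powr (- 2 / d)) (at_right V0)"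
      by (rule order_tendstoD(1)) (use X eps in \<open>simp add: s_def\<close>)
    from eventually_happens'[OF trivial_limit_at_right_real eventually_conj[OF this eventually_at_right_less]]
    obtain v where v: "V0 < v" "s < S * v powr (- 2 / d)" by blast
    have v0: "v > 0" using v V0 by simp
    obtain \<delta> where \<delta>: "\<delta> > 0" and leb: "\<And>(u :: real^'n \<Rightarrow> real^'n) B. u \<in> test_functions UNIV \<Longrightarrow> B \<in> sets borel \<Longrightarrow>
        (\<And>y. emeasure lborel (B \<inter> cube (1 / \<delta>) y) \<le> ennreal v) \<Longrightarrow>
        sqint (\<lambda>x. indicator (- B) x *\<^sub>R u x) \<le> \<delta> * sqint u \<Longrightarrow>
        sqint (\<lambda>x. trace (gradient u x)) \<le> \<delta> * sqint u \<Longrightarrow> s' * sqint u \<le> sqint (gradient u)"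
    proof (rule local_energy_bound[OF energy_bound_stokes_const[OF S(1) v0 v(2)[unfolded d_def]] s'(1,2)])
      fix \<delta> :: real
      assume 1: "\<delta> > 0" and 2: "\<And>(u :: real^'n \<Rightarrow> real^'n) B. u \<in> test_functions UNIV \<Longrightarrow> B \<in> sets borel \<Longrightarrow>
        (\<And>y. emeasure lborel (B \<inter> cube (1 / \<delta>) y) \<le> ennreal v) \<Longrightarrow>
        sqint (\<lambda>x. indicator (- B) x *\<^sub>R u x) \<le> \<delta> * sqint u \<Longrightarrow>
        sqint (\<lambda>x. trace (gradient u x)) \<le> \<delta> * sqint u \<Longrightarrow> s' * sqint u \<le> sqint (gradient u)"
      show thesis by (rule that[OF 1 2])
    qed
    \<comment> \<open>Strictly between d / v and \<nu>: exp(- \<nu>') exceeds p, as the tail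
      estimate asks, and v \<nu>' still exceeds d.\<close>
    define \<nu>' where "\<nu>' = (d / v + \<nu>) / 2"
    have "d / v < \<nu>" using v V0 \<nu> v0 by (simp add: V0_def field_simps)
    have "d / v > 0" using d v0 by simp
    have \<nu>': "\<nu>' < \<nu>" "d / v < \<nu>'" "\<nu>' > 0"
    proof -
      have mid: "(a + b) / 2 < b \<and> a < (a + b) / 2 \<and> 0 < (a + b) / 2" if "a < b" "0 < a" for a b :: real
        using that by simp
      from mid[OF \<open>d / v < \<nu>\<close> \<open>d / v > 0\<close>] show "\<nu>' < \<nu>" "d / v < \<nu>'" "\<nu>' > 0"
        unfolding \<nu>'_def by blast+
    qed
    \<comment> \<open>The excess of v \<nu>' over d is 2 \<kappa>: one \<kappa> pays for the subsets
      of a window, the other is the rate.\<close>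
    define \<kappa> where "\<kappa> = (v * \<nu>' - d) / 2"
    have \<kappa>: "\<kappa> > 0" "v * \<nu>' = real CARD('n) + 2 * \<kappa>"
      using \<nu>'(2) v0 by (auto simp: \<kappa>_def d_def field_simps)
    have nonneg: "AE \<omega> in M. 0 \<le> \<xi> z \<omega>" for z using range[of z] by eventually_elim simp
    have pp: "0 \<le> p" "p < exp (- \<nu>')" using p \<nu> \<nu>' by auto
    obtain \<eta> where \<eta>: "\<eta> > 0" and tail: "\<And>C. finite C \<Longrightarrow>
        prob {\<omega> \<in> space M. (\<Sum>z\<in>C. \<xi> z \<omega>) \<le> \<eta> * real (card C)} \<le> exp (- \<nu>') ^ card C"
    proof (rule sum_lower_tail[OF indep ident nonneg zero pp])
      fix \<eta> :: real
      assume 1: "\<eta> > 0" and 2: "\<And>C. finite C \<Longrightarrow>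
        prob {\<omega> \<in> space M. (\<Sum>z\<in>C. \<xi> z \<omega>) \<le> \<eta> * real (card C)} \<le> exp (- \<nu>') ^ card C"
      show thesis by (rule that[OF 1 2])
    qed
    have rv: "\<xi> z \<in> borel_measurable M" for z using indep unfolding indep_vars_def by simp
    \<comment> \<open>A bound for m / R: as c is at most 1, c^d \<le> c \<le> \<kappa>, whence m^d
      \<le> \<kappa> R^d = \<kappa> ln t.\<close>
    define c where "c = min 1 \<kappa>"
    have c: "0 < c" "c \<le> 1" "c \<le> \<kappa>" using \<kappa> by (auto simp: c_def)
    \<comment> \<open>A window must cover a cube of side 2 R / \<delta>, so it has about 2 R /
      (\<delta> L) blocks per coordinate; 4 in place of 2 absorbs the rounding.\<close>
    define L where "L = nat \<lceil>4 / (\<delta> * c)\<rceil> + 1"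
    have L: "L > 0" by (simp add: L_def)
    have Lc: "4 / (\<delta> * real L) \<le> c"
    proof -
      have "4 / (\<delta> * c) \<le> real L" unfolding L_def by linarith
      then show ?thesis using \<delta> c L by (simp add: field_simps)
    qed
    define C where "C = (real L * real CARD('n))\<^sup>2 * 2 ^ CARD('n) / \<eta>"
    have C: "C \<ge> 0" using \<eta> by (simp add: C_def)
    \<comment> \<open>There are countably many cells, so one null set \<open>N\<close> serves all of
      them.\<close>
    have "AE \<omega> in M. \<forall>z. \<xi> z \<omega> \<le> measure lebesgue (obstacles V \<omega> \<inter> unit_cell z)"
      using vol by (subst AE_all_countable) simp
    then obtain N where N: "N \<in> null_sets M" "{\<omega> \<in> space M. \<not> (\<forall>z. \<xi> z \<omega> \<le> measure lebesgue (obstacles V \<omega> \<inter> unit_cell z))} \<subseteq> N"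
      by (auto elim!: AE_E simp: null_sets_def)
    \<comment> \<open>Three demands on R: at least 1; 2 R / (\<delta> L) at least 3, so that
      rounding at most doubles it; and the Poincare error s' C / R^2 at most \<delta>.\<close>
    define R0 where "R0 = max 1 (max (3 * \<delta> * real L / 2) (s' * C / \<delta>))"
    have R0: "R0 \<ge> 1" "3 * \<delta> * real L / 2 \<le> R0" "s' * C / \<delta> \<le> R0"
      unfolding R0_def
      by (rule max.cobounded1, rule max.coboundedI2[OF max.cobounded1], rule max.coboundedI2[OF max.cobounded2])
    have "eventually (\<lambda>t. R0 powr d \<le> ln t) at_top"
      using ln_at_top by (simp add: filterlim_at_top)
    moreover have "eventually (\<lambda>t::real. 5 \<le> t) at_top" by (rule eventually_ge_at_top)
    moreover have "eventually (\<lambda>t::real. 1 \<le> ln t) at_top"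
      using ln_at_top by (simp add: filterlim_at_top)
    ultimately have "eventually (\<lambda>t. 1 - 5 ^ CARD('n) * t powr (- \<kappa>) \<le> inner_prob M (Ev t)) at_top"
    proof eventually_elim
      case (elim t)
      define R where "R = ln t powr (1 / d)"
      have R: "R > 0" using elim(3) by (simp add: R_def)
      have RR0: "R0 \<le> R"
      proof -
        have "R0 = (R0 powr d) powr (1 / d)" using d R0(1) by (simp add: powr_powr)
        also have "\<dots> \<le> R" unfolding R_def using elim(1) d by (intro powr_mono2) auto
        finally show ?thesis .
      qed
      have Rd: "R ^ CARD('n) = ln t"
        using elim(3) d by (simp add: R_def d_def powr_powr flip: powr_realpow)
      have R2: "R\<^sup>2 = ln t powr (2 / d)"
        using elim(3) by (simp add: R_def powr_powr flip: powr_realpow powr_numeral)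
      have Rln: "R \<le> ln t"
        using powr_mono[of "1 / d" 1 "ln t"] elim(3) d by (simp add: R_def)
      have Rsq: "s' * C \<le> \<delta> * R\<^sup>2"
      proof -
        have "R * 1 \<le> R * R" using R R0(1) RR0 by (intro mult_left_mono) auto
        then have "s' * C / \<delta> \<le> R\<^sup>2" using R0(3) RR0 by (simp add: power2_eq_square)
        then show ?thesis using \<delta> by (simp add: pos_divide_le_eq mult.commute)
      qed
      define m where "m = nat \<lceil>2 * (R / \<delta>) / real L\<rceil> + 2"
      have q3: "3 \<le> 2 * (R / \<delta>) / real L"
        using R0(2) RR0 \<delta> L by (simp add: field_simps)
      have m_lo: "2 * (R / \<delta>) / real L + 1 \<le> real m" unfolding m_def by linarith
      have "real m \<le> 2 * (R / \<delta>) / real L + 3" unfolding m_def using q3 by linarith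
      also have "\<dots> \<le> 2 * (2 * (R / \<delta>) / real L)" using q3 by linarith
      also have "\<dots> = 4 / (\<delta> * real L) * R" by simp
      also have "\<dots> \<le> c * R" using R by (intro mult_right_mono Lc) simp
      finally have m_hi: "real m \<le> c * R" .
      have md: "real m ^ CARD('n) \<le> \<kappa> * ln t"
      proof -
        have "real m ^ CARD('n) \<le> (c * R) ^ CARD('n)" by (rule power_mono[OF m_hi]) simp
        also have "\<dots> = c ^ CARD('n) * ln t" by (simp add: power_mult_distrib Rd)
        also have "c ^ CARD('n) \<le> c ^ 1" using c by (intro power_decreasing) auto
        also have "c ^ 1 \<le> \<kappa>" using c by simp
        finally show ?thesis using elim(3) by (simp add: mult_right_mono)
      qed
      have mln: "real m \<le> ln t"
      proof -
        have "c * R \<le> 1 * R" using c R by (intro mult_right_mono) auto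
        then show ?thesis using m_hi Rln by simp
      qed
      define T where "T = \<lceil>t\<rceil> + 2 + int m"
      have T: "t + 2 + real m \<le> real_of_int T" unfolding T_def by simp
      \<comment> \<open>Built from \<open>\<xi>\<close> and a null set, hence measurable; for
        \<open>inner_prob\<close> it remains to place it inside \<open>Ev t\<close>.\<close>
      define E where "E = few_sparse M \<xi> \<eta> L m T (v * ln t) - N"
      have p': "0 < exp (- \<nu>')" "exp (- \<nu>') < 1" using \<nu>' by auto
      have T0: "T \<ge> 0" using T elim(2) by linarith
      have few: "few_sparse M \<xi> \<eta> L m T (v * ln t) \<in> sets M"
        by (rule few_sparse_prob(1)[OF rv tail p' L T0])
      have "E \<in> sets M" using few N by (auto simp: E_def)
      moreover have "E \<subseteq> Ev t"
      proof
        fix \<omega> assume \<omega>: "\<omega> \<in> E"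
        then have \<omega>s: "\<omega> \<in> space M" and \<omega>f: "\<omega> \<in> few_sparse M \<xi> \<eta> L m T (v * ln t)"
          by (auto simp: E_def few_sparse_def)
        have \<omega>v: "\<xi> z \<omega> \<le> measure lebesgue (obstacles V \<omega> \<inter> unit_cell z)" for z
          using \<omega> \<omega>s N(2) by (auto simp: E_def)
        have ob: "obstacles V \<omega> \<in> sets borel" using closed[OF \<omega>s] by simp
        define B where "B = (sparse_region (sparse_blocks \<xi> \<eta> L \<omega>) L t :: (real^'n) set)"
        have "ereal (s' / R\<^sup>2) \<le> stokes_eigenvalue (flow_region V t \<omega>)"
        proof (rule stokes_eigenvalue_ge[OF R \<delta>])
          fix u assume u: "u \<in> test_functions (flow_region V t \<omega>)"
            and g: "R\<^sup>2 * sqint (gradient u) \<le> s' * sqint u"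
            and dv: "R\<^sup>2 * sqint (\<lambda>x. trace (gradient u x)) \<le> \<delta> * sqint u"
          \<comment> \<open>By \<open>g\<close> the energy is at most s' / R^2 times the mass, so
            the share of the mass off the sparse region is at most C s' / R^2, which is at most
            \<delta>.\<close>
          have out: "sqint (\<lambda>x. indicator (- B) x *\<^sub>R u x) \<le> \<delta> * sqint u"
          proof -
            have "sqint (\<lambda>x. indicator (- B) x *\<^sub>R u x) \<le> C * sqint (gradient u)"
              unfolding B_def C_def using mass_outside_sparse_region[of u t "obstacles V \<omega>" \<xi> \<omega> L \<eta>, OF u[unfolded flow_region_def] ob \<omega>v L \<eta>] .
            from mult_left_mono[OF this, of "R\<^sup>2"]
            have "R\<^sup>2 * sqint (\<lambda>x. indicator (- B) x *\<^sub>R u x) \<le> C * (R\<^sup>2 * sqint (gradient u))"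
              by (simp add: mult.left_commute)
            also have "\<dots> \<le> C * (s' * sqint u)" using C g by (rule mult_left_mono[rotated])
            also have "\<dots> = (s' * C) * sqint u" by simp
            also have "\<dots> \<le> (\<delta> * R\<^sup>2) * sqint u" by (rule mult_right_mono[OF Rsq]) simp
            finally have "R\<^sup>2 * sqint (\<lambda>x. indicator (- B) x *\<^sub>R u x) \<le> R\<^sup>2 * (\<delta> * sqint u)" by (simp add: mult_ac)
            then show ?thesis using R by (simp add: mult_le_cancel_left_pos)
          qed
          show "s' * sqint u \<le> R\<^sup>2 * sqint (gradient u)"
          proof (rule scaled_energy_bound[where \<delta>=\<delta> and V=v and B=B, OF _ R test_UNIV[OF u] _ _ _ out dv])
            fix w :: "real^'n \<Rightarrow> real^'n" and A
            assume "w \<in> test_functions UNIV" "A \<in> sets borel" "\<And>y. emeasure lborel (A \<inter> cube (1 / \<delta>) y) \<le> ennreal v"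
              "sqint (\<lambda>x. indicator (- A) x *\<^sub>R w x) \<le> \<delta> * sqint w" "sqint (\<lambda>x. trace (gradient w x)) \<le> \<delta> * sqint w"
            then show "s' * sqint w \<le> sqint (gradient w)" by (rule leb)
          next
            show "B \<in> sets borel" by (simp add: B_def)
          next
            fix y
            show "emeasure lborel (B \<inter> cube (R / \<delta>) y) \<le> ennreal (v * R ^ CARD('n))"
              unfolding B_def Rd
              by (rule volume_sparse_region[OF \<omega>f L _ m_lo T]) (use R \<delta> elim v0 in auto)
          qed (use v0 in auto)
        qed
        then have "ereal (R\<^sup>2) * ereal (s' / R\<^sup>2) \<le> ereal (R\<^sup>2) * stokes_eigenvalue (flow_region V t \<omega>)"
          by (intro ereal_mult_left_mono) auto
        moreover have "ereal (X - \<epsilon>) < ereal (R\<^sup>2) * ereal (s' / R\<^sup>2)" using s'(3) R by simp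
        ultimately have "ereal (X - \<epsilon>) < ereal (R\<^sup>2) * stokes_eigenvalue (flow_region V t \<omega>)"
          by (rule order_less_le_trans[rotated])
        then show "\<omega> \<in> Ev t" using \<omega>s by (simp add: Ev_def R2)
      qed
      ultimately have "prob E \<le> inner_prob M (Ev t)" by (rule inner_prob_bounds(2)[OF prob])
      moreover have "prob E = prob (few_sparse M \<xi> \<eta> L m T (v * ln t))"
        unfolding E_def by (simp add: measure_Diff_null_set few N(1))
      moreover have "1 - 5 ^ CARD('n) * t powr (- \<kappa>) \<le> prob (few_sparse M \<xi> \<eta> L m T (v * ln t))"
        unfolding T_def
        by (rule few_sparse_prob_asymptotic[OF rv tail \<nu>'(3) \<kappa> L elim(2,3) md mln])
      ultimately show ?case by linarith
    qed
    with \<kappa>(1) show ?thesis by blast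
  qed
  then obtain \<kappa> where \<kappa>: "\<kappa> > 0" and ev: "eventually (\<lambda>t. 1 - 5 ^ CARD('n) * t powr (- \<kappa>) \<le> inner_prob M (Ev t)) at_top"
    by blast
  have "((\<lambda>t::real. 1 - 5 ^ CARD('n) * t powr (- \<kappa>)) \<longlongrightarrow> 1 - 5 ^ CARD('n) * 0) at_top"
    using \<kappa> by (intro tendsto_intros tendsto_neg_powr filterlim_ident) auto
  then have "((\<lambda>t. inner_prob M (Ev t)) \<longlongrightarrow> 1) at_top"
    using ev inner_prob_bounds(1)[OF prob]
    by (intro tendsto_sandwich[OF ev _ _ tendsto_const]) auto
  then show ?thesis unfolding target Ev_def .
qed

end
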